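(* Let $A=(A_1,\dots,A_n)\in\mathbb{R}^n$ be a vector with $A_i\ge 0$ for all $i$, and let $D=n+A_1+\cdots+A_n$. Let $f\in W^{1,2}(\mathbb{R}^n,x^A\,dx)$ be real-valued with $\int_{\mathbb{R}^n_A}|f|^2x^A\,dx=1$. Then equality occurs in the sharp $L^2$-logarithmic Sobolev inequality with monomial weight $$\int_{\mathbb{R}^n_A}|f|^2(\log|f|^2)\,x^A\,dx\le\frac{D}{2}\log\left(\frac{2}{\Pi(A)\,e\,D}\int_{\mathbb{R}^n_A}|\nabla f|^2x^A\,dx\right)$$ (which holds for every such $f$) if and only if $$f(x)=\beta\exp\left(-\frac{|x-x_0|^2}{\sigma}\right)\quad\text{for a.e. } x\in\mathbb{R}^n_A$$ for some $\sigma>0$, some $x_0=((x_0)_1,\dots,(x_0)_n)\in\mathbb{R}^n$ such that $(x_0)_i=0$ whenever $A_i>0$, and some $\beta\in\mathbb{R}$ satisfying $$|\beta|^{-2}=\left(\frac{\sigma\,\Pi(A)}{2}\right)^{D/2}.$$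
   Context: Here $|\cdot|$ is the Euclidean norm on $\mathbb{R}^n$. For a nonnegative vector $A\in\mathbb{R}^n$, set $$\mathbb{R}^n_A=\{x=(x_1,\dots,x_n)\in\mathbb{R}^n: x_i>0\text{ if }A_i>0\},\qquad x^A=|x_1|^{A_1}\cdots|x_n|^{A_n}.$$ For an open set $\Omega\subset\mathbb{R}^n$, $W^{1,2}(\Omega,x^A\,dx)$ is the set of measurable functions $f$ on $\Omega$ (with weak gradient $\nabla f$) such that $\int_\Omega(|f|^2+|\nabla f|^2)x^A\,dx<\infty$. The constant $\Pi(A)$ is $$\Pi(A)=\left[\frac{\prod_{i=1}^n\Gamma\left(\frac{A_i+1}{2}\right)}{2^k}\right]^{2/D},$$ where $k$ is the number of indices $i\in\{1,\dots,n\}$ with $A_i>0$. The convention $0\log 0=0$ is used. *)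

theory Defs
  imports "HOL-Analysis.Analysis"
begin

definition partial_deriv :: "'n \<Rightarrow> (real ^ 'n \<Rightarrow> real) \<Rightarrow> real ^ 'n \<Rightarrow> real"
  where "partial_deriv i \<phi> x = frechet_derivative \<phi> (at x) (axis i 1)"

primrec C_k :: "nat \<Rightarrow> (real ^ 'n \<Rightarrow> real) \<Rightarrow> bool"
  where
    "C_k 0 \<phi> \<longleftrightarrow> continuous_on UNIV \<phi>"
  | "C_k (Suc k) \<phi> \<longleftrightarrow> (\<forall>x. \<phi> differentiable (at x)) \<and> (\<forall>i. C_k k (partial_deriv i \<phi>))"

definition test_functions :: "(real ^ 'n) set \<Rightarrow> (real ^ 'n \<Rightarrow> real) set"
  where "test_functions \<Omega> =
    {\<phi>. (\<forall>k. C_k k \<phi>) \<and> compact (closure {x. \<phi> x \<noteq> 0}) \<and> closure {x. \<phi> x \<noteq> 0} \<subseteq> \<Omega>}"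

definition locally_integrable ::
    "(real ^ 'n) set \<Rightarrow> (real ^ 'n \<Rightarrow> 'b::euclidean_space) \<Rightarrow> bool"
  where "locally_integrable \<Omega> f \<longleftrightarrow>
    (\<forall>K. compact K \<and> K \<subseteq> \<Omega> \<longrightarrow> f absolutely_integrable_on K)"

definition has_weak_gradient ::
    "(real ^ 'n) set \<Rightarrow> (real ^ 'n \<Rightarrow> real) \<Rightarrow> (real ^ 'n \<Rightarrow> real ^ 'n) \<Rightarrow> bool"
  where "has_weak_gradient \<Omega> f g \<longleftrightarrow>
    locally_integrable \<Omega> f \<and> locally_integrable \<Omega> g \<and>
    (\<forall>\<phi>\<in>test_functions \<Omega>. \<forall>i.
      (LINT x|lebesgue_on \<Omega>. f x * partial_deriv i \<phi> x)
        = - (LINT x|lebesgue_on \<Omega>. g x $ i * \<phi> x))"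

(* Weak gradients on an open set are unique only up to null sets; this picks a version.
   It is meaningful only for f that have a weak gradient. *)
definition weak_gradient ::
    "(real ^ 'n) set \<Rightarrow> (real ^ 'n \<Rightarrow> real) \<Rightarrow> real ^ 'n \<Rightarrow> real ^ 'n"
  where "weak_gradient \<Omega> f = (SOME g. has_weak_gradient \<Omega> f g)"

definition W12 :: "(real ^ 'n) set \<Rightarrow> (real ^ 'n \<Rightarrow> real) \<Rightarrow> (real ^ 'n \<Rightarrow> real) set"
  where "W12 \<Omega> w =
    {f. f \<in> borel_measurable (lebesgue_on \<Omega>) \<and> (\<exists>g. has_weak_gradient \<Omega> f g) \<and>
      integrable (lebesgue_on \<Omega>)
        (\<lambda>x. (\<bar>f x\<bar>\<^sup>2 + (norm (weak_gradient \<Omega> f x))\<^sup>2) * w x)}"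

definition monomial_domain :: "real ^ 'n \<Rightarrow> (real ^ 'n) set"
  where "monomial_domain A = {x. \<forall>i. A $ i > 0 \<longrightarrow> x $ i > 0}"

(* The case split is needed because 0 powr 0 = 0, whereas factors with A_i = 0 are 1. *)
definition monomial_weight :: "real ^ 'n \<Rightarrow> real ^ 'n \<Rightarrow> real"
  where "monomial_weight A x = (\<Prod>i\<in>UNIV. if A $ i = 0 then 1 else \<bar>x $ i\<bar> powr (A $ i))"

definition hom_dim :: "real ^ 'n \<Rightarrow> real"
  where "hom_dim A = real CARD('n) + (\<Sum>i\<in>UNIV. A $ i)"

definition Pi_const :: "real ^ 'n \<Rightarrow> real"
  where "Pi_const A =
    ((\<Prod>i\<in>UNIV. Gamma ((A $ i + 1) / 2)) / 2 ^ card {i. A $ i > 0}) powr (2 / hom_dim A)"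

(* Integral with values in the extended reals. The entropy integrand below need not be integrable:
   its negative part can have infinite integral, and then the entropy is - \<infinity>, whereas the
   Bochner integral would be 0. The value \<infinity> for \<infinity> - \<infinity> is a library convention. *)
definition ext_integral :: "'a measure \<Rightarrow> ('a \<Rightarrow> real) \<Rightarrow> ereal"
  where "ext_integral M h =
    enn2ereal (\<integral>\<^sup>+x. ennreal (h x) \<partial>M) - enn2ereal (\<integral>\<^sup>+x. ennreal (- h x) \<partial>M)"

(* The convention 0 log 0 = 0 holds because ln 0 = 0. *)
definition log_sobolev_lhs :: "real ^ 'n \<Rightarrow> (real ^ 'n \<Rightarrow> real) \<Rightarrow> ereal"
  where "log_sobolev_lhs A f =
    ext_integral (lebesgue_on (monomial_domain A))
      (\<lambda>x. \<bar>f x\<bar>\<^sup>2 * ln (\<bar>f x\<bar>\<^sup>2) * monomial_weight A x)"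

definition log_sobolev_rhs :: "real ^ 'n \<Rightarrow> (real ^ 'n \<Rightarrow> real) \<Rightarrow> real"
  where "log_sobolev_rhs A f =
    hom_dim A / 2 * ln (2 / (Pi_const A * exp 1 * hom_dim A) *
      (LINT x|lebesgue_on (monomial_domain A).
        (norm (weak_gradient UNIV f x))\<^sup>2 * monomial_weight A x))"

end

theory Submission
  imports Defs "HOL-Probability.Probability"
begin

text \<open>The proof is a mass transportation argument. Restricted to almost every line, \<open>f\<close> is absolutely
  continuous, and the Knothe map, which rearranges one coordinate after the other by monotone maps
  \<open>T\<^sub>i\<close>, pushes \<open>f\<^sup>2 x\<^sup>A dx\<close> forward to the reference probability with density proportional to
  \<open>x\<^sup>A exp (- |x|\<^sup>2 / 2)\<close>. The one-dimensional change of variables expresses the conditional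
  densities, hence \<open>ln f\<^sup>2\<close>, through the derivatives \<open>T\<^sub>i'\<close> and the ratios \<open>T\<^sub>i / x\<^sub>i\<close>; the inequality
  \<open>ln u \<le> l u - 1 - ln l\<close>, integration by parts along lines and a completed square turn this into
  a bound of the entropy by the energy for every \<open>l > 0\<close>, and the best \<open>l\<close> gives the theorem.

  If equality holds for the order of coordinates starting with \<open>i\<close>, then \<open>2 l \<partial>\<^sub>i f + T\<^sub>i f = 0\<close>
  with \<open>T\<^sub>i\<close> depending on \<open>x\<^sub>i\<close> only, and equality in the logarithmic inequality makes \<open>T\<^sub>i\<close>
  affine. Since \<open>i\<close> is arbitrary, \<open>f\<close> is a Gaussian.\<close>

section \<open>Smooth test functions\<close>

text \<open>A triangular map is used because each of its components is a monotone map of the line: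
  its derivative is the explicit quotient p / \<phi>(T) of densities and enters only through
  integrated identities. This suits an f that may vanish on large sets and is only weakly
  differentiable. The reference law is the weight times a Gaussian. The weight then contributes the
  term a T / x next to T', and the second moment of each component of the map is 1 + a whatever f
  is. Hence T disappears from the final bound, and \<Pi>(A) comes from the normalizing constants
  \<open>Z\<close>. T may be unbounded and the entropy may be -\<infinity>. So T is truncated in the
  integration by parts, and the entropy is bounded through a pointwise majorant with finite
  integral. In a triangular map only the first component is a function of one variable. For this
  reason the bound keeps the contribution of the first coordinate apart from the rest. Marginals are
  simplest for product probabilities, so integrals against x^A dx are rewritten over the reference
  law with density \<open>\<Psi>\<close>.\<close>

definition exp_bump :: "real poly \<Rightarrow> real \<Rightarrow> real"
  where "exp_bump P x = (if x > 0 then poly P (1 / x) * exp (- (1 / x)) else 0)"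

text \<open>Smoothness is encoded as membership in a class closed under differentiation, so that
  \<open>C_k\<close> follows for all k by induction. Primitives are included because cut-offs and
  test functions below are constructed as primitives.\<close>

inductive smooth_fun :: "(real \<Rightarrow> real) \<Rightarrow> bool"
  where
    bump: "smooth_fun (exp_bump P)"
  | const: "smooth_fun (\<lambda>x. c)"
  | add: "smooth_fun u \<Longrightarrow> smooth_fun v \<Longrightarrow> smooth_fun (\<lambda>x. u x + v x)"
  | mult: "smooth_fun u \<Longrightarrow> smooth_fun v \<Longrightarrow> smooth_fun (\<lambda>x. u x * v x)"
  | affine: "smooth_fun u \<Longrightarrow> smooth_fun (\<lambda>x. u (a * x + b))"
  | antideriv: "smooth_fun u \<Longrightarrow> (\<And>x. (v has_real_derivative u x) (at x)) \<Longrightarrow> smooth_fun v"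

lemma poly_exp_tendsto_0: "((\<lambda>y. poly P y * exp (- y)) \<longlongrightarrow> (0::real)) at_top"
proof (induction P)
  case 0
  then show ?case by simp
next
  case (pCons a P)
  have "((\<lambda>y. y ^ k * exp (- y)) \<longlongrightarrow> (0::real)) at_top" for k
    using tendsto_power_div_exp_0[of k] by (simp add: exp_minus field_simps)
  then have *: "((\<lambda>y. coeff Q i * (y ^ i * exp (- y))) \<longlongrightarrow> (0::real)) at_top" for Q i
    by (intro tendsto_mult_right_zero)
  have "((\<lambda>y. \<Sum>i\<le>degree (pCons a P). coeff (pCons a P) i * (y ^ i * exp (- y))) \<longlongrightarrow> (0::real)) at_top"
    by (intro tendsto_null_sum *)
  then show ?case
    unfolding poly_altdef[of "pCons a P"] sum_distrib_right mult.assoc .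
qed

text \<open>By the chain rule P turns into X^2 (P - P'), so the polynomial parameter absorbs all
  derivatives of exp (-1 / x). At 0 the difference quotient has the same form, with X P, and tends
  to 0 because the exponential beats every polynomial in 1 / x.\<close>

lemma exp_bump_deriv:
  "(exp_bump P has_real_derivative exp_bump ([:0, 0, 1:] * (P - pderiv P)) x) (at x)"
proof -
  consider "x > 0" | "x = 0" | "x < 0" by linarith
  then show ?thesis
  proof cases
    case 1
    have "((\<lambda>x. poly P (1 / x) * exp (- (1 / x))) has_real_derivative
        exp_bump ([:0, 0, 1:] * (P - pderiv P)) x) (at x)"
      using 1
      by (auto intro!: derivative_eq_intros DERIV_chain2[OF poly_DERIV] simp: exp_bump_def field_simps power2_eq_square)
    moreover have "\<forall>\<^sub>F y in nhds x. poly P (1 / y) * exp (- (1 / y)) = exp_bump P y"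
      using eventually_nhds_in_open[of "{0<..}" x] 1 by (auto elim!: eventually_mono simp: exp_bump_def)
    ultimately show ?thesis
      by (simp add: DERIV_cong_ev[OF refl _ refl])
  next
    case 3
    have "\<forall>\<^sub>F y in nhds x. 0 = exp_bump P y"
      using eventually_nhds_in_open[of "{..<0}" x] 3 by (auto elim!: eventually_mono simp: exp_bump_def)
    then have "((\<lambda>x. 0::real) has_real_derivative 0) (at x) \<longleftrightarrow> (exp_bump P has_real_derivative 0) (at x)"
      by (intro DERIV_cong_ev) auto
    then show ?thesis
      using 3 by (simp add: exp_bump_def)
  next
    case 2
    have "((\<lambda>y. poly ([:0, 1:] * P) (inverse y) * exp (- inverse y)) \<longlongrightarrow> (0::real)) (at_right 0)"
      using filterlim_compose[OF poly_exp_tendsto_0 filterlim_inverse_at_top_right] .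
    then have R: "((\<lambda>y. exp_bump P y / y) \<longlongrightarrow> 0) (at_right 0)"
      by (rule Lim_transform_eventually)
        (auto simp: eventually_at_right_field exp_bump_def field_simps intro!: exI[of _ 1])
    have L: "((\<lambda>y. exp_bump P y / y) \<longlongrightarrow> 0) (at_left 0)"
      by (rule Lim_transform_eventually[OF tendsto_const[of 0]])
        (auto simp: eventually_at_left_field exp_bump_def intro!: exI[of _ "-1"])
    have "((\<lambda>y. exp_bump P y / y) \<longlongrightarrow> 0) (at 0)"
      using R L by (simp add: filterlim_at_split)
    then show ?thesis
      using 2 by (simp add: DERIV_def exp_bump_def)
  qed
qed

lemma smooth_fun_deriv:
  assumes "smooth_fun u"
  obtains u' where "smooth_fun u'" "\<And>x. (u has_real_derivative u' x) (at x)"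
proof -
  have "\<exists>u'. smooth_fun u' \<and> (\<forall>x. (u has_real_derivative u' x) (at x))"
    using assms
  proof induction
    case (bump P)
    then show ?case using exp_bump_deriv smooth_fun.bump by blast
  next
    case (const c)
    then show ?case by (intro exI[of _ "\<lambda>_. 0"]) (auto intro: smooth_fun.const)
  next
    case (add u v)
    then obtain u' v' where "smooth_fun u'" "\<forall>x. (u has_real_derivative u' x) (at x)"
      "smooth_fun v'" "\<forall>x. (v has_real_derivative v' x) (at x)" by blast
    then show ?case
      by (intro exI[of _ "\<lambda>x. u' x + v' x"]) (auto intro: smooth_fun.add derivative_intros)
  next
    case (mult u v)
    then obtain u' v' where "smooth_fun u'" "\<forall>x. (u has_real_derivative u' x) (at x)"
      "smooth_fun v'" "\<forall>x. (v has_real_derivative v' x) (at x)" by blast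
    with mult.hyps show ?case
      by (intro exI[of _ "\<lambda>x. u' x * v x + v' x * u x"])
        (auto intro: smooth_fun.add smooth_fun.mult DERIV_mult)
  next
    case (affine u a b)
    then obtain u' where "smooth_fun u'" "\<forall>x. (u has_real_derivative u' x) (at x)" by blast
    note u' = this
    have "((\<lambda>x. u (a * x + b)) has_real_derivative u' (a * x + b) * a) (at x)" for x
    proof -
      have "((\<lambda>x. a * x + b) has_real_derivative a) (at x)"
        using DERIV_add[OF DERIV_cmult_Id[of a x UNIV] DERIV_const[of b]] by simp
      then show ?thesis
        using DERIV_chain2[where f = u and g = "\<lambda>x. a * x + b"] u'(2) by blast
    qed
    moreover have "smooth_fun (\<lambda>x. u' (a * x + b) * a)"
      by (rule smooth_fun.mult[OF smooth_fun.affine[OF u'(1)] smooth_fun.const])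
    ultimately show ?case by blast
  next
    case (antideriv u v)
    then show ?case by blast
  qed
  then show ?thesis using that by blast
qed

lemma smooth_fun_continuous: "smooth_fun u \<Longrightarrow> continuous_on S u"
  by (metis smooth_fun_deriv DERIV_isCont continuous_at_imp_continuous_on)

lemma has_derivative_prod_coords:
  fixes \<theta> :: "'n::finite \<Rightarrow> real \<Rightarrow> real"
  assumes "\<And>j. (\<theta> j has_real_derivative \<theta>' j (x $ j)) (at (x $ j))"
  shows "((\<lambda>x::real^'n. \<Prod>j\<in>UNIV. \<theta> j (x $ j)) has_derivative
    (\<lambda>h. \<Sum>i\<in>UNIV. \<theta>' i (x $ i) * h $ i * (\<Prod>j\<in>UNIV - {i}. \<theta> j (x $ j)))) (at x)"
proof -
  have "((\<lambda>x::real^'n. \<theta> j (x $ j)) has_derivative (\<lambda>h. \<theta>' j (x $ j) * h $ j)) (at x)" for j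
  proof -
    have "((\<lambda>x::real^'n. x $ j) has_derivative (\<lambda>h. h $ j)) (at x)"
      by (intro bounded_linear_imp_has_derivative bounded_linear_vec_nth)
    from has_derivative_compose[OF this assms[of j, unfolded has_field_derivative_def]]
    show ?thesis .
  qed
  then show ?thesis
    by (intro has_derivative_prod) 
qed

text \<open>A partial derivative replaces a single factor, so the products are closed under partial
  derivatives; the induction in \<open>C_k_prod_coords\<close> lives on this.\<close>

lemma partial_deriv_prod_coords:
  fixes \<theta> :: "'n::finite \<Rightarrow> real \<Rightarrow> real"
  assumes "\<And>j x. (\<theta> j has_real_derivative \<theta>' j x) (at x)"
  shows "partial_deriv i (\<lambda>x::real^'n. \<Prod>j\<in>UNIV. \<theta> j (x $ j)) =
    (\<lambda>x. \<Prod>j\<in>UNIV. (\<theta>(i := \<theta>' i)) j (x $ j))"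
proof
  fix x :: "real^'n"
  have "partial_deriv i (\<lambda>x::real^'n. \<Prod>j\<in>UNIV. \<theta> j (x $ j)) x =
      (\<Sum>k\<in>UNIV. \<theta>' k (x $ k) * axis i 1 $ k * (\<Prod>j\<in>UNIV - {k}. \<theta> j (x $ j)))"
    unfolding partial_deriv_def
    by (subst frechet_derivative_at[OF has_derivative_prod_coords[of \<theta> \<theta>' x], symmetric]) (use assms in auto)
  also have "\<dots> = (\<Sum>k\<in>UNIV. if k = i then \<theta>' i (x $ i) * (\<Prod>j\<in>UNIV - {i}. \<theta> j (x $ j)) else 0)"
    by (intro sum.cong) (auto simp: axis_def)
  also have "\<dots> = \<theta>' i (x $ i) * (\<Prod>j\<in>UNIV - {i}. \<theta> j (x $ j))"
    by simp
  also have "\<dots> = (\<Prod>j\<in>UNIV. (\<theta>(i := \<theta>' i)) j (x $ j))"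
    by (subst prod.remove[of UNIV i]) (auto intro!: prod.cong)
  finally show "partial_deriv i (\<lambda>x::real^'n. \<Prod>j\<in>UNIV. \<theta> j (x $ j)) x = \<dots>" .
qed

lemma C_k_prod_coords:
  fixes \<theta> :: "'n::finite \<Rightarrow> real \<Rightarrow> real"
  assumes "\<And>j. smooth_fun (\<theta> j)"
  shows "C_k k (\<lambda>x::real^'n. \<Prod>j\<in>UNIV. \<theta> j (x $ j))"
  using assms
proof (induction k arbitrary: \<theta>)
  case 0
  have "continuous_on UNIV (\<lambda>x::real^'n. \<theta> j (x $ j))" for j
    using continuous_on_compose2[OF smooth_fun_continuous[OF 0, of UNIV] continuous_on_component[OF continuous_on_id]]
    by auto
  then show ?case by (auto intro: continuous_on_prod)
next
  case (Suc k)
  obtain \<theta>' where \<theta>': "\<And>j. smooth_fun (\<theta>' j)" "\<And>j x. (\<theta> j has_real_derivative \<theta>' j x) (at x)"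
  proof -
    have "\<forall>j. \<exists>u'. smooth_fun u' \<and> (\<forall>x. (\<theta> j has_real_derivative u' x) (at x))"
      using smooth_fun_deriv[OF Suc.prems] by blast
    then show ?thesis using that by metis
  qed
  have "smooth_fun ((\<theta>(i := \<theta>' i)) j)" for i j
    using \<theta>'(1) Suc.prems by auto
  then have "C_k k (partial_deriv i (\<lambda>x::real^'n. \<Prod>j\<in>UNIV. \<theta> j (x $ j)))" for i
    unfolding partial_deriv_prod_coords[of \<theta> \<theta>', OF \<theta>'(2)] by (rule Suc.IH)
  moreover have "(\<lambda>x::real^'n. \<Prod>j\<in>UNIV. \<theta> j (x $ j)) differentiable at x" for x
    unfolding differentiable_def using has_derivative_prod_coords[of \<theta> \<theta>' x] \<theta>'(2) by blast
  ultimately show ?case by simp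
qed

lemma prod_coords_test_function:
  fixes \<theta> :: "'n::finite \<Rightarrow> real \<Rightarrow> real"
  assumes "\<And>j. smooth_fun (\<theta> j)" and "\<And>j x. \<theta> j x \<noteq> 0 \<Longrightarrow> \<bar>x\<bar> \<le> M"
  shows "(\<lambda>x::real^'n. \<Prod>j\<in>UNIV. \<theta> j (x $ j)) \<in> test_functions UNIV"
proof -
  have "{x::real^'n. (\<Prod>j\<in>UNIV. \<theta> j (x $ j)) \<noteq> 0} \<subseteq> cbox (\<chi> i. -M) (\<chi> i. M)"
  proof
    fix x :: "real^'n" assume "x \<in> {x. (\<Prod>j\<in>UNIV. \<theta> j (x $ j)) \<noteq> 0}"
    then have "\<bar>x $ i\<bar> \<le> M" for i using assms(2)[of i] by auto
    then show "x \<in> cbox (\<chi> i. -M) (\<chi> i. M)"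
      by (auto simp: mem_box_cart abs_le_iff minus_le_iff)
  qed
  then have "bounded {x::real^'n. (\<Prod>j\<in>UNIV. \<theta> j (x $ j)) \<noteq> 0}"
    using bounded_cbox bounded_subset by blast
  then show ?thesis
    using C_k_prod_coords[OF assms(1)] by (auto simp: test_functions_def compact_closure)
qed

lemma continuous_antiderivative:
  fixes b :: "real \<Rightarrow> real"
  assumes cont: "\<And>S. continuous_on S b"
  obtains s where "\<And>x. (s has_real_derivative b x) (at x)" "s 0 = 0"
proof -
  define s where "s x = (if x \<ge> 0 then integral {0..x} b else - integral {x..0} b)" for x
  have int: "b integrable_on {l..u}" for l u
    by (rule integrable_continuous_real[OF cont])
  have s: "(s has_real_derivative b x) (at x)" for x
  proof -
    define M where "M = \<bar>x\<bar> + 1"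
    have "((\<lambda>u. integral {-M..u} b) has_real_derivative b x) (at x within {-M..M})"
      by (rule integral_has_real_derivative[OF cont]) (auto simp: M_def)
    then have "((\<lambda>u. integral {-M..u} b) has_real_derivative b x) (at x)"
      by (subst (asm) at_within_interior) (auto simp: M_def)
    then have "((\<lambda>u. integral {-M..u} b - integral {-M..0} b) has_real_derivative b x) (at x)"
      by (auto intro!: derivative_eq_intros)
    moreover have "\<forall>\<^sub>F u in nhds x. integral {-M..u} b - integral {-M..0} b = s u"
    proof -
      have "integral {-M..u} b - integral {-M..0} b = s u" if "u \<in> {-M<..<M}" for u
      proof (cases "u \<ge> 0")
        case True
        then have "integral {-M..0} b + integral {0..u} b = integral {-M..u} b"
          using that by (intro Henstock_Kurzweil_Integration.integral_combine int) auto
        then show ?thesis using True by (simp add: s_def)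
      next
        case False
        then have "integral {-M..u} b + integral {u..0} b = integral {-M..0} b"
          using that by (intro Henstock_Kurzweil_Integration.integral_combine int) auto
        then show ?thesis using False by (simp add: s_def)
      qed
      then show ?thesis
        using eventually_nhds_in_open[of "{-M<..<M}" x] by (force elim: eventually_mono simp: M_def)
    qed
    ultimately show ?thesis by (simp add: DERIV_cong_ev[OF refl _ refl])
  qed
  show thesis
    using s by (rule that) (simp add: s_def)
qed

text \<open>A normalized primitive of a bump that is positive exactly on (0, 1).\<close>

lemma smooth_step:
  obtains \<sigma> :: "real \<Rightarrow> real" where "smooth_fun \<sigma>" "\<And>x. x \<le> 0 \<Longrightarrow> \<sigma> x = 0" "\<And>x. x \<ge> 1 \<Longrightarrow> \<sigma> x = 1"
    "\<And>x. 0 \<le> \<sigma> x" "\<And>x. \<sigma> x \<le> 1"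
proof -
  define b where "b x = exp_bump 1 x * exp_bump 1 (-1 * x + 1)" for x
  have b: "smooth_fun b"
    unfolding b_def by (rule smooth_fun.mult[OF smooth_fun.bump smooth_fun.affine[OF smooth_fun.bump]])
  have b_nonneg: "b x \<ge> 0" for x
    by (auto simp: b_def exp_bump_def)
  have b_pos: "b x > 0" if "0 < x" "x < 1" for x
    using that by (auto simp: b_def exp_bump_def)
  have b_0: "b x = 0" if "x \<le> 0 \<or> x \<ge> 1" for x
    using that by (auto simp: b_def exp_bump_def)
  obtain s where s: "\<And>x. (s has_real_derivative b x) (at x)" and s0: "s 0 = 0"
    using continuous_antiderivative[of b] smooth_fun_continuous[OF b] by blast
  have mono: "s x \<le> s y" if "x \<le> y" for x y
    using DERIV_nonneg_imp_nondecreasing[OF that] s b_nonneg by blast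
  have const_left: "s x = 0" if "x \<le> 0" for x
  proof (cases "x = 0")
    case False
    then have "s 0 - s x = 0" 
      using MVT2[of x 0 s b] s that b_0 by (metis diff_gt_0_iff_gt less_eq_real_def mult_zero_right)
    then show ?thesis using s0 by simp
  qed (simp add: s0)
  have const_right: "s x = s 1" if "x \<ge> 1" for x
  proof (cases "x = 1")
    case False
    then have "s x - s 1 = 0" 
      using MVT2[of 1 x s b] s that b_0 by (metis less_eq_real_def mult_zero_right)
    then show ?thesis by simp
  qed simp
  obtain z where "0 < z" "z < 1" "s 1 - s 0 = (1 - 0) * b z"
    using MVT2[of 0 1 s b] s by auto
  then have s1: "s 1 > 0"
    using b_pos[of z] s0 by simp
  show thesis
  proof (rule that[of "\<lambda>x. (1 / s 1) * s x"])
    show "smooth_fun (\<lambda>x. 1 / s 1 * s x)"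
      by (rule smooth_fun.mult[OF smooth_fun.const smooth_fun.antideriv[OF b s]])
    show "1 / s 1 * s x = 1" if "x \<ge> 1" for x
      using const_right[OF that] s1 by (metis nonzero_eq_divide_eq order_less_irrefl mult.commute times_divide_eq_right mult_1)
    show "1 / s 1 * s x \<ge> 0" for x
      using mono[of 0 x] const_left[of x] s0 s1 by (cases "x \<ge> 0") auto
    show "1 / s 1 * s x \<le> 1" for x
      using mono[of x 1] const_right[of x] s1 by (cases "x \<le> 1") auto
  qed (simp add: const_left)
qed

section \<open>Products of probability measures on the line\<close>

text \<open>Points are total functions on all indices. A tuple indexed by S alone is represented by
  \<open>splice S x y\<close> with y irrelevant or integrated out, which avoids product spaces over
  varying index sets.\<close>

definition splice :: "'i set \<Rightarrow> ('i \<Rightarrow> 'b) \<Rightarrow> ('i \<Rightarrow> 'b) \<Rightarrow> 'i \<Rightarrow> 'b"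
  where "splice S x y = (\<lambda>j. if j \<in> S then x j else y j)"

lemma splice_insert: "i \<notin> S \<Longrightarrow> splice S x (y(i := t)) = splice (insert i S) (x(i := t)) y"
  by (auto simp: splice_def fun_eq_iff)

lemma splice_splice: "splice S (splice S x y) z = splice S x z"
  by (auto simp: splice_def fun_eq_iff)

lemma splice_empty: "splice {} x y = y" and splice_UNIV: "splice UNIV x y = x"
  by (auto simp: splice_def fun_eq_iff)

locale real_product_prob =
  fixes \<mu> :: "'i::finite \<Rightarrow> real measure"
  assumes prob: "\<And>i. prob_space (\<mu> i)" and sets_\<mu>[measurable_cong]: "\<And>i. sets (\<mu> i) = sets borel"
begin

sublocale P: product_prob_space \<mu> UNIV
  using prob by (simp add: product_prob_space_def product_prob_space_axioms_def product_sigma_finite_def prob_space_imp_sigma_finite)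

sublocale P: finite_product_prob_space \<mu> UNIV
  by unfold_locales simp

abbreviation M :: "('i \<Rightarrow> real) measure" where "M \<equiv> Pi\<^sub>M UNIV \<mu>"

lemma space_\<mu>[simp]: "space (\<mu> i) = UNIV"
  using sets_eq_imp_space_eq[OF sets_\<mu>] by simp

lemma space_M[simp]: "space M = UNIV"
  by (simp add: space_PiM)

lemma prob_M: "prob_space M"
  by (rule P.prob_space_axioms)

lemma sigma_finite_M: "sigma_finite_measure M" and sigma_finite_\<mu>: "sigma_finite_measure (\<mu> i)"
  by (intro prob_space_imp_sigma_finite prob_M prob)+

lemma measurable_splice[measurable]: "(\<lambda>(x, y). splice S x y) \<in> M \<Otimes>\<^sub>M M \<rightarrow>\<^sub>M M"
  unfolding splice_def case_prod_beta
  by (rule measurable_PiM_single') (auto simp: space_pair_measure split: if_split)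

lemma measurable_splice2[measurable]:
  "f \<in> N \<rightarrow>\<^sub>M M \<Longrightarrow> g \<in> N \<rightarrow>\<^sub>M M \<Longrightarrow> (\<lambda>x. splice S (f x) (g x)) \<in> N \<rightarrow>\<^sub>M M"
  using measurable_compose[OF measurable_Pair measurable_splice[of S], of f N g] by simp

lemma measurable_line[measurable]:
  "f \<in> N \<rightarrow>\<^sub>M M \<Longrightarrow> g \<in> borel_measurable N \<Longrightarrow> (\<lambda>x. (f x)(i := g x)) \<in> N \<rightarrow>\<^sub>M M"
  by (rule measurable_fun_upd[where J = UNIV]) (auto simp: measurable_cong_sets[OF refl sets_\<mu>])

text \<open>The preimage of a box is the product of a box that constrains only S and one that
  constrains only the complement, and the free factors have mass 1. Fubini for marginals rests on
  this identity.\<close>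

lemma distr_splice: "distr (M \<Otimes>\<^sub>M M) M (\<lambda>(x, y). splice S x y) = M"
proof (rule P.PiM_eqI)
  fix A assume A: "\<And>i. i \<in> UNIV \<Longrightarrow> A i \<in> sets (\<mu> i)"
  interpret M2: pair_sigma_finite M M
    by (intro pair_sigma_finite.intro prob_space_imp_sigma_finite prob_M)
  let ?B = "\<lambda>S. Pi\<^sub>E UNIV (\<lambda>j. if j \<in> S then A j else UNIV)"
  have B: "?B S \<in> sets M" for S
    using A by (intro sets_PiM_I_finite) auto
  have "emeasure M (?B S) = (\<Prod>j\<in>UNIV. emeasure (\<mu> j) (if j \<in> S then A j else UNIV))" for S
    using A by (subst P.emeasure_PiM) auto
  also have "(\<Prod>j\<in>UNIV. emeasure (\<mu> j) (if j \<in> S then A j else UNIV)) = (\<Prod>j\<in>S. emeasure (\<mu> j) (A j))" for S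
    using prob_space.emeasure_space_1[OF prob]
    by (subst prod.mono_neutral_cong_right[of UNIV S]) auto
  finally have eB: "emeasure M (?B S) = (\<Prod>j\<in>S. emeasure (\<mu> j) (A j))" for S .
  have "emeasure (distr (M \<Otimes>\<^sub>M M) M (\<lambda>(x, y). splice S x y)) (Pi\<^sub>E UNIV A)
      = emeasure (M \<Otimes>\<^sub>M M) ((\<lambda>(x, y). splice S x y) -` Pi\<^sub>E UNIV A \<inter> space (M \<Otimes>\<^sub>M M))"
    using A by (intro emeasure_distr) auto
  also have "(\<lambda>(x, y). splice S x y) -` Pi\<^sub>E UNIV A \<inter> space (M \<Otimes>\<^sub>M M) = ?B S \<times> ?B (- S)"
    by (auto simp: space_pair_measure splice_def PiE_iff split: if_splits)
  also have "emeasure (M \<Otimes>\<^sub>M M) \<dots> = emeasure M (?B S) * emeasure M (?B (- S))"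
    using B by (intro sigma_finite_measure.emeasure_pair_measure_Times[OF sigma_finite_M])
  also have "\<dots> = (\<Prod>j\<in>UNIV. emeasure (\<mu> j) (A j))"
    unfolding eB by (subst prod.union_disjoint[symmetric]) auto
  finally show "emeasure (distr (M \<Otimes>\<^sub>M M) M (\<lambda>(x, y). splice S x y)) (Pi\<^sub>E UNIV A) = (\<Prod>i\<in>UNIV. emeasure (\<mu> i) (A i))" .
qed auto

lemma nn_integral_splice:
  assumes [measurable]: "H \<in> borel_measurable M"
  shows "(\<integral>\<^sup>+x. H x \<partial>M) = (\<integral>\<^sup>+x. \<integral>\<^sup>+y. H (splice S x y) \<partial>M \<partial>M)"
proof -
  interpret M2: pair_sigma_finite M M
    by (intro pair_sigma_finite.intro prob_space_imp_sigma_finite prob_M)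
  have "(\<integral>\<^sup>+x. H x \<partial>M) = (\<integral>\<^sup>+x. H x \<partial>distr (M \<Otimes>\<^sub>M M) M (\<lambda>(x, y). splice S x y))"
    by (simp add: distr_splice)
  also have "\<dots> = (\<integral>\<^sup>+z. H (splice S (fst z) (snd z)) \<partial>(M \<Otimes>\<^sub>M M))"
    by (subst nn_integral_distr) (auto simp: case_prod_beta)
  also have "\<dots> = (\<integral>\<^sup>+x. \<integral>\<^sup>+y. H (splice S x y) \<partial>M \<partial>M)"
    by (subst sigma_finite_measure.nn_integral_fst[OF sigma_finite_M, symmetric]) auto
  finally show ?thesis .
qed

lemma distr_component: "distr M (\<mu> i) (\<lambda>x. x i) = \<mu> i"
  using P.PiM_component[of i] by simp

lemma nn_integral_component:
  assumes [measurable]: "h \<in> borel_measurable borel"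
  shows "(\<integral>\<^sup>+x. h (x i) \<partial>M) = (\<integral>\<^sup>+t. h t \<partial>\<mu> i)"
proof -
  have "(\<integral>\<^sup>+t. h t \<partial>\<mu> i) = (\<integral>\<^sup>+t. h t \<partial>distr M (\<mu> i) (\<lambda>x. x i))"
    by (simp add: distr_component)
  also have "\<dots> = (\<integral>\<^sup>+x. h (x i) \<partial>M)"
    by (subst nn_integral_distr) auto
  finally show ?thesis ..
qed

lemma nn_integral_line:
  assumes [measurable]: "H \<in> borel_measurable M"
  shows "(\<integral>\<^sup>+x. H x \<partial>M) = (\<integral>\<^sup>+x. \<integral>\<^sup>+t. H (x(i := t)) \<partial>\<mu> i \<partial>M)"
proof -
  have upd: "splice (- {i}) x y = x(i := y i)" for x y :: "'i \<Rightarrow> real"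
    by (auto simp: splice_def fun_eq_iff)
  have "(\<integral>\<^sup>+x. H x \<partial>M) = (\<integral>\<^sup>+x. \<integral>\<^sup>+y. H (x(i := y i)) \<partial>M \<partial>M)"
    using nn_integral_splice[of H "- {i}"] by (simp only: upd assms)
  also have "\<dots> = (\<integral>\<^sup>+x. \<integral>\<^sup>+t. H (x(i := t)) \<partial>\<mu> i \<partial>M)"
    by (intro nn_integral_cong nn_integral_component) measurable
  finally show ?thesis .
qed

lemma distr_line: "distr (M \<Otimes>\<^sub>M \<mu> i) M (\<lambda>(x, t). x(i := t)) = M"
proof (rule measure_eqI)
  fix A assume "A \<in> sets (distr (M \<Otimes>\<^sub>M \<mu> i) M (\<lambda>(x, t). x(i := t)))"
  then have [measurable]: "A \<in> sets M" by simp
  interpret M2: pair_sigma_finite M "\<mu> i"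
    by (intro pair_sigma_finite.intro prob_space_imp_sigma_finite prob_M prob)
  have "emeasure (distr (M \<Otimes>\<^sub>M \<mu> i) M (\<lambda>(x, t). x(i := t))) A
      = (\<integral>\<^sup>+x. indicator A x \<partial>distr (M \<Otimes>\<^sub>M \<mu> i) M (\<lambda>(x, t). x(i := t)))"
    by simp
  also have "\<dots> = (\<integral>\<^sup>+x. \<integral>\<^sup>+t. indicator A (x(i := t)) \<partial>\<mu> i \<partial>M)"
    by (subst nn_integral_distr, measurable, subst sigma_finite_measure.nn_integral_fst[OF sigma_finite_\<mu>, symmetric]) (auto simp: case_prod_beta)
  also have "\<dots> = (\<integral>\<^sup>+x. indicator A x \<partial>M)"
    by (rule nn_integral_line[symmetric]) auto
  finally show "emeasure (distr (M \<Otimes>\<^sub>M \<mu> i) M (\<lambda>(x, t). x(i := t))) A = emeasure M A"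
    by simp
qed simp

text \<open>Fubini for null sets. The i-th coordinate of x is overwritten, so x may range over the
  whole space.\<close>

lemma AE_line:
  assumes "AE x in M. Q x"
  shows "AE x in M. AE t in \<mu> i. Q (x(i := t))"
proof -
  interpret M2: pair_sigma_finite M "\<mu> i"
    by (intro pair_sigma_finite.intro prob_space_imp_sigma_finite prob_M prob)
  obtain N where N: "{x. \<not> Q x} \<subseteq> N" "emeasure M N = 0" "N \<in> sets M"
    using AE_E[OF assms] by auto
  note [measurable] = N(3)
  have "0 = (\<integral>\<^sup>+x. indicator N x \<partial>M)" using N by simp
  also have "\<dots> = (\<integral>\<^sup>+x. \<integral>\<^sup>+t. indicator N (x(i := t)) \<partial>\<mu> i \<partial>M)"
    by (rule nn_integral_line) simp
  finally have "AE x in M. (\<integral>\<^sup>+t. indicator N (x(i := t)) \<partial>\<mu> i) = 0"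
    by (subst (asm) eq_commute, subst (asm) nn_integral_0_iff_AE) auto
  then show ?thesis
  proof eventually_elim
    case (elim x)
    then have "AE t in \<mu> i. indicator N (x(i := t)) = (0::ennreal)"
      by (subst (asm) nn_integral_0_iff_AE) auto
    then show ?case
      by eventually_elim (use N(1) in \<open>auto simp: indicator_def split: if_splits\<close>)
  qed
qed

lemma
  fixes H :: "('i \<Rightarrow> real) \<Rightarrow> real"
  assumes int: "integrable M H"
  shows AE_integrable_line: "AE x in M. integrable (\<mu> i) (\<lambda>t. H (x(i := t)))"
    and integrable_integral_line: "integrable M (\<lambda>x. \<integral>t. H (x(i := t)) \<partial>\<mu> i)"
    and integral_line: "(\<integral>x. H x \<partial>M) = (\<integral>x. \<integral>t. H (x(i := t)) \<partial>\<mu> i \<partial>M)"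
proof -
  interpret M2: pair_sigma_finite M "\<mu> i"
    by (intro pair_sigma_finite.intro prob_space_imp_sigma_finite prob_M prob)
  have [measurable]: "H \<in> borel_measurable M" using int by simp
  have int2: "integrable (M \<Otimes>\<^sub>M \<mu> i) (\<lambda>(x, t). H (x(i := t)))"
    using int unfolding case_prod_beta
    by (subst (asm) distr_line[of i, symmetric], subst (asm) integrable_distr_eq) (auto simp: case_prod_beta)
  show "AE x in M. integrable (\<mu> i) (\<lambda>t. H (x(i := t)))"
    using M2.AE_integrable_fst'[OF int2] by simp
  show "integrable M (\<lambda>x. \<integral>t. H (x(i := t)) \<partial>\<mu> i)"
    using M2.integrable_fst'[OF int2] by simp
  have "(\<integral>x. H x \<partial>M) = (\<integral>z. H ((fst z)(i := snd z)) \<partial>(M \<Otimes>\<^sub>M \<mu> i))"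
    by (subst distr_line[of i, symmetric], subst integral_distr) (auto simp: case_prod_beta)
  then show "(\<integral>x. H x \<partial>M) = (\<integral>x. \<integral>t. H (x(i := t)) \<partial>\<mu> i \<partial>M)"
    using M2.integral_fst'[OF int2] by (simp add: case_prod_unfold)
qed

text \<open>The conditional expectation of F given the coordinates in S. All coordinates of y are
  integrated, but \<open>splice\<close> discards those in S.\<close>

definition marginal :: "(('i \<Rightarrow> real) \<Rightarrow> ennreal) \<Rightarrow> 'i set \<Rightarrow> ('i \<Rightarrow> real) \<Rightarrow> ennreal"
  where "marginal F S x = (\<integral>\<^sup>+y. F (splice S x y) \<partial>M)"

lemma measurable_marginal[measurable]:
  assumes [measurable]: "F \<in> borel_measurable M"
  shows "marginal F S \<in> borel_measurable M"
proof -
  interpret sigma_finite_measure M by (intro prob_space_imp_sigma_finite prob_M)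
  show ?thesis unfolding marginal_def by measurable
qed

lemma marginal_splice: "marginal F S (splice S x y) = marginal F S x"
  by (simp add: marginal_def splice_splice)

lemma marginal_upd: "i \<notin> S \<Longrightarrow> marginal F S (x(i := t)) = marginal F S x"
  unfolding marginal_def by (intro nn_integral_cong arg_cong[of _ _ F]) (auto simp: splice_def fun_eq_iff)

lemma marginal_UNIV: "marginal F UNIV x = F x"
  by (simp add: marginal_def splice_UNIV prob_space.emeasure_space_1[OF prob_M, simplified])

lemma marginal_empty: "marginal F {} x = (\<integral>\<^sup>+y. F y \<partial>M)"
  by (simp add: marginal_def splice_empty)

lemma marginal_insert:
  assumes [measurable]: "F \<in> borel_measurable M" and "i \<notin> S"
  shows "marginal F S x = (\<integral>\<^sup>+t. marginal F (insert i S) (x(i := t)) \<partial>\<mu> i)"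
proof -
  interpret M2: pair_sigma_finite M "\<mu> i"
    by (intro pair_sigma_finite.intro prob_space_imp_sigma_finite prob_M prob)
  have [measurable]: "(\<lambda>z. splice (insert i S) (x(i := snd z)) (fst z)) \<in> M \<Otimes>\<^sub>M \<mu> i \<rightarrow>\<^sub>M M"
    by (intro measurable_splice2 measurable_line) (auto simp: sets_PiM)
  have "marginal F S x = (\<integral>\<^sup>+y. \<integral>\<^sup>+t. F (splice S x (y(i := t))) \<partial>\<mu> i \<partial>M)"
    unfolding marginal_def by (rule nn_integral_line) measurable
  also have "\<dots> = (\<integral>\<^sup>+y. \<integral>\<^sup>+t. F (splice (insert i S) (x(i := t)) y) \<partial>\<mu> i \<partial>M)"
    by (simp add: splice_insert[OF assms(2)])
  also have "\<dots> = (\<integral>\<^sup>+t. \<integral>\<^sup>+y. F (splice (insert i S) (x(i := t)) y) \<partial>M \<partial>\<mu> i)"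
    by (rule M2.Fubini'[symmetric]) (auto simp: case_prod_beta)
  finally show ?thesis unfolding marginal_def .
qed

text \<open>The defining property of a conditional expectation; the last hypothesis says that H
  depends on the coordinates in S only.\<close>

lemma nn_integral_marginal:
  assumes [measurable]: "F \<in> borel_measurable M" "H \<in> borel_measurable M"
    and H: "\<And>x y. H (splice S x y) = H x"
  shows "(\<integral>\<^sup>+x. H x * marginal F S x \<partial>M) = (\<integral>\<^sup>+x. H x * F x \<partial>M)"
proof -
  have "(\<integral>\<^sup>+x. H x * F x \<partial>M) = (\<integral>\<^sup>+x. \<integral>\<^sup>+y. H (splice S x y) * F (splice S x y) \<partial>M \<partial>M)"
    by (rule nn_integral_splice) measurable
  also have "\<dots> = (\<integral>\<^sup>+x. H x * marginal F S x \<partial>M)"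
    unfolding marginal_def H by (intro nn_integral_cong nn_integral_cmult) measurable
  finally show ?thesis ..
qed

lemma AE_marginal_finite:
  assumes [measurable]: "F \<in> borel_measurable M" and "(\<integral>\<^sup>+x. F x \<partial>M) < \<infinity>"
  shows "AE x in M. marginal F S x < \<infinity>"
proof -
  have "(\<integral>\<^sup>+x. marginal F S x \<partial>M) = (\<integral>\<^sup>+x. F x \<partial>M)"
    using nn_integral_marginal[of F "\<lambda>_. 1" S] by simp
  then show ?thesis
    using assms(2) nn_integral_PInf_AE[of "marginal F S" M] by (auto simp: less_top)
qed

text \<open>Test \<open>nn_integral_marginal\<close> with the indicator of the zero set of the
  marginal.\<close>

lemma AE_marginal_pos:
  assumes [measurable]: "F \<in> borel_measurable M"
  shows "AE x in M. marginal F S x = 0 \<longrightarrow> F x = 0"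
proof -
  let ?H = "\<lambda>x. if marginal F S x = 0 then 1 else 0::ennreal"
  have "(\<integral>\<^sup>+x. ?H x * F x \<partial>M) = (\<integral>\<^sup>+x. ?H x * marginal F S x \<partial>M)"
    by (rule nn_integral_marginal[symmetric]) (auto simp: marginal_splice)
  also have "\<dots> = (\<integral>\<^sup>+x. 0 \<partial>M)"
    by (intro nn_integral_cong) auto
  finally have "AE x in M. ?H x * F x = 0"
    by (simp add: nn_integral_0_iff_AE)
  then show ?thesis by eventually_elim (auto split: if_splits)
qed

text \<open>Averaging over one coordinate does not change a function that is constant on almost all
  lines in that direction. Averaging over one coordinate after another therefore leads from the
  function to its mean. Applying \<open>arctan\<close> makes it bounded, so that all averages
  exist.\<close>

lemma AE_const_of_lines:
  fixes v :: "('i \<Rightarrow> real) \<Rightarrow> real"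
  assumes [measurable]: "v \<in> borel_measurable M"
    and lines: "\<And>i. AE x in M. \<exists>c. AE t in \<mu> i. v (x(i := t)) = c"
  shows "\<exists>c. AE x in M. v x = c"
proof -
  define u where "u x = arctan (v x)" for x
  have [measurable]: "u \<in> borel_measurable M" unfolding u_def by measurable
  have bnd: "\<bar>u x\<bar> \<le> 2" for x
    unfolding u_def using arctan_bounded[of "v x"] pi_less_4 by linarith
  have int: "integrable M (\<lambda>y. u (splice S x y))" for S x
    using bnd by (intro finite_measure.integrable_const_bound[where B = 2])
      (auto intro: prob_space.finite_measure prob_M)
  have borel_measurable_integral_splice: "(\<lambda>t. \<integral>y. u (splice S (x(i := t)) y) \<partial>M) \<in> borel_measurable (\<mu> i)" for S x i
  proof -
    have [measurable]: "(\<lambda>z. splice S (x(i := fst z)) (snd z)) \<in> \<mu> i \<Otimes>\<^sub>M M \<rightarrow>\<^sub>M M"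
      by (intro measurable_splice2 measurable_line) auto
    show ?thesis
      by (rule sigma_finite_measure.borel_measurable_lebesgue_integral[OF sigma_finite_M])
        (auto simp: case_prod_beta)
  qed
  \<comment> \<open>The induction runs over the complement of S, the set of coordinates already
    averaged out.\<close>
  have *: "AE x in M. u x = (\<integral>y. u (splice S x y) \<partial>M)" if "finite (- S)" for S
    using that
  proof (induction "- S" arbitrary: S rule: finite_induct)
    case empty
    then have "S = UNIV" by auto
    then show ?case 
      by (simp add: splice_UNIV prob_space.prob_space[OF prob_M, simplified])
  next
    case (insert i R)
    define S' where "S' = insert i S"
    have S': "R = - S'" "i \<notin> S" using insert unfolding S'_def by auto
    have E: "(\<integral>y. u (splice S x y) \<partial>M) = (\<integral>t. \<integral>y. u (splice S' (x(i := t)) y) \<partial>M \<partial>\<mu> i)" for x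
    proof -
      interpret M2: pair_prob_space "\<mu> i" M
        by (intro pair_prob_space.intro pair_sigma_finite.intro prob_space_imp_sigma_finite prob_M prob)
      have [measurable]: "(\<lambda>z. splice S' (x(i := fst z)) (snd z)) \<in> \<mu> i \<Otimes>\<^sub>M M \<rightarrow>\<^sub>M M"
        by (intro measurable_splice2 measurable_line) auto
      have i2: "integrable (\<mu> i \<Otimes>\<^sub>M M) (\<lambda>(t, y). u (splice S' (x(i := t)) y))"
        using bnd by (intro M2.P.integrable_const_bound[where B = 2]) (auto simp: case_prod_beta)
      have "(\<integral>y. u (splice S x y) \<partial>M) = (\<integral>y. \<integral>t. u (splice S x (y(i := t))) \<partial>\<mu> i \<partial>M)"
        by (rule integral_line[OF int])
      also have "\<dots> = (\<integral>y. \<integral>t. u (splice S' (x(i := t)) y) \<partial>\<mu> i \<partial>M)"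
        by (simp add: splice_insert[OF S'(2)] S'_def)
      also have "\<dots> = (\<integral>t. \<integral>y. u (splice S' (x(i := t)) y) \<partial>M \<partial>\<mu> i)"
        using M2.Fubini_integral[OF i2] by simp
      finally show ?thesis .
    qed
    have "AE x in M. u x = (\<integral>y. u (splice S' x y) \<partial>M)"
      using insert.hyps(3)[OF S'(1)] .
    from AE_line[OF this, of i] lines[of i]
    have "AE x in M. AE t in \<mu> i. u (x(i := t)) = (\<integral>y. u (splice S x y) \<partial>M)"
    proof eventually_elim
      case (elim x)
      obtain c where c: "AE t in \<mu> i. v (x(i := t)) = c" using elim(2) by blast
      have uc: "AE t in \<mu> i. u (x(i := t)) = arctan c"
        using c by eventually_elim (simp add: u_def)
      have "AE t in \<mu> i. (\<integral>y. u (splice S' (x(i := t)) y) \<partial>M) = arctan c"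
        using elim(1) uc by eventually_elim simp
      then have "(\<integral>y. u (splice S x y) \<partial>M) = (\<integral>t. arctan c \<partial>\<mu> i)"
        unfolding E by (intro integral_cong_AE) (auto intro!: borel_measurable_integral_splice)
      then have "(\<integral>y. u (splice S x y) \<partial>M) = arctan c"
        using prob_space.prob_space[OF prob, of i] by simp
      with uc show ?case by simp
    qed
    moreover have "(\<integral>y. u (splice S (x(i := t)) y) \<partial>M) = (\<integral>y. u (splice S x y) \<partial>M)" for x t
    proof -
      have "splice S (x(i := t)) y = splice S x y" for y
        using S'(2) by (auto simp: splice_def)
      then show ?thesis by simp
    qed
    ultimately have "AE x in M. AE t in \<mu> i. u (x(i := t)) = (\<integral>y. u (splice S (x(i := t)) y) \<partial>M)"
      by simp
    \<comment> \<open>The exceptional set is measured by integrating its indicator first along the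
      lines in direction i.\<close>
    then have "AE x in M. (\<integral>\<^sup>+t. (if u (x(i := t)) = (\<integral>y. u (splice S (x(i := t)) y) \<partial>M) then 0 else 1) \<partial>\<mu> i) = 0"
    proof eventually_elim
      case (elim x)
      then have "AE t in \<mu> i. (if u (x(i := t)) = (\<integral>y. u (splice S (x(i := t)) y) \<partial>M) then 0 else 1) = (0::ennreal)"
        by eventually_elim simp
      then show ?case by (subst nn_integral_cong_AE[where v = "\<lambda>_. 0"]) auto
    qed
    moreover have [measurable]: "(\<lambda>x. \<integral>y. u (splice S x y) \<partial>M) \<in> borel_measurable M"
    proof -
      interpret sigma_finite_measure M by (intro prob_space_imp_sigma_finite prob_M)
      show ?thesis by measurable
    qed
    ultimately have "(\<integral>\<^sup>+x. (if u x = (\<integral>y. u (splice S x y) \<partial>M) then 0 else 1) \<partial>M) = 0"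
      by (subst nn_integral_line[where i = i]) (auto simp: nn_integral_cong_AE[where v = "\<lambda>_. 0"])
    then have "AE x in M. (if u x = (\<integral>y. u (splice S x y) \<partial>M) then 0 else 1) = (0::ennreal)"
      by (subst (asm) nn_integral_0_iff_AE) auto
    then show ?case by eventually_elim (auto split: if_splits)
  qed
  have "AE x in M. u x = (\<integral>y. u y \<partial>M)"
    using *[of "{}"] by (simp add: splice_empty)
  then have "AE x in M. v x = tan (\<integral>y. u y \<partial>M)"
    by eventually_elim (metis u_def tan_arctan)
  then show ?thesis by blast
qed

end

section \<open>Absolutely continuous functions\<close>

text \<open>Local absolute continuity with the derivative carried as data: the increments of u are
  prescribed at every pair of points, whereas u' matters only up to null sets.\<close>

definition ac :: "(real \<Rightarrow> real) \<Rightarrow> (real \<Rightarrow> real) \<Rightarrow> bool"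
  where "ac u u' \<longleftrightarrow> (\<forall>a b. set_integrable lborel {a..b} u') \<and>
    (\<forall>a b. a \<le> b \<longrightarrow> u b - u a = (LBINT x:{a..b}. u' x))"

lemma integrable_lborel_prod_mult:
  fixes U V :: "real \<Rightarrow> real"
  assumes U: "integrable lborel U" and V: "integrable lborel V"
  shows "integrable (lborel \<Otimes>\<^sub>M lborel) (\<lambda>(s, t). U s * V t)"
proof (rule lborel_pair.Fubini_integrable)
  have [measurable]: "U \<in> borel_measurable borel" "V \<in> borel_measurable borel"
    using U V by auto
  show "(\<lambda>(s, t). U s * V t) \<in> borel_measurable (lborel \<Otimes>\<^sub>M lborel)"
    by measurable
  show "integrable lborel (\<lambda>s. LINT t|lborel. norm (case (s, t) of (s, t) \<Rightarrow> U s * V t))"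
    using U V by (simp add: abs_mult)
  show "AE s in lborel. integrable lborel (\<lambda>t. case (s, t) of (s, t) \<Rightarrow> U s * V t)"
    using V by simp
qed

lemma ac_integrable: "ac u u' \<Longrightarrow> set_integrable lborel {a..b} u'"
  and ac_diff: "ac u u' \<Longrightarrow> a \<le> b \<Longrightarrow> u b - u a = (LBINT x:{a..b}. u' x)"
  by (auto simp: ac_def)

lemma ac_measurable_deriv:
  assumes "ac u u'"
  shows "u' \<in> borel_measurable borel"
proof -
  have "(\<lambda>x. indicator {- real n..real n} x * u' x) \<in> borel_measurable borel" for n
    using ac_integrable[OF assms] unfolding set_integrable_def by (auto dest!: borel_measurable_integrable)
  moreover have "(\<lambda>n. indicator {- real n..real n} x * u' x) \<longlonglongrightarrow> u' x" for x
  proof (rule tendsto_eventually)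
    obtain k where k: "real k \<ge> \<bar>x\<bar>" using real_arch_simple by blast
    show "\<forall>\<^sub>F n in sequentially. indicator {- real n..real n} x * u' x = u' x"
    proof (rule eventually_sequentiallyI[of k])
      fix n assume "k \<le> n"
      then have "real n \<ge> \<bar>x\<bar>" using k by linarith
      then show "indicator {- real n..real n} x * u' x = u' x" by (auto simp: indicator_def)
    qed
  qed
  ultimately show ?thesis
    by (rule borel_measurable_LIMSEQ_real[rotated])
qed

lemma ac_continuous:
  assumes "ac u u'"
  shows "continuous_on S u"
proof -
  have "continuous_on {-M<..<M} u" for M
  proof -
    have "u' absolutely_integrable_on {-M..M}"
      using ac_integrable[OF assms, of "-M" M] by (simp add: absolutely_integrable_on_def set_integrable_def integrable_completion borel_measurable_integrable)
    then have "u' integrable_on {-M..M}"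
      by (rule set_lebesgue_integral_eq_integral)
    then have "continuous_on {-M..M} (\<lambda>x. u (-M) + integral {-M..x} u')"
      by (intro continuous_intros indefinite_integral_continuous_1)
    moreover have "u (-M) + integral {-M..x} u' = u x" if "x \<in> {-M..M}" for x
      using ac_diff[OF assms, of "-M" x] that set_borel_integral_eq_integral(2)[OF ac_integrable[OF assms, of "-M" x]]
      by auto
    ultimately have "continuous_on {-M..M} u"
      by (rule continuous_on_eq)
    then show ?thesis by (rule continuous_on_subset) auto
  qed
  then have "isCont u x" for x
    by (rule continuous_on_interior[where S = "{-(\<bar>x\<bar> + 1)<..<\<bar>x\<bar> + 1}"]) (simp add: interior_open, linarith)
  then show ?thesis
    by (intro continuous_at_imp_continuous_on) auto
qed

lemma ac_measurable: "ac u u' \<Longrightarrow> u \<in> borel_measurable borel"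
  using borel_measurable_continuous_onI[OF ac_continuous] .

lemma set_integrable_continuous_mult:
  fixes v :: "real \<Rightarrow> real"
  assumes "set_integrable lborel {a..b} u" and "continuous_on {a..b} v"
  shows "set_integrable lborel {a..b} (\<lambda>x. u x * v x)"
proof -
  have "compact (v ` {a..b})" using assms(2) compact_continuous_image by blast
  then obtain B where B: "\<And>x. x \<in> {a..b} \<Longrightarrow> \<bar>v x\<bar> \<le> B"
    using compact_imp_bounded bounded_iff by (metis image_eqI real_norm_def)
  have [measurable]: "(\<lambda>x. indicator {a..b} x * u x) \<in> borel_measurable lborel"
    using assms(1) unfolding set_integrable_def by (auto dest!: borel_measurable_integrable)
  have [measurable]: "(\<lambda>x. indicator {a..b} x * v x) \<in> borel_measurable lborel"
    using borel_measurable_continuous_on_indicator[OF _ assms(2)] by simp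
  have "integrable lborel (\<lambda>x. (indicator {a..b} x * u x) * (indicator {a..b} x * v x))"
  proof (rule Bochner_Integration.integrable_bound)
    show "integrable lborel (\<lambda>x. B * (indicator {a..b} x * u x))"
      using assms(1) unfolding set_integrable_def by simp
    show "AE x in lborel. norm (indicator {a..b} x * u x * (indicator {a..b} x * v x)) \<le> norm (B * (indicator {a..b} x * u x))"
    proof (rule AE_I2)
      fix x
      show "norm (indicator {a..b} x * u x * (indicator {a..b} x * v x)) \<le> norm (B * (indicator {a..b} x * u x))"
        using B[of x] by (auto simp: indicator_def abs_mult mult.commute[of "\<bar>u x\<bar>"] intro!: mult_right_mono
            dest: order_trans[OF _ abs_ge_self])
    qed
  qed measurable
  moreover have "(\<lambda>x. (indicator {a..b} x * u x) * (indicator {a..b} x * v x)) = (\<lambda>x. indicator {a..b} x * (u x * v x))"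
    by (auto simp: indicator_def fun_eq_iff)
  ultimately show ?thesis
    by (simp add: set_integrable_def)
qed

text \<open>Both increments are integrals over \<open>[a, b]\<close>, so their product is an integral over the
  square, which is split along the diagonal.\<close>

lemma ac_mult:
  assumes u: "ac u u'" and v: "ac v v'"
  shows "ac (\<lambda>x. u x * v x) (\<lambda>x. u' x * v x + v' x * u x)"
  unfolding ac_def
proof (intro conjI allI impI)
  show *: "set_integrable lborel {a..b} (\<lambda>x. u' x * v x + v' x * u x)" for a b
    by (intro set_integral_add set_integrable_continuous_mult ac_integrable[OF u] ac_integrable[OF v]
        ac_continuous[OF u] ac_continuous[OF v])
  fix a b :: real assume ab: "a \<le> b"
  define U where "U x = indicator {a..b} x * u' x" for x
  define V where "V x = indicator {a..b} x * v' x" for x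
  have iU: "integrable lborel U" and iV: "integrable lborel V"
    using ac_integrable[OF u, of a b] ac_integrable[OF v, of a b]
    by (auto simp: U_def[abs_def] V_def[abs_def] set_integrable_def)
  have [measurable]: "U \<in> borel_measurable borel" "V \<in> borel_measurable borel"
    using borel_measurable_integrable[OF iU] borel_measurable_integrable[OF iV] by auto
  have uU: "(LINT s|lborel. U s * indicator {..t} s) = u t - u a"
    "(LINT s|lborel. U s * indicator {..<t} s) = u t - u a" if "t \<in> {a..b}" for t
  proof -
    have "(LINT s|lborel. U s * indicator {..t} s) = (LBINT s:{a..t}. u' s)"
      unfolding set_lebesgue_integral_def using that
      by (intro Bochner_Integration.integral_cong) (auto simp: U_def indicator_def)
    then show "(LINT s|lborel. U s * indicator {..t} s) = u t - u a"
      using ac_diff[OF u, of a t] that by simp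
    moreover have "(LINT s|lborel. U s * indicator {..t} s) = (LINT s|lborel. U s * indicator {..<t} s)"
      using AE_lborel_singleton[of t] by (intro integral_cong_AE) (auto simp: indicator_def)
    ultimately show "(LINT s|lborel. U s * indicator {..<t} s) = u t - u a" by simp
  qed
  have vV: "(LINT s|lborel. V s * indicator {..t} s) = v t - v a" if "t \<in> {a..b}" for t
  proof -
    have "(LINT s|lborel. V s * indicator {..t} s) = (LBINT s:{a..t}. v' s)"
      unfolding set_lebesgue_integral_def using that
      by (intro Bochner_Integration.integral_cong) (auto simp: V_def indicator_def)
    then show ?thesis
      using ac_diff[OF v, of a t] that by simp
  qed
  have tot: "(LINT s|lborel. U s) = u b - u a" "(LINT s|lborel. V s) = v b - v a"
    using ac_diff[OF u ab] ac_diff[OF v ab] by (auto simp: U_def V_def set_lebesgue_integral_def)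
  have i2: "integrable (lborel \<Otimes>\<^sub>M lborel) (\<lambda>(s, t). U s * V t)"
    using iU iV by (rule integrable_lborel_prod_mult)
  have i2a: "integrable (lborel \<Otimes>\<^sub>M lborel) (\<lambda>(s, t). U s * V t * indicator {..t} s)"
   and i2b: "integrable (lborel \<Otimes>\<^sub>M lborel) (\<lambda>(s, t). U s * V t * indicator {..<s} t)"
    by (rule Bochner_Integration.integrable_bound[OF i2]; auto simp: indicator_def)+
  have "(u b - u a) * (v b - v a) = (LINT s|lborel. LINT t|lborel. U s * V t)"
    using tot by simp
  also have "\<dots> = (LINT z|(lborel \<Otimes>\<^sub>M lborel). U (fst z) * V (snd z))"
    using lborel_pair.integral_fst'[OF i2] by (simp add: case_prod_unfold)
  also have "\<dots> = (LINT z|(lborel \<Otimes>\<^sub>M lborel). (case z of (s, t) \<Rightarrow> U s * V t * indicator {..t} s) +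
      (case z of (s, t) \<Rightarrow> U s * V t * indicator {..<s} t))"
    by (intro Bochner_Integration.integral_cong) (auto simp: indicator_def)
  also have "\<dots> = (LINT z|(lborel \<Otimes>\<^sub>M lborel). (case z of (s, t) \<Rightarrow> U s * V t * indicator {..t} s)) +
      (LINT z|(lborel \<Otimes>\<^sub>M lborel). (case z of (s, t) \<Rightarrow> U s * V t * indicator {..<s} t))"
    by (intro Bochner_Integration.integral_add i2a i2b)
  also have "(LINT z|(lborel \<Otimes>\<^sub>M lborel). (case z of (s, t) \<Rightarrow> U s * V t * indicator {..t} s)) =
      (LINT t|lborel. V t * (LINT s|lborel. U s * indicator {..t} s))"
  proof -
    have "(LINT s|lborel. U s * V t * indicator {..t} s) = V t * (LINT s|lborel. U s * indicator {..t} s)" for t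
      by (subst integral_mult_right_zero[symmetric]) (simp add: mult_ac)
    then show ?thesis using lborel_pair.integral_snd[OF i2a] by simp
  qed
  also have "\<dots> = (LINT t|lborel. V t * (u t - u a))"
    by (intro Bochner_Integration.integral_cong) (use uU(1) in \<open>auto simp: V_def indicator_def\<close>)
  also have "(LINT z|(lborel \<Otimes>\<^sub>M lborel). (case z of (s, t) \<Rightarrow> U s * V t * indicator {..<s} t)) =
      (LINT s|lborel. U s * (LINT t|lborel. V t * indicator {..<s} t))"
    using lborel_pair.integral_fst'[OF i2b] by (simp add: mult.assoc)
  also have "\<dots> = (LINT s|lborel. U s * (LINT t|lborel. V t * indicator {..s} t))"
  proof -
    have "(LINT t|lborel. V t * indicator {..<s} t) = (LINT t|lborel. V t * indicator {..s} t)" for s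
      using AE_lborel_singleton[of s] by (intro integral_cong_AE) (auto simp: indicator_def)
    then show ?thesis by simp
  qed
  also have "\<dots> = (LINT s|lborel. U s * (v s - v a))"
    by (intro Bochner_Integration.integral_cong) (use vV in \<open>auto simp: U_def indicator_def\<close>)
  finally have main: "(u b - u a) * (v b - v a) =
    (LINT t|lborel. V t * (u t - u a)) + (LINT s|lborel. U s * (v s - v a))" .
  have iVu: "integrable lborel (\<lambda>t. V t * u t)" and iUv: "integrable lborel (\<lambda>t. U t * v t)"
    using set_integrable_continuous_mult[OF ac_integrable[OF v] ac_continuous[OF u], of a b]
      set_integrable_continuous_mult[OF ac_integrable[OF u] ac_continuous[OF v], of a b]
    by (simp_all add: set_integrable_def U_def V_def mult.assoc)
  have "(LINT t|lborel. V t * (u t - u a)) = (LINT t|lborel. V t * u t) - (v b - v a) * u a"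
    using iVu iV tot by (simp add: right_diff_distrib Bochner_Integration.integral_diff)
  moreover have "(LINT t|lborel. U t * (v t - v a)) = (LINT t|lborel. U t * v t) - (u b - u a) * v a"
    using iUv iU tot by (simp add: right_diff_distrib Bochner_Integration.integral_diff)
  moreover have "(LBINT x:{a..b}. u' x * v x + v' x * u x) = (LINT t|lborel. U t * v t) + (LINT t|lborel. V t * u t)"
    unfolding set_lebesgue_integral_def
    by (subst Bochner_Integration.integral_add[OF iUv iVu, symmetric])
      (auto intro!: Bochner_Integration.integral_cong simp: U_def V_def indicator_def)
  ultimately show "u b * v b - u a * v a = (LBINT x:{a..b}. u' x * v x + v' x * u x)"
    using main by (simp add: algebra_simps)
qed

lemma ac_C1:
  assumes "\<And>x. (u has_real_derivative u' x) (at x)" and "continuous_on UNIV u'"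
  shows "ac u u'"
  unfolding ac_def
proof (intro conjI allI impI)
  show "set_integrable lborel {a..b} u'" for a b
    using borel_integrable_compact[OF compact_Icc continuous_on_subset[OF assms(2)], of a b]
    by (simp add: set_integrable_def mult.commute)
  fix a b :: real assume "a \<le> b"
  then have "(LBINT x. u' x * indicator {a..b} x) = u b - u a"
    using assms(2) by (intro integral_FTC_Icc_real assms(1)) (auto simp: continuous_on_eq_continuous_at)
  then show "u b - u a = (LBINT x:{a..b}. u' x)"
    by (simp add: set_lebesgue_integral_def mult.commute)
qed

lemma ac_const_on:
  assumes "ac u u'" and "AE x in lborel. l < x \<longrightarrow> x < r \<longrightarrow> u' x = 0"
    and "s \<in> {l<..<r}" "t \<in> {l<..<r}"
  shows "u s = u t"
proof -
  have "u s = u t" if "l < s" "t < r" "s \<le> t" for s t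
  proof -
    have "AE x in lborel. indicator {s..t} x *\<^sub>R u' x = 0"
      using assms(2) by eventually_elim (use that in \<open>auto simp: indicator_def\<close>)
    then have "(LBINT x:{s..t}. u' x) = 0"
      unfolding set_lebesgue_integral_def by (rule integral_eq_zero_AE)
    then show ?thesis using ac_diff[OF assms(1) that(3)] by simp
  qed
  then show ?thesis using assms(3,4) by (metis greaterThanLessThan_iff linear)
qed

text \<open>Otherwise the absolute value of P would stay above half of that of L on a half-line,
  which has infinite measure.\<close>

lemma integrable_limit_zero_at_bot:
  fixes P :: "real \<Rightarrow> real"
  assumes "integrable lborel P" and "(P \<longlongrightarrow> L) at_bot"
  shows "L = 0"
proof (rule ccontr)
  assume "L \<noteq> 0"
  then have "\<forall>\<^sub>F x in at_bot. dist (P x) L < \<bar>L\<bar> / 2"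
    using assms(2) by (intro tendstoD) auto
  then obtain B where B: "\<And>x. x \<le> B \<Longrightarrow> dist (P x) L < \<bar>L\<bar> / 2"
    unfolding eventually_at_bot_linorder by blast
  have "integrable lborel (\<lambda>x. indicator {..B} x * (\<bar>L\<bar> / 2))"
  proof (rule Bochner_Integration.integrable_bound[OF assms(1)])
    show "AE x in lborel. norm (indicator {..B} x * (\<bar>L\<bar> / 2)) \<le> norm (P x)"
    proof (rule AE_I2)
      fix x
      have "\<bar>L\<bar> / 2 \<le> \<bar>P x\<bar>" if "x \<le> B"
        using B[OF that] unfolding dist_real_def by linarith
      then show "norm (indicator {..B} x * (\<bar>L\<bar> / 2)) \<le> norm (P x)"
        by (auto simp: indicator_def)
    qed
  qed measurable
  then have "integrable lborel (indicator {..B} :: real \<Rightarrow> real)"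
    using \<open>L \<noteq> 0\<close> integrable_mult_right[of "2 / \<bar>L\<bar>" lborel "\<lambda>x. indicator {..B} x * (\<bar>L\<bar> / 2)"] by simp
  then have "emeasure lborel {..B} < \<infinity>"
    by (simp add: integrable_indicator_iff)
  then obtain n where n: "emeasure lborel {..B} < of_nat n"
    using ennreal_Ex_less_of_nat by (auto simp: less_top)
  have "emeasure lborel {B - real n..B} \<le> emeasure lborel {..B}"
    by (intro emeasure_mono) auto
  with n show False
    by (simp add: ennreal_of_nat_eq_real_of_nat)
qed

text \<open>Integrability of P' gives P a limit at -\<infinity>, and integrability of P forces this
  limit to be 0. The total integral of P' follows by applying the same formula to the reflected
  function, for which the first claim is proved in general form.\<close>

lemma ac_eq_integral_Iic:
  assumes ac: "ac P P'" and P: "integrable lborel P" and P': "integrable lborel P'"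
  shows "P t = (LINT r|lborel. P' r * indicator {..t} r)" and "(LINT r|lborel. P' r) = 0"
proof -
  have [measurable]: "P' \<in> borel_measurable borel" using P' by auto
  have *: "P t = (LINT r|lborel. P' r * indicator {..t} r)"
    if ac: "ac P P'" and P: "integrable lborel P" and P': "integrable lborel P'" for P P' and t
  proof -
    have [measurable]: "P' \<in> borel_measurable borel" using P' by auto
    have "((\<lambda>s. LINT r|lborel. P' r * indicator {s..t} r) \<longlongrightarrow> (LINT r|lborel. P' r * indicator {..t} r)) at_bot"
      unfolding filterlim_at_bot_mirror
    proof (rule integral_dominated_convergence_at_top[where w = "\<lambda>r. \<bar>P' r\<bar>"])
      show "AE r in lborel. ((\<lambda>x. P' r * indicator {- x..t} r) \<longlongrightarrow> P' r * indicator {..t} r) at_top"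
      proof (intro AE_I2 tendsto_eventually)
        fix r
        show "\<forall>\<^sub>F x in at_top. P' r * indicator {- x..t} r = P' r * indicator {..t} r"
          using eventually_ge_at_top[of "- r"] by eventually_elim (auto simp: indicator_def)
      qed
    qed (use P' in \<open>auto simp: indicator_def intro!: always_eventually AE_I2\<close>)
    then have "((\<lambda>s. P t - (LINT r|lborel. P' r * indicator {s..t} r)) \<longlongrightarrow> P t - (LINT r|lborel. P' r * indicator {..t} r)) at_bot"
      by (intro tendsto_intros)
    moreover have "\<forall>\<^sub>F s in at_bot. P t - (LINT r|lborel. P' r * indicator {s..t} r) = P s"
      using eventually_le_at_bot[of t]
    proof eventually_elim
      case (elim s)
      then show ?case using ac_diff[OF ac elim] by (simp add: set_lebesgue_integral_def mult.commute)
    qed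
    ultimately have "(P \<longlongrightarrow> P t - (LINT r|lborel. P' r * indicator {..t} r)) at_bot"
      by (rule Lim_transform_eventually)
    from integrable_limit_zero_at_bot[OF P this] show ?thesis by simp
  qed
  show "P t = (LINT r|lborel. P' r * indicator {..t} r)"
    by (rule *[OF assms])
  have "ac (\<lambda>x. P (- x)) (\<lambda>x. - P' (- x))"
    unfolding ac_def
  proof (intro conjI allI impI)
    show "set_integrable lborel {a..b} (\<lambda>x. - P' (- x))" for a b
      unfolding set_integrable_def
      by (rule Bochner_Integration.integrable_bound[OF lborel_integrable_real_affine[OF P', of "-1" 0]])
        (auto simp: indicator_def)
    fix a b :: real assume "a \<le> b"
    then have "P (- a) - P (- b) = (LBINT x:{- b..- a}. P' x)"
      using ac_diff[OF ac, of "-b" "-a"] by simp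
    also have "\<dots> = (LBINT x:{a..b}. P' (- x))"
      unfolding set_lebesgue_integral_def
      by (subst lborel_integral_real_affine[where c = "-1" and t = 0])
        (auto intro!: Bochner_Integration.integral_cong simp: indicator_def)
    finally show "P (- b) - P (- a) = (LBINT x:{a..b}. - P' (- x))"
      by (simp add: set_lebesgue_integral_def)
  qed
  moreover have "integrable lborel (\<lambda>x. P (- x))" "integrable lborel (\<lambda>x. - P' (- x))"
    using lborel_integrable_real_affine[OF P', of "-1" 0] lborel_integrable_real_affine[OF P, of "-1" 0]
    by auto
  ultimately have "P (- 0) = (LINT r|lborel. - P' (- r) * indicator {..0} r)"
    using *[of "\<lambda>x. P (- x)" "\<lambda>x. - P' (- x)" 0] by simp
  also have "\<dots> = (LINT r|lborel. - P' r * indicator {0..} r)"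
    by (subst lborel_integral_real_affine[where c = "-1" and t = 0])
        (auto intro!: Bochner_Integration.integral_cong simp: indicator_def)
  also have "\<dots> = (LINT r|lborel. - P' r * indicator {0<..} r)"
    using AE_lborel_singleton[of 0] by (intro integral_cong_AE) (auto simp: indicator_def)
  finally have "(LINT r|lborel. P' r * indicator {..0} r) + (LINT r|lborel. P' r * indicator {0<..} r) = 0"
    using *[OF assms, of 0] by simp
  moreover have "integrable lborel (\<lambda>r. P' r * indicator {..0} r)" "integrable lborel (\<lambda>r. P' r * indicator {0<..} r)"
    using P' by (auto intro!: integrable_real_mult_indicator)
  ultimately have "(LINT r|lborel. P' r * indicator {..0} r + P' r * indicator {0<..} r) = 0"
    by (simp add: Bochner_Integration.integral_add)
  also have "(\<lambda>r. P' r * indicator {..0} r + P' r * indicator {0<..} r) = P'"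
    by (auto simp: indicator_def fun_eq_iff)
  finally show "(LINT r|lborel. P' r) = 0" .
qed

text \<open>Boundary terms are avoided: the double integral of V' t * P' r is 0 because P' has
  integral 0, and cutting the plane along r = t splits it into the two sides of the formula. The
  constant \<kappa> drops out for the same reason.\<close>

lemma ac_integration_by_parts:
  assumes ac: "ac P P'" and P: "integrable lborel P" and P': "integrable lborel P'"
    and V': "integrable lborel V'"
    and V: "\<And>r. V r = \<kappa> + (LINT t|lborel. V' t * indicator {..r} t)"
  shows "integrable lborel (\<lambda>t. V' t * P t)" and "integrable lborel (\<lambda>t. V t * P' t)"
    and "(LINT t|lborel. V' t * P t) = - (LINT t|lborel. V t * P' t)"
proof -
  note I = ac_eq_integral_Iic[OF ac P P']
  have [measurable]: "P' \<in> borel_measurable borel" "V' \<in> borel_measurable borel" using P' V' by auto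
  have i2: "integrable (lborel \<Otimes>\<^sub>M lborel) (\<lambda>(t, r). V' t * P' r)"
    using V' P' by (rule integrable_lborel_prod_mult)
  have i2a: "integrable (lborel \<Otimes>\<^sub>M lborel) (\<lambda>(t, r). V' t * P' r * indicator {..t} r)"
   and i2b: "integrable (lborel \<Otimes>\<^sub>M lborel) (\<lambda>(t, r). V' t * P' r * indicator {..<r} t)"
    by (rule Bochner_Integration.integrable_bound[OF i2]; auto simp: indicator_def)+
  have e1: "(LINT r|lborel. V' t * P' r * indicator {..t} r) = V' t * P t" for t
    by (simp add: I(1)[of t] mult.assoc)
  have e2: "(LINT t|lborel. V' t * P' r * indicator {..<r} t) = V r * P' r - \<kappa> * P' r" for r
  proof -
    have "(LINT t|lborel. V' t * indicator {..<r} t) = (LINT t|lborel. V' t * indicator {..r} t)"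
      using AE_lborel_singleton[of r] by (intro integral_cong_AE) (auto simp: indicator_def)
    then have "(LINT t|lborel. P' r * (V' t * indicator {..<r} t)) = P' r * (V r - \<kappa>)"
      by (simp add: V)
    then show ?thesis by (simp add: algebra_simps)
  qed
  show 1: "integrable lborel (\<lambda>t. V' t * P t)"
    using lborel_pair.integrable_fst'[OF i2a] by (simp add: e1)
  have 2: "integrable lborel (\<lambda>r. V r * P' r - \<kappa> * P' r)"
    using lborel_pair.integrable_snd[OF i2b] by (simp add: e2)
  from Bochner_Integration.integrable_add[OF this integrable_mult_right[OF P', of \<kappa>]]
  show 3: "integrable lborel (\<lambda>t. V t * P' t)" by simp
  have "0 = (LINT t|lborel. LINT r|lborel. V' t * P' r)"
    by (simp add: I(2))
  also have "\<dots> = (LINT z|(lborel \<Otimes>\<^sub>M lborel). V' (fst z) * P' (snd z))"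
    using lborel_pair.integral_fst'[OF i2] by (simp add: case_prod_unfold)
  also have "\<dots> = (LINT z|(lborel \<Otimes>\<^sub>M lborel). (case z of (t, r) \<Rightarrow> V' t * P' r * indicator {..t} r) +
      (case z of (t, r) \<Rightarrow> V' t * P' r * indicator {..<r} t))"
    by (intro Bochner_Integration.integral_cong) (auto simp: indicator_def)
  also have "\<dots> = (LINT z|(lborel \<Otimes>\<^sub>M lborel). (case z of (t, r) \<Rightarrow> V' t * P' r * indicator {..t} r)) +
      (LINT z|(lborel \<Otimes>\<^sub>M lborel). (case z of (t, r) \<Rightarrow> V' t * P' r * indicator {..<r} t))"
    by (intro Bochner_Integration.integral_add i2a i2b)
  also have "\<dots> = (LINT t|lborel. V' t * P t) + (LINT r|lborel. V r * P' r - \<kappa> * P' r)"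
    using lborel_pair.integral_fst'[OF i2a] lborel_pair.integral_snd[OF i2b] by (simp add: e1 e2)
  also have "(LINT r|lborel. V r * P' r - \<kappa> * P' r) = (LINT r|lborel. V r * P' r)"
    using 3 P' I(2) by (subst Bochner_Integration.integral_diff) auto
  finally show "(LINT t|lborel. V' t * P t) = - (LINT t|lborel. V t * P' t)" by simp
qed

section \<open>Monotone transport on the line\<close>

text \<open>Truncation to [-n, n]. The transport map may be unbounded, and its truncation has a
  derivative integrable on the whole line, as the integration by parts requires.\<close>

definition clamp :: "real \<Rightarrow> real \<Rightarrow> real" where "clamp n y = max (- n) (min n y)"

locale prob_density =
  fixes p :: "real \<Rightarrow> real"
  assumes measurable_p[measurable]: "p \<in> borel_measurable borel"
    and p_nonneg: "\<And>x. 0 \<le> p x"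
    and p_total: "(\<integral>\<^sup>+x. ennreal (p x) \<partial>lborel) = 1"
begin

definition law :: "real measure" where "law = density lborel (\<lambda>x. ennreal (p x))"

abbreviation G :: "real \<Rightarrow> real" where "G \<equiv> cdf law"

lemma sets_law[measurable_cong, simp]: "sets law = sets borel" and space_law[simp]: "space law = UNIV"
  by (auto simp: law_def)

sublocale prob_space law
  by standard (auto simp: law_def emeasure_density p_total)

sublocale D: real_distribution law
  by standard auto

lemma cdf_eq_nn_integral: "G t = enn2real (\<integral>\<^sup>+s. ennreal (p s) * indicator {..t} s \<partial>lborel)"
  by (simp add: cdf_def measure_def law_def emeasure_density)

lemma continuous_cdf: "isCont G x"
proof -
  have "emeasure law {x} = (\<integral>\<^sup>+s. ennreal (p s) * indicator {x} s \<partial>lborel)"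
    by (simp add: law_def emeasure_density)
  also have "\<dots> = (\<integral>\<^sup>+(s::real). 0 \<partial>lborel)"
    by (intro nn_integral_cong_AE eventually_mono[OF AE_lborel_singleton[of x]]) (auto simp: indicator_def)
  finally show ?thesis
    by (subst D.isCont_cdf) (simp add: measure_def)
qed

lemma cdf_attains:
  assumes "0 < u" "u < 1"
  obtains t where "G t = u"
proof -
  have "\<forall>\<^sub>F t in at_bot. G t < u"
    using D.cdf_lim_at_bot assms(1) by (rule order_tendstoD)
  then obtain a where a: "G a < u"
    by (auto simp: eventually_at_bot_linorder)
  have "\<forall>\<^sub>F t in at_top. u < G t"
    using D.cdf_lim_at_top_prob assms(2) by (rule order_tendstoD)
  then obtain b where b: "u < G b"
    by (auto simp: eventually_at_top_linorder)
  have "a \<le> b"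
    using a b D.cdf_nondecreasing[of b a] by linarith
  then have "\<exists>t. a \<le> t \<and> t \<le> b \<and> G t = u"
    using a b continuous_cdf by (intro IVT) auto
  then show ?thesis using that by blast
qed

lemma measurable_cdf[measurable]: "G \<in> borel_measurable borel"
  using continuous_cdf by (intro borel_measurable_continuous_onI continuous_at_imp_continuous_on) auto

text \<open>A law without atoms is pushed to the uniform law by its own cdf. Since G may be flat,
  the set is compared with half-lines ending where G equals u or slightly more.\<close>

lemma prob_cdf_le:
  assumes u: "0 < u" "u < 1"
  shows "prob {t. G t \<le> u} = u"
proof (rule antisym)
  show "prob {t. G t \<le> u} \<le> u"
  proof (rule field_le_epsilon)
    fix e :: real assume "0 < e"
    define d where "d = min e ((1 - u) / 2)"
    have d: "0 < d" "d \<le> e" "u + d < 1" using u \<open>0 < e\<close> by (auto simp: d_def min_def field_simps)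
    obtain t where t: "G t = u + d" using cdf_attains[of "u + d"] u d by auto
    have "s \<le> t" if "G s \<le> u" for s
      using D.cdf_nondecreasing[of t s] that t d by linarith
    then have "prob {s. G s \<le> u} \<le> prob {..t}"
      by (intro finite_measure_mono) auto
    then show "prob {t. G t \<le> u} \<le> u + e"
      using t d by (simp add: cdf_def)
  qed
  obtain t where t: "G t = u" using cdf_attains[OF u] .
  have "prob {..t} \<le> prob {s. G s \<le> u}"
    using D.cdf_nondecreasing t by (intro finite_measure_mono) auto
  then show "u \<le> prob {t. G t \<le> u}"
    using t by (simp add: cdf_def)
qed

text \<open>The uniform law does not charge its endpoints. Almost all points are thereby confined to
  the range where \<open>quantile\<close> inverts the reference cdf.\<close>

lemma AE_cdf_strict: "AE t in law. 0 < G t \<and> G t < 1"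
proof -
  have "prob {t. G t \<le> 0} \<le> 0"
  proof (rule field_le_epsilon)
    fix e :: real assume "0 < e"
    define d where "d = min e (1 / 2)"
    have d: "0 < d" "d < 1" "d \<le> e" using \<open>0 < e\<close> by (auto simp: d_def)
    have "prob {t. G t \<le> 0} \<le> prob {t. G t \<le> d}"
      using d by (intro finite_measure_mono) auto
    then show "prob {t. G t \<le> 0} \<le> 0 + e"
      using prob_cdf_le[of d] d by simp
  qed
  then have 0: "prob {t. G t \<le> 0} = 0"
    using measure_nonneg[of law] by (metis antisym)
  have "1 \<le> prob {t. G t < 1}"
  proof (rule field_le_epsilon)
    fix e :: real assume "0 < e"
    define d where "d = min e (1 / 2)"
    have d: "0 < d" "d < 1" "d \<le> e" using \<open>0 < e\<close> by (auto simp: d_def)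
    have "prob {t. G t \<le> 1 - d} \<le> prob {t. G t < 1}"
      using d by (intro finite_measure_mono) auto
    then show "1 \<le> prob {t. G t < 1} + e"
      using prob_cdf_le[of "1 - d"] d by simp
  qed
  then have 1: "prob {t. G t < 1} = 1"
    using prob_le_1 antisym by blast
  have "AE t in law. t \<notin> {t. G t \<le> 0}"
    using 0 by (intro AE_not_in) (auto simp: null_sets_def emeasure_eq_measure)
  moreover have "AE t in law. t \<in> {t. G t < 1}"
    using 1 by (subst AE_in_set_eq_1) auto
  ultimately show ?thesis by eventually_elim auto
qed

lemma AE_law: "(AE t in law. Q t) \<longleftrightarrow> (AE t in lborel. p t \<noteq> 0 \<longrightarrow> Q t)"
  unfolding law_def by (subst AE_density) (auto simp: p_nonneg less_le)

text \<open>Flat pieces of G carry no mass, so almost surely the values of G decide the order of the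
  points.\<close>

lemma AE_cdf_eq_le: "AE t in law. G t \<le> G r \<longrightarrow> t \<le> r"
proof -
  have "prob ({t. G t \<le> G r} - {..r}) = prob {t. G t \<le> G r} - prob {..r}"
    using D.cdf_nondecreasing by (intro finite_measure_Diff) auto
  also have "prob {t. G t \<le> G r} \<le> prob {..r}"
  proof -
    consider "G r = 0" | "G r = 1" | "0 < G r" "G r < 1"
      using D.cdf_nonneg[of r] D.cdf_bounded_prob[of r] by linarith
    then show ?thesis
    proof cases
      case 1
      have "AE t in law. t \<notin> {t. G t \<le> G r}"
        using AE_cdf_strict by eventually_elim (use 1 in auto)
      then have "prob {t. G t \<le> G r} = 0"
        by (subst prob_eq_0) auto
      then show ?thesis by simp
    next
      case 2
      then show ?thesis by (simp add: cdf_def)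
    next
      case 3
      then show ?thesis using prob_cdf_le[of "G r"] by (simp add: cdf_def)
    qed
  qed
  finally have "prob ({t. G t \<le> G r} - {..r}) = 0"
    using measure_nonneg[of law "{t. G t \<le> G r} - {..r}"] by linarith
  then have "AE t in law. t \<notin> {t. G t \<le> G r} - {..r}"
    by (subst (asm) prob_eq_0) auto
  then show ?thesis by eventually_elim auto
qed

end

text \<open>Positivity on all of D makes the reference cdf strictly increasing there, so that it has
  a true inverse. The source density is allowed to vanish anywhere.\<close>

locale ref_density = R: prob_density \<phi> for \<phi> :: "real \<Rightarrow> real" +
  fixes D :: "real set"
  assumes D: "D = UNIV \<or> D = {0<..}"
    and \<phi>_pos: "\<And>x. x \<in> D \<Longrightarrow> 0 < \<phi> x" and \<phi>_zero: "\<And>x. x \<notin> D \<Longrightarrow> \<phi> x = 0"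
begin

lemma sets_D[measurable]: "D \<in> sets borel"
  using D by auto

lemma D_upward: "x \<in> D \<Longrightarrow> x \<le> y \<Longrightarrow> y \<in> D"
  using D by auto

lemma cdf_strict_mono:
  assumes "x \<in> D" "x < y"
  shows "R.G x < R.G y"
proof -
  have "R.prob {x<..y} > 0"
  proof (rule ccontr)
    assume "\<not> R.prob {x<..y} > 0"
    then have "R.prob {x<..y} = 0" using measure_nonneg[of R.law "{x<..y}"] by linarith
    then have "AE t in R.law. t \<notin> {x<..y}"
      by (subst (asm) R.prob_eq_0) auto
    then have "AE t in lborel. t \<notin> {x<..y}"
      unfolding R.AE_law
    proof eventually_elim
      case (elim t)
      then show ?case using \<phi>_pos[of t] D_upward[OF assms(1), of t] by auto
    qed
    then have "emeasure lborel {x<..y} = 0"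
      by (subst (asm) AE_iff_measurable[of "{x<..y}"]) auto
    then show False using assms(2) by simp
  qed
  then show ?thesis
    using R.D.cdf_diff_eq[OF assms(2)] by simp
qed

lemma cdf_D_bounds:
  assumes "x \<in> D"
  shows "0 < R.G x" "R.G x < 1"
proof -
  obtain y where y: "y \<in> D" "y < x"
    using D assms by (metis UNIV_I greaterThan_iff dense lt_ex)
  show "0 < R.G x"
    using cdf_strict_mono[OF y] R.D.cdf_nonneg[of y] by linarith
  show "R.G x < 1"
    using cdf_strict_mono[OF assms, of "x + 1"] R.D.cdf_bounded_prob[of "x + 1"] by linarith
qed

lemma cdf_not_D:
  assumes "x \<notin> D"
  shows "R.G x = 0"
proof -
  have "AE t in R.law. t \<notin> {..x}"
    unfolding R.AE_law using D assms \<phi>_zero by (intro AE_I2) force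
  then show ?thesis
    unfolding cdf_def by (subst R.prob_eq_0) auto
qed

text \<open>The default value 1 lies in D in both cases, so the quantile of any number belongs to
  D.\<close>

definition quantile :: "real \<Rightarrow> real"
  where "quantile u = (if 0 < u \<and> u < 1 then THE y. y \<in> D \<and> R.G y = u else 1)"

lemma
  assumes "0 < u" "u < 1"
  shows quantile_in_D: "quantile u \<in> D" and cdf_quantile: "R.G (quantile u) = u"
proof -
  obtain t where t: "R.G t = u" using R.cdf_attains[OF assms] .
  then have tD: "t \<in> D" using cdf_not_D[of t] assms by auto
  have "y = t" if "y \<in> D" "R.G y = u" for y
    using cdf_strict_mono[OF that(1), of t] cdf_strict_mono[OF tD, of y] that t by (metis less_irrefl linorder_less_linear)
  then have "\<exists>!y. y \<in> D \<and> R.G y = u" using t tD by blast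
  then have "quantile u \<in> D \<and> R.G (quantile u) = u"
    unfolding quantile_def using assms theI'[of "\<lambda>y. y \<in> D \<and> R.G y = u"] by simp
  then show "quantile u \<in> D" "R.G (quantile u) = u" by auto
qed

lemma quantile_le_iff:
  assumes "0 < u" "u < 1" "y \<in> D"
  shows "quantile u \<le> y \<longleftrightarrow> u \<le> R.G y"
  using cdf_strict_mono[OF assms(3), of "quantile u"] cdf_quantile[OF assms(1,2)]
    R.D.cdf_nondecreasing[of "quantile u" y] by (metis not_le)

lemma quantile_mono: "0 < u \<Longrightarrow> u \<le> v \<Longrightarrow> v < 1 \<Longrightarrow> quantile u \<le> quantile v"
  by (subst quantile_le_iff) (auto simp: quantile_in_D cdf_quantile)

lemma measurable_quantile[measurable]: "quantile \<in> borel_measurable borel"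
proof (subst borel_measurable_iff_le, intro allI)
  fix y :: real
  have "{u. quantile u \<le> y} = (if y \<in> D then {u. 0 < u \<and> u < 1 \<and> u \<le> R.G y} else {}) \<union>
      (if 1 \<le> y then {u. \<not> (0 < u \<and> u < 1)} else {})"
  proof (intro set_eqI)
    fix u
    show "u \<in> {u. quantile u \<le> y} \<longleftrightarrow> u \<in> (if y \<in> D then {u. 0 < u \<and> u < 1 \<and> u \<le> R.G y} else {}) \<union>
      (if 1 \<le> y then {u. \<not> (0 < u \<and> u < 1)} else {})"
    proof (cases "0 < u \<and> u < 1")
      case True
      then show ?thesis
        using quantile_le_iff[of u y] D_upward[OF quantile_in_D[of u], of y] by auto
    next
      case False
      then have "quantile u = 1" by (auto simp: quantile_def)
      then show ?thesis using False by auto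
    qed
  qed
  also have "\<dots> \<in> sets borel"
  proof -
    have "{u. 0 < u \<and> u < 1 \<and> u \<le> R.G y} = {0<..<1} \<inter> {..R.G y}" "{u. \<not> (0 < u \<and> u < 1)} = {..0} \<union> {1::real..}"
      by auto
    then show ?thesis by simp
  qed
  finally show "{u \<in> space borel. quantile u \<le> y} \<in> sets borel" by simp
qed

lemma continuous_quantile:
  assumes "0 < u" "u < 1"
  shows "isCont quantile u"
proof -
  have yD: "quantile u \<in> D" using quantile_in_D[OF assms] .
  show ?thesis
    unfolding continuous_at
  proof (rule order_tendstoI)
    fix a assume a: "a < quantile u"
    have "\<forall>\<^sub>F v in at u. R.G a < v \<and> v < 1 \<and> 0 < v"
    proof -
      have "R.G a < u"
        using cdf_strict_mono[of a "quantile u"] cdf_not_D[of a] cdf_quantile[OF assms] a assms by metis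
      then have "\<forall>\<^sub>F v in nhds u. v \<in> {max 0 (R.G a)<..<1}"
        using assms by (intro eventually_nhds_in_open) auto
      then show ?thesis by (auto simp: eventually_at_filter elim: eventually_mono)
    qed
    then show "\<forall>\<^sub>F v in at u. a < quantile v"
    proof eventually_elim
      case (elim v)
      show ?case
        using R.D.cdf_nondecreasing[of "quantile v" a] cdf_quantile[of v] elim by (metis not_le)
    qed
  next
    fix a assume a: "quantile u < a"
    have "\<forall>\<^sub>F v in at u. v < R.G a \<and> v < 1 \<and> 0 < v"
    proof -
      have "u < R.G a"
        using cdf_strict_mono[OF yD a] cdf_quantile[OF assms] by simp
      then have "\<forall>\<^sub>F v in nhds u. v \<in> {0<..<min 1 (R.G a)}"
        using assms by (intro eventually_nhds_in_open) auto
      then show ?thesis by (auto simp: eventually_at_filter elim: eventually_mono)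
    qed
    then show "\<forall>\<^sub>F v in at u. quantile v < a"
    proof eventually_elim
      case (elim v)
      show ?case
        using R.D.cdf_nondecreasing[of a "quantile v"] cdf_quantile[of v] elim by (metis not_le)
    qed
  qed
qed

end

locale transport = ref_density \<phi> D + N: prob_density p for \<phi> D p
begin

definition T :: "real \<Rightarrow> real" where "T t = quantile (N.G t)"

text \<open>The derivative dictated by the mass balance p = \<phi>(T) T'. It is a quotient of
  densities by definition and not a limit of difference quotients.\<close>

definition T' :: "real \<Rightarrow> real" where "T' t = p t / \<phi> (T t)"

lemma measurable_T[measurable]: "T \<in> borel_measurable borel"
  unfolding T_def by measurable

lemma measurable_T'[measurable]: "T' \<in> borel_measurable borel"
  unfolding T'_def by measurable

lemma T'_nonneg: "0 \<le> T' t"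
  by (simp add: T'_def N.p_nonneg R.p_nonneg)

lemma T_in_D: "0 < N.G t \<Longrightarrow> N.G t < 1 \<Longrightarrow> T t \<in> D"
  by (simp add: T_def quantile_in_D)

text \<open>Compared through distribution functions: for y in D the event T \<le> y is, almost
  surely, the event that the cdf of the source is at most \<open>R.G y\<close>, and that cdf is
  uniformly distributed.\<close>

lemma distr_T: "distr N.law borel T = R.law"
proof (rule cdf_unique)
  show "real_distribution (distr N.law borel T)"
    by (rule N.real_distribution_distr) auto
  show "real_distribution R.law" ..
  show "cdf (distr N.law borel T) = R.G"
  proof
    fix y
    have 1: "cdf (distr N.law borel T) y = N.prob {t. T t \<le> y}"
      unfolding cdf_def by (subst measure_distr) (auto simp: vimage_def)
    show "cdf (distr N.law borel T) y = R.G y"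
    proof (cases "y \<in> D")
      case True
      have "N.prob {t. T t \<le> y} = N.prob {t. N.G t \<le> R.G y}"
      proof (rule N.finite_measure_eq_AE)
        show "AE t in N.law. (t \<in> {t. T t \<le> y}) = (t \<in> {t. N.G t \<le> R.G y})"
          using N.AE_cdf_strict by eventually_elim (use True in \<open>auto simp: T_def quantile_le_iff\<close>)
      qed auto
      then show ?thesis
        using 1 N.prob_cdf_le[of "R.G y"] cdf_D_bounds[OF True] by simp
    next
      case False
      have "AE t in N.law. t \<notin> {t. T t \<le> y}"
        using N.AE_cdf_strict
        by eventually_elim (use False D_upward[OF T_in_D] in auto)
      then have "N.prob {t. T t \<le> y} = 0"
        by (subst N.prob_eq_0) auto
      then show ?thesis using 1 cdf_not_D[OF False] by simp
    qed
  qed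
qed

lemma nn_integral_T:
  assumes [measurable]: "h \<in> borel_measurable borel"
  shows "(\<integral>\<^sup>+t. h (T t) * ennreal (p t) \<partial>lborel) = (\<integral>\<^sup>+y. h y * ennreal (\<phi> y) \<partial>lborel)"
proof -
  have "(\<integral>\<^sup>+t. h (T t) * ennreal (p t) \<partial>lborel) = (\<integral>\<^sup>+t. h (T t) \<partial>N.law)"
    unfolding N.law_def by (subst nn_integral_density) (auto simp: mult.commute)
  also have "\<dots> = (\<integral>\<^sup>+y. h y \<partial>R.law)"
    by (subst distr_T[symmetric], subst nn_integral_distr) auto
  also have "\<dots> = (\<integral>\<^sup>+y. h y * ennreal (\<phi> y) \<partial>lborel)"
    unfolding R.law_def by (subst nn_integral_density) (auto simp: mult.commute)
  finally show ?thesis .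
qed

text \<open>The chain rule for the truncated transport map, in integral form; it is read off from the
  push-forward identity, so that no pointwise differentiability is needed.\<close>

lemma nn_integral_T'_Iic:
  assumes r: "0 < N.G r" "N.G r < 1"
  shows "(\<integral>\<^sup>+t. ennreal (T' t) * indicator {t. \<bar>T t\<bar> < n} t * indicator {..r} t \<partial>lborel) =
    emeasure lborel (D \<inter> {-n<..<n} \<inter> {..T r})"
proof -
  let ?h = "\<lambda>y. ennreal (1 / \<phi> y) * indicator (D \<inter> {-n<..<n} \<inter> {..T r}) y"
  have "AE t in lborel. ennreal (T' t) * indicator {t. \<bar>T t\<bar> < n} t * indicator {..r} t = ?h (T t) * ennreal (p t)"
  proof -
    have "AE t in N.law. 0 < N.G t \<and> N.G t < 1" by (rule N.AE_cdf_strict)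
    \<comment> \<open>As flat pieces of the source cdf carry no mass, the half-line up to r is a
      sublevel set of T up to null sets.\<close>
    then have "AE t in N.law. T t \<in> D \<and> (T t \<le> T r \<longleftrightarrow> t \<le> r)"
      using N.AE_cdf_eq_le[of r]
    proof eventually_elim
      case (elim t)
      have "T t \<le> T r \<longleftrightarrow> N.G t \<le> N.G r"
        unfolding T_def using elim r by (subst quantile_le_iff) (auto simp: quantile_in_D cdf_quantile)
      then show ?case
        using elim T_in_D N.D.cdf_nondecreasing[of t r] by auto
    qed
    then show ?thesis
      unfolding N.AE_law
    proof eventually_elim
      case (elim t)
      show ?case
      proof (cases "p t = 0")
        case False
        then have *: "T t \<in> D" "T t \<le> T r \<longleftrightarrow> t \<le> r" using elim by auto
        have "ennreal (T' t) = ennreal (1 / \<phi> (T t)) * ennreal (p t)"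
          using R.p_nonneg N.p_nonneg by (simp add: T'_def flip: ennreal_mult)
        then show ?thesis using * by (auto simp: indicator_def)
      qed (simp add: T'_def)
    qed
  qed
  then have "(\<integral>\<^sup>+t. ennreal (T' t) * indicator {t. \<bar>T t\<bar> < n} t * indicator {..r} t \<partial>lborel) =
      (\<integral>\<^sup>+t. ?h (T t) * ennreal (p t) \<partial>lborel)"
    by (rule nn_integral_cong_AE)
  also have "\<dots> = (\<integral>\<^sup>+y. ?h y * ennreal (\<phi> y) \<partial>lborel)"
    by (rule nn_integral_T) measurable
  also have "\<dots> = (\<integral>\<^sup>+y. indicator (D \<inter> {-n<..<n} \<inter> {..T r}) y \<partial>lborel)"
  proof (intro nn_integral_cong)
    fix y
    show "?h y * ennreal (\<phi> y) = indicator (D \<inter> {-n<..<n} \<inter> {..T r}) y"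
      using \<phi>_pos[of y] by (auto simp: indicator_def simp flip: ennreal_mult)
  qed
  also have "\<dots> = emeasure lborel (D \<inter> {-n<..<n} \<inter> {..T r})"
    by (subst nn_integral_indicator) auto
  finally show ?thesis .
qed

text \<open>After the push-forward the factor 1 / \<phi> cancels the reference density, and the
  length of a subset of (-n, n) is left.\<close>

lemma integrable_T':
  "integrable lborel (\<lambda>t. T' t * indicator {t. \<bar>T t\<bar> < n} t)"
proof (rule integrableI_nonneg)
  let ?h = "\<lambda>y. ennreal (1 / \<phi> y) * indicator (D \<inter> {-n<..<n}) y"
  have "AE t in N.law. T t \<in> D"
    using N.AE_cdf_strict by eventually_elim (rule T_in_D, auto)
  then have "AE t in lborel. ennreal (T' t * indicator {t. \<bar>T t\<bar> < n} t) = ?h (T t) * ennreal (p t)"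
    unfolding N.AE_law
  proof eventually_elim
    case (elim t)
    show ?case
    proof (cases "p t = 0")
      case False
      then show ?thesis
        using elim R.p_nonneg N.p_nonneg by (auto simp: T'_def indicator_def simp flip: ennreal_mult)
    qed (simp add: T'_def)
  qed
  then have "(\<integral>\<^sup>+t. ennreal (T' t * indicator {t. \<bar>T t\<bar> < n} t) \<partial>lborel) = (\<integral>\<^sup>+t. ?h (T t) * ennreal (p t) \<partial>lborel)"
    by (rule nn_integral_cong_AE)
  also have "\<dots> = (\<integral>\<^sup>+y. ?h y * ennreal (\<phi> y) \<partial>lborel)"
    by (rule nn_integral_T) measurable
  also have "\<dots> \<le> (\<integral>\<^sup>+y. indicator {-n<..<n} y \<partial>lborel)"
  proof (intro nn_integral_mono)
    fix y
    show "?h y * ennreal (\<phi> y) \<le> indicator {-n<..<n} y"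
      using \<phi>_pos[of y] by (auto simp: indicator_def simp flip: ennreal_mult)
  qed
  also have "\<dots> < \<infinity>"
    by (cases "-n \<le> n") auto
  finally show "(\<integral>\<^sup>+t. ennreal (T' t * indicator {t. \<bar>T t\<bar> < n} t) \<partial>lborel) < \<infinity>" .
qed (auto simp: T'_nonneg)

text \<open>The integral is the length of the part of D in (-n, n) below T r. The added constant is
  the left end of that part: -n on the line, 0 on the half-line.\<close>

lemma clamp_T_eq_integral:
  assumes n: "0 < n" and r: "0 < N.G r" "N.G r < 1"
  shows "clamp n (T r) = (if D = UNIV then - n else 0) +
    (LINT t|lborel. T' t * indicator {t. \<bar>T t\<bar> < n} t * indicator {..r} t)"
proof -
  have "(LINT t|lborel. T' t * indicator {t. \<bar>T t\<bar> < n} t * indicator {..r} t) =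
      enn2real (\<integral>\<^sup>+t. ennreal (T' t * indicator {t. \<bar>T t\<bar> < n} t * indicator {..r} t) \<partial>lborel)"
    by (rule integral_eq_nn_integral) (auto simp: T'_nonneg)
  also have "(\<integral>\<^sup>+t. ennreal (T' t * indicator {t. \<bar>T t\<bar> < n} t * indicator {..r} t) \<partial>lborel) =
      (\<integral>\<^sup>+t. ennreal (T' t) * indicator {t. \<bar>T t\<bar> < n} t * indicator {..r} t \<partial>lborel)"
    by (intro nn_integral_cong) (auto simp: indicator_def)
  also have "\<dots> = emeasure lborel (D \<inter> {-n<..<n} \<inter> {..T r})"
    by (rule nn_integral_T'_Iic[OF r])
  finally have *: "(LINT t|lborel. T' t * indicator {t. \<bar>T t\<bar> < n} t * indicator {..r} t) =
    measure lborel (D \<inter> {-n<..<n} \<inter> {..T r})"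
    by (simp add: measure_def)
  show ?thesis
  proof (cases "D = UNIV")
    case True
    consider "T r \<le> - n" | "- n < T r" "T r < n" | "T r \<ge> n" by linarith
    then have "measure lborel (D \<inter> {-n<..<n} \<inter> {..T r}) = clamp n (T r) + n"
    proof cases
      case 1
      then have "D \<inter> {-n<..<n} \<inter> {..T r} = {}" by auto
      then show ?thesis using 1 n by (simp add: clamp_def)
    next
      case 2
      then have "D \<inter> {-n<..<n} \<inter> {..T r} = {-n<..T r}" using True by auto
      then show ?thesis using 2 n by (simp add: clamp_def)
    next
      case 3
      then have "D \<inter> {-n<..<n} \<inter> {..T r} = {-n<..<n}" using True by auto
      then show ?thesis using 3 n by (simp add: clamp_def)
    qed
    then show ?thesis using * True by simp
  next
    case False
    then have D0: "D = {0<..}" using D by auto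
    have T0: "T r > 0" using T_in_D[OF r] D0 by auto
    consider "T r < n" | "T r \<ge> n" by linarith
    then have "measure lborel (D \<inter> {-n<..<n} \<inter> {..T r}) = clamp n (T r)"
    proof cases
      case 1
      then have "D \<inter> {-n<..<n} \<inter> {..T r} = {0<..T r}" using D0 n by auto
      then show ?thesis using 1 n T0 by (simp add: clamp_def)
    next
      case 2
      then have "D \<inter> {-n<..<n} \<inter> {..T r} = {0<..<n}" using D0 n by auto
      then show ?thesis using 2 n by (simp add: clamp_def)
    qed
    then show ?thesis using * False by simp
  qed
qed

end

section \<open>Monomial weights on the line\<close>

text \<open>The weight is extended by 0 off its half-line if a > 0, so that integrals over the real
  line stand for integrals over \<open>dom1 a\<close>.\<close>

definition wt :: "real \<Rightarrow> real \<Rightarrow> real"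
  where "wt a t = (if a = 0 then 1 else if t > 0 then t powr a else 0)"

definition dom1 :: "real \<Rightarrow> real set" where "dom1 a = {t. a > 0 \<longrightarrow> t > 0}"

text \<open>The mass of the weight times the Gaussian. For a = 0 the whole line counts instead of a
  half-line, hence the factor 2; this is also the origin of the power of 2 in
  \<open>Pi_const\<close>.\<close>

definition Z :: "real \<Rightarrow> real"
  where "Z a = 2 powr ((a - 1) / 2) * Gamma ((a + 1) / 2) * (if a = 0 then 2 else 1)"

definition phi :: "real \<Rightarrow> real \<Rightarrow> real" where "phi a t = wt a t * exp (- (t\<^sup>2 / 2)) / Z a"

lemma measurable_wt[measurable]: "wt a \<in> borel_measurable borel"
  unfolding wt_def by measurable

lemma measurable_phi[measurable]: "phi a \<in> borel_measurable borel"
  unfolding phi_def by measurable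

lemma wt_nonneg: "0 \<le> wt a t"
  by (simp add: wt_def)

lemma wt_pos_iff: "a \<ge> 0 \<Longrightarrow> 0 < wt a t \<longleftrightarrow> t \<in> dom1 a"
  by (auto simp: wt_def dom1_def)

lemma wt_not_dom: "a \<ge> 0 \<Longrightarrow> t \<notin> dom1 a \<Longrightarrow> wt a t = 0"
  by (auto simp: wt_def dom1_def)

lemma Z_pos: "a \<ge> 0 \<Longrightarrow> Z a > 0"
  by (auto simp: Z_def intro!: mult_pos_pos Gamma_real_pos)

lemma nn_integral_even_real:
  fixes f :: "real \<Rightarrow> ennreal"
  assumes [measurable]: "f \<in> borel_measurable borel" and even: "\<And>x. f (- x) = f x"
  shows "(\<integral>\<^sup>+x. f x \<partial>lborel) = 2 * (\<integral>\<^sup>+x. f x * indicator {0..} x \<partial>lborel)"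
proof -
  have "(\<integral>\<^sup>+x. f x \<partial>lborel) = (\<integral>\<^sup>+x. f x * indicator {0..} x + f x * indicator {..<0} x \<partial>lborel)"
    by (intro nn_integral_cong) (auto simp: indicator_def)
  also have "\<dots> = (\<integral>\<^sup>+x. f x * indicator {0..} x \<partial>lborel) + (\<integral>\<^sup>+x. f x * indicator {..<0} x \<partial>lborel)"
    by (rule nn_integral_add) measurable
  also have "(\<integral>\<^sup>+x. f x * indicator {..<0} x \<partial>lborel) = (\<integral>\<^sup>+x. f x * indicator {0<..} x \<partial>lborel)"
    by (subst nn_integral_real_affine[where c = "-1" and t = 0])
      (auto simp: even indicator_def intro!: nn_integral_cong)
  also have "\<dots> = (\<integral>\<^sup>+x. f x * indicator {0..} x \<partial>lborel)"
    by (intro nn_integral_cong_AE eventually_mono[OF AE_lborel_singleton[of 0]]) (auto simp: indicator_def)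
  finally show ?thesis by (simp add: mult_2)
qed

text \<open>The substitution t = s^2 / 2 in Euler's integral for Gamma, carried out on compact
  intervals [0, n] and extended by monotone convergence.\<close>

lemma nn_integral_powr_gauss:
  assumes a: "a > -1"
  shows "(\<integral>\<^sup>+t. ennreal (t powr a * exp (- (t\<^sup>2 / 2))) * indicator {0..} t \<partial>lborel) =
    ennreal (2 powr ((a - 1) / 2) * Gamma ((a + 1) / 2))"
proof -
  define x where "x = (a + 1) / 2"
  have x: "x > 0" using a by (simp add: x_def)
  define f where "f t = t powr (x - 1) / exp t" for t :: real
  define g :: "real \<Rightarrow> real" where "g s = s\<^sup>2 / 2" for s
  have [measurable]: "f \<in> borel_measurable borel" unfolding f_def by measurable
  have sub: "(\<integral>\<^sup>+t. ennreal (f t) * indicator {0..g (real n)} t \<partial>lborel) =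
      (\<integral>\<^sup>+s. ennreal (f (g s) * s) * indicator {0..real n} s \<partial>lborel)" for n :: nat
  proof -
    have "(\<integral>\<^sup>+t. ennreal (f t * indicator {g 0..g (real n)} t) \<partial>lborel) =
        (\<integral>\<^sup>+s. ennreal (f (g s) * s * indicator {0..real n} s) \<partial>lborel)"
      by (rule nn_integral_substitution[where g = g and g' = "\<lambda>s. s"])
        (auto simp: g_def[abs_def] set_borel_measurable_def intro!: derivative_eq_intros continuous_intros)
    then show ?thesis by (simp add: g_def nn_integral_set_ennreal)
  qed
  have fgs: "ennreal (f (g s) * s) * indicator {0..} s =
      ennreal (2 powr ((1 - a) / 2)) * (ennreal (s powr a * exp (- (s\<^sup>2 / 2))) * indicator {0..} s)" for s
  proof (cases "s > 0")
    case True
    have 1: "g s powr (x - 1) = s powr (2 * (x - 1)) / 2 powr (x - 1)"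
      unfolding g_def using True powr_powr[of s 2 "x - 1"] by (simp add: powr_divide)
    have 2: "s powr (2 * (x - 1)) * s = s powr a"
      using True powr_mult_base[of s "2 * (x - 1)"] by (simp add: x_def mult.commute field_simps)
    have 3: "1 / 2 powr (x - 1) = 2 powr ((1 - a) / 2)"
    proof -
      have "1 / 2 powr (x - 1) = 2 powr (- (x - 1))" by (simp only: powr_minus_divide)
      also have "- (x - 1) = (1 - a) / 2" by (simp add: x_def field_simps)
      finally show ?thesis .
    qed
    have "f (g s) * s = (1 / 2 powr (x - 1)) * (s powr (2 * (x - 1)) * s) * exp (- g s)"
      unfolding f_def 1 exp_minus divide_inverse by (simp only: mult_ac mult_1)
    then have "f (g s) * s = 2 powr ((1 - a) / 2) * (s powr a * exp (- (s\<^sup>2 / 2)))"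
      unfolding 2 3 by (simp add: g_def)
    then show ?thesis by (simp add: ennreal_mult mult.assoc)
  qed (auto simp: indicator_def)
  have gtop: "\<exists>n::nat. t \<le> g (real n)" for t
  proof -
    obtain n :: nat where "2 * \<bar>t\<bar> + 1 \<le> real n" using real_arch_simple by blast
    moreover from this have "real n * 1 \<le> real n * real n" by (intro mult_left_mono) auto
    ultimately show ?thesis by (intro exI[of _ n]) (auto simp: g_def power2_eq_square)
  qed
  have gmono: "mono (\<lambda>n::nat. g (real n))"
    by (auto simp: g_def mono_def intro!: power_mono)
  have "ennreal (Gamma x) = (\<integral>\<^sup>+t. ennreal (f t) * indicator {0..} t \<partial>lborel)"
    unfolding Gamma_conv_nn_integral_real[OF x] f_def
    by (intro nn_integral_cong) (auto simp: indicator_def)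
  also have "\<dots> = (SUP n::nat. (\<integral>\<^sup>+t. ennreal (f t) * indicator {0..g (real n)} t \<partial>lborel))"
  proof -
    have "incseq (\<lambda>(n::nat) t. ennreal (f t) * indicator {0..g (real n)} t)"
      using gmono by (auto simp: incseq_def le_fun_def indicator_def mono_def dest: order_trans)
    moreover have "(SUP n::nat. ennreal (f t) * indicator {0..g (real n)} t) = ennreal (f t) * indicator {0..} t" for t
    proof (rule antisym)
      obtain n :: nat where "t \<le> g (real n)" using gtop by blast
      then show "ennreal (f t) * indicator {0..} t \<le> (SUP n::nat. ennreal (f t) * indicator {0..g (real n)} t)"
        by (intro SUP_upper2[of n]) (auto simp: indicator_def)
    qed (auto intro!: SUP_least simp: indicator_def)
    ultimately show ?thesis
      by (subst nn_integral_monotone_convergence_SUP[symmetric]) auto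
  qed
  also have "\<dots> = (SUP n::nat. (\<integral>\<^sup>+s. ennreal (f (g s) * s) * indicator {0..real n} s \<partial>lborel))"
    by (simp add: sub)
  also have "\<dots> = (\<integral>\<^sup>+s. ennreal (f (g s) * s) * indicator {0..} s \<partial>lborel)"
  proof -
    have "incseq (\<lambda>(n::nat) s. ennreal (f (g s) * s) * indicator {0..real n} s)"
      by (auto simp: incseq_def le_fun_def indicator_def)
    moreover have "(SUP n::nat. ennreal (f (g s) * s) * indicator {0..real n} s) = ennreal (f (g s) * s) * indicator {0..} s" for s
    proof (rule antisym)
      obtain n :: nat where "s \<le> real n" using real_arch_simple by blast
      then show "ennreal (f (g s) * s) * indicator {0..} s \<le> (SUP n::nat. ennreal (f (g s) * s) * indicator {0..real n} s)"
        by (intro SUP_upper2[of n]) (auto simp: indicator_def)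
    qed (auto intro!: SUP_least simp: indicator_def)
    ultimately show ?thesis
      unfolding g_def
      by (subst nn_integral_monotone_convergence_SUP[symmetric]) auto
  qed
  also have "\<dots> = ennreal (2 powr ((1 - a) / 2)) * (\<integral>\<^sup>+t. ennreal (t powr a * exp (- (t\<^sup>2 / 2))) * indicator {0..} t \<partial>lborel)"
    unfolding fgs by (subst nn_integral_cmult) auto
  finally have *: "ennreal (Gamma x) = ennreal (2 powr ((1 - a) / 2)) * (\<integral>\<^sup>+t. ennreal (t powr a * exp (- (t\<^sup>2 / 2))) * indicator {0..} t \<partial>lborel)" .
  have "ennreal (2 powr ((a - 1) / 2)) * ennreal (2 powr ((1 - a) / 2)) = 1"
    by (simp add: powr_add[symmetric] field_simps flip: ennreal_mult)
  then have "(\<integral>\<^sup>+t. ennreal (t powr a * exp (- (t\<^sup>2 / 2))) * indicator {0..} t \<partial>lborel) = ennreal (2 powr ((a - 1) / 2)) * ennreal (Gamma x)"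
    unfolding * by (simp flip: mult.assoc)
  then show ?thesis
    using x by (simp add: x_def ennreal_mult Gamma_real_pos less_imp_le)
qed

text \<open>The second moment is the same kind of integral with a + 2 in place of a, and the
  functional equation of Gamma turns it into 1 + a times the mass.\<close>

lemma nn_integral_wt_gauss:
  assumes a: "a \<ge> 0"
  shows "(\<integral>\<^sup>+t. ennreal (wt a t * exp (- (t\<^sup>2 / 2))) \<partial>lborel) = ennreal (Z a)"
    and "(\<integral>\<^sup>+t. ennreal (t\<^sup>2 * (wt a t * exp (- (t\<^sup>2 / 2)))) \<partial>lborel) = ennreal ((1 + a) * Z a)"
proof -
  have G: "2 powr ((a + 2 - 1) / 2) * Gamma ((a + 2 + 1) / 2) = (1 + a) * (2 powr ((a - 1) / 2) * Gamma ((a + 1) / 2))"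
  proof -
    have g1: "Gamma ((a + 2 + 1) / 2) = (a + 1) / 2 * Gamma ((a + 1) / 2)"
      using Gamma_plus1[of "(a + 1) / 2"] a nonpos_Ints_nonpos[of "(a + 1) / 2"] by (force simp: field_simps)
    have g2: "2 powr ((a + 2 - 1) / 2) = 2 * 2 powr ((a - 1) / 2)"
      using powr_add[of 2 1 "(a - 1) / 2"] by (simp add: field_simps)
    show ?thesis unfolding g1 g2 by (simp add: field_simps)
  qed
  have sq: "t\<^sup>2 * (t powr a) = t powr (a + 2)" if "t > 0" for t :: real
    using that by (simp add: powr_add)
  show "(\<integral>\<^sup>+t. ennreal (wt a t * exp (- (t\<^sup>2 / 2))) \<partial>lborel) = ennreal (Z a)"
  proof (cases "a = 0")
    case True
    have "(\<integral>\<^sup>+t. ennreal (wt a t * exp (- (t\<^sup>2 / 2))) \<partial>lborel) =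
        2 * (\<integral>\<^sup>+t. ennreal (wt a t * exp (- (t\<^sup>2 / 2))) * indicator {0..} t \<partial>lborel)"
      using True by (subst nn_integral_even_real) (auto simp: wt_def)
    also have "(\<integral>\<^sup>+t. ennreal (wt a t * exp (- (t\<^sup>2 / 2))) * indicator {0..} t \<partial>lborel) =
        (\<integral>\<^sup>+t. ennreal (t powr a * exp (- (t\<^sup>2 / 2))) * indicator {0..} t \<partial>lborel)"
      by (intro nn_integral_cong_AE eventually_mono[OF AE_lborel_singleton[of 0]])
        (use True in \<open>auto simp: wt_def indicator_def\<close>)
    also have "\<dots> = ennreal (2 powr ((a - 1) / 2) * Gamma ((a + 1) / 2))"
      using a by (intro nn_integral_powr_gauss) auto
    finally show ?thesis
      using True by (simp add: Z_def mult.commute ennreal_mult' flip: ennreal_numeral)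
  next
    case False
    have "(\<integral>\<^sup>+t. ennreal (wt a t * exp (- (t\<^sup>2 / 2))) \<partial>lborel) =
        (\<integral>\<^sup>+t. ennreal (t powr a * exp (- (t\<^sup>2 / 2))) * indicator {0..} t \<partial>lborel)"
      using False by (intro nn_integral_cong) (auto simp: wt_def indicator_def)
    then show ?thesis using nn_integral_powr_gauss[of a] a False by (simp add: Z_def)
  qed
  show "(\<integral>\<^sup>+t. ennreal (t\<^sup>2 * (wt a t * exp (- (t\<^sup>2 / 2)))) \<partial>lborel) = ennreal ((1 + a) * Z a)"
  proof (cases "a = 0")
    case True
    have "(\<integral>\<^sup>+t. ennreal (t\<^sup>2 * (wt a t * exp (- (t\<^sup>2 / 2)))) \<partial>lborel) =
        2 * (\<integral>\<^sup>+t. ennreal (t\<^sup>2 * (wt a t * exp (- (t\<^sup>2 / 2)))) * indicator {0..} t \<partial>lborel)"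
      using True by (subst nn_integral_even_real) (auto simp: wt_def)
    also have "(\<integral>\<^sup>+t. ennreal (t\<^sup>2 * (wt a t * exp (- (t\<^sup>2 / 2)))) * indicator {0..} t \<partial>lborel) =
        (\<integral>\<^sup>+t. ennreal (t powr (a + 2) * exp (- (t\<^sup>2 / 2))) * indicator {0..} t \<partial>lborel)"
      by (intro nn_integral_cong_AE eventually_mono[OF AE_lborel_singleton[of 0]])
        (use True sq in \<open>auto simp: wt_def indicator_def\<close>)
    also have "\<dots> = ennreal ((1 + a) * (2 powr ((a - 1) / 2) * Gamma ((a + 1) / 2)))"
      unfolding G[symmetric] using a by (intro nn_integral_powr_gauss) auto
    finally show ?thesis
      using True by (simp add: Z_def mult.commute ennreal_mult' flip: ennreal_numeral)
  next
    case False
    have "(\<integral>\<^sup>+t. ennreal (t\<^sup>2 * (wt a t * exp (- (t\<^sup>2 / 2)))) \<partial>lborel) =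
        (\<integral>\<^sup>+t. ennreal (t powr (a + 2) * exp (- (t\<^sup>2 / 2))) * indicator {0..} t \<partial>lborel)"
    proof (intro nn_integral_cong)
      fix t
      show "ennreal (t\<^sup>2 * (wt a t * exp (- (t\<^sup>2 / 2)))) = ennreal (t powr (a + 2) * exp (- (t\<^sup>2 / 2))) * indicator {0..} t"
        using False sq[of t] by (auto simp: wt_def indicator_def mult.assoc[symmetric])
    qed
    also have "\<dots> = ennreal ((1 + a) * (2 powr ((a - 1) / 2) * Gamma ((a + 1) / 2)))"
      unfolding G[symmetric] using a by (intro nn_integral_powr_gauss) auto
    finally show ?thesis using a False by (simp add: Z_def)
  qed
qed

lemma nn_integral_phi:
  assumes a: "a \<ge> 0"
  shows "(\<integral>\<^sup>+t. ennreal (phi a t) \<partial>lborel) = 1"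
    and "(\<integral>\<^sup>+t. ennreal (t\<^sup>2) * ennreal (phi a t) \<partial>lborel) = ennreal (1 + a)"
proof -
  have Z: "Z a > 0" using Z_pos[OF a] .
  have "ennreal (phi a t) = ennreal (1 / Z a) * ennreal (wt a t * exp (- (t\<^sup>2 / 2)))" for t
    using Z wt_nonneg by (simp add: phi_def flip: ennreal_mult)
  then have "(\<integral>\<^sup>+t. ennreal (phi a t) \<partial>lborel) = ennreal (1 / Z a) * ennreal (Z a)"
    by (simp add: nn_integral_cmult nn_integral_wt_gauss[OF a])
  then show "(\<integral>\<^sup>+t. ennreal (phi a t) \<partial>lborel) = 1"
    using Z by (simp flip: ennreal_mult)
  have "ennreal (t\<^sup>2) * ennreal (phi a t) = ennreal (1 / Z a) * ennreal (t\<^sup>2 * (wt a t * exp (- (t\<^sup>2 / 2))))" for t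
    using Z wt_nonneg by (simp add: phi_def field_simps flip: ennreal_mult)
  then have "(\<integral>\<^sup>+t. ennreal (t\<^sup>2) * ennreal (phi a t) \<partial>lborel) = ennreal (1 / Z a) * ennreal ((1 + a) * Z a)"
    by (simp add: nn_integral_cmult nn_integral_wt_gauss[OF a])
  then show "(\<integral>\<^sup>+t. ennreal (t\<^sup>2) * ennreal (phi a t) \<partial>lborel) = ennreal (1 + a)"
    using Z a by (simp flip: ennreal_mult)
qed

lemma phi_nonneg: "a \<ge> 0 \<Longrightarrow> 0 \<le> phi a t"
  using Z_pos[of a] wt_nonneg[of a t] by (simp add: phi_def)

lemma phi_pos_iff: "a \<ge> 0 \<Longrightarrow> 0 < phi a t \<longleftrightarrow> t \<in> dom1 a"
  using Z_pos[of a] wt_pos_iff[of a t] by (simp add: phi_def zero_less_mult_iff zero_less_divide_iff)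

lemma ref_density_phi:
  assumes "a \<ge> 0"
  shows "ref_density (phi a) (dom1 a)"
proof
  show "dom1 a = UNIV \<or> dom1 a = {0<..}"
    by (auto simp: dom1_def)
qed (use assms phi_pos_iff[of a] phi_nonneg[of a] nn_integral_phi[of a] in \<open>auto simp: less_le\<close>)

text \<open>For 0 < a < 1 the derivative blows up at 0 but remains integrable there. The increments
  are therefore computed from the integral of a power starting at 0; everything vanishes to the left
  of 0.\<close>

lemma ac_wt:
  assumes a: "a \<ge> 0"
  shows "ac (wt a) (\<lambda>t. a / t * wt a t)"
proof (cases "a = 0")
  case True
  then have "wt a = (\<lambda>_. 1)" by (auto simp: wt_def)
  then show ?thesis using True ac_C1[of "\<lambda>_. 1" "\<lambda>_. 0"] by auto
next
  case False
  have eq: "a / t * wt a t = indicator {0..} t * (a * t powr (a - 1))" for t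
    using False by (auto simp: wt_def indicator_def powr_diff)
  have H: "((\<lambda>t. a * t powr (a - 1)) has_integral c powr a) {0..c}" if "c \<ge> 0" for c
    using has_integral_mult_right[OF has_integral_powr_from_0[of "a - 1" c], of a] that a False by simp
  have N: "(\<integral>\<^sup>+t. ennreal (a * t powr (a - 1)) * indicator {0..c} t \<partial>lborel) = ennreal (c powr a)" if "c \<ge> 0" for c
    using nn_integral_has_integral_lebesgue[OF _ H[OF that]] a
    by (simp add: nn_integral_completion indicator_mult_ennreal mult.commute)
  have set0: "set_integrable lborel {0..c} (\<lambda>t. a / t * wt a t)"
    and int0: "(LBINT t:{0..c}. a / t * wt a t) = c powr a" if c: "c \<ge> 0" for c
  proof -
    have E: "(\<integral>\<^sup>+t. ennreal (indicator {0..c} t * (a / t * wt a t)) \<partial>lborel) = ennreal (c powr a)"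
      unfolding N[OF c, symmetric] eq by (intro nn_integral_cong) (auto simp: indicator_def)
    have nn: "0 \<le> indicator {0..c} t * (a / t * wt a t)" for t
      unfolding eq using a by (auto simp: indicator_def)
    show "set_integrable lborel {0..c} (\<lambda>t. a / t * wt a t)"
      unfolding set_integrable_def real_scaleR_def
      using E nn by (intro integrableI_nonneg) auto
    show "(LBINT t:{0..c}. a / t * wt a t) = c powr a"
      unfolding set_lebesgue_integral_def real_scaleR_def
      using E nn by (subst integral_eq_nn_integral) auto
  qed
  show ?thesis
    unfolding ac_def
  proof (intro conjI allI impI)
    show si: "set_integrable lborel {l..r} (\<lambda>t. a / t * wt a t)" for l r
    proof (rule set_integrable_subset)
      have "set_integrable lborel ({l..<0} \<union> {0..\<bar>r\<bar>}) (\<lambda>t. a / t * wt a t)"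
      proof (rule set_integrable_Un)
        have "(\<lambda>t. indicator {l..<0} t *\<^sub>R (a / t * wt a t)) = (\<lambda>_. 0)"
          using False by (auto simp: wt_def indicator_def)
        then show "set_integrable lborel {l..<0} (\<lambda>t. a / t * wt a t)"
          unfolding set_integrable_def by simp
        show "set_integrable lborel {0..\<bar>r\<bar>} (\<lambda>t. a / t * wt a t)"
          by (rule set0) simp
      qed auto
      then show "set_integrable lborel ({l..<0} \<union> {0..\<bar>r\<bar>}) (\<lambda>t. a / t * wt a t)" .
    qed auto
    have Iic: "(LBINT t:{l..r}. a / t * wt a t) = wt a r" if "l \<le> 0" "l \<le> r" for l r
    proof (cases "r > 0")
      case True
      have "(LBINT t:{l..r}. a / t * wt a t) = (LBINT t:{0..r}. a / t * wt a t)"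
        unfolding set_lebesgue_integral_def using that
        by (intro Bochner_Integration.integral_cong) (use False in \<open>auto simp: wt_def indicator_def\<close>)
      then show ?thesis using int0[of r] True False by (simp add: wt_def)
    next
      case r: False
      have "(LBINT t:{l..r}. a / t * wt a t) = (LBINT t:{l..r}. 0)"
        unfolding set_lebesgue_integral_def using that r False
        by (intro Bochner_Integration.integral_cong) (auto simp: wt_def indicator_def)
      then show ?thesis using r False by (simp add: wt_def)
    qed
    fix l r :: real assume lr: "l \<le> r"
    define m where "m = min l 0"
    have "(LBINT t:{m..r}. a / t * wt a t) = (LBINT t:{m..l} \<union> {l<..r}. a / t * wt a t)"
      using lr by (intro arg_cong2[of _ _ _ _ "set_lebesgue_integral lborel"]) (auto simp: m_def)
    also have "\<dots> = (LBINT t:{m..l}. a / t * wt a t) + (LBINT t:{l<..r}. a / t * wt a t)"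
    proof (rule set_integral_Un)
      show "set_integrable lborel {l<..r} (\<lambda>t. a / t * wt a t)"
        by (rule set_integrable_subset[OF si[of l r]]) auto
    qed (auto intro: si simp del: times_divide_eq_left)
    also have "(LBINT t:{l<..r}. a / t * wt a t) = (LBINT t:{l..r}. a / t * wt a t)"
      unfolding set_lebesgue_integral_def
      by (intro integral_cong_AE eventually_mono[OF AE_lborel_singleton[of l]]) (auto simp: indicator_def)
    finally show "wt a r - wt a l = (LBINT t:{l..r}. a / t * wt a t)"
      using Iic[of m r] Iic[of m l] lr unfolding m_def by linarith
  qed
qed

locale line_transport = transport "phi a" "dom1 a" p for a p +
  assumes a_nonneg: "a \<ge> 0"
begin

text \<open>Integration by parts for the truncated T against h^2 times the weight. The summand a / t
  is the logarithmic derivative of the weight; without the truncation the identity equates the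
  integrals of (T' + a T / t) h^2 and of -2 T h h' against the weight.\<close>

lemma line_parts:
  assumes n: "n > 0" and h: "ac h h'"
    and h2: "integrable lborel (\<lambda>t. (h t)\<^sup>2 * wt a t)" and h'2: "integrable lborel (\<lambda>t. (h' t)\<^sup>2 * wt a t)"
    and supp: "AE t in lborel. p t = 0 \<longrightarrow> h t * wt a t = 0"
  shows "integrable lborel (\<lambda>t. (T' t * indicator {t. \<bar>T t\<bar> < n} t + a / t * clamp n (T t)) * (h t)\<^sup>2 * wt a t)"
    and "(LINT t|lborel. (T' t * indicator {t. \<bar>T t\<bar> < n} t + a / t * clamp n (T t)) * (h t)\<^sup>2 * wt a t) =
      - 2 * (LINT t|lborel. clamp n (T t) * (h t * h' t * wt a t))"
proof -
  note [measurable] = ac_measurable[OF h] ac_measurable_deriv[OF h]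
  have [measurable]: "clamp n \<in> borel_measurable borel" unfolding clamp_def by measurable
  have clamp_le: "\<bar>clamp n y\<bar> \<le> n" for y using n by (auto simp: clamp_def)
  have clamp_mult: "norm (clamp n y * X) \<le> norm (n * X)" for y X :: real
    using mult_right_mono[OF clamp_le[of y] abs_ge_zero[of X]] n by (simp add: abs_mult)
  define P where "P t = (h t * h t) * wt a t" for t
  define P' where "P' t = (h' t * h t + h' t * h t) * wt a t + (a / t * wt a t) * (h t * h t)" for t
  have P: "ac P P'"
    unfolding P_def P'_def by (rule ac_mult[OF ac_mult[OF h h] ac_wt[OF a_nonneg]])
  have iP: "integrable lborel P"
    using h2 by (simp add: P_def[abs_def] power2_eq_square)
  have ihh': "integrable lborel (\<lambda>t. h t * h' t * wt a t)"
  proof (rule Bochner_Integration.integrable_bound[OF Bochner_Integration.integrable_add[OF h2 h'2]])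
    show "AE t in lborel. norm (h t * h' t * wt a t) \<le> norm ((h t)\<^sup>2 * wt a t + (h' t)\<^sup>2 * wt a t)"
    proof (rule AE_I2)
      fix t
      have "0 \<le> \<bar>h t\<bar> * \<bar>h' t\<bar>" by simp
      then have "\<bar>h t * h' t\<bar> \<le> (h t)\<^sup>2 + (h' t)\<^sup>2"
        using sum_squares_bound[of "\<bar>h t\<bar>" "\<bar>h' t\<bar>"] unfolding abs_mult power2_abs by linarith
      then have "\<bar>h t * h' t\<bar> * wt a t \<le> ((h t)\<^sup>2 + (h' t)\<^sup>2) * wt a t"
        using wt_nonneg by (rule mult_right_mono)
      then show "norm (h t * h' t * wt a t) \<le> norm ((h t)\<^sup>2 * wt a t + (h' t)\<^sup>2 * wt a t)"
        using wt_nonneg[of a t] by (simp add: abs_mult distrib_right)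
    qed
  qed measurable
  \<comment> \<open>On [0, 1] the derivative of the weight is integrable and h is bounded; beyond 1
    the factor a / t is at most a, so P serves as majorant.\<close>
  have iw: "integrable lborel (\<lambda>t. (a / t * wt a t) * (h t * h t))"
  proof -
    have s: "set_integrable lborel {0..1} (\<lambda>t. (a / t * wt a t) * (h t * h t))"
      by (intro set_integrable_continuous_mult ac_integrable[OF ac_wt[OF a_nonneg]] continuous_on_mult ac_continuous[OF h])
    show ?thesis
    proof (rule Bochner_Integration.integrable_bound)
      show "integrable lborel (\<lambda>t. \<bar>indicator {0..1} t * ((a / t * wt a t) * (h t * h t))\<bar> + a * P t)"
        using s iP unfolding set_integrable_def real_scaleR_def
        by (intro Bochner_Integration.integrable_add integrable_abs integrable_mult_right) 
      show "AE t in lborel. norm ((a / t * wt a t) * (h t * h t)) \<le> norm (\<bar>indicator {0..1} t * ((a / t * wt a t) * (h t * h t))\<bar> + a * P t)"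
      proof (rule AE_I2)
        fix t
        define X where "X = (a / t * wt a t) * (h t * h t)"
        have Pn: "0 \<le> a * P t" using wt_nonneg[of a t] a_nonneg by (simp add: P_def)
        have "\<bar>X\<bar> \<le> \<bar>indicator {0..1} t * X\<bar> + a * P t"
        proof -
          consider "t < 0" | "0 \<le> t" "t \<le> 1" | "t > 1" by linarith
          then show ?thesis
          proof cases
            case 1
            then have "a / t * wt a t = 0" by (auto simp: wt_def)
            then have "X = 0" by (simp only: X_def mult_zero_left)
            then show ?thesis using Pn by simp
          next
            case 2
            then show ?thesis using Pn by (simp add: indicator_def)
          next
            case 3
            have "X = (a / t) * P t" by (simp add: X_def P_def)
            moreover have "(a / t) * P t \<le> a * P t"
            proof (rule mult_right_mono)
              show "a / t \<le> a" using 3 a_nonneg mult_left_mono[of 1 t a] by (simp add: field_simps)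
              show "0 \<le> P t" using wt_nonneg[of a t] by (simp add: P_def)
            qed
            moreover have "0 \<le> (a / t) * P t"
              using 3 a_nonneg wt_nonneg[of a t] by (simp add: P_def)
            ultimately show ?thesis by linarith
          qed
        qed
        then show "norm ((a / t * wt a t) * (h t * h t)) \<le> norm (\<bar>indicator {0..1} t * ((a / t * wt a t) * (h t * h t))\<bar> + a * P t)"
          unfolding X_def[symmetric] by simp
      qed
    qed measurable
  qed
  have iP': "integrable lborel P'"
    using Bochner_Integration.integrable_add[OF integrable_mult_right[OF ihh', of 2] iw]
    by (rule Bochner_Integration.integrable_cong[OF refl, THEN iffD1, rotated])
      (simp add: P'_def algebra_simps)
  define V where "V r = (if dom1 a = UNIV then - n else 0) +
    (LINT t|lborel. T' t * indicator {t. \<bar>T t\<bar> < n} t * indicator {..r} t)" for r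
  note parts = ac_integration_by_parts[OF P iP iP' integrable_T' V_def]
  \<comment> \<open>V is known to equal the truncated T where the cdf lies strictly between 0 and 1,
    which covers almost every point with p t \<noteq> 0. Where p t = 0, \<open>supp\<close> makes P'
    vanish.\<close>
  have AEV: "AE t in lborel. V t * P' t = clamp n (T t) * P' t"
  proof -
    have "AE t in lborel. p t \<noteq> 0 \<longrightarrow> 0 < N.G t \<and> N.G t < 1"
      using N.AE_cdf_strict unfolding N.AE_law .
    then show ?thesis
      using supp
    proof eventually_elim
      case (elim t)
      show ?case
      proof (cases "p t = 0")
        case True
        then have "P' t = 0" using elim by (auto simp: P'_def)
        then show ?thesis by simp
      next
        case False
        then show ?thesis using elim clamp_T_eq_integral[OF n, of t] by (simp add: V_def)
      qed
    qed
  qed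
  have i1: "integrable lborel (\<lambda>t. clamp n (T t) * (h t * h' t * wt a t))"
    by (rule Bochner_Integration.integrable_bound[OF integrable_mult_right[OF ihh', of n]])
      (measurable, intro AE_I2 clamp_mult)
  have i2: "integrable lborel (\<lambda>t. clamp n (T t) * ((a / t * wt a t) * (h t * h t)))"
    by (rule Bochner_Integration.integrable_bound[OF integrable_mult_right[OF iw, of n]])
      (measurable, intro AE_I2 clamp_mult)
  have split: "(T' t * indicator {t. \<bar>T t\<bar> < n} t + a / t * clamp n (T t)) * (h t)\<^sup>2 * wt a t =
    T' t * indicator {t. \<bar>T t\<bar> < n} t * P t + clamp n (T t) * ((a / t * wt a t) * (h t * h t))" for t
    by (simp add: P_def power2_eq_square algebra_simps)
  show "integrable lborel (\<lambda>t. (T' t * indicator {t. \<bar>T t\<bar> < n} t + a / t * clamp n (T t)) * (h t)\<^sup>2 * wt a t)"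
    unfolding split using parts(1) i2 by (rule Bochner_Integration.integrable_add)
  have "(LINT t|lborel. V t * P' t) = (LINT t|lborel. clamp n (T t) * P' t)"
    using AEV parts(2) by (intro integral_cong_AE) (auto simp: P'_def)
  also have "\<dots> = (LINT t|lborel. 2 * (clamp n (T t) * (h t * h' t * wt a t)) + clamp n (T t) * ((a / t * wt a t) * (h t * h t)))"
    by (intro Bochner_Integration.integral_cong) (auto simp: P'_def algebra_simps)
  also have "\<dots> = 2 * (LINT t|lborel. clamp n (T t) * (h t * h' t * wt a t)) + (LINT t|lborel. clamp n (T t) * ((a / t * wt a t) * (h t * h t)))"
    using i1 i2 by (simp add: Bochner_Integration.integral_add)
  finally show "(LINT t|lborel. (T' t * indicator {t. \<bar>T t\<bar> < n} t + a / t * clamp n (T t)) * (h t)\<^sup>2 * wt a t) =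
      - 2 * (LINT t|lborel. clamp n (T t) * (h t * h' t * wt a t))"
    unfolding split using parts(1,3) i2 by (simp add: Bochner_Integration.integral_add)
qed

end

section \<open>The Knothe rearrangement\<close>

abbreviation quant :: "real \<Rightarrow> real \<Rightarrow> real" where "quant a \<equiv> ref_density.quantile (phi a) (dom1 a)"

lemma integrable_mult_cancel:
  fixes f :: "'a \<Rightarrow> real"
  assumes "c \<noteq> 0" "integrable N (\<lambda>x. c * f x)"
  shows "integrable N f"
  using integrable_mult_right[of "1 / c" N "\<lambda>x. c * f x"] assms by simp

lemma quant_in_dom1:
  assumes "a \<ge> 0"
  shows "quant a u \<in> dom1 a"
proof -
  interpret ref_density "phi a" "dom1 a" by (rule ref_density_phi[OF assms])
  show ?thesis
  proof (cases "0 < u \<and> u < 1")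
    case True
    then show ?thesis using quantile_in_D[of u] by simp
  next
    case False
    then have "quantile u = 1" unfolding quantile_def by (rule if_not_P)
    then show ?thesis by (simp add: dom1_def)
  qed
qed

lemma ln_phi:
  assumes "a \<ge> 0" "t \<in> dom1 a"
  shows "ln (phi a t) = a * ln t - t\<^sup>2 / 2 - ln (Z a)"
proof -
  have "wt a t > 0" using assms wt_pos_iff by blast
  then have "ln (phi a t) = ln (wt a t) - t\<^sup>2 / 2 - ln (Z a)"
    using Z_pos[OF assms(1)] by (simp add: phi_def ln_mult ln_div)
  moreover have "ln (wt a t) = a * ln t"
    using assms by (auto simp: wt_def dom1_def ln_powr)
  ultimately show ?thesis by simp
qed

text \<open>The tangent line of ln at the point 1 / l.\<close>

lemma ln_le_scaled:
  assumes "x > 0" "(l::real) > 0"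
  shows "ln x \<le> l * x - 1 - ln l"
  using ln_le_minus_one[of "l * x"] assms by (simp add: ln_mult)

lemma ln_eq_scaled:
  assumes "x > 0" "(l::real) > 0" "ln x = l * x - 1 - ln l"
  shows "x = 1 / l"
  using ln_eq_minus_one[of "l * x"] assms by (simp add: ln_mult field_simps)

locale monomial_product =
  fixes A :: "'i::finite \<Rightarrow> real"
  assumes A_nonneg: "\<And>i. 0 \<le> A i"
begin

sublocale real_product_prob "\<lambda>i. density lborel (\<lambda>t. ennreal (phi (A i) t))"
proof (rule real_product_prob.intro)
  show "prob_space (density lborel (\<lambda>t. ennreal (phi (A i) t)))" for i
    by (rule prob_spaceI) (simp add: emeasure_density nn_integral_phi[OF A_nonneg])
qed simp

abbreviation \<mu>1 :: "'i \<Rightarrow> real measure" where "\<mu>1 i \<equiv> density lborel (\<lambda>t. ennreal (phi (A i) t))"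

text \<open>The density of x^A dx with respect to the reference law M, see
  \<open>prod_phi_\<Psi>\<close>.\<close>

definition \<Psi> :: "('i \<Rightarrow> real) \<Rightarrow> real"
  where "\<Psi> x = (\<Prod>j\<in>UNIV. exp ((x j)\<^sup>2 / 2) * Z (A j))"

lemma measurable_\<Psi>[measurable]: "\<Psi> \<in> borel_measurable M"
  unfolding \<Psi>_def by measurable

lemma \<Psi>_pos: "\<Psi> x > 0"
  unfolding \<Psi>_def by (intro prod_pos ballI mult_pos_pos exp_gt_zero Z_pos A_nonneg)

definition \<Psi>off :: "'i \<Rightarrow> ('i \<Rightarrow> real) \<Rightarrow> real"
  where "\<Psi>off i x = (\<Prod>j\<in>UNIV - {i}. exp ((x j)\<^sup>2 / 2) * Z (A j))"

lemma \<Psi>off_pos: "\<Psi>off i x > 0"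
  unfolding \<Psi>off_def by (intro prod_pos ballI mult_pos_pos exp_gt_zero Z_pos A_nonneg)

text \<open>On a line, \<open>\<Psi>\<close> times the one-dimensional reference density is the bare
  weight up to a constant of that line, which is the form that \<open>line_parts\<close> works
  with.\<close>

lemma \<Psi>_upd_phi: "\<Psi> (x(i := t)) * phi (A i) t = \<Psi>off i x * wt (A i) t"
proof -
  have "\<Psi> (x(i := t)) = exp (t\<^sup>2 / 2) * Z (A i) * \<Psi>off i x"
    unfolding \<Psi>_def \<Psi>off_def by (subst prod.remove[of UNIV i]) (auto intro!: prod.cong)
  then show ?thesis
    using Z_pos[OF A_nonneg[of i]] by (simp add: phi_def exp_minus field_simps)
qed

lemma ln_\<Psi>: "ln (\<Psi> x) = (\<Sum>j\<in>UNIV. (x j)\<^sup>2 / 2 + ln (Z (A j)))"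
proof -
  have Z: "Z (A j) > 0" for j by (rule Z_pos[OF A_nonneg])
  have "ln (\<Psi> x) = (\<Sum>j\<in>UNIV. ln (exp ((x j)\<^sup>2 / 2) * Z (A j)))"
    unfolding \<Psi>_def by (intro ln_prod) (simp_all add: less_imp_neq[OF Z, symmetric])
  then show ?thesis by (simp add: ln_mult_pos[OF exp_gt_zero Z])
qed

lemma AE_\<mu>1: "(AE t in \<mu>1 i. Q t) \<longleftrightarrow> (AE t in lborel. t \<in> dom1 (A i) \<longrightarrow> Q t)"
  by (subst AE_density) (auto simp: phi_pos_iff[OF A_nonneg])

lemma AE_dom: "AE x in M. x i \<in> dom1 (A i)"
proof -
  have "AE t in \<mu>1 i. t \<in> dom1 (A i)" unfolding AE_\<mu>1 by simp
  then have "AE t in distr M (\<mu>1 i) (\<lambda>x. x i). t \<in> dom1 (A i)"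
    by (subst distr_component)
  moreover have "(\<lambda>x. x i) \<in> M \<rightarrow>\<^sub>M \<mu>1 i" by measurable
  ultimately show ?thesis by (rule AE_distrD[rotated])
qed

end

text \<open>What is kept of the Sobolev hypothesis after slicing. Since f and g are only determined
  up to null sets, agreement with an absolutely continuous h is asked for almost everywhere, and
  only on the domain of the coordinate.\<close>

locale sobolev_lines = monomial_product A for A :: "'i::finite \<Rightarrow> real" +
  fixes f :: "('i \<Rightarrow> real) \<Rightarrow> real" and g :: "'i \<Rightarrow> ('i \<Rightarrow> real) \<Rightarrow> real"
  assumes measurable_f[measurable]: "f \<in> borel_measurable M"
    and measurable_g[measurable]: "\<And>i. g i \<in> borel_measurable M"
    and f_norm: "(\<integral>\<^sup>+x. ennreal ((f x)\<^sup>2 * \<Psi> x) \<partial>M) = 1"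
    and g_int: "\<And>i. integrable M (\<lambda>x. (g i x)\<^sup>2 * \<Psi> x)"
    and lines: "\<And>i. AE x in M. \<exists>h h'. ac h h' \<and>
      (AE t in lborel. t \<in> dom1 (A i) \<longrightarrow> h t = f (x(i := t)) \<and> h' t = g i (x(i := t)))"
begin

text \<open>The density of the probability f^2 x^A dx with respect to M.\<close>

definition F :: "('i \<Rightarrow> real) \<Rightarrow> real" where "F x = (f x)\<^sup>2 * \<Psi> x"

lemma measurable_F[measurable]: "F \<in> borel_measurable M"
  unfolding F_def by measurable

lemma F_nonneg: "F x \<ge> 0"
  using \<Psi>_pos[of x] by (simp add: F_def)

lemma F_total: "(\<integral>\<^sup>+x. ennreal (F x) \<partial>M) = 1"
  using f_norm by (simp add: F_def)

lemma integrable_F: "integrable M F"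
  using F_total F_nonneg by (intro integrableI_nonneg) auto

lemma integral_F: "(\<integral>x. F x \<partial>M) = 1"
  using F_total F_nonneg by (simp add: integral_eq_nn_integral)

abbreviation m :: "'i set \<Rightarrow> ('i \<Rightarrow> real) \<Rightarrow> ennreal" where "m \<equiv> marginal (\<lambda>x. ennreal (F x))"

abbreviation mr :: "'i set \<Rightarrow> ('i \<Rightarrow> real) \<Rightarrow> real" where "mr S x \<equiv> enn2real (m S x)"

lemma AE_m_finite: "AE x in M. m S x < \<infinity>"
  by (rule AE_marginal_finite) (auto simp: F_total)

lemma AE_m_pos: "AE x in M. F x \<noteq> 0 \<longrightarrow> 0 < m S x"
  using AE_marginal_pos[of "\<lambda>x. ennreal (F x)" S]
  by (auto elim!: eventually_mono simp: F_nonneg less_le zero_less_iff_neq_zero)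

lemma nn_integral_m: "(\<integral>\<^sup>+x. m S x \<partial>M) = 1"
  using nn_integral_marginal[of "\<lambda>x. ennreal (F x)" "\<lambda>_. 1" S] by (simp add: F_total)

lemma m_empty: "m {} x = 1"
  by (simp add: marginal_empty F_total)

lemma m_UNIV: "m UNIV x = ennreal (F x)"
  by (rule marginal_UNIV)

end

text \<open>One step of the Knothe rearrangement: the conditional law of the \<open>i\<close>-th coordinate given the
  coordinates in \<open>S\<close> is transported to the reference law.\<close>

locale knothe_step = sobolev_lines A f g for A :: "'i::finite \<Rightarrow> real" and f g +
  fixes S :: "'i set" and i :: 'i
  assumes i_notin: "i \<notin> S"
begin

abbreviation "a \<equiv> A i"

lemma a_nonneg: "a \<ge> 0" by (rule A_nonneg)

text \<open>The conditional Lebesgue density of the i-th coordinate given those in S. It is shown to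
  have mass 1 for \<open>good\<close> points only.\<close>

definition dens :: "('i \<Rightarrow> real) \<Rightarrow> real \<Rightarrow> real"
  where "dens x t = mr (insert i S) (x(i := t)) / mr S x * phi a t"

definition Gx :: "('i \<Rightarrow> real) \<Rightarrow> real"
  where "Gx x = enn2real (\<integral>\<^sup>+s. ennreal (dens x s) * indicator {..x i} s \<partial>lborel)"

definition Tx :: "('i \<Rightarrow> real) \<Rightarrow> real" where "Tx x = quant a (Gx x)"

definition T'x :: "('i \<Rightarrow> real) \<Rightarrow> real" where "T'x x = dens x (x i) / phi a (Tx x)"

lemma measurable_mr[measurable]: "mr R \<in> borel_measurable M"
  by measurable

lemma measurable_dens[measurable]:
  assumes [measurable]: "u \<in> N \<rightarrow>\<^sub>M M" "v \<in> borel_measurable N"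
  shows "(\<lambda>z. dens (u z) (v z)) \<in> borel_measurable N"
proof -
  have 1: "(\<lambda>z. (u z)(i := v z)) \<in> N \<rightarrow>\<^sub>M M" by measurable
  have "(\<lambda>z. mr (insert i S) ((u z)(i := v z))) \<in> borel_measurable N"
    using measurable_compose[OF 1 measurable_mr] .
  moreover have "(\<lambda>z. mr S (u z)) \<in> borel_measurable N"
    using measurable_compose[OF assms(1) measurable_mr] .
  ultimately show ?thesis unfolding dens_def by measurable
qed

lemma measurable_Gx[measurable]: "Gx \<in> borel_measurable M"
proof -
  have "(\<lambda>z. ennreal (dens (fst z) (snd z)) * (if snd z \<le> (fst z) i then 1 else 0)) \<in> borel_measurable (M \<Otimes>\<^sub>M lborel)"
    by measurable
  moreover have "(\<lambda>z. ennreal (dens (fst z) (snd z)) * (if snd z \<le> (fst z) i then 1 else 0)) =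
      (\<lambda>(x, s). ennreal (dens x s) * indicator {..x i} s)"
    by (auto simp: fun_eq_iff indicator_def)
  ultimately have "(\<lambda>(x, s). ennreal (dens x s) * indicator {..x i} s) \<in> borel_measurable (M \<Otimes>\<^sub>M lborel)"
    by simp
  from lborel.borel_measurable_nn_integral[OF this]
  have "(\<lambda>x. \<integral>\<^sup>+s. ennreal (dens x s) * indicator {..x i} s \<partial>lborel) \<in> borel_measurable M" .
  then show ?thesis unfolding Gx_def by measurable
qed

lemma measurable_quant[measurable]: "quant a \<in> borel_measurable borel"
  by (rule ref_density.measurable_quantile[OF ref_density_phi[OF a_nonneg]])

lemma measurable_Tx[measurable]: "Tx \<in> borel_measurable M"
  unfolding Tx_def by measurable

lemma measurable_T'x[measurable]: "T'x \<in> borel_measurable M"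
  unfolding T'x_def by measurable

lemma dens_nonneg: "dens x t \<ge> 0"
  using phi_nonneg[OF a_nonneg] by (simp add: dens_def)

lemma dens_upd: "dens (x(i := s)) t = dens x t"
  by (simp add: dens_def marginal_upd[OF i_notin])

lemma dens_splice: "dens (splice (insert i S) x y) t = dens x t"
proof -
  have "(splice (insert i S) x y)(i := t) = splice (insert i S) (x(i := t)) y"
    by (auto simp: splice_def fun_eq_iff)
  moreover have "m S (splice (insert i S) x y) = m S x"
    unfolding marginal_def using i_notin
    by (intro nn_integral_cong arg_cong[of _ _ "\<lambda>x. ennreal (F x)"]) (auto simp: splice_def fun_eq_iff)
  ultimately show ?thesis by (simp add: dens_def marginal_splice)
qed

lemma Tx_splice: "Tx (splice (insert i S) x y) = Tx x"
  by (simp add: Tx_def Gx_def dens_splice) (simp add: splice_def)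

lemma Tx_in_dom: "Tx x \<in> dom1 a"
  unfolding Tx_def by (rule quant_in_dom1[OF a_nonneg])

lemma T'x_nonneg: "T'x x \<ge> 0"
  by (simp add: T'x_def dens_nonneg phi_nonneg[OF a_nonneg])

definition good :: "('i \<Rightarrow> real) \<Rightarrow> bool" where "good x \<longleftrightarrow> 0 < m S x \<and> m S x < \<infinity>"

lemma nn_integral_m_line: "(\<integral>\<^sup>+t. m (insert i S) (x(i := t)) * ennreal (phi a t) \<partial>lborel) = m S x"
proof -
  have [measurable]: "(\<lambda>t. m (insert i S) (x(i := t))) \<in> borel_measurable lborel"
  proof -
    have "(\<lambda>t. x(i := t)) \<in> lborel \<rightarrow>\<^sub>M M" by measurable
    from measurable_compose[OF this, of "m (insert i S)"] show ?thesis by simp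
  qed
  have "m S x = (\<integral>\<^sup>+t. m (insert i S) (x(i := t)) \<partial>\<mu>1 i)"
    by (rule marginal_insert[OF _ i_notin]) measurable
  also have "\<dots> = (\<integral>\<^sup>+t. m (insert i S) (x(i := t)) * ennreal (phi a t) \<partial>lborel)"
    by (subst nn_integral_density) (auto simp: mult.commute)
  finally show ?thesis ..
qed

text \<open>Undoes the division in \<open>dens\<close>. If the marginal over S is 0, the larger
  marginal vanishes almost everywhere on the line inside the domain; if it is positive and finite,
  the larger one is finite almost everywhere there.\<close>

lemma AE_m_line:
  assumes "m S x < \<infinity>"
  shows "AE t in lborel. m (insert i S) (x(i := t)) * ennreal (phi a t) = m S x * ennreal (dens x t) \<and>
    (t \<in> dom1 a \<longrightarrow> m (insert i S) (x(i := t)) < \<infinity>)"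
proof -
  have [measurable]: "(\<lambda>t. m (insert i S) (x(i := t))) \<in> borel_measurable lborel"
  proof -
    have "(\<lambda>t. x(i := t)) \<in> lborel \<rightarrow>\<^sub>M M" by measurable
    from measurable_compose[OF this, of "m (insert i S)"] show ?thesis by simp
  qed
  show ?thesis
  proof (cases "m S x = 0")
    case True
    then have "(\<integral>\<^sup>+t. m (insert i S) (x(i := t)) * ennreal (phi a t) \<partial>lborel) = 0"
      by (simp add: nn_integral_m_line)
    then have "AE t in lborel. m (insert i S) (x(i := t)) * ennreal (phi a t) = 0"
      by (subst (asm) nn_integral_0_iff_AE) auto
    then show ?thesis
    proof eventually_elim
      case (elim t)
      have "t \<in> dom1 a \<Longrightarrow> m (insert i S) (x(i := t)) = 0"
        using elim phi_pos_iff[OF a_nonneg, of t] by auto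
      then show ?case using True elim by auto
    qed
  next
    case False
    have "AE t in lborel. m (insert i S) (x(i := t)) * ennreal (phi a t) < \<infinity>"
      using nn_integral_PInf_AE[of "\<lambda>t. m (insert i S) (x(i := t)) * ennreal (phi a t)" lborel] assms
      by (auto simp: nn_integral_m_line less_top)
    then show ?thesis
    proof eventually_elim
      case (elim t)
      define r where "r = mr S x"
      have r: "m S x = ennreal r" "r > 0"
        using assms False by (auto simp: r_def enn2real_positive_iff less_top zero_less_iff_neq_zero)
      show ?case
      proof (cases "t \<in> dom1 a")
        case True
        then have "phi a t > 0" using phi_pos_iff[OF a_nonneg] by blast
        then have fin: "m (insert i S) (x(i := t)) < \<infinity>"
          using elim by (cases "m (insert i S) (x(i := t))") (auto simp: ennreal_top_mult)
        then obtain s where s: "m (insert i S) (x(i := t)) = ennreal s" "s \<ge> 0"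
          by (cases "m (insert i S) (x(i := t))") auto
        have "ennreal s * ennreal (phi a t) = ennreal r * ennreal (s / r * phi a t)"
          using s(2) r phi_nonneg[OF a_nonneg, of t] by (simp flip: ennreal_mult)
        then show ?thesis using s fin r by (simp add: dens_def)
      next
        case False
        then have "phi a t = 0" using phi_pos_iff[OF a_nonneg, of t] phi_nonneg[OF a_nonneg, of t] by auto
        then show ?thesis using False by (simp add: dens_def)
      qed
    qed
  qed
qed

lemma line_transport_dens:
  assumes "good x"
  shows "line_transport a (dens x)"
proof -
  have x: "0 < m S x" "m S x < \<infinity>" using assms by (auto simp: good_def)
  have [measurable]: "dens x \<in> borel_measurable borel"
    using measurable_dens[of "\<lambda>_. x" borel "\<lambda>t. t"] by simp
  have "m S x = (\<integral>\<^sup>+t. m S x * ennreal (dens x t) \<partial>lborel)"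
    unfolding nn_integral_m_line[of x, symmetric]
    by (intro nn_integral_cong_AE eventually_mono[OF AE_m_line[OF x(2)]]) (simp add: nn_integral_m_line)
  also have "\<dots> = m S x * (\<integral>\<^sup>+t. ennreal (dens x t) \<partial>lborel)"
    by (subst nn_integral_cmult) auto
  finally have "(\<integral>\<^sup>+t. ennreal (dens x t) \<partial>lborel) = 1"
    using x by (metis ennreal_mult_cancel_left less_irrefl mult.right_neutral infinity_ennreal_def)
  then have "prob_density (dens x)"
    by unfold_locales (auto simp: dens_nonneg)
  then show ?thesis
    using ref_density_phi[OF a_nonneg] a_nonneg
    by (simp add: line_transport_def line_transport_axioms_def transport_def)
qed

lemma
  assumes "good x"
  shows Tx_line: "Tx (x(i := t)) = transport.T (phi a) (dom1 a) (dens x) t"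
    and T'x_line: "T'x (x(i := t)) = transport.T' (phi a) (dom1 a) (dens x) t"
proof -
  interpret line_transport a "dens x" by (rule line_transport_dens[OF assms])
  have 3: "Gx (x(i := t)) = N.G t"
    by (simp add: Gx_def dens_upd N.cdf_eq_nn_integral)
  show 1: "Tx (x(i := t)) = T t"
    by (simp add: Tx_def 3 T_def)
  show "T'x (x(i := t)) = T' t"
    by (simp add: T'x_def 1 dens_upd T'_def)
qed

text \<open>\<open>Tx\<close> involves the coordinates in S and i only, so F may be exchanged for
  its marginal. On each line the push-forward then yields the second moment of the reference law,
  whatever f is.\<close>

lemma nn_integral_Tx_sq: "(\<integral>\<^sup>+x. ennreal ((Tx x)\<^sup>2) * ennreal (F x) \<partial>M) = ennreal (1 + a)"
proof -
  have "(\<integral>\<^sup>+x. ennreal ((Tx x)\<^sup>2) * ennreal (F x) \<partial>M) = (\<integral>\<^sup>+x. ennreal ((Tx x)\<^sup>2) * m (insert i S) x \<partial>M)"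
    by (rule nn_integral_marginal[symmetric]) (auto simp: Tx_splice)
  also have "\<dots> = (\<integral>\<^sup>+x. \<integral>\<^sup>+t. ennreal ((Tx (x(i := t)))\<^sup>2) * m (insert i S) (x(i := t)) \<partial>\<mu>1 i \<partial>M)"
    by (rule nn_integral_line) measurable
  also have "\<dots> = (\<integral>\<^sup>+x. ennreal (1 + a) * m S x \<partial>M)"
  proof (rule nn_integral_cong_AE)
    show "AE x in M. (\<integral>\<^sup>+t. ennreal ((Tx (x(i := t)))\<^sup>2) * m (insert i S) (x(i := t)) \<partial>\<mu>1 i) = ennreal (1 + a) * m S x"
      using AE_m_finite[of S]
    proof eventually_elim
      case (elim x)
      have [measurable]: "(\<lambda>t. m (insert i S) (x(i := t))) \<in> borel_measurable lborel"
        "(\<lambda>t. Tx (x(i := t))) \<in> borel_measurable lborel" 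
      proof -
        have "(\<lambda>t. x(i := t)) \<in> lborel \<rightarrow>\<^sub>M M" by measurable
        from measurable_compose[OF this, of "m (insert i S)"] measurable_compose[OF this measurable_Tx]
        show "(\<lambda>t. m (insert i S) (x(i := t))) \<in> borel_measurable lborel"
          "(\<lambda>t. Tx (x(i := t))) \<in> borel_measurable lborel" by simp_all
      qed
      have [measurable]: "dens x \<in> borel_measurable borel"
        using measurable_dens[of "\<lambda>_. x" borel "\<lambda>t. t"] by simp
      have "(\<integral>\<^sup>+t. ennreal ((Tx (x(i := t)))\<^sup>2) * m (insert i S) (x(i := t)) \<partial>\<mu>1 i) =
          (\<integral>\<^sup>+t. ennreal ((Tx (x(i := t)))\<^sup>2) * (m (insert i S) (x(i := t)) * ennreal (phi a t)) \<partial>lborel)"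
        by (subst nn_integral_density) (auto simp: mult_ac)
      also have "\<dots> = (\<integral>\<^sup>+t. m S x * (ennreal ((Tx (x(i := t)))\<^sup>2) * ennreal (dens x t)) \<partial>lborel)"
        by (intro nn_integral_cong_AE eventually_mono[OF AE_m_line[OF elim]]) (auto simp: mult_ac)
      also have "\<dots> = m S x * (\<integral>\<^sup>+t. ennreal ((Tx (x(i := t)))\<^sup>2) * ennreal (dens x t) \<partial>lborel)"
        by (subst nn_integral_cmult) auto
      also have "\<dots> = m S x * ennreal (1 + a)"
      proof (cases "m S x = 0")
        case False
        then have good: "good x" using elim by (simp add: good_def zero_less_iff_neq_zero)
        interpret line_transport a "dens x" by (rule line_transport_dens[OF good])
        have "(\<integral>\<^sup>+t. ennreal ((T t)\<^sup>2) * ennreal (dens x t) \<partial>lborel) = (\<integral>\<^sup>+y. ennreal (y\<^sup>2) * ennreal (phi a y) \<partial>lborel)"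
          by (rule nn_integral_T) measurable
        then show ?thesis
          by (simp add: Tx_line[OF good] nn_integral_phi[OF a_nonneg])
      qed simp
      finally show ?case by (simp add: mult.commute)
    qed
  qed
  also have "\<dots> = ennreal (1 + a)"
    by (simp add: nn_integral_cmult nn_integral_m)
  finally show ?thesis .
qed

lemma integrable_Tx_sq: "integrable M (\<lambda>x. (Tx x)\<^sup>2 * F x)"
  and integral_Tx_sq: "(\<integral>x. (Tx x)\<^sup>2 * F x \<partial>M) = 1 + a"
proof -
  have *: "(\<integral>\<^sup>+x. ennreal ((Tx x)\<^sup>2 * F x) \<partial>M) = ennreal (1 + a)"
    using nn_integral_Tx_sq by (simp add: ennreal_mult F_nonneg)
  then show "integrable M (\<lambda>x. (Tx x)\<^sup>2 * F x)"
    by (intro integrableI_nonneg) (auto simp: F_nonneg)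
  show "(\<integral>x. (Tx x)\<^sup>2 * F x \<partial>M) = 1 + a"
    using * a_nonneg by (subst integral_eq_nn_integral) (auto simp: F_nonneg)
qed

text \<open>The product of T f and g is bounded by (T f)^2 + g^2, and the first square has the
  finite integral 1 + a. The majorized u covers T and its truncations alike.\<close>

lemma integrable_mixed:
  assumes [measurable]: "u \<in> borel_measurable M" and u: "\<And>x. \<bar>u x\<bar> \<le> \<bar>Tx x\<bar>"
  shows "integrable M (\<lambda>x. u x * (f x * g i x * \<Psi> x))"
proof (rule Bochner_Integration.integrable_bound[OF Bochner_Integration.integrable_add[OF integrable_Tx_sq g_int[of i]]])
  show "AE x in M. norm (u x * (f x * g i x * \<Psi> x)) \<le> norm ((Tx x)\<^sup>2 * F x + (g i x)\<^sup>2 * \<Psi> x)"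
  proof (rule AE_I2)
    fix x
    have "\<bar>u x * f x\<bar> \<le> \<bar>Tx x * f x\<bar>"
      using u[of x] by (simp add: abs_mult mult_right_mono)
    then have "\<bar>u x * f x\<bar> * \<bar>g i x\<bar> \<le> \<bar>Tx x * f x\<bar> * \<bar>g i x\<bar>"
      by (rule mult_right_mono) simp
    moreover have "0 \<le> \<bar>Tx x * f x\<bar> * \<bar>g i x\<bar>" by simp
    ultimately have "\<bar>u x * f x\<bar> * \<bar>g i x\<bar> \<le> (Tx x * f x)\<^sup>2 + (g i x)\<^sup>2"
      using sum_squares_bound[of "\<bar>Tx x * f x\<bar>" "\<bar>g i x\<bar>"] unfolding power2_abs by linarith
    then have "\<bar>u x * f x\<bar> * \<bar>g i x\<bar> * \<Psi> x \<le> ((Tx x * f x)\<^sup>2 + (g i x)\<^sup>2) * \<Psi> x"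
      using \<Psi>_pos[of x] by (intro mult_right_mono) auto
    then show "norm (u x * (f x * g i x * \<Psi> x)) \<le> norm ((Tx x)\<^sup>2 * F x + (g i x)\<^sup>2 * \<Psi> x)"
      using \<Psi>_pos[of x] by (simp add: abs_mult F_def power_mult_distrib algebra_simps)
  qed
qed measurable

lemma measurable_clamp[measurable]: "clamp n \<in> borel_measurable borel"
  unfolding clamp_def by measurable

lemma abs_clamp_le: "n \<ge> 0 \<Longrightarrow> \<bar>clamp n y\<bar> \<le> \<bar>y\<bar>"
  by (auto simp: clamp_def)

text \<open>The integrand of \<open>line_parts\<close> on the line through x.\<close>

definition D_n :: "real \<Rightarrow> ('i \<Rightarrow> real) \<Rightarrow> real"
  where "D_n n x = T'x x * indicator {x. \<bar>Tx x\<bar> < n} x + a / x i * clamp n (Tx x)"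

lemma measurable_D_n[measurable]: "D_n n \<in> borel_measurable M"
  unfolding D_n_def by measurable

lemma D_n_nonneg: "x i \<in> dom1 a \<Longrightarrow> n > 0 \<Longrightarrow> D_n n x \<ge> 0"
  using Tx_in_dom[of x] T'x_nonneg[of x] a_nonneg
  by (auto simp: D_n_def dom1_def clamp_def indicator_def intro!: add_nonneg_nonneg)

text \<open>\<open>line_parts\<close> integrated over all lines in direction i. The map comes from
  the marginal, but f itself is integrated by parts, with the coordinates outside S and i as
  parameters. Nonnegativity of \<open>D_n\<close> on the domain permits working with nonnegative
  integrals.\<close>

lemma nn_integral_D_n:
  assumes n: "n > 0"
  shows "(\<integral>\<^sup>+x. ennreal (D_n n x * F x) \<partial>M) = ennreal (- 2 * (\<integral>x. clamp n (Tx x) * (f x * g i x * \<Psi> x) \<partial>M))"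
proof -
  define K where "K x = clamp n (Tx x) * (f x * g i x * \<Psi> x)" for x
  have [measurable]: "K \<in> borel_measurable M" unfolding K_def by measurable
  have iK: "integrable M K"
    unfolding K_def by (rule integrable_mixed) (use n abs_clamp_le in auto)
  \<comment> \<open>The sign is recorded with the value: it allows the outer integral to be taken
    inside \<open>ennreal\<close>.\<close>
  have line: "AE x in M. (\<integral>\<^sup>+t. ennreal (D_n n (x(i := t)) * F (x(i := t))) \<partial>\<mu>1 i) = ennreal (- 2 * (\<integral>t. K (x(i := t)) \<partial>\<mu>1 i)) \<and>
    - 2 * (\<integral>t. K (x(i := t)) \<partial>\<mu>1 i) \<ge> 0"
    using AE_m_finite[of S] lines[of i] AE_line[OF AE_m_pos[of "insert i S"], of i]
      AE_integrable_line[OF integrable_F, of i] AE_integrable_line[OF g_int[of i], of i]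
  proof eventually_elim
    case (elim x)
    have line_meas[measurable]: "(\<lambda>t. x(i := t)) \<in> borel \<rightarrow>\<^sub>M M"
      using measurable_line[of "\<lambda>_. x" borel "\<lambda>t. t" i] by simp
    note [measurable] = measurable_compose[OF line_meas measurable_f] measurable_compose[OF line_meas measurable_g[of i]]
      measurable_compose[OF line_meas measurable_Tx] measurable_compose[OF line_meas measurable_T'x]
      measurable_compose[OF line_meas measurable_\<Psi>] measurable_compose[OF line_meas measurable_F]
      measurable_compose[OF line_meas measurable_D_n] measurable_compose[OF line_meas \<open>K \<in> borel_measurable M\<close>]
    obtain h h' where h: "ac h h'" and
      hf: "AE t in lborel. t \<in> dom1 a \<longrightarrow> h t = f (x(i := t)) \<and> h' t = g i (x(i := t))"
      using elim(2) by blast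
    note [measurable] = ac_measurable[OF h] ac_measurable_deriv[OF h]
    have E: "\<Psi> (x(i := t)) * phi a t = \<Psi>off i x * wt a t" for t by (rule \<Psi>_upd_phi)
    have Kint: "(\<integral>t. K (x(i := t)) \<partial>\<mu>1 i) = (LINT t|lborel. phi a t * K (x(i := t)))"
      by (subst integral_density) (auto simp: phi_nonneg[OF a_nonneg])
    show ?case
    proof (cases "m S x = 0")
      case True
      \<comment> \<open>Where the marginal over S vanishes, f vanishes almost everywhere on the
        line, and both sides are 0.\<close>
      have "AE t in lborel. t \<in> dom1 a \<longrightarrow> F (x(i := t)) = 0 \<and> f (x(i := t)) = 0"
        using AE_m_line[OF elim(1)] elim(3)[unfolded AE_\<mu>1]
      proof eventually_elim
        case (elim t)
        show ?case
        proof
          assume t: "t \<in> dom1 a"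
          then have "phi a t > 0" using phi_pos_iff[OF a_nonneg] by blast
          then have "F (x(i := t)) = 0" using elim True t by auto
          then show "F (x(i := t)) = 0 \<and> f (x(i := t)) = 0"
            using \<Psi>_pos[of "x(i := t)"] by (simp add: F_def)
        qed
      qed
      then have *: "AE t in \<mu>1 i. F (x(i := t)) = 0 \<and> K (x(i := t)) = 0"
        unfolding AE_\<mu>1 by eventually_elim (simp add: K_def)
      have "(\<integral>\<^sup>+t. ennreal (D_n n (x(i := t)) * F (x(i := t))) \<partial>\<mu>1 i) = (\<integral>\<^sup>+t. 0 \<partial>\<mu>1 i)"
        using * by (intro nn_integral_cong_AE) (auto elim!: eventually_mono)
      moreover have "(\<integral>t. K (x(i := t)) \<partial>\<mu>1 i) = 0"
        by (rule integral_eq_zero_AE) (use * in \<open>auto elim!: eventually_mono\<close>)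
      ultimately show ?thesis by simp
    next
      case False
      then have good: "good x" using elim(1) by (simp add: good_def zero_less_iff_neq_zero)
      interpret line_transport a "dens x" by (rule line_transport_dens[OF good])
      have phiF: "AE t in lborel. phi a t * F (x(i := t)) = \<Psi>off i x * ((h t)\<^sup>2 * wt a t)"
        using hf
      proof eventually_elim
        case (elim t)
        show ?case
        proof (cases "t \<in> dom1 a")
          case True
          have "phi a t * F (x(i := t)) = (f (x(i := t)))\<^sup>2 * (\<Psi> (x(i := t)) * phi a t)"
            by (simp add: F_def)
          then show ?thesis unfolding E using elim True by simp
        next
          case False
          then show ?thesis using wt_not_dom[OF a_nonneg] by (simp add: phi_def)
        qed
      qed
      have phig: "AE t in lborel. phi a t * ((g i (x(i := t)))\<^sup>2 * \<Psi> (x(i := t))) = \<Psi>off i x * ((h' t)\<^sup>2 * wt a t)"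
        using hf
      proof eventually_elim
        case (elim t)
        show ?case
        proof (cases "t \<in> dom1 a")
          case True
          have "phi a t * ((g i (x(i := t)))\<^sup>2 * \<Psi> (x(i := t))) = (g i (x(i := t)))\<^sup>2 * (\<Psi> (x(i := t)) * phi a t)"
            by simp
          then show ?thesis unfolding E using elim True by simp
        next
          case False
          then show ?thesis using wt_not_dom[OF a_nonneg] by (simp add: phi_def)
        qed
      qed
      have "integrable lborel (\<lambda>t. phi a t * F (x(i := t)))"
        using elim(4) by (subst (asm) integrable_density) (auto simp: phi_nonneg[OF a_nonneg])
      then have "integrable lborel (\<lambda>t. \<Psi>off i x * ((h t)\<^sup>2 * wt a t))"
        using phiF by (subst (asm) integrable_cong_AE) auto
      then have h2: "integrable lborel (\<lambda>t. (h t)\<^sup>2 * wt a t)"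
        by (rule integrable_mult_cancel[rotated]) (use \<Psi>off_pos[of i x] in auto)
      have "integrable lborel (\<lambda>t. phi a t * ((g i (x(i := t)))\<^sup>2 * \<Psi> (x(i := t))))"
        using elim(5) by (subst (asm) integrable_density) (auto simp: phi_nonneg[OF a_nonneg])
      then have "integrable lborel (\<lambda>t. \<Psi>off i x * ((h' t)\<^sup>2 * wt a t))"
        using phig by (subst (asm) integrable_cong_AE) auto
      then have h'2: "integrable lborel (\<lambda>t. (h' t)\<^sup>2 * wt a t)"
        by (rule integrable_mult_cancel[rotated]) (use \<Psi>off_pos[of i x] in auto)
      \<comment> \<open>Where F is nonzero the marginal is almost surely positive, so a zero of the
        conditional density in the domain is almost surely a zero of f.\<close>
      have supp: "AE t in lborel. dens x t = 0 \<longrightarrow> h t * wt a t = 0"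
        using AE_m_line[OF elim(1)] elim(3)[unfolded AE_\<mu>1] hf
      proof eventually_elim
        case (elim t)
        show ?case
        proof (cases "t \<in> dom1 a")
          case True
          then have "phi a t > 0" using phi_pos_iff[OF a_nonneg] by blast
          then have "dens x t = 0 \<Longrightarrow> F (x(i := t)) = 0" using elim True by auto
          then show ?thesis
            using elim True \<Psi>_pos[of "x(i := t)"] by (auto simp: F_def)
        next
          case False
          then show ?thesis using wt_not_dom[OF a_nonneg] by simp
        qed
      qed
      note LP = line_parts[OF n h h2 h'2 supp]
      let ?L = "\<lambda>t. (T' t * indicator {t. \<bar>T t\<bar> < n} t + a / t * clamp n (T t)) * (h t)\<^sup>2 * wt a t"
      have L_nonneg: "?L t \<ge> 0" for t
      proof (cases "t \<in> dom1 a")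
        case True
        have "D_n n (x(i := t)) \<ge> 0" using D_n_nonneg[of "x(i := t)"] True n by simp
        moreover have "D_n n (x(i := t)) = T' t * indicator {t. \<bar>T t\<bar> < n} t + a / t * clamp n (T t)"
          by (simp add: D_n_def Tx_line[OF good] T'x_line[OF good] indicator_def)
        ultimately show ?thesis using wt_nonneg[of a t] by simp
      next
        case False
        then show ?thesis using wt_not_dom[OF a_nonneg] by simp
      qed
      have Keq: "(LINT t|lborel. phi a t * K (x(i := t))) = \<Psi>off i x * (LINT t|lborel. clamp n (T t) * (h t * h' t * wt a t))"
      proof -
        have "AE t in lborel. phi a t * K (x(i := t)) = \<Psi>off i x * (clamp n (T t) * (h t * h' t * wt a t))"
          using hf
        proof eventually_elim
          case (elim t)
          show ?case
          proof (cases "t \<in> dom1 a")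
            case True
            have "phi a t * K (x(i := t)) = clamp n (T t) * (f (x(i := t)) * g i (x(i := t))) * (\<Psi> (x(i := t)) * phi a t)"
              by (simp add: K_def Tx_line[OF good])
            then show ?thesis unfolding E using elim True by simp
          next
            case False
            then show ?thesis using wt_not_dom[OF a_nonneg] by (simp add: phi_def)
          qed
        qed
        then have "(LINT t|lborel. phi a t * K (x(i := t))) = (LINT t|lborel. \<Psi>off i x * (clamp n (T t) * (h t * h' t * wt a t)))"
          by (intro integral_cong_AE) auto
        then show ?thesis by simp
      qed
      have "(\<integral>\<^sup>+t. ennreal (D_n n (x(i := t)) * F (x(i := t))) \<partial>\<mu>1 i) =
          (\<integral>\<^sup>+t. ennreal (phi a t) * ennreal (D_n n (x(i := t)) * F (x(i := t))) \<partial>lborel)"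
        by (subst nn_integral_density) auto
      also have "\<dots> = (\<integral>\<^sup>+t. ennreal (\<Psi>off i x * ?L t) \<partial>lborel)"
      proof (intro nn_integral_cong_AE)
        show "AE t in lborel. ennreal (phi a t) * ennreal (D_n n (x(i := t)) * F (x(i := t))) = ennreal (\<Psi>off i x * ?L t)"
          using phiF
        proof eventually_elim
          case (elim t)
          have "ennreal (phi a t) * ennreal (D_n n (x(i := t)) * F (x(i := t))) = ennreal (D_n n (x(i := t)) * (phi a t * F (x(i := t))))"
            using phi_nonneg[OF a_nonneg, of t] by (simp add: ennreal_mult' mult_ac)
          also have "D_n n (x(i := t)) * (phi a t * F (x(i := t))) = \<Psi>off i x * ?L t"
            unfolding elim by (simp add: D_n_def Tx_line[OF good] T'x_line[OF good] indicator_def)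
          finally show ?case .
        qed
      qed
      also have "\<dots> = ennreal (LINT t|lborel. \<Psi>off i x * ?L t)"
        using LP(1) L_nonneg \<Psi>off_pos[of i x] by (intro nn_integral_eq_integral integrable_mult_right) (auto intro!: AE_I2 mult_nonneg_nonneg simp: less_imp_le)
      also have "(LINT t|lborel. \<Psi>off i x * ?L t) = - 2 * (\<integral>t. K (x(i := t)) \<partial>\<mu>1 i)"
        using LP(2) unfolding Kint Keq by simp
      finally have 1: "(\<integral>\<^sup>+t. ennreal (D_n n (x(i := t)) * F (x(i := t))) \<partial>\<mu>1 i) = ennreal (- 2 * (\<integral>t. K (x(i := t)) \<partial>\<mu>1 i))" .
      have "(LINT t|lborel. ?L t) \<ge> 0"
        using L_nonneg by (intro Bochner_Integration.integral_nonneg) auto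
      then have "- 2 * (LINT t|lborel. clamp n (T t) * (h t * h' t * wt a t)) \<ge> 0"
        unfolding LP(2) .
      then have "- 2 * (\<integral>t. K (x(i := t)) \<partial>\<mu>1 i) \<ge> 0"
        unfolding Kint Keq using \<Psi>off_pos[of i x] by (simp add: mult_le_0_iff)
      with 1 show ?thesis by simp
    qed
  qed
  have iK2: "integrable M (\<lambda>x. - 2 * (\<integral>t. K (x(i := t)) \<partial>\<mu>1 i))"
    by (intro integrable_mult_right integrable_integral_line iK)
  have "(\<integral>\<^sup>+x. ennreal (D_n n x * F x) \<partial>M) = (\<integral>\<^sup>+x. \<integral>\<^sup>+t. ennreal (D_n n (x(i := t)) * F (x(i := t))) \<partial>\<mu>1 i \<partial>M)"
    by (rule nn_integral_line) measurable
  also have "\<dots> = (\<integral>\<^sup>+x. ennreal (- 2 * (\<integral>t. K (x(i := t)) \<partial>\<mu>1 i)) \<partial>M)"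
    using line by (intro nn_integral_cong_AE) (auto elim!: eventually_mono)
  also have "\<dots> = ennreal (\<integral>x. - 2 * (\<integral>t. K (x(i := t)) \<partial>\<mu>1 i) \<partial>M)"
    using line iK2 by (intro nn_integral_eq_integral) (auto elim!: eventually_mono)
  also have "(\<integral>x. - 2 * (\<integral>t. K (x(i := t)) \<partial>\<mu>1 i) \<partial>M) = - 2 * (\<integral>x. K x \<partial>M)"
    using integral_line[OF iK, of i] by simp
  finally show ?thesis unfolding K_def .
qed

end

section \<open>The bound for one coordinate and its equality case\<close>

context knothe_step
begin

text \<open>The weighted divergence of the i-th component of the map: its derivative plus its
  product with the logarithmic derivative of the weight.\<close>

definition L :: "('i \<Rightarrow> real) \<Rightarrow> real" where "L x = T'x x + a / x i * Tx x"

lemma measurable_L[measurable]: "L \<in> borel_measurable M"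
  unfolding L_def by measurable

text \<open>Monotone convergence on the left and, by \<open>integrable_mixed\<close>, dominated
  convergence on the right. That \<open>D_n\<close> increases with n is established where x i lies
  in the domain, hence the indicator in E.\<close>

lemma nn_integral_L: "(\<integral>\<^sup>+x. ennreal (L x * F x) \<partial>M) = ennreal (- 2 * (\<integral>x. Tx x * (f x * g i x * \<Psi> x) \<partial>M))"
proof -
  define E where "E n x = ennreal (D_n (real (Suc n)) x * F x) * indicator {x. x i \<in> dom1 a} x" for n x
  have [measurable]: "dom1 a \<in> sets borel" unfolding dom1_def by simp
  have [measurable]: "{x. x i \<in> dom1 a} \<in> sets M"
  proof -
    have "{x \<in> space M. x i \<in> dom1 a} \<in> sets M" by measurable
    then show ?thesis by simp
  qed
  have clampT: "a / x i * clamp n (Tx x) = (if a = 0 then 0 else a / x i * min n (Tx x))" if "n > 0" "x i \<in> dom1 a" for n x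
    using Tx_in_dom[of x] that a_nonneg by (auto simp: clamp_def dom1_def)
  have "incseq E"
  proof (rule incseq_SucI, rule le_funI)
    fix n x
    show "E n x \<le> E (Suc n) x"
    proof (cases "x i \<in> dom1 a")
      case True
      have c: "a / x i * clamp (real (Suc k)) (Tx x) = (if a = 0 then 0 else a / x i * min (real (Suc k)) (Tx x))" for k
        using True by (intro clampT) simp_all
      have "a \<noteq> 0 \<Longrightarrow> 0 \<le> a / x i"
        using True a_nonneg by (simp add: dom1_def)
      then have "D_n (real (Suc n)) x \<le> D_n (real (Suc (Suc n))) x"
        unfolding D_n_def c using T'x_nonneg[of x]
        by (intro add_mono) (auto simp: indicator_def simp del: times_divide_eq_left intro!: mult_left_mono)
      then show ?thesis
        using F_nonneg[of x] by (auto simp: E_def indicator_def intro!: ennreal_leI mult_right_mono)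
    qed (simp add: E_def)
  qed
  moreover have "E n \<in> borel_measurable M" for n
    unfolding E_def by measurable
  moreover have "(\<lambda>n. E n x) \<longlonglongrightarrow> ennreal (L x * F x) * indicator {x. x i \<in> dom1 a} x" for x
  proof (rule tendsto_eventually)
    obtain k :: nat where k: "\<bar>Tx x\<bar> < real k" using reals_Archimedean2 by blast
    have "E n x = ennreal (L x * F x) * indicator {x. x i \<in> dom1 a} x" if "n \<ge> k" for n
    proof -
      have "\<bar>Tx x\<bar> < real (Suc n)" using k that by simp
      then have "D_n (real (Suc n)) x = L x"
        by (auto simp: D_n_def L_def clamp_def min_def max_def)
      then show ?thesis by (simp add: E_def)
    qed
    then show "\<forall>\<^sub>F n in sequentially. E n x = ennreal (L x * F x) * indicator {x. x i \<in> dom1 a} x"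
      by (auto simp: eventually_sequentially)
  qed
  ultimately have "(\<lambda>n. \<integral>\<^sup>+x. E n x \<partial>M) \<longlonglongrightarrow> (\<integral>\<^sup>+x. ennreal (L x * F x) * indicator {x. x i \<in> dom1 a} x \<partial>M)"
    by (rule nn_integral_LIMSEQ)
  also have "(\<integral>\<^sup>+x. ennreal (L x * F x) * indicator {x. x i \<in> dom1 a} x \<partial>M) = (\<integral>\<^sup>+x. ennreal (L x * F x) \<partial>M)"
    by (intro nn_integral_cong_AE eventually_mono[OF AE_dom[of i]]) auto
  also have "(\<lambda>n. \<integral>\<^sup>+x. E n x \<partial>M) = (\<lambda>n. ennreal (- 2 * (\<integral>x. clamp (real (Suc n)) (Tx x) * (f x * g i x * \<Psi> x) \<partial>M)))"
  proof
    fix n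
    have "(\<integral>\<^sup>+x. E n x \<partial>M) = (\<integral>\<^sup>+x. ennreal (D_n (real (Suc n)) x * F x) \<partial>M)"
      unfolding E_def by (intro nn_integral_cong_AE eventually_mono[OF AE_dom[of i]]) auto
    then show "(\<integral>\<^sup>+x. E n x \<partial>M) = ennreal (- 2 * (\<integral>x. clamp (real (Suc n)) (Tx x) * (f x * g i x * \<Psi> x) \<partial>M))"
      using nn_integral_D_n[of "real (Suc n)"] by simp
  qed
  finally have lim1: "(\<lambda>n. ennreal (- 2 * (\<integral>x. clamp (real (Suc n)) (Tx x) * (f x * g i x * \<Psi> x) \<partial>M)))
      \<longlonglongrightarrow> (\<integral>\<^sup>+x. ennreal (L x * F x) \<partial>M)" .
  have "(\<lambda>n. \<integral>x. clamp (real (Suc n)) (Tx x) * (f x * g i x * \<Psi> x) \<partial>M) \<longlonglongrightarrow> (\<integral>x. Tx x * (f x * g i x * \<Psi> x) \<partial>M)"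
  proof (rule integral_dominated_convergence[where w = "\<lambda>x. \<bar>Tx x * (f x * g i x * \<Psi> x)\<bar>"])
    show "integrable M (\<lambda>x. \<bar>Tx x * (f x * g i x * \<Psi> x)\<bar>)"
      by (intro integrable_abs integrable_mixed) auto
    show "AE x in M. (\<lambda>n. clamp (real (Suc n)) (Tx x) * (f x * g i x * \<Psi> x)) \<longlonglongrightarrow> Tx x * (f x * g i x * \<Psi> x)"
    proof (intro AE_I2 tendsto_eventually)
      fix x
      obtain k :: nat where k: "\<bar>Tx x\<bar> < real k" using reals_Archimedean2 by blast
      have "clamp (real (Suc n)) (Tx x) = Tx x" if "n \<ge> k" for n
      proof -
        have "\<bar>Tx x\<bar> < real (Suc n)" using k that by simp
        then show ?thesis by (auto simp: clamp_def min_def max_def)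
      qed
      then show "\<forall>\<^sub>F n in sequentially. clamp (real (Suc n)) (Tx x) * (f x * g i x * \<Psi> x) = Tx x * (f x * g i x * \<Psi> x)"
        unfolding eventually_sequentially by (intro exI[of _ k]) simp
    qed
    show "AE x in M. norm (clamp (real (Suc n)) (Tx x) * (f x * g i x * \<Psi> x)) \<le> \<bar>Tx x * (f x * g i x * \<Psi> x)\<bar>" for n
    proof (rule AE_I2)
      fix x
      show "norm (clamp (real (Suc n)) (Tx x) * (f x * g i x * \<Psi> x)) \<le> \<bar>Tx x * (f x * g i x * \<Psi> x)\<bar>"
        using abs_clamp_le[of "real (Suc n)" "Tx x"] unfolding real_norm_def abs_mult[of "clamp _ _"] abs_mult[of "Tx x"]
        by (intro mult_right_mono) auto
    qed
  qed measurable
  then have "(\<lambda>n. ennreal (- 2 * (\<integral>x. clamp (real (Suc n)) (Tx x) * (f x * g i x * \<Psi> x) \<partial>M)))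
      \<longlonglongrightarrow> ennreal (- 2 * (\<integral>x. Tx x * (f x * g i x * \<Psi> x) \<partial>M))"
    by (intro tendsto_ennrealI tendsto_mult tendsto_const)
  with lim1 show ?thesis by (rule LIMSEQ_unique)
qed

lemma AE_L_nonneg: "AE x in M. 0 \<le> L x * F x"
  using AE_dom[of i]
proof eventually_elim
  case (elim x)
  then have "0 \<le> L x"
    using Tx_in_dom[of x] T'x_nonneg[of x] a_nonneg by (auto simp: L_def dom1_def intro!: add_nonneg_nonneg)
  then show ?case using F_nonneg[of x] by simp
qed

lemma integrable_L: "integrable M (\<lambda>x. L x * F x)"
  using nn_integral_L AE_L_nonneg by (intro integrableI_nonneg) auto

text \<open>The maximum stems from applying \<open>ennreal\<close> to a real whose sign is not
  recorded. \<open>AE_first_order\<close> removes it, since the left-hand side is positive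
  there.\<close>

lemma integral_L: "(\<integral>x. L x * F x \<partial>M) = max 0 (- 2 * (\<integral>x. Tx x * (f x * g i x * \<Psi> x) \<partial>M))"
  using nn_integral_L AE_L_nonneg by (subst integral_eq_nn_integral) (auto simp: enn2real_ennreal max_def ennreal_neg)

definition energy :: real where "energy = (\<integral>x. (g i x)\<^sup>2 * \<Psi> x \<partial>M)"

text \<open>The cross term of the square is, up to a factor, the integral that
  \<open>nn_integral_L\<close> relates to the divergence, and the T^2 term has the known integral 1
  + a.\<close>

lemma square_completion:
  "(\<integral>x. (2 * l * g i x + Tx x * f x)\<^sup>2 * \<Psi> x \<partial>M) / 2 =
    2 * l\<^sup>2 * energy + (1 + a) / 2 + 2 * l * (\<integral>x. Tx x * (f x * g i x * \<Psi> x) \<partial>M)"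
  and integrable_square: "integrable M (\<lambda>x. (2 * l * g i x + Tx x * f x)\<^sup>2 * \<Psi> x)"
proof -
  have eq: "(2 * l * g i x + Tx x * f x)\<^sup>2 * \<Psi> x =
      4 * l\<^sup>2 * ((g i x)\<^sup>2 * \<Psi> x) + (Tx x)\<^sup>2 * F x + 4 * l * (Tx x * (f x * g i x * \<Psi> x))" for x
    by (simp add: F_def power2_eq_square algebra_simps)
  have i1: "integrable M (\<lambda>x. Tx x * (f x * g i x * \<Psi> x))"
    by (intro integrable_mixed) auto
  show "integrable M (\<lambda>x. (2 * l * g i x + Tx x * f x)\<^sup>2 * \<Psi> x)"
    unfolding eq using i1 g_int[of i] integrable_Tx_sq by (intro Bochner_Integration.integrable_add integrable_mult_right)
  have "(\<integral>x. (2 * l * g i x + Tx x * f x)\<^sup>2 * \<Psi> x \<partial>M) =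
      4 * l\<^sup>2 * energy + (1 + a) + 4 * l * (\<integral>x. Tx x * (f x * g i x * \<Psi> x) \<partial>M)"
    unfolding eq using i1 g_int[of i] integrable_Tx_sq
    by (simp add: Bochner_Integration.integral_add Bochner_Integration.integrable_add energy_def integral_Tx_sq)
  then show "(\<integral>x. (2 * l * g i x + Tx x * f x)\<^sup>2 * \<Psi> x \<partial>M) / 2 =
    2 * l\<^sup>2 * energy + (1 + a) / 2 + 2 * l * (\<integral>x. Tx x * (f x * g i x * \<Psi> x) \<partial>M)"
    by (simp add: field_simps)
qed

text \<open>The majorant of \<open>Lq\<close>: the logarithms of T' and, a times, of T / x i are
  replaced by their tangent line at 1 / l.\<close>

definition Rx :: "real \<Rightarrow> ('i \<Rightarrow> real) \<Rightarrow> real"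
  where "Rx l x = l * L x - (1 + a) * (1 + ln l) - (Tx x)\<^sup>2 / 2 - ln (Z a)"

definition bound :: "real \<Rightarrow> real"
  where "bound l = 2 * l\<^sup>2 * energy - (1 + a) * (1 + ln l) - ln (Z a)"

lemma Rx_F: "Rx l x * F x = l * (L x * F x) - ((1 + a) * (1 + ln l) + ln (Z a)) * F x - (1 / 2) * ((Tx x)\<^sup>2 * F x)"
  by (simp add: Rx_def algebra_simps)

lemma integrable_Rx: "integrable M (\<lambda>x. Rx l x * F x)"
  unfolding Rx_F
  by (intro Bochner_Integration.integrable_diff integrable_mult_right integrable_L integrable_F integrable_Tx_sq)

lemma integral_Rx: "(\<integral>x. Rx l x * F x \<partial>M) = l * (\<integral>x. L x * F x \<partial>M) - (1 + a) * (1 + ln l) - ln (Z a) - (1 + a) / 2"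
  unfolding Rx_F using integrable_L integrable_F integrable_Tx_sq
  by (simp add: Bochner_Integration.integral_diff Bochner_Integration.integrable_diff integral_F integral_Tx_sq)

lemma energy_nonneg: "energy \<ge> 0"
  unfolding energy_def using \<Psi>_pos by (intro Bochner_Integration.integral_nonneg) (auto simp: less_imp_le)

lemma square_nonneg: "0 \<le> (\<integral>x. (2 * l * g i x + Tx x * f x)\<^sup>2 * \<Psi> x \<partial>M)"
  using \<Psi>_pos by (intro Bochner_Integration.integral_nonneg) (auto simp: less_imp_le)

text \<open>The term T^2 / 2 in \<open>Rx\<close> integrates to (1 + a) / 2 and cancels what the
  completed square leaves over, so \<open>bound\<close> contains no trace of T.\<close>

lemma integral_Rx_le:
  assumes l: "l > 0"
  shows "(\<integral>x. Rx l x * F x \<partial>M) \<le> bound l"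
proof -
  have "l * (\<integral>x. L x * F x \<partial>M) \<le> 2 * l\<^sup>2 * energy + (1 + a) / 2"
  proof (cases "- 2 * (\<integral>x. Tx x * (f x * g i x * \<Psi> x) \<partial>M) \<le> 0")
    case True
    then show ?thesis using energy_nonneg a_nonneg by (simp add: integral_L)
  next
    case False
    then have "l * (\<integral>x. L x * F x \<partial>M) = - (2 * l * (\<integral>x. Tx x * (f x * g i x * \<Psi> x) \<partial>M))"
      by (simp add: integral_L)
    then show ?thesis
      using square_completion[of l] square_nonneg[of l] by linarith
  qed
  then show ?thesis unfolding integral_Rx bound_def by simp
qed

text \<open>Equality leaves no room for the square, whose integral must be 0. The summand (1 + a) /
  2 > 0 rules out the value 0 in \<open>integral_L\<close>.\<close>

lemma AE_first_order:
  assumes l: "l > 0" and eq: "(\<integral>x. Rx l x * F x \<partial>M) = bound l"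
  shows "AE x in M. 2 * l * g i x + Tx x * f x = 0"
proof -
  have *: "l * (\<integral>x. L x * F x \<partial>M) = 2 * l\<^sup>2 * energy + (1 + a) / 2"
    using eq unfolding integral_Rx bound_def by simp
  moreover have "2 * l\<^sup>2 * energy + (1 + a) / 2 > 0"
    using energy_nonneg a_nonneg by (intro add_nonneg_pos) auto
  ultimately have "0 < l * (\<integral>x. L x * F x \<partial>M)"
    by linarith
  then have "(\<integral>x. L x * F x \<partial>M) > 0"
    using l by (simp add: zero_less_mult_iff)
  then have LT: "(\<integral>x. L x * F x \<partial>M) = - 2 * (\<integral>x. Tx x * (f x * g i x * \<Psi> x) \<partial>M)"
    by (simp add: integral_L max_def split: if_splits)
  have "(\<integral>x. (2 * l * g i x + Tx x * f x)\<^sup>2 * \<Psi> x \<partial>M) = 0"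
  proof -
    have "l * (\<integral>x. L x * F x \<partial>M) = - (2 * l * (\<integral>x. Tx x * (f x * g i x * \<Psi> x) \<partial>M))"
      unfolding LT by simp
    then show ?thesis using * square_completion[of l] by linarith
  qed
  then have "AE x in M. (2 * l * g i x + Tx x * f x)\<^sup>2 * \<Psi> x = 0"
    using integrable_square \<Psi>_pos by (subst (asm) integral_nonneg_eq_0_iff_AE) (auto simp: less_imp_le)
  then show ?thesis
    by eventually_elim (use \<Psi>_pos in \<open>auto simp: less_imp_neq[OF \<Psi>_pos, symmetric]\<close>)
qed

text \<open>The logarithm of the conditional density of the i-th coordinate given S, relative to the
  weight. Along a chain of sets S these terms telescope to ln (f^2).\<close>

definition Lq :: "('i \<Rightarrow> real) \<Rightarrow> real"
  where "Lq x = ln (mr (insert i S) x) - ln (mr S x) - ln (Z a) - (x i)\<^sup>2 / 2"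

text \<open>The mass balance \<open>dens x (x i)\<close> = phi (T) T' expresses \<open>Lq\<close>
  through ln T' and a (ln T - ln (x i)). Each logarithm touches its tangent line only at 1 / l,
  which gives the equality case.\<close>

lemma AE_Lq_le:
  assumes l: "l > 0"
  shows "AE x in M. F x \<noteq> 0 \<longrightarrow> Lq x \<le> Rx l x \<and>
    (Lq x = Rx l x \<longrightarrow> T'x x = 1 / l \<and> (a > 0 \<longrightarrow> Tx x = x i / l))"
  using AE_m_finite[of S] AE_m_finite[of "insert i S"] AE_m_pos[of S] AE_m_pos[of "insert i S"] AE_dom[of i]
proof eventually_elim
  case (elim x)
  show ?case
  proof
    assume F: "F x \<noteq> 0"
    have m1: "mr S x > 0" and m2: "mr (insert i S) x > 0"
      using elim F by (auto simp: enn2real_positive_iff)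
    have p1: "phi a (x i) > 0" and p2: "phi a (Tx x) > 0"
      using phi_pos_iff[OF a_nonneg] elim(5) Tx_in_dom by blast+
    have T'eq: "T'x x = mr (insert i S) x / mr S x * phi a (x i) / phi a (Tx x)"
      by (simp add: T'x_def dens_def)
    then have T'pos: "T'x x > 0" using m1 m2 p1 p2 by simp
    have "ln (T'x x) = ln (mr (insert i S) x) - ln (mr S x) + ln (phi a (x i)) - ln (phi a (Tx x))"
      unfolding T'eq using m1 m2 p1 p2 by (simp add: ln_mult_pos ln_divide_pos)
    then have Lq: "Lq x = ln (T'x x) + a * (ln (Tx x) - ln (x i)) - (Tx x)\<^sup>2 / 2 - ln (Z a)"
      unfolding ln_phi[OF a_nonneg elim(5)] ln_phi[OF a_nonneg Tx_in_dom] Lq_def by (simp add: algebra_simps)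
    have R: "Rx l x = (l * T'x x - 1 - ln l) + a * (l * (Tx x / x i) - 1 - ln l) - (Tx x)\<^sup>2 / 2 - ln (Z a)"
      by (simp add: Rx_def L_def algebra_simps)
    have 1: "ln (T'x x) \<le> l * T'x x - 1 - ln l"
      by (rule ln_le_scaled[OF T'pos l])
    show "Lq x \<le> Rx l x \<and> (Lq x = Rx l x \<longrightarrow> T'x x = 1 / l \<and> (a > 0 \<longrightarrow> Tx x = x i / l))"
    proof (cases "a > 0")
      case False
      then have "a = 0" using a_nonneg by simp
      then show ?thesis using 1 ln_eq_scaled[OF T'pos l] unfolding Lq R by auto
    next
      case True
      then have pos: "x i > 0" "Tx x > 0" using elim(5) Tx_in_dom[of x] by (auto simp: dom1_def)
      then have e: "ln (Tx x) - ln (x i) = ln (Tx x / x i)" by (simp add: ln_divide_pos)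
      have 2: "ln (Tx x / x i) \<le> l * (Tx x / x i) - 1 - ln l"
        using pos l by (intro ln_le_scaled) auto
      then have 3: "a * ln (Tx x / x i) \<le> a * (l * (Tx x / x i) - 1 - ln l)"
        using a_nonneg by (rule mult_left_mono)
      have "T'x x = 1 / l \<and> Tx x = x i / l" if "Lq x = Rx l x"
      proof -
        have "ln (T'x x) = l * T'x x - 1 - ln l"
          "a * ln (Tx x / x i) = a * (l * (Tx x / x i) - 1 - ln l)"
          using that 1 3 unfolding Lq R e by linarith+
        then have "T'x x = 1 / l" "Tx x / x i = 1 / l"
          using True pos l T'pos by (auto intro!: ln_eq_scaled)
        then show ?thesis using pos l by (simp add: field_simps)
      qed
      then show ?thesis using 1 3 unfolding Lq R e by auto
    qed
  qed
qed

end

section \<open>Summation over the coordinates\<close>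

context sobolev_lines
begin

definition energy_of :: "'i \<Rightarrow> real" where "energy_of i = (\<integral>x. (g i x)\<^sup>2 * \<Psi> x \<partial>M)"

definition bnd :: "real \<Rightarrow> 'i \<Rightarrow> real"
  where "bnd l i = 2 * l\<^sup>2 * energy_of i - (1 + A i) * (1 + ln l) - ln (Z (A i))"

text \<open>The entropy integrand may fail to be integrable, so the bound is stated through an
  integrable majorant r. The coordinate i stays in front and its term ln (mr {i} x) is kept exact,
  to be analysed separately in the equality case.\<close>

lemma knothe_chain:
  assumes l: "l > 0" and "finite R" "i \<notin> R"
  shows "\<exists>r. integrable M (\<lambda>x. r x * F x) \<and> (\<integral>x. r x * F x \<partial>M) \<le> (\<Sum>j\<in>R. bnd l j) \<and>
    (AE x in M. F x \<noteq> 0 \<longrightarrow>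
      ln (mr (insert i R) x) - (\<Sum>j\<in>R. (x j)\<^sup>2 / 2 + ln (Z (A j))) \<le> ln (mr {i} x) + r x)"
  using assms(2,3)
proof (induction R rule: finite_induct)
  case empty
  then show ?case by (intro exI[of _ "\<lambda>_. 0"]) auto
next
  case (insert j R)
  then obtain r where r: "integrable M (\<lambda>x. r x * F x)" "(\<integral>x. r x * F x \<partial>M) \<le> (\<Sum>j\<in>R. bnd l j)"
    "AE x in M. F x \<noteq> 0 \<longrightarrow> ln (mr (insert i R) x) - (\<Sum>j\<in>R. (x j)\<^sup>2 / 2 + ln (Z (A j))) \<le> ln (mr {i} x) + r x"
    by auto
  interpret K: knothe_step A f g "insert i R" j
    using insert by unfold_locales auto
  have b: "K.bound l = bnd l j"
    by (simp add: K.bound_def bnd_def K.energy_def energy_of_def)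
  show ?case
  proof (intro exI[of _ "\<lambda>x. r x + K.Rx l x"] conjI)
    show "integrable M (\<lambda>x. (r x + K.Rx l x) * F x)"
      unfolding distrib_right using r(1) K.integrable_Rx by (rule Bochner_Integration.integrable_add)
    show "(\<integral>x. (r x + K.Rx l x) * F x \<partial>M) \<le> (\<Sum>j\<in>insert j R. bnd l j)"
      unfolding distrib_right using r(1,2) K.integrable_Rx[of l] K.integral_Rx_le[OF l] insert.hyps b
      by (simp add: Bochner_Integration.integral_add)
    show "AE x in M. F x \<noteq> 0 \<longrightarrow> ln (mr (insert i (insert j R)) x) - (\<Sum>j\<in>insert j R. (x j)\<^sup>2 / 2 + ln (Z (A j)))
        \<le> ln (mr {i} x) + (r x + K.Rx l x)"
      using r(3) K.AE_Lq_le[OF l]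
    proof eventually_elim
      case (elim x)
      then show ?case
        using insert.hyps by (auto simp: K.Lq_def insert_commute)
    qed
  qed
qed

lemma knothe_bound:
  assumes l: "l > 0"
  shows "\<exists>r. integrable M (\<lambda>x. r x * F x) \<and> (\<integral>x. r x * F x \<partial>M) \<le> (\<Sum>j\<in>UNIV - {i}. bnd l j) \<and>
    (AE x in M. F x \<noteq> 0 \<longrightarrow> ln ((f x)\<^sup>2) \<le> knothe_step.Lq A f {} i x + r x)"
proof -
  obtain r where r: "integrable M (\<lambda>x. r x * F x)" "(\<integral>x. r x * F x \<partial>M) \<le> (\<Sum>j\<in>UNIV - {i}. bnd l j)"
    "AE x in M. F x \<noteq> 0 \<longrightarrow> ln (mr (insert i (UNIV - {i})) x) -
      (\<Sum>j\<in>UNIV - {i}. (x j)\<^sup>2 / 2 + ln (Z (A j))) \<le> ln (mr {i} x) + r x"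
    using knothe_chain[OF l, of "UNIV - {i}" i] by auto
  interpret K: knothe_step A f g "{}" i by unfold_locales auto
  have "AE x in M. F x \<noteq> 0 \<longrightarrow> ln ((f x)\<^sup>2) \<le> K.Lq x + r x"
    using r(3)
  proof eventually_elim
    case (elim x)
    show ?case
    proof
      assume F: "F x \<noteq> 0"
      have "insert i (UNIV - {i}) = UNIV" by auto
      then have "mr (insert i (UNIV - {i})) x = F x"
        by (simp add: m_UNIV F_nonneg)
      moreover have "ln (F x) = ln ((f x)\<^sup>2) + (\<Sum>j\<in>UNIV. (x j)\<^sup>2 / 2 + ln (Z (A j)))"
        using F \<Psi>_pos[of x] by (simp add: F_def ln_mult_pos ln_\<Psi>)
      moreover have "(\<Sum>j\<in>UNIV. (x j)\<^sup>2 / 2 + ln (Z (A j))) = ((x i)\<^sup>2 / 2 + ln (Z (A i))) + (\<Sum>j\<in>UNIV - {i}. (x j)\<^sup>2 / 2 + ln (Z (A j)))"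
        by (rule sum.remove) auto
      moreover have "ln (mr {i} x) = K.Lq x + ln (Z (A i)) + (x i)\<^sup>2 / 2"
        by (simp add: K.Lq_def m_empty)
      ultimately show "ln ((f x)\<^sup>2) \<le> K.Lq x + r x"
        using elim F by simp
    qed
  qed
  then show ?thesis using r by blast
qed

lemma entropy_bound:
  assumes l: "l > 0"
  shows "\<exists>r. integrable M (\<lambda>x. r x * F x) \<and> (\<integral>x. r x * F x \<partial>M) \<le> (\<Sum>j\<in>UNIV. bnd l j) \<and>
    (AE x in M. F x \<noteq> 0 \<longrightarrow> ln ((f x)\<^sup>2) \<le> r x)"
proof -
  \<comment> \<open>Any coordinate may come first; only the equality case makes use of the
    choice.\<close>
  fix i :: 'i
  obtain r where r: "integrable M (\<lambda>x. r x * F x)" "(\<integral>x. r x * F x \<partial>M) \<le> (\<Sum>j\<in>UNIV - {i}. bnd l j)"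
    "AE x in M. F x \<noteq> 0 \<longrightarrow> ln ((f x)\<^sup>2) \<le> knothe_step.Lq A f {} i x + r x"
    using knothe_bound[OF l] by blast
  interpret K: knothe_step A f g "{}" i by unfold_locales auto
  have b: "K.bound l = bnd l i"
    by (simp add: K.bound_def bnd_def K.energy_def energy_of_def)
  show ?thesis
  proof (intro exI[of _ "\<lambda>x. K.Rx l x + r x"] conjI)
    show "integrable M (\<lambda>x. (K.Rx l x + r x) * F x)"
      unfolding distrib_right using K.integrable_Rx r(1) by (rule Bochner_Integration.integrable_add)
    have "(\<Sum>j\<in>UNIV. bnd l j) = bnd l i + (\<Sum>j\<in>UNIV - {i}. bnd l j)"
      by (rule sum.remove) auto
    then show "(\<integral>x. (K.Rx l x + r x) * F x \<partial>M) \<le> (\<Sum>j\<in>UNIV. bnd l j)"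
      unfolding distrib_right using r(1,2) K.integrable_Rx[of l] K.integral_Rx_le[OF l] b
      by (simp add: Bochner_Integration.integral_add)
    show "AE x in M. F x \<noteq> 0 \<longrightarrow> ln ((f x)\<^sup>2) \<le> K.Rx l x + r x"
      using r(3) K.AE_Lq_le[OF l] by eventually_elim force
  qed
qed

text \<open>Two upper bounds add up to an attained value, so the bound for i is attained on its own,
  and the pointwise inequality below it becomes an equality where F \<noteq> 0. With S empty it
  concerns a map that is conditioned on nothing.\<close>

lemma entropy_equality:
  assumes l: "l > 0" and int: "integrable M (\<lambda>x. ln ((f x)\<^sup>2) * F x)"
    and eq: "(\<integral>x. ln ((f x)\<^sup>2) * F x \<partial>M) = (\<Sum>j\<in>UNIV. bnd l j)"
  shows "AE x in M. 2 * l * g i x + knothe_step.Tx A f {} i x * f x = 0"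
    and "AE x in M. F x \<noteq> 0 \<longrightarrow> knothe_step.T'x A f {} i x = 1 / l \<and>
      (A i > 0 \<longrightarrow> knothe_step.Tx A f {} i x = x i / l)"
proof -
  obtain r where r: "integrable M (\<lambda>x. r x * F x)" "(\<integral>x. r x * F x \<partial>M) \<le> (\<Sum>j\<in>UNIV - {i}. bnd l j)"
    "AE x in M. F x \<noteq> 0 \<longrightarrow> ln ((f x)\<^sup>2) \<le> knothe_step.Lq A f {} i x + r x"
    using knothe_bound[OF l] by blast
  interpret K: knothe_step A f g "{}" i by unfold_locales auto
  have b: "K.bound l = bnd l i"
    by (simp add: K.bound_def bnd_def K.energy_def energy_of_def)
  have sum: "(\<Sum>j\<in>UNIV. bnd l j) = bnd l i + (\<Sum>j\<in>UNIV - {i}. bnd l j)"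
    by (rule sum.remove) auto
  have iR: "integrable M (\<lambda>x. K.Rx l x * F x + r x * F x)"
    using K.integrable_Rx r(1) by (rule Bochner_Integration.integrable_add)
  have "AE x in M. F x \<noteq> 0 \<longrightarrow> ln ((f x)\<^sup>2) \<le> K.Rx l x + r x"
    using r(3) K.AE_Lq_le[OF l] by eventually_elim force
  then have le: "AE x in M. 0 \<le> K.Rx l x * F x + r x * F x - ln ((f x)\<^sup>2) * F x"
  proof eventually_elim
    case (elim x)
    then show ?case
      using mult_right_mono[OF _ F_nonneg[of x], of "ln ((f x)\<^sup>2)" "K.Rx l x + r x"]
      by (cases "F x = 0") (auto simp: distrib_right)
  qed
  have "(\<integral>x. K.Rx l x * F x + r x * F x - ln ((f x)\<^sup>2) * F x \<partial>M) =
      (\<integral>x. K.Rx l x * F x \<partial>M) + (\<integral>x. r x * F x \<partial>M) - (\<Sum>j\<in>UNIV. bnd l j)"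
    using K.integrable_Rx[of l] r(1) iR int eq
    by (simp add: Bochner_Integration.integral_add Bochner_Integration.integral_diff)
  moreover have "0 \<le> (\<integral>x. K.Rx l x * F x + r x * F x - ln ((f x)\<^sup>2) * F x \<partial>M)"
    using le by (rule integral_nonneg_AE)
  ultimately have z: "(\<integral>x. K.Rx l x * F x + r x * F x - ln ((f x)\<^sup>2) * F x \<partial>M) = 0"
    and R: "(\<integral>x. K.Rx l x * F x \<partial>M) = K.bound l"
    using r(2) K.integral_Rx_le[OF l] sum b by linarith+
  show "AE x in M. 2 * l * g i x + K.Tx x * f x = 0"
    by (rule K.AE_first_order[OF l R])
  have "AE x in M. K.Rx l x * F x + r x * F x - ln ((f x)\<^sup>2) * F x = 0"
    using z le Bochner_Integration.integrable_diff[OF iR int]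
    by (subst (asm) integral_nonneg_eq_0_iff_AE) auto
  then show "AE x in M. F x \<noteq> 0 \<longrightarrow> K.T'x x = 1 / l \<and> (A i > 0 \<longrightarrow> K.Tx x = x i / l)"
    using r(3) K.AE_Lq_le[OF l]
  proof eventually_elim
    case (elim x)
    show ?case
    proof
      assume F: "F x \<noteq> 0"
      have "(K.Rx l x + r x - ln ((f x)\<^sup>2)) * F x = 0"
        using elim(1) by (simp add: algebra_simps)
      then have "K.Rx l x + r x = ln ((f x)\<^sup>2)" using F by simp
      then have "K.Lq x = K.Rx l x" using elim F by force
      then show "K.T'x x = 1 / l \<and> (A i > 0 \<longrightarrow> K.Tx x = x i / l)"
        using elim F by blast
    qed
  qed
qed

end

section \<open>The equality case\<close>

text \<open>Serves to pick a single point or line that has all almost sure properties at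
  once.\<close>

lemma ex_of_not_AE:
  assumes "\<not> (AE x in N. P x)" "AE x in N. Q x"
  shows "\<exists>x. \<not> P x \<and> Q x"
proof (rule ccontr)
  assume "\<nexists>x. \<not> P x \<and> Q x"
  then have "AE x in N. P x" using assms(2) by (auto elim: eventually_mono)
  with assms(1) show False by blast
qed

section \<open>Rigidity of the one-dimensional transport\<close>

context line_transport
begin

lemma dom1_bounds_cdf: "t \<in> dom1 a \<Longrightarrow> 0 < R.G t \<and> R.G t < 1"
  using cdf_D_bounds by blast

lemma cdf_eq: "0 < N.G t \<Longrightarrow> N.G t < 1 \<Longrightarrow> R.G (T t) = N.G t"
  by (simp add: T_def cdf_quantile)

lemma interior_support:
  assumes "0 < N.G t" "N.G t < 1"
  obtains s r where "s < t" "t < r" "0 < N.G s" "N.G r < 1"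
proof -
  have "(N.G \<longlongrightarrow> N.G t) (nhds t)"
    using N.continuous_cdf[of t] unfolding isCont_def tendsto_at_iff_tendsto_nhds .
  then have "\<forall>\<^sub>F u in nhds t. N.G u \<in> {0<..<1}"
    by (rule topological_tendstoD) (use assms in auto)
  then obtain e where e: "e > 0" "\<And>u. dist u t < e \<Longrightarrow> N.G u \<in> {0<..<1}"
    by (auto simp: eventually_nhds_metric)
  show thesis
    using e(1) e(2)[of "t - e / 2"] e(2)[of "t + e / 2"] by (intro that[of "t - e / 2" "t + e / 2"]) (auto simp: dist_real_def)
qed

text \<open>The truncation level exceeds both end values, so the formula for the truncated map
  yields the increment of T itself.\<close>

lemma T_increment:
  assumes T': "AE t in lborel. 0 < N.G t \<longrightarrow> N.G t < 1 \<longrightarrow> T' t = k"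
    and sr: "s \<le> r" "0 < N.G s" "N.G r < 1"
  shows "T r - T s = k * (r - s)"
proof -
  have r: "0 < N.G r" and s: "N.G s < 1"
    using sr N.D.cdf_nondecreasing[OF sr(1)] by linarith+
  define n where "n = max \<bar>T s\<bar> \<bar>T r\<bar> + 1"
  have n: "n > 0" using abs_ge_zero[of "T s"] abs_ge_zero[of "T r"] unfolding n_def by linarith
  have cl: "clamp n (T r) = T r" "clamp n (T s) = T s"
    by (auto simp: clamp_def n_def)
  have "T r - T s = (LINT t|lborel. T' t * indicator {t. \<bar>T t\<bar> < n} t * indicator {..r} t) -
      (LINT t|lborel. T' t * indicator {t. \<bar>T t\<bar> < n} t * indicator {..s} t)"
    using clamp_T_eq_integral[OF n r sr(3)] clamp_T_eq_integral[OF n sr(2) s] unfolding cl by linarith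
  also have "\<dots> = (LINT t|lborel. T' t * indicator {t. \<bar>T t\<bar> < n} t * indicator {..r} t -
      T' t * indicator {t. \<bar>T t\<bar> < n} t * indicator {..s} t)"
    by (intro Bochner_Integration.integral_diff[symmetric] integrable_real_mult_indicator integrable_T') auto
  also have "\<dots> = (LINT t|lborel. k * indicator {s<..r} t)"
  proof (rule integral_cong_AE)
    show "AE t in lborel. T' t * indicator {t. \<bar>T t\<bar> < n} t * indicator {..r} t -
      T' t * indicator {t. \<bar>T t\<bar> < n} t * indicator {..s} t = k * indicator {s<..r} t"
      using T'
    proof eventually_elim
      case (elim t)
      show ?case
      proof (cases "s < t \<and> t \<le> r")
        case True
        have G: "N.G s \<le> N.G t" "N.G t \<le> N.G r"
          using True N.D.cdf_nondecreasing by auto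
        then have "T s \<le> T t" "T t \<le> T r"
          unfolding T_def using sr by (auto intro!: quantile_mono)
        then have "\<bar>T t\<bar> < n" by (auto simp: n_def)
        moreover have "T' t = k" using elim G sr by auto
        ultimately show ?thesis using True by (simp add: indicator_def)
      next
        case False
        then show ?thesis using sr(1) by (auto simp: indicator_def)
      qed
    qed
  qed measurable
  also have "\<dots> = k * (r - s)" using sr(1) by simp
  finally show ?thesis .
qed

text \<open>T is affine on the interval where the source cdf lies strictly between 0 and 1. Its
  image must exhaust a reference law that charges every piece of the domain, so this interval
  contains the whole domain.\<close>

lemma T_affine:
  assumes l: "l > 0"
    and T': "AE t in lborel. 0 < N.G t \<longrightarrow> N.G t < 1 \<longrightarrow> T' t = 1 / l \<and> (a > 0 \<longrightarrow> T t = t / l)"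
  obtains b where "a > 0 \<Longrightarrow> b = 0" "\<And>t. t \<in> dom1 a \<Longrightarrow> T t = t / l + b"
proof -
  have T'1: "AE t in lborel. 0 < N.G t \<longrightarrow> N.G t < 1 \<longrightarrow> T' t = 1 / l"
    using T' by eventually_elim auto
  obtain t0 where t0: "N.G t0 = 1 / 2" using N.cdf_attains[of "1 / 2"] by auto
  define b where "b = T t0 - t0 / l"
  have J: "T t = t / l + b" if "0 < N.G t" "N.G t < 1" for t
  proof (cases "t \<le> t0")
    case True
    then show ?thesis using T_increment[OF T'1, of t t0] that t0 by (simp add: b_def diff_divide_distrib)
  next
    case False
    then show ?thesis using T_increment[OF T'1, of t0 t] that t0 by (simp add: b_def diff_divide_distrib)
  qed
  have b0: "b = 0" if a: "a > 0"
  proof -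
    obtain s r where sr: "s < t0" "t0 < r" "0 < N.G s" "N.G r < 1"
      using interior_support[of t0] t0 by auto
    \<comment> \<open>The support contains a proper interval, so some point of it satisfies the
      almost sure identity T t = t / l.\<close>
    have "\<not> (AE t in lborel. t \<notin> {s<..<r})"
    proof
      assume "AE t in lborel. t \<notin> {s<..<r}"
      then have "emeasure lborel {s<..<r} = 0"
        by (subst (asm) AE_iff_measurable[of "{s<..<r}"]) auto
      then show False using sr by simp
    qed
    from ex_of_not_AE[OF this T'] obtain t
      where t: "t \<in> {s<..<r}" "0 < N.G t \<longrightarrow> N.G t < 1 \<longrightarrow> T t = t / l"
      using a by blast
    have "0 < N.G t" "N.G t < 1"
      using t(1) sr N.D.cdf_nondecreasing[of s t] N.D.cdf_nondecreasing[of t r] by auto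
    then show ?thesis using t(2) J[of t] by simp
  qed
  have dom: "t / l + b \<in> dom1 a" if "t \<in> dom1 a" for t
    using that b0 l by (cases "a > 0") (auto simp: dom1_def)
  have full: "0 < N.G t \<and> N.G t < 1" if t: "t \<in> dom1 a" for t
  proof (rule ccontr)
    assume "\<not> (0 < N.G t \<and> N.G t < 1)"
    then consider "N.G t = 0" | "N.G t = 1"
      using N.D.cdf_nonneg[of t] N.D.cdf_bounded_prob[of t] by linarith
    then show False
    proof cases
      case 1
      \<comment> \<open>If the source cdf vanished at t, a point s where it equals v would lie to
        the right of t, and T s would have reference cdf at least 2 v instead of v. The second case
        is the mirror image.\<close>
      define v where "v = R.G (t / l + b) / 2"
      have v: "0 < v" "v < R.G (t / l + b)" "v < 1"
        using dom1_bounds_cdf[OF dom[OF t]] by (auto simp: v_def)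
      obtain s where s: "N.G s = v" using N.cdf_attains v by blast
      have "t \<le> s" using N.D.cdf_nondecreasing[of s t] s v 1 by linarith
      then have "t / l + b \<le> s / l + b" using l by (simp add: divide_right_mono)
      then have "R.G (t / l + b) \<le> R.G (T s)" using J[of s] s v by (simp add: R.D.cdf_nondecreasing)
      then show False using cdf_eq[of s] s v by simp
    next
      case 2
      define v where "v = (R.G (t / l + b) + 1) / 2"
      have v: "0 < v" "R.G (t / l + b) < v" "v < 1"
        using dom1_bounds_cdf[OF dom[OF t]] by (auto simp: v_def)
      obtain s where s: "N.G s = v" using N.cdf_attains v by blast
      have "s \<le> t" using N.D.cdf_nondecreasing[of t s] s v 2 by linarith
      then have "s / l + b \<le> t / l + b" using l by (simp add: divide_right_mono)
      then have "R.G (T s) \<le> R.G (t / l + b)" using J[of s] s v by (simp add: R.D.cdf_nondecreasing)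
      then show False using cdf_eq[of s] s v by simp
    qed
  qed
  show thesis
    using b0 J full by (intro that[of b]) auto
qed

text \<open>A solution of the first order equation \<open>2 l h' + T h = 0\<close> is a constant times a positive
  function, so it has no zero inside the support.\<close>

lemma nonvanishing:
  assumes l: "l > 0" and h: "ac h h'"
    and ode: "AE t in lborel. 0 < N.G t \<longrightarrow> N.G t < 1 \<longrightarrow> 2 * l * h' t + T t * h t = 0"
    and t0: "0 < N.G t0" "N.G t0 < 1" "h t0 \<noteq> 0" and t1: "0 < N.G t1" "N.G t1 < 1"
  shows "h t1 \<noteq> 0"
proof -
  obtain s where s: "s < min t0 t1" "0 < N.G s"
    using interior_support[of t0] interior_support[of t1] t0 t1 by (metis min_def)
  obtain r where r: "max t0 t1 < r" "N.G r < 1"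
    using interior_support[of t0] interior_support[of t1] t0 t1 by (metis max_def)
  \<comment> \<open>Freezing the argument outside [s, r] makes the coefficient continuous on the
    whole line; exp of its primitive Y is then an integrating factor on (s, r).\<close>
  define c where "c t = T (max s (min r t)) / (2 * l)" for t
  have G: "0 < N.G (max s (min r t)) \<and> N.G (max s (min r t)) < 1" for t
  proof -
    have "N.G s \<le> N.G (max s (min r t))" "N.G (max s (min r t)) \<le> N.G r"
      using s r by (auto intro!: N.D.cdf_nondecreasing)
    then show ?thesis using s r by linarith
  qed
  have cT: "isCont T t" if "0 < N.G t" "N.G t < 1" for t
    unfolding T_def using continuous_quantile[OF that] N.continuous_cdf by (rule isCont_o2[rotated])
  have "isCont c t" for t
    unfolding c_def using l cT[of "max s (min r t)"] G[of t]
    by (intro continuous_intros isCont_o2[of t "\<lambda>t. max s (min r t)" T]) auto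
  then have c: "continuous_on S c" for S
    by (intro continuous_at_imp_continuous_on) auto
  obtain Y where Y: "\<And>x. (Y has_real_derivative c x) (at x)"
    using continuous_antiderivative[of c] c by blast
  have cY: "continuous_on UNIV Y"
    using Y DERIV_isCont continuous_at_imp_continuous_on by blast
  have eY: "ac (\<lambda>t. exp (Y t)) (\<lambda>t. exp (Y t) * c t)"
  proof (rule ac_C1)
    show "((\<lambda>t. exp (Y t)) has_real_derivative exp (Y x) * c x) (at x)" for x
      using Y[of x] by (auto intro!: derivative_eq_intros)
    show "continuous_on UNIV (\<lambda>t. exp (Y t) * c t)"
      using c cY by (intro continuous_intros)
  qed
  have "AE t in lborel. s < t \<longrightarrow> t < r \<longrightarrow> h' t * exp (Y t) + exp (Y t) * c t * h t = 0"
    using ode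
  proof eventually_elim
    case (elim t)
    show ?case
    proof (intro impI)
      assume t: "s < t" "t < r"
      then have m: "max s (min r t) = t" by simp
      have "2 * l * h' t + T t * h t = 0" using elim G[of t] m by simp
      then have "h' t + c t * h t = 0"
        using l by (simp add: c_def m field_simps)
      then have "exp (Y t) * (h' t + c t * h t) = 0" by simp
      then show "h' t * exp (Y t) + exp (Y t) * c t * h t = 0"
        by (simp add: algebra_simps)
    qed
  qed
  from ac_const_on[OF ac_mult[OF h eY] this, of t0 t1]
  have "h t0 * exp (Y t0) = h t1 * exp (Y t1)"
    using s r by auto
  then show ?thesis using t0 by auto
qed

end

section \<open>From equality to a Gaussian\<close>

context sobolev_lines
begin

text \<open>With S empty the conditional density is the same for all x, so T is one function of x i.
  The pointwise equality conditions are known only where F \<noteq> 0; on a line where F is not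
  almost everywhere 0, the first order equation keeps h from vanishing, so they hold on the whole
  support and T is affine.\<close>

lemma first_order_affine:
  assumes l: "l > 0" and int: "integrable M (\<lambda>x. ln ((f x)\<^sup>2) * F x)"
    and eq: "(\<integral>x. ln ((f x)\<^sup>2) * F x \<partial>M) = (\<Sum>j\<in>UNIV. bnd l j)"
  obtains b where "A i > 0 \<Longrightarrow> b = 0" "AE x in M. 2 * l * g i x + (x i / l + b) * f x = 0"
proof -
  interpret K: knothe_step A f g "{}" i by unfold_locales auto
  define d where "d = K.dens (\<lambda>_. 0)"
  have dens: "K.dens x = d" for x
  proof
    fix t
    have "splice {i} x (\<lambda>_. 0) = (\<lambda>_. 0)(i := x i)" by (auto simp: splice_def fun_eq_iff)
    then show "K.dens x t = d t"
      using K.dens_splice[of x "\<lambda>_. 0" t] K.dens_upd[of "\<lambda>_. 0" "x i" t] by (simp add: d_def)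
  qed
  have good: "K.good x" for x by (simp add: K.good_def m_empty)
  interpret line_transport "A i" d
    using K.line_transport_dens[OF good] dens by simp
  have Tx: "K.Tx x = T (x i)" and T'x: "K.T'x x = T' (x i)" for x
    using K.Tx_line[OF good, of x "x i"] K.T'x_line[OF good, of x "x i"] by (simp_all add: dens)
  have e1: "AE x in M. 2 * l * g i x + T (x i) * f x = 0"
    using entropy_equality(1)[OF l int eq, of i] by (simp add: Tx)
  have e2: "AE x in M. F x \<noteq> 0 \<longrightarrow> T' (x i) = 1 / l \<and> (A i > 0 \<longrightarrow> T (x i) = x i / l)"
    using entropy_equality(2)[OF l int eq, of i] by (simp add: Tx T'x)
  have "\<not> (AE x in M. AE t in \<mu>1 i. F (x(i := t)) = 0)"
  proof
    assume "AE x in M. AE t in \<mu>1 i. F (x(i := t)) = 0"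
    then have "AE x in M. (\<integral>\<^sup>+t. ennreal (F (x(i := t))) \<partial>\<mu>1 i) = 0"
    proof eventually_elim
      case (elim x)
      then have "(\<integral>\<^sup>+t. ennreal (F (x(i := t))) \<partial>\<mu>1 i) = (\<integral>\<^sup>+t. 0 \<partial>\<mu>1 i)"
        by (intro nn_integral_cong_AE) (auto elim!: eventually_mono)
      then show ?case by simp
    qed
    then have "(\<integral>\<^sup>+x. \<integral>\<^sup>+t. ennreal (F (x(i := t))) \<partial>\<mu>1 i \<partial>M) = (\<integral>\<^sup>+x. 0 \<partial>M)"
      by (rule nn_integral_cong_AE)
    then show False
      using nn_integral_line[of "\<lambda>x. ennreal (F x)" i] F_total by simp
  qed
  note neg = this
  have "AE x in M. (\<exists>h h'. ac h h' \<and>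
      (AE t in lborel. t \<in> dom1 (A i) \<longrightarrow> h t = f (x(i := t)) \<and> h' t = g i (x(i := t)))) \<and>
      (AE t in \<mu>1 i. 2 * l * g i (x(i := t)) + T t * f (x(i := t)) = 0) \<and>
      (AE t in \<mu>1 i. F (x(i := t)) \<noteq> 0 \<longrightarrow> T' t = 1 / l \<and> (A i > 0 \<longrightarrow> T t = t / l)) \<and>
      (AE t in \<mu>1 i. F (x(i := t)) \<noteq> 0 \<longrightarrow> 0 < m {i} (x(i := t)))"
    using lines[of i] AE_line[OF e1, of i] AE_line[OF e2, of i] AE_line[OF AE_m_pos[of "{i}"], of i]
    by eventually_elim simp
  from ex_of_not_AE[OF neg this] obtain x where x0: "\<not> (AE t in \<mu>1 i. F (x(i := t)) = 0)"
    and x1: "\<exists>h h'. ac h h' \<and> (AE t in lborel. t \<in> dom1 (A i) \<longrightarrow> h t = f (x(i := t)) \<and> h' t = g i (x(i := t)))"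
    and x2: "AE t in lborel. t \<in> dom1 (A i) \<longrightarrow> 2 * l * g i (x(i := t)) + T t * f (x(i := t)) = 0"
    and x3: "AE t in lborel. t \<in> dom1 (A i) \<longrightarrow> F (x(i := t)) \<noteq> 0 \<longrightarrow> T' t = 1 / l \<and> (A i > 0 \<longrightarrow> T t = t / l)"
    and x4: "AE t in lborel. t \<in> dom1 (A i) \<longrightarrow> F (x(i := t)) \<noteq> 0 \<longrightarrow> 0 < m {i} (x(i := t))"
    unfolding AE_\<mu>1 by blast
  obtain h h' where h: "ac h h'"
    and hf: "AE t in lborel. t \<in> dom1 (A i) \<longrightarrow> h t = f (x(i := t)) \<and> h' t = g i (x(i := t))"
    using x1 by blast
  have JD: "t \<in> dom1 (A i)" if "0 < N.G t" "N.G t < 1" for t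
  proof (rule ccontr)
    assume t: "t \<notin> dom1 (A i)"
    have "AE s in N.law. s \<notin> {..t}"
      unfolding N.AE_law
    proof (rule AE_I2, rule impI)
      fix s assume "d s \<noteq> 0"
      then have "s \<in> dom1 (A i)"
        using wt_not_dom[OF A_nonneg] by (auto simp: d_def K.dens_def phi_def)
      then show "s \<notin> {..t}" using t by (auto simp: dom1_def)
    qed
    then have "N.G t = 0" unfolding cdf_def by (subst N.prob_eq_0) auto
    then show False using that by simp
  qed
  have ode: "AE t in lborel. 0 < N.G t \<longrightarrow> N.G t < 1 \<longrightarrow> 2 * l * h' t + T t * h t = 0"
    using hf x2 by eventually_elim (use JD in auto)
  have "AE t in lborel. d t \<noteq> 0 \<longrightarrow> 0 < N.G t \<and> N.G t < 1"
    using N.AE_cdf_strict unfolding N.AE_law .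
  have "\<exists>t0. 0 < N.G t0 \<and> N.G t0 < 1 \<and> h t0 \<noteq> 0"
  proof (rule ccontr)
    assume none: "\<not> ?thesis"
    have fin: "m {} x < \<infinity>" by (simp add: m_empty)
    have "AE t in lborel. t \<in> dom1 (A i) \<longrightarrow> F (x(i := t)) = 0"
      using \<open>AE t in lborel. d t \<noteq> 0 \<longrightarrow> 0 < N.G t \<and> N.G t < 1\<close> hf x4 K.AE_m_line[OF fin]
    proof eventually_elim
      case (elim t)
      show ?case
      proof (rule impI, rule ccontr)
        assume t: "t \<in> dom1 (A i)" and Fn: "F (x(i := t)) \<noteq> 0"
        have "m {i} (x(i := t)) * ennreal (phi (A i) t) = ennreal (d t)"
          using elim(4) by (simp add: m_empty dens)
        moreover have "m {i} (x(i := t)) > 0" using elim t Fn by blast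
        moreover have "phi (A i) t > 0" using phi_pos_iff[OF A_nonneg] t by blast
        ultimately have "d t \<noteq> 0" by auto
        then have "h t = 0" using elim(1) none by blast
        then show False using elim(2) t Fn by (simp add: F_def)
      qed
    qed
    then show False using x0 unfolding AE_\<mu>1 by simp
  qed
  then obtain t0 where t0: "0 < N.G t0" "N.G t0 < 1" "h t0 \<noteq> 0" by blast
  have "AE t in lborel. 0 < N.G t \<longrightarrow> N.G t < 1 \<longrightarrow> T' t = 1 / l \<and> (A i > 0 \<longrightarrow> T t = t / l)"
    using x3 hf
  proof eventually_elim
    case (elim t)
    show ?case
    proof (intro impI)
      assume t: "0 < N.G t" "N.G t < 1"
      have "h t \<noteq> 0" by (rule nonvanishing[OF l h ode t0 t])
      then have "F (x(i := t)) \<noteq> 0"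
        using elim(2) JD[OF t] \<Psi>_pos[of "x(i := t)"] by (simp add: F_def)
      then show "T' t = 1 / l \<and> (A i > 0 \<longrightarrow> T t = t / l)" using elim(1) JD[OF t] by blast
    qed
  qed
  from T_affine[OF l this] obtain b where b: "A i > 0 \<Longrightarrow> b = 0" "\<And>t. t \<in> dom1 (A i) \<Longrightarrow> T t = t / l + b"
    by blast
  have "AE x in M. 2 * l * g i x + (x i / l + b) * f x = 0"
    using e1 AE_dom[of i] by eventually_elim (simp add: b(2))
  then show thesis using that b(1) by blast
qed

text \<open>Multiplying f by exp Q, the reciprocal of the expected Gaussian, gives a function with
  zero derivative along almost every line in each direction, and \<open>AE_const_of_lines\<close>
  applies.\<close>

theorem gaussian_of_equality:
  assumes l: "l > 0" and int: "integrable M (\<lambda>x. ln ((f x)\<^sup>2) * F x)"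
    and eq: "(\<integral>x. ln ((f x)\<^sup>2) * F x \<partial>M) = (\<Sum>j\<in>UNIV. bnd l j)"
  shows "\<exists>b c. (\<forall>i. A i > 0 \<longrightarrow> b i = 0) \<and> (AE x in M. f x = c * exp (- (\<Sum>j\<in>UNIV. (x j / l + b j)\<^sup>2 / 4)))"
proof -
  have "\<exists>b. (A i > 0 \<longrightarrow> b = 0) \<and> (AE x in M. 2 * l * g i x + (x i / l + b) * f x = 0)" for i
    using first_order_affine[OF l int eq, of i] by blast
  then have "\<forall>i. \<exists>b. (A i > 0 \<longrightarrow> b = 0) \<and> (AE x in M. 2 * l * g i x + (x i / l + b) * f x = 0)"
    by (rule allI)
  from choice[OF this] obtain b where b: "\<And>i. A i > 0 \<Longrightarrow> b i = 0"
    and fo: "\<And>i. AE x in M. 2 * l * g i x + (x i / l + b i) * f x = 0" by blast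
  define Q where "Q x = (\<Sum>j\<in>UNIV. (x j / l + b j)\<^sup>2 / 4)" for x :: "'i \<Rightarrow> real"
  have [measurable]: "Q \<in> borel_measurable M" unfolding Q_def by measurable
  define u where "u x = f x * exp (Q x)" for x
  have "AE x in M. \<exists>c. AE t in \<mu>1 i. u (x(i := t)) = c" for i
    using lines[of i] AE_line[OF fo[of i], of i]
  proof eventually_elim
    case (elim x)
    obtain h h' where h: "ac h h'"
      and hf: "AE t in lborel. t \<in> dom1 (A i) \<longrightarrow> h t = f (x(i := t)) \<and> h' t = g i (x(i := t))"
      using elim(1) by blast
    define q where "q t = (t / l + b i)\<^sup>2 / 4" for t
    \<comment> \<open>This is the derivative of q, so exp (q t) is an integrating factor of the
      first order equation.\<close>
    define c where "c t = (t / l + b i) / (2 * l)" for t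
    have eq: "ac (\<lambda>t. exp (q t)) (\<lambda>t. exp (q t) * c t)"
    proof (rule ac_C1)
      show "((\<lambda>t. exp (q t)) has_real_derivative exp (q x) * c x) (at x)" for x
        unfolding q_def c_def using l by (auto intro!: derivative_eq_intros simp: field_simps power2_eq_square)
      show "continuous_on UNIV (\<lambda>t. exp (q t) * c t)"
        unfolding q_def c_def by (intro continuous_intros) (use l in auto)
    qed
    have zero: "AE t in lborel. t \<in> dom1 (A i) \<longrightarrow> h' t * exp (q t) + exp (q t) * c t * h t = 0"
      using hf elim(2)[unfolded AE_\<mu>1]
    proof eventually_elim
      case (elim t)
      show ?case
      proof
        assume "t \<in> dom1 (A i)"
        then have "2 * l * h' t + (t / l + b i) * h t = 0" using elim by simp
        then have "h' t + c t * h t = 0" using l by (simp add: c_def field_simps)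
        then have "exp (q t) * (h' t + c t * h t) = 0" by simp
        then show "h' t * exp (q t) + exp (q t) * c t * h t = 0" by (simp add: algebra_simps)
      qed
    qed
    have const: "h t * exp (q t) = h 1 * exp (q 1)" if t: "t \<in> dom1 (A i)" for t
    proof -
      \<comment> \<open>The open interval starting at lo contains t and the base point 1 and stays
        inside the domain.\<close>
      define lo where "lo = (if A i > 0 then 0 else min t 1 - 1)"
      have "AE z in lborel. lo < z \<longrightarrow> z < max t 1 + 1 \<longrightarrow> h' z * exp (q z) + exp (q z) * c z * h z = 0"
        using zero by eventually_elim (auto simp: lo_def dom1_def)
      moreover have "lo < t" "lo < 1" using t by (auto simp: lo_def dom1_def)
      ultimately show ?thesis
        by (intro ac_const_on[OF ac_mult[OF h eq], of lo "max t 1 + 1" t 1]) (auto simp del: mult_eq_0_iff)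
    qed
    define E where "E = exp (\<Sum>j\<in>UNIV - {i}. (x j / l + b j)\<^sup>2 / 4)"
    have QE: "exp (Q (x(i := t))) = exp (q t) * E" for t
    proof -
      have "Q (x(i := t)) = q t + (\<Sum>j\<in>UNIV - {i}. (x j / l + b j)\<^sup>2 / 4)"
        unfolding Q_def q_def by (subst sum.remove[of UNIV i]) (auto intro!: sum.cong)
      then show ?thesis by (simp add: E_def exp_add)
    qed
    show ?case
    proof (intro exI[of _ "h 1 * exp (q 1) * E"])
      show "AE t in \<mu>1 i. u (x(i := t)) = h 1 * exp (q 1) * E"
        unfolding AE_\<mu>1 using hf
      proof eventually_elim
        case (elim t)
        show ?case
        proof
          assume t: "t \<in> dom1 (A i)"
          then have "u (x(i := t)) = (h t * exp (q t)) * E" using elim by (simp add: u_def QE)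
          then show "u (x(i := t)) = h 1 * exp (q 1) * E" unfolding const[OF t] .
        qed
      qed
    qed
  qed
  moreover have "u \<in> borel_measurable M" unfolding u_def by measurable
  ultimately obtain c where "AE x in M. u x = c"
    using AE_const_of_lines[of u] by blast
  then have "AE x in M. f x = c * exp (- Q x)"
    by eventually_elim (auto simp: u_def exp_minus field_simps)
  then show ?thesis using b unfolding Q_def by blast
qed

end

section \<open>Lebesgue measure on functions\<close>

abbreviation lborel_fun :: "('n::finite \<Rightarrow> real) measure"
  where "lborel_fun \<equiv> Pi\<^sub>M UNIV (\<lambda>_. lborel)"

lemma space_lborel_fun[simp]: "space lborel_fun = UNIV"
  by (simp add: space_PiM)

lemma measurable_vec_lambda[measurable]: "vec_lambda \<in> lborel_fun \<rightarrow>\<^sub>M (borel :: (real^'n::finite) measure)"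
proof (subst borel_measurable_euclidean_space, rule ballI)
  fix b :: "real^'n" assume "b \<in> Basis"
  then obtain i where "b = axis i 1" by (auto simp: Basis_vec_def)
  then have "(\<lambda>x. vec_lambda x \<bullet> b) = (\<lambda>x. x i)"
    by (auto simp: inner_axis)
  then show "(\<lambda>x. vec_lambda x \<bullet> b) \<in> borel_measurable lborel_fun" by simp
qed

lemma measurable_vec_nth[measurable]: "vec_nth \<in> (borel :: (real^'n::finite) measure) \<rightarrow>\<^sub>M lborel_fun"
  by (rule measurable_PiM_single') (auto intro!: borel_measurable_continuous_onI continuous_intros)

lemma vec_nth_vec_lambda: "vec_nth (vec_lambda x) = x"
  by (simp add: fun_eq_iff)

lemma vec_lambda_box:
  fixes l u :: "real^'n"
  shows "vec_lambda x \<in> box l u \<longleftrightarrow> (\<forall>j. l $ j < x j \<and> x j < u $ j)"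
  by (simp add: mem_box_cart)

lemma product_sigma_finite_lborel: "product_sigma_finite (\<lambda>_. lborel :: real measure)"
  by (simp add: product_sigma_finite_def sigma_finite_lborel)

text \<open>Checked on boxes. Coordinatewise arguments take place on the product space of functions
  and return to vectors through this identity.\<close>

lemma distr_lborel_fun: "distr lborel_fun borel vec_lambda = (lborel :: (real^'n::finite) measure)"
proof (rule lborel_eqI[symmetric])
  fix l u :: "real^'n" assume "\<And>b. b \<in> Basis \<Longrightarrow> l \<bullet> b \<le> u \<bullet> b"
  then have le: "l $ i \<le> u $ i" for i
    using axis_in_Basis_iff[of i "1::real"] by (metis inner_axis inner_real_def mult.right_neutral Basis_real_def singletonI)
  have "emeasure (distr lborel_fun borel vec_lambda) (box l u) = emeasure lborel_fun (Pi\<^sub>E UNIV (\<lambda>i. {l $ i <..< u $ i}))"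
    by (subst emeasure_distr) (auto intro!: arg_cong[of _ _ "emeasure lborel_fun"] simp: vec_lambda_box PiE_iff)
  also have "\<dots> = (\<Prod>i\<in>UNIV. emeasure lborel {l $ i <..< u $ i})"
    by (rule product_sigma_finite.emeasure_PiM[OF product_sigma_finite_lborel]) auto
  also have "\<dots> = ennreal (\<Prod>i\<in>UNIV. u $ i - l $ i)"
    using le by (simp add: prod_ennreal)
  also have "(\<Prod>i\<in>UNIV. u $ i - l $ i) = measure lborel (cbox l u)"
    using le by (subst content_cbox_cart) (auto simp: interval_ne_empty_cart)
  also have "\<dots> = (\<Prod>b\<in>Basis. (u - l) \<bullet> b)"
    using \<open>\<And>b. b \<in> Basis \<Longrightarrow> l \<bullet> b \<le> u \<bullet> b\<close> by (simp add: content_cbox)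
  finally show "emeasure (distr lborel_fun borel vec_lambda) (box l u) = ennreal (\<Prod>b\<in>Basis. (u - l) \<bullet> b)" .
qed simp

lemma AE_lborel_fun: "(AE x in (lborel :: (real^'n::finite) measure). Q x) \<longleftrightarrow> (AE x in lborel_fun. Q (vec_lambda x))"
  if "{x. Q x} \<in> sets borel"
  using that by (subst distr_lborel_fun[symmetric], subst AE_distr_iff) auto

definition obox :: "('n \<Rightarrow> real) \<Rightarrow> ('n \<Rightarrow> real) \<Rightarrow> ('n::finite \<Rightarrow> real) \<Rightarrow> real"
  where "obox l u x = (\<Prod>j\<in>UNIV. indicator {l j<..<u j} (x j))"

lemma obox_eq: "obox l u x = (if \<forall>j. l j < x j \<and> x j < u j then 1 else 0)"
  by (auto simp: obox_def indicator_def)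

lemma measurable_obox[measurable]: "obox l u \<in> borel_measurable lborel_fun"
  unfolding obox_def by measurable

text \<open>The positive and the negative part of V, used as densities, have the same finite mass on
  every box. Boxes generate the Borel sets and are stable under intersection, so the two measures
  coincide, although they live on disjoint sets.\<close>

lemma AE_zero_of_boxes:
  fixes V :: "('n::finite \<Rightarrow> real) \<Rightarrow> real"
  assumes [measurable]: "V \<in> borel_measurable lborel_fun"
    and int: "\<And>l u. (\<forall>j. l j < u j) \<Longrightarrow> integrable lborel_fun (\<lambda>x. V x * obox l u x)"
    and zero: "\<And>l u. (\<forall>j. l j < u j) \<Longrightarrow> (LINT x|lborel_fun. V x * obox l u x) = 0"
  shows "AE x in lborel_fun. V x = 0"
proof -
  define \<nu> :: "real \<Rightarrow> (real^'n) measure"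
    where "\<nu> s = distr (density lborel_fun (\<lambda>x. ennreal (s * V x))) borel vec_lambda" for s
  have em: "emeasure (\<nu> s) (box l u) = (\<integral>\<^sup>+x. ennreal (s * (V x * obox (vec_nth l) (vec_nth u) x)) \<partial>lborel_fun)" for s l u
  proof -
    have "emeasure (\<nu> s) (box l u) = emeasure (density lborel_fun (\<lambda>x. ennreal (s * V x))) (vec_lambda -` box l u)"
      unfolding \<nu>_def by (subst emeasure_distr) auto
    also have "\<dots> = (\<integral>\<^sup>+x. ennreal (s * V x) * indicator (vec_lambda -` box l u) x \<partial>lborel_fun)"
    proof (subst emeasure_density)
      have "vec_lambda -` box l u \<inter> space lborel_fun \<in> sets lborel_fun"
        by (rule measurable_sets[OF measurable_vec_lambda]) simp
      then show "vec_lambda -` box l u \<in> sets lborel_fun" by simp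
    qed auto
    also have "\<dots> = (\<integral>\<^sup>+x. ennreal (s * (V x * obox (vec_nth l) (vec_nth u) x)) \<partial>lborel_fun)"
      by (intro nn_integral_cong) (auto simp: indicator_def vec_lambda_box obox_eq)
    finally show ?thesis .
  qed
  have eq: "emeasure (\<nu> 1) (box l u) = emeasure (\<nu> (-1)) (box l u)"
    and fin: "emeasure (\<nu> 1) (box l u) \<noteq> \<infinity>" for l u :: "real^'n"
  proof -
    have "emeasure (\<nu> 1) (box l u) = emeasure (\<nu> (-1)) (box l u) \<and> emeasure (\<nu> 1) (box l u) \<noteq> \<infinity>"
    proof (cases "\<forall>j. l $ j < u $ j")
      case False
      then obtain j where "u $ j \<le> l $ j" by (auto simp: not_less)
      then have "x \<notin> box l u" for x
        unfolding mem_box_cart by (auto intro!: exI[of _ j])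
      then have "box l u = {}" by blast
      then show ?thesis by simp
    next
      case True
      note i = int[OF True] and z = zero[OF True]
      have "(\<integral>\<^sup>+x. ennreal (1 * (V x * obox (vec_nth l) (vec_nth u) x)) \<partial>lborel_fun) < \<infinity>"
      proof -
        have "(\<integral>\<^sup>+x. ennreal (1 * (V x * obox (vec_nth l) (vec_nth u) x)) \<partial>lborel_fun) \<le>
            (\<integral>\<^sup>+x. ennreal (norm (V x * obox (vec_nth l) (vec_nth u) x)) \<partial>lborel_fun)"
          by (intro nn_integral_mono ennreal_leI) auto
        then show ?thesis using i by (auto simp: integrable_iff_bounded elim: le_less_trans)
      qed
      moreover have "(\<integral>\<^sup>+x. ennreal ((-1) * (V x * obox (vec_nth l) (vec_nth u) x)) \<partial>lborel_fun) < \<infinity>"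
      proof -
        have "(\<integral>\<^sup>+x. ennreal ((-1) * (V x * obox (vec_nth l) (vec_nth u) x)) \<partial>lborel_fun) \<le>
            (\<integral>\<^sup>+x. ennreal (norm (V x * obox (vec_nth l) (vec_nth u) x)) \<partial>lborel_fun)"
          by (intro nn_integral_mono ennreal_leI) auto
        then show ?thesis using i by (auto simp: integrable_iff_bounded elim: le_less_trans)
      qed
      moreover have "enn2real (\<integral>\<^sup>+x. ennreal (1 * (V x * obox (vec_nth l) (vec_nth u) x)) \<partial>lborel_fun) =
          enn2real (\<integral>\<^sup>+x. ennreal ((-1) * (V x * obox (vec_nth l) (vec_nth u) x)) \<partial>lborel_fun)"
        using z real_lebesgue_integral_def[OF i] by simp
      ultimately show ?thesis
        unfolding em by (auto simp: less_top) (metis ennreal_enn2real less_top)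
    qed
    then show "emeasure (\<nu> 1) (box l u) = emeasure (\<nu> (-1)) (box l u)" "emeasure (\<nu> 1) (box l u) \<noteq> \<infinity>" by auto
  qed
  have "\<nu> 1 = \<nu> (-1)"
  proof (rule measure_eqI_generator_eq)
    let ?E = "range (\<lambda>(a, b). box a b :: (real^'n) set)"
    show "Int_stable ?E"
      by (auto simp: Int_stable_def box_Int_box)
    show "?E \<subseteq> Pow UNIV" "sets (\<nu> 1) = sigma_sets UNIV ?E" "sets (\<nu> (-1)) = sigma_sets UNIV ?E"
      by (simp_all add: borel_eq_box \<nu>_def)
    let ?A = "\<lambda>n::nat. box (- (real n *\<^sub>R One)) (real n *\<^sub>R One) :: (real^'n) set"
    show "range ?A \<subseteq> ?E" "(\<Union>i. ?A i) = UNIV"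
      unfolding UN_box_eq_UNIV by auto
  qed (use eq fin in auto)
  then have eqB: "emeasure (\<nu> 1) B = emeasure (\<nu> (-1)) B" for B by simp
  have emB: "emeasure (\<nu> s) (vec_nth -` C) = (\<integral>\<^sup>+x. ennreal (s * V x) * indicator C x \<partial>lborel_fun)"
    if "C \<in> sets lborel_fun" for s C
  proof -
    have m: "(vec_nth -` C :: (real^'n) set) \<in> sets borel"
      using measurable_sets[OF measurable_vec_nth that] by simp
    have "emeasure (\<nu> s) (vec_nth -` C) = emeasure (density lborel_fun (\<lambda>x. ennreal (s * V x))) C"
      unfolding \<nu>_def using m by (subst emeasure_distr) (auto intro!: arg_cong2[of _ _ _ _ emeasure] simp: vec_nth_vec_lambda)
    then show ?thesis using that by (simp add: emeasure_density)
  qed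
  have C: "(\<integral>\<^sup>+x. ennreal (1 * V x) * indicator C x \<partial>lborel_fun) = (\<integral>\<^sup>+x. ennreal ((-1) * V x) * indicator C x \<partial>lborel_fun)"
    if "C \<in> sets lborel_fun" for C
    unfolding emB[OF that, symmetric] by (rule eqB)
  have pos: "AE x in lborel_fun. ennreal (s * V x) = 0" if s: "s = 1 \<or> s = -1" for s :: real
  proof -
    let ?C = "{x \<in> space lborel_fun. s * V x > 0}"
    have m: "?C \<in> sets lborel_fun" by measurable
    have "(\<integral>\<^sup>+x. ennreal (s * V x) * indicator ?C x \<partial>lborel_fun) = (\<integral>\<^sup>+x. ennreal ((-s) * V x) * indicator ?C x \<partial>lborel_fun)"
      using C[OF m] s by auto
    also have "\<dots> = (\<integral>\<^sup>+(x::'n \<Rightarrow> real). 0 \<partial>lborel_fun)"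
      by (intro nn_integral_cong) (auto simp: indicator_def ennreal_neg)
    finally have "(\<integral>\<^sup>+x. ennreal (s * V x) * indicator ?C x \<partial>lborel_fun) = 0" by simp
    then have "AE x in lborel_fun. ennreal (s * V x) * indicator ?C x = 0"
      using m by (subst (asm) nn_integral_0_iff_AE) auto
    then show ?thesis by eventually_elim (auto simp: indicator_def ennreal_eq_0_iff split: if_splits)
  qed
  show ?thesis
    using pos[of 1] pos[of "-1"] by (auto elim!: eventually_elim2 simp: ennreal_eq_0_iff)
qed

section \<open>Weighted Lebesgue measure over the reference law\<close>

context monomial_product
begin

definition Wt :: "('i \<Rightarrow> real) \<Rightarrow> real" where "Wt x = (\<Prod>i\<in>UNIV. wt (A i) (x i))"

lemma measurable_M_iff: "measurable M N = measurable lborel_fun N"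
  by (intro measurable_cong_sets sets_PiM_cong) auto

lemma M_eq_density: "M = density lborel_fun (\<lambda>x. ennreal (\<Prod>i\<in>UNIV. phi (A i) (x i)))"
proof (rule P.PiM_eqI[symmetric])
  show "sets (density lborel_fun (\<lambda>x. ennreal (\<Prod>i\<in>UNIV. phi (A i) (x i)))) = sets M"
    by (simp, intro sets_PiM_cong) auto
  fix B assume B: "\<And>i. i \<in> UNIV \<Longrightarrow> B i \<in> sets (\<mu>1 i)"
  then have [measurable]: "B i \<in> sets borel" for i by simp
  have PB: "Pi\<^sub>E UNIV B \<in> sets lborel_fun" by (intro sets_PiM_I_finite) auto
  have "emeasure (density lborel_fun (\<lambda>x. ennreal (\<Prod>i\<in>UNIV. phi (A i) (x i)))) (Pi\<^sub>E UNIV B) =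
      (\<integral>\<^sup>+x. ennreal (\<Prod>i\<in>UNIV. phi (A i) (x i)) * indicator (Pi\<^sub>E UNIV B) x \<partial>lborel_fun)"
    using PB by (subst emeasure_density) auto
  also have "\<dots> = (\<integral>\<^sup>+x. (\<Prod>i\<in>UNIV. ennreal (phi (A i) (x i)) * indicator (B i) (x i)) \<partial>lborel_fun)"
  proof (intro nn_integral_cong)
    fix x :: "'i \<Rightarrow> real"
    have "indicator (Pi\<^sub>E UNIV B) x = (\<Prod>i\<in>UNIV. indicator (B i) (x i) :: ennreal)"
      by (auto simp: indicator_def PiE_iff)
    then show "ennreal (\<Prod>i\<in>UNIV. phi (A i) (x i)) * indicator (Pi\<^sub>E UNIV B) x =
        (\<Prod>i\<in>UNIV. ennreal (phi (A i) (x i)) * indicator (B i) (x i))"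
      using phi_nonneg[OF A_nonneg] by (simp add: prod.distrib prod_ennreal)
  qed
  also have "\<dots> = (\<Prod>i\<in>UNIV. (\<integral>\<^sup>+t. ennreal (phi (A i) t) * indicator (B i) t \<partial>lborel))"
    by (subst product_sigma_finite.product_nn_integral_prod[OF product_sigma_finite_lborel]) auto
  also have "\<dots> = (\<Prod>i\<in>UNIV. emeasure (\<mu>1 i) (B i))"
    by (intro prod.cong refl) (auto simp: emeasure_density)
  finally show "emeasure (density lborel_fun (\<lambda>x. ennreal (\<Prod>i\<in>UNIV. phi (A i) (x i)))) (Pi\<^sub>E UNIV B) =
      (\<Prod>i\<in>UNIV. emeasure (\<mu>1 i) (B i))" .
qed simp

lemma prod_phi_nonneg: "0 \<le> (\<Prod>i\<in>UNIV. phi (A i) (x i))"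
  by (intro prod_nonneg) (auto simp: phi_nonneg[OF A_nonneg])

lemma prod_phi_pos_iff: "0 < (\<Prod>i\<in>UNIV. phi (A i) (x i)) \<longleftrightarrow> (\<forall>i. x i \<in> dom1 (A i))"
proof
  assume *: "0 < (\<Prod>i\<in>UNIV. phi (A i) (x i))"
  have "phi (A i) (x i) > 0" for i
    using * phi_nonneg[OF A_nonneg[of i], of "x i"] by (auto simp: less_le)
  then show "\<forall>i. x i \<in> dom1 (A i)" using phi_pos_iff[OF A_nonneg] by blast
next
  assume "\<forall>i. x i \<in> dom1 (A i)"
  then show "0 < (\<Prod>i\<in>UNIV. phi (A i) (x i))"
    using phi_pos_iff[OF A_nonneg] by (intro prod_pos) auto
qed

lemma prod_phi_\<Psi>: "(\<Prod>i\<in>UNIV. phi (A i) (x i)) * \<Psi> x = Wt x"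
proof -
  have "phi (A i) t * (exp (t\<^sup>2 / 2) * Z (A i)) = wt (A i) t" for i t
    using Z_pos[OF A_nonneg[of i]] by (simp add: phi_def exp_minus field_simps)
  then show ?thesis by (simp add: \<Psi>_def Wt_def flip: prod.distrib)
qed

lemma AE_M: "(AE x in M. Q x) \<longleftrightarrow> (AE x in lborel_fun. (\<forall>i. x i \<in> dom1 (A i)) \<longrightarrow> Q x)"
proof -
  have "(AE x in M. Q x) \<longleftrightarrow> (AE x in lborel_fun. 0 < ennreal (\<Prod>i\<in>UNIV. phi (A i) (x i)) \<longrightarrow> Q x)"
    by (subst M_eq_density, subst AE_density) auto
  then show ?thesis by (simp only: ennreal_less_zero_iff prod_phi_pos_iff)
qed

lemma nn_integral_M_\<Psi>:
  assumes [measurable]: "H \<in> borel_measurable lborel_fun"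
  shows "(\<integral>\<^sup>+x. ennreal (\<Psi> x) * H x \<partial>M) = (\<integral>\<^sup>+x. ennreal (Wt x) * H x \<partial>lborel_fun)"
proof -
  have [measurable]: "\<Psi> \<in> borel_measurable lborel_fun" using measurable_\<Psi> by (simp only: measurable_M_iff)
  have "(\<integral>\<^sup>+x. ennreal (\<Psi> x) * H x \<partial>M) = (\<integral>\<^sup>+x. ennreal (\<Prod>i\<in>UNIV. phi (A i) (x i)) * (ennreal (\<Psi> x) * H x) \<partial>lborel_fun)"
    by (subst M_eq_density, subst nn_integral_density) auto
  also have "\<dots> = (\<integral>\<^sup>+x. ennreal (Wt x) * H x \<partial>lborel_fun)"
    unfolding prod_phi_\<Psi>[symmetric] using prod_phi_nonneg
    by (simp add: ennreal_mult' mult.assoc)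
  finally show ?thesis .
qed

lemma
  fixes H :: "('i \<Rightarrow> real) \<Rightarrow> real"
  assumes [measurable]: "H \<in> borel_measurable lborel_fun"
  shows integrable_M_\<Psi>: "integrable M (\<lambda>x. H x * \<Psi> x) \<longleftrightarrow> integrable lborel_fun (\<lambda>x. H x * Wt x)"
    and integral_M_\<Psi>: "(\<integral>x. H x * \<Psi> x \<partial>M) = (LINT x|lborel_fun. H x * Wt x)"
proof -
  have [measurable]: "\<Psi> \<in> borel_measurable lborel_fun" using measurable_\<Psi> by (simp only: measurable_M_iff)
  have eq: "(\<Prod>i\<in>UNIV. phi (A i) (x i)) * (H x * \<Psi> x) = H x * Wt x" for x
    unfolding prod_phi_\<Psi>[symmetric] by (simp add: mult_ac)
  show "integrable M (\<lambda>x. H x * \<Psi> x) \<longleftrightarrow> integrable lborel_fun (\<lambda>x. H x * Wt x)"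
    by (subst M_eq_density, subst integrable_density) (auto simp: prod_phi_nonneg eq)
  show "(\<integral>x. H x * \<Psi> x \<partial>M) = (LINT x|lborel_fun. H x * Wt x)"
    by (subst M_eq_density, subst integral_density) (auto simp: prod_phi_nonneg eq)
qed

end

text \<open>With all exponents 0 the law M is the standard Gaussian, and Lebesgue measure has the
  positive density \<open>\<Psi>\<close> over it. In this way the statements on lines for
  probability measures carry over to Lebesgue measure.\<close>

interpretation std: monomial_product "\<lambda>_::'n::finite. 0"
  by unfold_locales simp

lemma wt_0[simp]: "wt 0 t = 1" and dom1_0[simp]: "dom1 0 = UNIV"
  by (auto simp: wt_def dom1_def)

lemma AE_lborel_fun_line:
  assumes "AE x in lborel_fun. Q x"
  shows "AE x in lborel_fun. AE t in lborel. Q (x(i := t))"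
proof -
  have "AE x in std.M. Q x"
    using assms by (simp add: std.AE_M)
  from std.AE_line[OF this, of i] show ?thesis
    by (simp add: std.AE_M std.AE_\<mu>1)
qed

text \<open>\<open>std.\<Psi>off\<close> restores Lebesgue measure in the other coordinates, while
  the i-th coordinate of x is integrated out with mass 1.\<close>

lemma nn_integral_lborel_fun_line:
  fixes H :: "('n::finite \<Rightarrow> real) \<Rightarrow> ennreal"
  assumes [measurable]: "H \<in> borel_measurable lborel_fun"
  shows "(\<integral>\<^sup>+x. H x \<partial>lborel_fun) = (\<integral>\<^sup>+x. ennreal (std.\<Psi>off i x) * (\<integral>\<^sup>+t. H (x(i := t)) \<partial>lborel) \<partial>std.M)"
proof -
  have [measurable]: "std.\<Psi> \<in> borel_measurable lborel_fun" using std.measurable_\<Psi> by (simp only: std.measurable_M_iff)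
  have line[measurable]: "(\<lambda>t. x(i := t)) \<in> borel \<rightarrow>\<^sub>M lborel_fun" for x :: "'n \<Rightarrow> real"
    by (rule measurable_PiM_single') (auto simp: fun_upd_def)
  note [measurable] = measurable_compose[OF line assms] measurable_compose[OF line \<open>std.\<Psi> \<in> borel_measurable lborel_fun\<close>]
  have "(\<integral>\<^sup>+x. H x \<partial>lborel_fun) = (\<integral>\<^sup>+x. ennreal (std.\<Psi> x) * H x \<partial>std.M)"
    by (subst std.nn_integral_M_\<Psi>) (auto simp: std.Wt_def)
  also have "\<dots> = (\<integral>\<^sup>+x. \<integral>\<^sup>+t. ennreal (std.\<Psi> (x(i := t))) * H (x(i := t)) \<partial>std.\<mu>1 i \<partial>std.M)"
    by (rule std.nn_integral_line) (auto simp: std.measurable_M_iff)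
  also have "\<dots> = (\<integral>\<^sup>+x. ennreal (std.\<Psi>off i x) * (\<integral>\<^sup>+t. H (x(i := t)) \<partial>lborel) \<partial>std.M)"
  proof (intro nn_integral_cong)
    fix x :: "'n \<Rightarrow> real"
    have "(\<integral>\<^sup>+t. ennreal (std.\<Psi> (x(i := t))) * H (x(i := t)) \<partial>std.\<mu>1 i) =
        (\<integral>\<^sup>+t. ennreal (phi 0 t) * (ennreal (std.\<Psi> (x(i := t))) * H (x(i := t))) \<partial>lborel)"
      by (subst nn_integral_density) auto
    also have "\<dots> = (\<integral>\<^sup>+t. ennreal (std.\<Psi>off i x) * H (x(i := t)) \<partial>lborel)"
    proof (intro nn_integral_cong)
      fix t
      have "ennreal (phi 0 t) * ennreal (std.\<Psi> (x(i := t))) = ennreal (std.\<Psi>off i x)"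
        using std.\<Psi>_upd_phi[of x i t] phi_nonneg[of 0 t]
        by (simp add: mult.commute flip: ennreal_mult')
      then show "ennreal (phi 0 t) * (ennreal (std.\<Psi> (x(i := t))) * H (x(i := t))) = ennreal (std.\<Psi>off i x) * H (x(i := t))"
        by (simp flip: mult.assoc)
    qed
    finally show "(\<integral>\<^sup>+t. ennreal (std.\<Psi> (x(i := t))) * H (x(i := t)) \<partial>std.\<mu>1 i) =
        ennreal (std.\<Psi>off i x) * (\<integral>\<^sup>+t. H (x(i := t)) \<partial>lborel)"
      by (simp add: nn_integral_cmult)
  qed
  finally show ?thesis .
qed

lemma nn_integral_lborel_fun_line_mono:
  fixes H1 H2 :: "('n::finite \<Rightarrow> real) \<Rightarrow> ennreal"
  assumes [measurable]: "H1 \<in> borel_measurable lborel_fun" "H2 \<in> borel_measurable lborel_fun"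
    and "AE x in lborel_fun. (\<integral>\<^sup>+t. H1 (x(i := t)) \<partial>lborel) \<le> (\<integral>\<^sup>+t. H2 (x(i := t)) \<partial>lborel)"
  shows "(\<integral>\<^sup>+x. H1 x \<partial>lborel_fun) \<le> (\<integral>\<^sup>+x. H2 x \<partial>lborel_fun)"
  unfolding nn_integral_lborel_fun_line[OF assms(1), of i] nn_integral_lborel_fun_line[OF assms(2), of i]
proof (rule nn_integral_mono_AE)
  have "AE x in std.M. (\<integral>\<^sup>+t. H1 (x(i := t)) \<partial>lborel) \<le> (\<integral>\<^sup>+t. H2 (x(i := t)) \<partial>lborel)"
    using assms(3) by (simp add: std.AE_M)
  then show "AE x in std.M. ennreal (std.\<Psi>off i x) * (\<integral>\<^sup>+t. H1 (x(i := t)) \<partial>lborel)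
      \<le> ennreal (std.\<Psi>off i x) * (\<integral>\<^sup>+t. H2 (x(i := t)) \<partial>lborel)"
    by eventually_elim (rule mult_left_mono, auto)
qed

lemma
  fixes H :: "('n::finite \<Rightarrow> real) \<Rightarrow> real"
  assumes int: "integrable lborel_fun H"
  shows AE_integrable_lborel_fun_line: "AE x in lborel_fun. integrable lborel (\<lambda>t. H (x(i := t)))"
    and integral_lborel_fun_line: "(LINT x|lborel_fun. H x) = (LINT x|std.M. std.\<Psi>off i x * (LINT t|lborel. H (x(i := t))))"
proof -
  have [measurable]: "H \<in> borel_measurable lborel_fun" using int by simp
  have [measurable]: "std.\<Psi> \<in> borel_measurable lborel_fun" using std.measurable_\<Psi> by (simp only: std.measurable_M_iff)
  have line[measurable]: "(\<lambda>t. x(i := t)) \<in> borel \<rightarrow>\<^sub>M lborel_fun" for x :: "'n \<Rightarrow> real"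
    by (rule measurable_PiM_single') (auto simp: fun_upd_def)
  note [measurable] = measurable_compose[OF line \<open>H \<in> borel_measurable lborel_fun\<close>] measurable_compose[OF line \<open>std.\<Psi> \<in> borel_measurable lborel_fun\<close>]
  have i: "integrable std.M (\<lambda>x. H x * std.\<Psi> x)"
    using int by (subst std.integrable_M_\<Psi>) (auto simp: std.Wt_def)
  have eq: "phi 0 t * (H (x(i := t)) * std.\<Psi> (x(i := t))) = std.\<Psi>off i x * H (x(i := t))" for x t
    using std.\<Psi>_upd_phi[of x i t] by (simp add: mult_ac)
  have "AE x in std.M. integrable (std.\<mu>1 i) (\<lambda>t. H (x(i := t)) * std.\<Psi> (x(i := t)))"
    by (rule std.AE_integrable_line[OF i])
  then have "AE x in lborel_fun. integrable (std.\<mu>1 i) (\<lambda>t. H (x(i := t)) * std.\<Psi> (x(i := t)))"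
    by (simp add: std.AE_M)
  then show "AE x in lborel_fun. integrable lborel (\<lambda>t. H (x(i := t)))"
  proof eventually_elim
    case (elim x)
    then have "integrable lborel (\<lambda>t. std.\<Psi>off i x * H (x(i := t)))"
      by (subst (asm) integrable_density) (auto simp: phi_nonneg eq)
    then show ?case
      by (rule integrable_mult_cancel[rotated]) (use std.\<Psi>off_pos[of i x] in auto)
  qed
  have "(LINT x|lborel_fun. H x) = (LINT x|std.M. H x * std.\<Psi> x)"
    by (subst std.integral_M_\<Psi>) (auto simp: std.Wt_def)
  also have "\<dots> = (LINT x|std.M. LINT t|std.\<mu>1 i. H (x(i := t)) * std.\<Psi> (x(i := t)))"
    by (rule std.integral_line[OF i])
  also have "\<dots> = (LINT x|std.M. std.\<Psi>off i x * (LINT t|lborel. H (x(i := t))))"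
    by (subst integral_density) (auto simp: phi_nonneg eq)
  finally show "(LINT x|lborel_fun. H x) = (LINT x|std.M. std.\<Psi>off i x * (LINT t|lborel. H (x(i := t))))" .
qed

lemma integral_lborel_fun_line_cong:
  fixes H1 H2 :: "('n::finite \<Rightarrow> real) \<Rightarrow> real"
  assumes i1: "integrable lborel_fun H1" and i2: "integrable lborel_fun H2"
    and "AE x in lborel_fun. (LINT t|lborel. H1 (x(i := t))) = (LINT t|lborel. H2 (x(i := t)))"
  shows "(LINT x|lborel_fun. H1 x) = (LINT x|lborel_fun. H2 x)"
proof -
  have 1: "(LINT t|lborel. H1 (x(i := t)) - H2 (x(i := t))) = 0"
    if "integrable lborel (\<lambda>t. H1 (x(i := t)))" "integrable lborel (\<lambda>t. H2 (x(i := t)))"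
      "(LINT t|lborel. H1 (x(i := t))) = (LINT t|lborel. H2 (x(i := t)))" for x
    using that by (simp add: Bochner_Integration.integral_diff)
  have "AE x in lborel_fun. (LINT t|lborel. H1 (x(i := t)) - H2 (x(i := t))) = 0"
    using AE_integrable_lborel_fun_line[OF i1, of i] AE_integrable_lborel_fun_line[OF i2, of i] assms(3)
    by eventually_elim (rule 1)
  then have "AE x in std.M. std.\<Psi>off i x * (LINT t|lborel. H1 (x(i := t)) - H2 (x(i := t))) = 0"
    by (auto simp: std.AE_M elim: eventually_mono)
  then have "(LINT x|std.M. std.\<Psi>off i x * (LINT t|lborel. H1 (x(i := t)) - H2 (x(i := t)))) = 0"
    by (rule integral_eq_zero_AE)
  then have "(LINT x|lborel_fun. H1 x - H2 x) = 0"
    using integral_lborel_fun_line[OF Bochner_Integration.integrable_diff[OF i1 i2], of i] by simp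
  then show ?thesis using i1 i2 by (simp add: Bochner_Integration.integral_diff)
qed

section \<open>Weak derivatives along lines\<close>

definition cube :: "real \<Rightarrow> ('n \<Rightarrow> real) set" where "cube m = {x. \<forall>j. \<bar>x j\<bar> \<le> m}"

text \<open>The signed indicator of the interval between 0 and t: integrating u against it gives the
  primitive of u from 0 for both signs of t.\<close>

definition sg :: "real \<Rightarrow> real \<Rightarrow> real"
  where "sg t s = (if 0 \<le> s \<and> s \<le> t then 1 else 0) - (if t \<le> s \<and> s \<le> 0 then 1 else 0)"

lemma sets_cube[measurable]: "cube m \<in> sets (lborel_fun :: ('n::finite \<Rightarrow> real) measure)"
proof -
  have "{x \<in> space lborel_fun. \<forall>j. \<bar>x j\<bar> \<le> m} \<in> sets (lborel_fun :: ('n::finite \<Rightarrow> real) measure)"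
    by measurable
  then show ?thesis by (simp add: cube_def)
qed

lemma measurable_upd[measurable (raw)]:
  assumes "u \<in> N \<rightarrow>\<^sub>M (lborel_fun :: ('n::finite \<Rightarrow> real) measure)" "v \<in> borel_measurable N"
  shows "(\<lambda>z. (u z)(i := v z)) \<in> N \<rightarrow>\<^sub>M lborel_fun"
  using assms by (intro measurable_fun_upd[where J = UNIV]) auto

lemma set_integrable_sg:
  assumes "\<And>m. set_integrable lborel {-m..m} u"
  shows "integrable lborel (\<lambda>s. u s * sg t s)"
proof -
  have i: "integrable lborel (\<lambda>s. indicator {-\<bar>t\<bar>..\<bar>t\<bar>} s * u s)"
    using assms[of "\<bar>t\<bar>"] by (simp add: set_integrable_def)
  have [measurable]: "sg t \<in> borel_measurable borel" unfolding sg_def by measurable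
  have eq: "u s * sg t s = (indicator {-\<bar>t\<bar>..\<bar>t\<bar>} s * u s) * sg t s" for s
    by (auto simp: sg_def indicator_def)
  have "norm ((indicator {-\<bar>t\<bar>..\<bar>t\<bar>} s * u s) * sg t s) \<le> norm (indicator {-\<bar>t\<bar>..\<bar>t\<bar>} s * u s)" for s
    by (auto simp: sg_def)
  then show ?thesis
    unfolding eq using borel_measurable_integrable[OF i]
    by (intro Bochner_Integration.integrable_bound[OF i] AE_I2) auto
qed

lemma ac_antideriv:
  assumes u: "\<And>m. set_integrable lborel {-m..m} u"
  shows "ac (\<lambda>t. LINT s|lborel. u s * sg t s) u"
  unfolding ac_def
proof (intro conjI allI impI)
  fix a b :: real
  show si: "set_integrable lborel {a..b} u"
    by (rule set_integrable_subset[OF u[of "max \<bar>a\<bar> \<bar>b\<bar>"]]) auto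
  assume ab: "a \<le> b"
  have "(LINT s|lborel. u s * sg b s) - (LINT s|lborel. u s * sg a s) = (LINT s|lborel. u s * sg b s - u s * sg a s)"
    by (intro Bochner_Integration.integral_diff[symmetric] set_integrable_sg u)
  also have "\<dots> = (LBINT s:{a..b}. u s)"
    unfolding set_lebesgue_integral_def
  proof (rule integral_cong_AE)
    show "(\<lambda>s. u s * sg b s - u s * sg a s) \<in> borel_measurable lborel"
      using set_integrable_sg[OF u] by (intro borel_measurable_diff borel_measurable_integrable)
    show "(\<lambda>s. indicator {a..b} s *\<^sub>R u s) \<in> borel_measurable lborel"
      using si unfolding set_integrable_def by (rule borel_measurable_integrable)
    show "AE s in lborel. u s * sg b s - u s * sg a s = indicator {a..b} s *\<^sub>R u s"
      using AE_lborel_singleton[of a] AE_lborel_singleton[of b] AE_lborel_singleton[of 0]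
    proof eventually_elim
      case (elim s)
      have "sg b s - sg a s = indicator {a..b} s"
        using elim ab by (auto simp: sg_def indicator_def)
      then show ?case by (simp add: right_diff_distrib[symmetric])
    qed
  qed
  finally show "(LINT s|lborel. u s * sg b s) - (LINT s|lborel. u s * sg a s) = (LBINT s:{a..b}. u s)" .
qed

lemma prod_upd:
  fixes \<theta> :: "'n::finite \<Rightarrow> real \<Rightarrow> real"
  shows "(\<Prod>j\<in>UNIV. \<theta> j ((x(i := t)) j)) = \<theta> i t * (\<Prod>j\<in>UNIV - {i}. \<theta> j (x j))"
  by (subst prod.remove[of UNIV i]) (auto intro!: prod.cong)

lemma integrable_mult_test:
  fixes H :: "('n::finite \<Rightarrow> real) \<Rightarrow> real"
  assumes H: "\<And>m. integrable lborel_fun (\<lambda>x. indicator (cube m) x * H x)"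
    and meas: "\<And>j. \<theta> j \<in> borel_measurable borel"
    and bnd: "\<And>j t. \<bar>\<theta> j t\<bar> \<le> C j" and supp: "\<And>j t. \<theta> j t \<noteq> 0 \<Longrightarrow> \<bar>t\<bar> \<le> m"
  shows "integrable lborel_fun (\<lambda>x. H x * (\<Prod>j\<in>UNIV. \<theta> j (x j)))"
proof -
  note [measurable] = meas
  let ?P = "\<lambda>x. \<Prod>j\<in>UNIV. \<theta> j (x j)"
  have eq: "H x * ?P x = (indicator (cube m) x * H x) * ?P x" for x
  proof (cases "x \<in> cube m")
    case False
    then obtain j where "\<theta> j (x j) = 0" using supp by (fastforce simp: cube_def)
    then have "?P x = 0" by auto
    then show ?thesis by simp
  qed simp
  have i: "integrable lborel_fun (\<lambda>x. (\<Prod>j\<in>UNIV. C j) * (indicator (cube m) x * H x))"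
    by (intro integrable_mult_right H)
  have P: "\<bar>?P x\<bar> \<le> (\<Prod>j\<in>UNIV. C j)" for x
    unfolding abs_prod using bnd by (intro prod_mono) auto
  have [measurable]: "(\<lambda>x. indicator (cube m) x * H x) \<in> borel_measurable lborel_fun"
    using H by (rule borel_measurable_integrable)
  show ?thesis
    unfolding eq
  proof (rule Bochner_Integration.integrable_bound[OF i])
    show "AE x in lborel_fun. norm ((indicator (cube m) x * H x) * ?P x) \<le> norm ((\<Prod>j\<in>UNIV. C j) * (indicator (cube m) x * H x))"
    proof (rule AE_I2)
      fix x
      have "\<bar>indicator (cube m) x * H x\<bar> * \<bar>?P x\<bar> \<le> \<bar>indicator (cube m) x * H x\<bar> * \<bar>\<Prod>j\<in>UNIV. C j\<bar>"
        using P[of x] by (intro mult_left_mono) auto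
      then show "norm ((indicator (cube m) x * H x) * ?P x) \<le> norm ((\<Prod>j\<in>UNIV. C j) * (indicator (cube m) x * H x))"
        unfolding real_norm_def abs_mult[of "indicator (cube m) x * H x" "?P x"] abs_mult[of "\<Prod>j\<in>UNIV. C j"]
        by (simp add: mult.commute)
    qed
  qed measurable
qed

lemma bounded_of_compact_support:
  fixes \<theta> :: "real \<Rightarrow> real"
  assumes "continuous_on UNIV \<theta>" "\<And>t. \<theta> t \<noteq> 0 \<Longrightarrow> \<bar>t\<bar> \<le> m"
  shows "\<exists>C. \<forall>t. \<bar>\<theta> t\<bar> \<le> C"
proof -
  have "compact (\<theta> ` {-m..m})"
    using assms(1) by (intro compact_continuous_image continuous_on_subset[OF assms(1)]) auto
  then obtain B where B: "\<And>t. t \<in> {-m..m} \<Longrightarrow> \<bar>\<theta> t\<bar> \<le> B"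
    using compact_imp_bounded bounded_iff by (metis image_eqI real_norm_def)
  have "\<bar>\<theta> t\<bar> \<le> max B 0" for t
    using B[of t] assms(2)[of t] by (cases "\<theta> t = 0") (auto simp: abs_le_iff)
  then show ?thesis by blast
qed

lemma deriv_support:
  fixes \<theta> :: "real \<Rightarrow> real"
  assumes "\<And>t. \<theta> t \<noteq> 0 \<Longrightarrow> \<bar>t\<bar> \<le> m" "\<And>t. (\<theta> has_real_derivative \<theta>' t) (at t)" "\<theta>' t \<noteq> 0"
  shows "\<bar>t\<bar> \<le> m"
proof (rule ccontr)
  assume "\<not> \<bar>t\<bar> \<le> m"
  then have "t \<in> - {-m..m}" by auto
  then have "\<forall>\<^sub>F s in nhds t. s \<in> - {-m..m}"
    by (intro eventually_nhds_in_open) auto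
  then have "\<forall>\<^sub>F s in nhds t. \<theta> s = 0"
    by eventually_elim (use assms(1) in \<open>force simp: abs_le_iff\<close>)
  then have "(\<theta> has_real_derivative \<theta>' t) (at t) \<longleftrightarrow> ((\<lambda>_. 0) has_real_derivative \<theta>' t) (at t)"
    by (intro DERIV_cong_ev) auto
  then have "\<theta>' t = 0"
    using assms(2)[of t] DERIV_unique DERIV_const by blast
  with assms(3) show False by simp
qed

text \<open>The weak derivative is tested on products of one-variable functions, since these can
  approximate indicators of boxes.\<close>

locale weak_partial =
  fixes f g :: "('n::finite \<Rightarrow> real) \<Rightarrow> real" and i :: 'n
  assumes measurable_f[measurable]: "f \<in> borel_measurable lborel_fun"
    and measurable_g[measurable]: "g \<in> borel_measurable lborel_fun"
    and f_loc: "\<And>m. integrable lborel_fun (\<lambda>x. indicator (cube m) x * f x)"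
    and g_loc: "\<And>m. integrable lborel_fun (\<lambda>x. indicator (cube m) x * g x)"
    and weak: "\<And>\<theta> \<theta>' m. (\<And>j. smooth_fun (\<theta> j)) \<Longrightarrow> (\<And>j t. \<theta> j t \<noteq> 0 \<Longrightarrow> \<bar>t\<bar> \<le> m) \<Longrightarrow>
      smooth_fun \<theta>' \<Longrightarrow> (\<And>t. (\<theta> i has_real_derivative \<theta>' t) (at t)) \<Longrightarrow>
      (LINT x|lborel_fun. f x * (\<Prod>j\<in>UNIV. (\<theta>(i := \<theta>')) j (x j))) = - (LINT x|lborel_fun. g x * (\<Prod>j\<in>UNIV. \<theta> j (x j)))"
begin

text \<open>The primitive of g along the line, starting at coordinate 0. The aim is to show that f -
  G does not depend on the i-th coordinate.\<close>

definition G :: "('n \<Rightarrow> real) \<Rightarrow> real" where "G x = (LINT s|lborel. g (x(i := s)) * sg (x i) s)"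

definition good :: "('n \<Rightarrow> real) \<Rightarrow> bool"
  where "good x \<longleftrightarrow> (\<forall>m. set_integrable lborel {-m..m} (\<lambda>t. g (x(i := t))))"

lemma measurable_G[measurable]: "G \<in> borel_measurable lborel_fun"
proof -
  have [measurable]: "(\<lambda>z. g ((fst z)(i := snd z))) \<in> borel_measurable (lborel_fun \<Otimes>\<^sub>M lborel)"
    by (rule measurable_compose[OF _ measurable_g]) measurable
  have [measurable]: "(\<lambda>z. fst z i) \<in> borel_measurable (lborel_fun \<Otimes>\<^sub>M lborel)"
    by (rule measurable_compose[OF measurable_fst]) simp
  show ?thesis
    unfolding G_def sg_def
    by (rule lborel.borel_measurable_lebesgue_integral) (unfold case_prod_unfold, measurable)
qed

lemma AE_good: "AE x in lborel_fun. good x"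
proof -
  have "AE x in lborel_fun. \<forall>m::nat. integrable lborel (\<lambda>t. indicator (cube (real m)) (x(i := t)) * g (x(i := t)))"
    unfolding AE_all_countable by (intro allI AE_integrable_lborel_fun_line g_loc)
  then show ?thesis
  proof eventually_elim
    case (elim x)
    show ?case
      unfolding good_def
    proof
      fix m :: real
      \<comment> \<open>Once k exceeds all coordinates of x, the indicator of the cube restricts to
        that of an interval on the line.\<close>
      obtain k :: nat where k: "max \<bar>m\<bar> (\<Sum>j\<in>UNIV. \<bar>x j\<bar>) \<le> real k" using real_arch_simple by blast
      have "\<bar>x j\<bar> \<le> real k" for j
        using k member_le_sum[of j UNIV "\<lambda>j. \<bar>x j\<bar>"] by auto
      then have "indicator (cube (real k)) (x(i := t)) = (indicator {- real k..real k} t :: real)" for t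
        by (auto simp: cube_def indicator_def abs_le_iff)
      then have "set_integrable lborel {- real k..real k} (\<lambda>t. g (x(i := t)))"
        using elim[rule_format, of k] by (simp add: set_integrable_def)
      then show "set_integrable lborel {- m..m} (\<lambda>t. g (x(i := t)))"
        by (rule set_integrable_subset) (use k in auto)
    qed
  qed
qed

lemma G_line: "G (x(i := t)) = (LINT s|lborel. g (x(i := s)) * sg t s)"
  by (simp add: G_def)

lemma ac_G: "good x \<Longrightarrow> ac (\<lambda>t. G (x(i := t))) (\<lambda>t. g (x(i := t)))"
  unfolding G_line by (rule ac_antideriv) (auto simp: good_def)

text \<open>Inside the cube the primitive is at most the integral of the absolute value of g over
  [-m, m] on the same line, and integrating this bound over the line costs a factor 2 m.\<close>

lemma G_loc: "integrable lborel_fun (\<lambda>x. indicator (cube m) x * G x)"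
proof (cases "m \<ge> 0")
  case False
  then have "cube m = ({} :: ('n \<Rightarrow> real) set)" by (auto simp: cube_def dest!: abs_ge_zero[THEN order_trans])
  then show ?thesis by simp
next
  case m: True
  show ?thesis
  proof (rule integrableI_bounded)
    show "(\<lambda>x. indicator (cube m) x * G x) \<in> borel_measurable lborel_fun" by measurable
    have "(\<integral>\<^sup>+x. ennreal (norm (indicator (cube m) x * G x)) \<partial>lborel_fun) \<le>
        (\<integral>\<^sup>+x. ennreal (2 * m) * ennreal (norm (indicator (cube m) x * g x)) \<partial>lborel_fun)"
    proof (rule nn_integral_lborel_fun_line_mono[where i = i])
      show "AE x in lborel_fun. (\<integral>\<^sup>+t. ennreal (norm (indicator (cube m) (x(i := t)) * G (x(i := t)))) \<partial>lborel) \<le>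
        (\<integral>\<^sup>+t. ennreal (2 * m) * ennreal (norm (indicator (cube m) (x(i := t)) * g (x(i := t)))) \<partial>lborel)"
        using AE_good
      proof eventually_elim
        case (elim x)
        note [measurable] = ac_measurable_deriv[OF ac_G[OF elim]]
        show ?case
        proof (cases "\<forall>j. j \<noteq> i \<longrightarrow> \<bar>x j\<bar> \<le> m")
          case False
          then have "x(i := t) \<notin> cube m" for t by (auto simp: cube_def)
          then show ?thesis by simp
        next
          case True
          then have c: "x(i := t) \<in> cube m \<longleftrightarrow> t \<in> {-m..m}" for t by (auto simp: cube_def abs_le_iff)
          define K where "K = (\<integral>\<^sup>+s. ennreal \<bar>g (x(i := s))\<bar> * indicator {-m..m} s \<partial>lborel)"
          have Gle: "ennreal \<bar>G (x(i := t))\<bar> \<le> K" if t: "t \<in> {-m..m}" for t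
          proof -
            have "integrable lborel (\<lambda>s. g (x(i := s)) * sg t s)"
              using elim by (intro set_integrable_sg) (auto simp: good_def)
            from integral_norm_bound_ennreal[OF this]
            have "ennreal \<bar>G (x(i := t))\<bar> \<le> (\<integral>\<^sup>+s. ennreal (norm (g (x(i := s)) * sg t s)) \<partial>lborel)"
              by (simp add: G_line)
            also have "\<dots> \<le> K"
              unfolding K_def using t by (intro nn_integral_mono) (auto simp: sg_def indicator_def)
            finally show ?thesis .
          qed
          have "(\<integral>\<^sup>+t. ennreal (norm (indicator (cube m) (x(i := t)) * G (x(i := t)))) \<partial>lborel) \<le> (\<integral>\<^sup>+t. K * indicator {-m..m} t \<partial>lborel)"
            using Gle c by (intro nn_integral_mono) (auto simp: indicator_def)
          also have "\<dots> = K * ennreal (2 * m)"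
            using m by (subst nn_integral_cmult_indicator) auto
          also have "\<dots> = (\<integral>\<^sup>+t. ennreal (2 * m) * (ennreal \<bar>g (x(i := t))\<bar> * indicator {-m..m} t) \<partial>lborel)"
            unfolding K_def by (subst nn_integral_cmult) (auto simp: mult.commute)
          also have "\<dots> = (\<integral>\<^sup>+t. ennreal (2 * m) * ennreal (norm (indicator (cube m) (x(i := t)) * g (x(i := t)))) \<partial>lborel)"
            using c by (intro nn_integral_cong) (auto simp: indicator_def)
          finally show ?thesis .
        qed
      qed
    qed measurable
    also have "\<dots> = ennreal (2 * m) * (\<integral>\<^sup>+x. ennreal (norm (indicator (cube m) x * g x)) \<partial>lborel_fun)"
      by (rule nn_integral_cmult) measurable
    also have "\<dots> < \<infinity>"
      using g_loc[of m] by (auto simp: integrable_iff_bounded ennreal_mult_less_top)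
    finally show "(\<integral>\<^sup>+x. ennreal (norm (indicator (cube m) x * G x)) \<partial>lborel_fun) < \<infinity>" .
  qed
qed

definition U :: "('n \<Rightarrow> real) \<Rightarrow> real" where "U x = f x - G x"

lemma measurable_U[measurable]: "U \<in> borel_measurable lborel_fun"
  unfolding U_def by measurable

lemma U_loc: "integrable lborel_fun (\<lambda>x. indicator (cube m) x * U x)"
  using Bochner_Integration.integrable_diff[OF f_loc[of m] G_loc[of m]]
  by (simp add: U_def right_diff_distrib)

text \<open>On almost every line G is absolutely continuous with derivative g, so it has the same
  weak derivative as f.\<close>

lemma weak_U:
  assumes sm: "\<And>j. smooth_fun (\<theta> j)" and supp: "\<And>j t. \<theta> j t \<noteq> 0 \<Longrightarrow> \<bar>t\<bar> \<le> m"
    and sm': "smooth_fun \<theta>'" and d: "\<And>t. (\<theta> i has_real_derivative \<theta>' t) (at t)"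
  shows "(LINT x|lborel_fun. U x * (\<Prod>j\<in>UNIV. (\<theta>(i := \<theta>')) j (x j))) = 0"
proof -
  have supp': "(\<theta>(i := \<theta>')) j t \<noteq> 0 \<Longrightarrow> \<bar>t\<bar> \<le> m" for j t
    using supp deriv_support[of "\<theta> i" m \<theta>' t] supp[of i] d by (cases "j = i") auto
  have sm2: "smooth_fun ((\<theta>(i := \<theta>')) j)" for j using sm sm' by auto
  have ex: "\<exists>C. \<forall>j t. \<bar>\<eta> j t\<bar> \<le> C j" if "\<And>j. smooth_fun (\<eta> j)" "\<And>j t. \<eta> j t \<noteq> 0 \<Longrightarrow> \<bar>t\<bar> \<le> m"
    for \<eta> :: "'n \<Rightarrow> real \<Rightarrow> real"
  proof -
    have "\<exists>C. \<forall>t. \<bar>\<eta> j t\<bar> \<le> C" for j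
      by (rule bounded_of_compact_support[OF smooth_fun_continuous[OF that(1)] that(2)])
    then show ?thesis by (intro choice) blast
  qed
  obtain C where C: "\<And>j t. \<bar>\<theta> j t\<bar> \<le> C j" using ex[of \<theta>] sm supp by blast
  obtain C' where C': "\<And>j t. \<bar>(\<theta>(i := \<theta>')) j t\<bar> \<le> C' j" using ex[of "\<theta>(i := \<theta>')"] sm2 supp' by blast
  have meas: "\<theta> j \<in> borel_measurable borel" "(\<theta>(i := \<theta>')) j \<in> borel_measurable borel" for j
    by (intro borel_measurable_continuous_onI smooth_fun_continuous sm sm2)+
  let ?P = "\<lambda>x. \<Prod>j\<in>UNIV. \<theta> j (x j)" and ?P' = "\<lambda>x. \<Prod>j\<in>UNIV. (\<theta>(i := \<theta>')) j (x j)"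
  have if': "integrable lborel_fun (\<lambda>x. f x * ?P' x)"
    by (rule integrable_mult_test[OF f_loc meas(2) C' supp'])
  have iG': "integrable lborel_fun (\<lambda>x. G x * ?P' x)"
    by (rule integrable_mult_test[OF G_loc meas(2) C' supp'])
  have ig: "integrable lborel_fun (\<lambda>x. g x * ?P x)"
    by (rule integrable_mult_test[OF g_loc meas(1) C supp])
  have "(LINT x|lborel_fun. G x * ?P' x) = (LINT x|lborel_fun. - (g x * ?P x))"
  proof (rule integral_lborel_fun_line_cong[where i = i, OF iG'])
    show "integrable lborel_fun (\<lambda>x. - (g x * ?P x))" using ig by simp
    show "AE x in lborel_fun. (LINT t|lborel. G (x(i := t)) * ?P' (x(i := t))) = (LINT t|lborel. - (g (x(i := t)) * ?P (x(i := t))))"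
      using AE_good
    proof eventually_elim
      case (elim x)
      let ?c = "\<Prod>j\<in>UNIV - {i}. \<theta> j (x j)"
      define k where "k = \<bar>m\<bar> + 1"
      have acG: "ac (\<lambda>t. G (x(i := t))) (\<lambda>t. g (x(i := t)))" by (rule ac_G[OF elim])
      have ac\<theta>: "ac (\<theta> i) \<theta>'"
        by (rule ac_C1[OF d smooth_fun_continuous[OF sm']])
      have z: "\<theta> i t = 0" "\<theta>' t = 0" if "t \<notin> {-k..k}" for t
      proof -
        have "\<not> \<bar>t\<bar> \<le> m" using that abs_ge_self[of m] unfolding k_def atLeastAtMost_iff by linarith
        then show "\<theta> i t = 0" "\<theta>' t = 0" using supp[of i t] supp'[of i t] by auto
      qed
      have zk: "\<theta> i k = 0" "\<theta> i (-k) = 0"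
      proof -
        have "\<not> \<bar>k\<bar> \<le> m" "\<not> \<bar>- k\<bar> \<le> m" unfolding k_def by linarith+
        then show "\<theta> i k = 0" "\<theta> i (-k) = 0" using supp[of i k] supp[of i "-k"] by auto
      qed
      have i1: "set_integrable lborel {-k..k} (\<lambda>t. g (x(i := t)) * \<theta> i t)"
        by (intro set_integrable_continuous_mult ac_integrable[OF acG] ac_continuous[OF ac\<theta>])
      have i2: "set_integrable lborel {-k..k} (\<lambda>t. \<theta>' t * G (x(i := t)))"
        by (intro set_integrable_continuous_mult ac_integrable[OF ac\<theta>] ac_continuous[OF acG])
      have "0 = (LBINT t:{-k..k}. g (x(i := t)) * \<theta> i t + \<theta>' t * G (x(i := t)))"
        using ac_diff[OF ac_mult[OF acG ac\<theta>], of "-k" k] zk by (simp add: k_def)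
      also have "\<dots> = (LBINT t:{-k..k}. g (x(i := t)) * \<theta> i t) + (LBINT t:{-k..k}. \<theta>' t * G (x(i := t)))"
        by (rule set_integral_add(2)[OF i1 i2])
      also have "(LBINT t:{-k..k}. g (x(i := t)) * \<theta> i t) = (LINT t|lborel. g (x(i := t)) * \<theta> i t)"
        unfolding set_lebesgue_integral_def using z
        by (intro Bochner_Integration.integral_cong) (auto simp: indicator_def)
      also have "(LBINT t:{-k..k}. \<theta>' t * G (x(i := t))) = (LINT t|lborel. G (x(i := t)) * \<theta>' t)"
        unfolding set_lebesgue_integral_def using z
        by (intro Bochner_Integration.integral_cong) (auto simp: indicator_def)
      finally have main: "(LINT t|lborel. G (x(i := t)) * \<theta>' t) = - (LINT t|lborel. g (x(i := t)) * \<theta> i t)"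
        by linarith
      have P: "?P (x(i := t)) = \<theta> i t * ?c" for t by (rule prod_upd)
      have P': "?P' (x(i := t)) = \<theta>' t * ?c" for t
        unfolding prod_upd[of "\<theta>(i := \<theta>')"] by (auto intro!: prod.cong)
      have "(LINT t|lborel. G (x(i := t)) * ?P' (x(i := t))) = (LINT t|lborel. G (x(i := t)) * \<theta>' t) * ?c"
        unfolding P' by (simp flip: mult.assoc)
      also have "\<dots> = (LINT t|lborel. - (g (x(i := t)) * ?P (x(i := t))))"
        unfolding main P by (simp flip: mult.assoc)
      finally show ?case .
    qed
  qed
  then have "(LINT x|lborel_fun. G x * ?P' x) = (LINT x|lborel_fun. f x * ?P' x)"
    using weak[where \<theta> = \<theta> and m = m and \<theta>' = \<theta>'] sm supp sm' d by simp
  then show ?thesis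
    using if' iG' by (simp add: U_def left_diff_distrib Bochner_Integration.integral_diff)
qed

end

text \<open>The integral of \<open>B lo hi k\<close> is (hi - lo) - 1 / (k + 2). The quotient in the
  derivative of \<Theta> is the ratio of the integrals over \<open>B lo hi k\<close> and
  \<open>B 0 1 k\<close>, so this derivative has mean zero, which gives its primitive compact
  support.\<close>

lemma smooth_interval_approx:
  obtains B :: "real \<Rightarrow> real \<Rightarrow> nat \<Rightarrow> real \<Rightarrow> real" and \<Theta> :: "real \<Rightarrow> real \<Rightarrow> nat \<Rightarrow> real \<Rightarrow> real"
  where "\<And>lo hi k. smooth_fun (B lo hi k)"
    and "\<And>lo hi k t. lo < hi \<Longrightarrow> \<bar>B lo hi k t\<bar> \<le> 1"
    and "\<And>lo hi k t. B lo hi k t \<noteq> 0 \<Longrightarrow> \<bar>t\<bar> \<le> \<bar>lo\<bar> + \<bar>hi\<bar> + 1"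
    and "\<And>lo hi t. lo < hi \<Longrightarrow> (\<lambda>k. B lo hi k t) \<longlonglongrightarrow> indicator {lo<..<hi} t"
    and "\<And>lo hi k. smooth_fun (\<Theta> lo hi k)"
    and "\<And>lo hi k t. (\<Theta> lo hi k has_real_derivative B lo hi k t - ((real k + 2) * (hi - lo) - 1) / (real k + 1) * B 0 1 k t) (at t)"
    and "\<And>lo hi k t. \<Theta> lo hi k t \<noteq> 0 \<Longrightarrow> \<bar>t\<bar> \<le> \<bar>lo\<bar> + \<bar>hi\<bar> + 2"
proof -
  obtain \<sigma> :: "real \<Rightarrow> real" where \<sigma>: "smooth_fun \<sigma>" and \<sigma>0: "\<And>x. x \<le> 0 \<Longrightarrow> \<sigma> x = 0"
    and \<sigma>1: "\<And>x. x \<ge> 1 \<Longrightarrow> \<sigma> x = 1" and \<sigma>_nonneg: "\<And>x. 0 \<le> \<sigma> x" and \<sigma>_le: "\<And>x. \<sigma> x \<le> 1"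
    using smooth_step by blast
  obtain S where S: "\<And>x. (S has_real_derivative \<sigma> x) (at x)" and S0: "S 0 = 0"
    using continuous_antiderivative[of \<sigma>] smooth_fun_continuous[OF \<sigma>] by blast
  have smS: "smooth_fun S" by (rule smooth_fun.antideriv[OF \<sigma> S])
  have acS: "ac S \<sigma>" by (rule ac_C1[OF S smooth_fun_continuous[OF \<sigma>]])
  have S_neg: "S y = 0" if "y \<le> 0" for y
  proof -
    have "S 0 - S y = (LBINT x:{y..0}. \<sigma> x)" by (rule ac_diff[OF acS that])
    also have "\<dots> = (LBINT x:{y..0}. 0)"
      unfolding set_lebesgue_integral_def by (intro Bochner_Integration.integral_cong) (auto simp: indicator_def \<sigma>0)
    finally show ?thesis using S0 by simp
  qed
  have S_pos: "S y = S 1 + (y - 1)" if "y \<ge> 1" for y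
  proof -
    have "S y - S 1 = (LBINT x:{1..y}. \<sigma> x)" by (rule ac_diff[OF acS that])
    also have "\<dots> = (LBINT x:{1..y}. 1)"
      unfolding set_lebesgue_integral_def by (intro Bochner_Integration.integral_cong) (auto simp: indicator_def \<sigma>1)
    finally show ?thesis using that by (simp add: set_lebesgue_integral_def)
  qed
  \<comment> \<open>The offset 1 makes the falling edge end at hi instead of starting there. The
    slope k + 2 keeps the integral (k + 1) / (k + 2) of \<open>B 0 1 k\<close> away from 0 even for
    k = 0.\<close>
  define B where "B lo hi k t = \<sigma> ((real k + 2) * t + - (real k + 2) * lo) + (- 1) * \<sigma> ((real k + 2) * t + (1 - (real k + 2) * hi))"
    for lo hi t :: real and k :: nat
  define Q where "Q lo hi k t = S ((real k + 2) * t + - (real k + 2) * lo) + (- 1) * S ((real k + 2) * t + (1 - (real k + 2) * hi))"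
    for lo hi t :: real and k :: nat
  define r where "r lo hi k = ((real k + 2) * (hi - lo) - 1) / (real k + 1)" for lo hi :: real and k :: nat
  define \<Theta> where "\<Theta> lo hi k t = (1 / (real k + 2)) * (Q lo hi k t + (- r lo hi k) * Q 0 1 k t)" for lo hi t :: real and k :: nat
  have lower: "(real k + 2) * (t - s) \<le> - 1" if "t \<le> s - 1" for k :: nat and t s :: real
  proof -
    have "(real k + 2) * (t - s) \<le> (real k + 2) * (- 1)" using that by (intro mult_left_mono) auto
    also have "\<dots> \<le> - 1" by simp
    finally show ?thesis .
  qed
  have upper: "(real k + 2) * (t - s) \<ge> 1" if "t \<ge> s + 1" for k :: nat and t s :: real
  proof -
    have "(1::real) \<le> (real k + 2) * 1" by simp
    also have "\<dots> \<le> (real k + 2) * (t - s)" using that by (intro mult_left_mono) auto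
    finally show ?thesis .
  qed
  have args: "(real k + 2) * t + - (real k + 2) * s = (real k + 2) * (t - s)"
    "(real k + 2) * t + (1 - (real k + 2) * s) = (real k + 2) * (t - s) + 1" for k :: nat and t s :: real
    by (auto simp: algebra_simps)
  have dQ: "(Q lo hi k has_real_derivative (real k + 2) * B lo hi k t) (at t)" for lo hi k t
  proof -
    have 1: "((\<lambda>t. S ((real k + 2) * t + c)) has_real_derivative \<sigma> ((real k + 2) * t + c) * (real k + 2)) (at t)" for c
    proof -
      have "((\<lambda>t. (real k + 2) * t + c) has_real_derivative (real k + 2)) (at t)"
        using DERIV_add[OF DERIV_cmult_Id[of "real k + 2" t UNIV] DERIV_const[of c]] by simp
      then show ?thesis
        using DERIV_chain2[where f = S and g = "\<lambda>t. (real k + 2) * t + c"] S by blast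
    qed
    show ?thesis
      unfolding Q_def B_def using DERIV_add[OF 1 DERIV_cmult[OF 1, of "-1"]]
      by (rule DERIV_cong) (simp add: algebra_simps)
  qed
  have smB: "smooth_fun (B lo hi k)" for lo hi k
    unfolding B_def by (rule smooth_fun.add[OF smooth_fun.affine[OF \<sigma>] smooth_fun.mult[OF smooth_fun.const smooth_fun.affine[OF \<sigma>]]])
  have smQ: "smooth_fun (Q lo hi k)" for lo hi k
    unfolding Q_def by (rule smooth_fun.add[OF smooth_fun.affine[OF smS] smooth_fun.mult[OF smooth_fun.const smooth_fun.affine[OF smS]]])
  have Q_low: "Q lo hi k t = 0" if "t \<le> lo" "t \<le> hi - 1" for lo hi k t
    unfolding Q_def args using that lower[of t hi k] by (simp add: S_neg mult_nonneg_nonpos)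
  have Q_high: "Q lo hi k t = (real k + 2) * (hi - lo) - 1" if "t \<ge> lo + 1" "t \<ge> hi" for lo hi k t
  proof -
    have 1: "S ((real k + 2) * (t - lo)) = S 1 + ((real k + 2) * (t - lo) - 1)"
      using that(1) by (intro S_pos upper) auto
    have 2: "S ((real k + 2) * (t - hi) + 1) = S 1 + ((real k + 2) * (t - hi) + 1 - 1)"
      using that(2) by (intro S_pos) simp
    show ?thesis unfolding Q_def args 1 2 by (simp add: algebra_simps)
  qed
  show thesis
  proof (rule that[of B \<Theta>])
    show "smooth_fun (B lo hi k)" for lo hi k by (rule smB)
    show "\<bar>B lo hi k t\<bar> \<le> 1" for lo hi k t
      unfolding B_def using \<sigma>_nonneg \<sigma>_le by (smt (verit))
    show "\<bar>t\<bar> \<le> \<bar>lo\<bar> + \<bar>hi\<bar> + 1" if "B lo hi k t \<noteq> 0" for lo hi k t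
    proof (rule ccontr)
      assume "\<not> \<bar>t\<bar> \<le> \<bar>lo\<bar> + \<bar>hi\<bar> + 1"
      then consider "t \<le> lo" "t \<le> hi - 1" | "t \<ge> lo + 1" "t \<ge> hi" by linarith
      then have "B lo hi k t = 0"
      proof cases
        case 1
        then show ?thesis
          unfolding B_def args using lower[of t hi k] by (simp add: \<sigma>0 mult_nonneg_nonpos)
      next
        case 2
        then show ?thesis
          unfolding B_def args using upper[of lo t k] by (simp add: \<sigma>1)
      qed
      with that show False by simp
    qed
    show "(\<lambda>k. B lo hi k t) \<longlonglongrightarrow> indicator {lo<..<hi} t" if "lo < hi" for lo hi t
    proof (rule tendsto_eventually)
      have big: "\<forall>\<^sub>F k in sequentially. (real k + 2) * d \<ge> 1" if "d > 0" for d :: real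
      proof -
        obtain k0 :: nat where k0: "1 / d \<le> real k0" using real_arch_simple by blast
        have "(real k + 2) * d \<ge> 1" if "k \<ge> k0" for k
        proof -
          have "1 / d \<le> real k + 2" using k0 that by linarith
          then show ?thesis using \<open>d > 0\<close> by (simp add: field_simps)
        qed
        then show ?thesis unfolding eventually_sequentially by blast
      qed
      consider "t \<le> lo" | "lo < t" "t < hi" | "t \<ge> hi" by linarith
      then show "\<forall>\<^sub>F k in sequentially. B lo hi k t = indicator {lo<..<hi} t"
      proof cases
        case 1
        have "\<forall>\<^sub>F k in sequentially. (real k + 2) * (hi - t) \<ge> 1" using 1 that by (intro big) auto
        then show ?thesis
        proof eventually_elim
          case (elim k)
          have "(real k + 2) * (t - hi) + 1 \<le> 0" using elim by (simp add: algebra_simps)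
          then show ?case unfolding B_def args using 1 by (simp add: \<sigma>0 mult_nonneg_nonpos)
        qed
      next
        case 2
        have "\<forall>\<^sub>F k in sequentially. (real k + 2) * (hi - t) \<ge> 1" "\<forall>\<^sub>F k in sequentially. (real k + 2) * (t - lo) \<ge> 1"
          using 2 by (auto intro!: big)
        then show ?thesis
        proof eventually_elim
          case (elim k)
          have "(real k + 2) * (t - hi) + 1 \<le> 0" using elim(1) by (simp add: algebra_simps)
          then show ?case unfolding B_def args using 2 elim(2) by (simp add: \<sigma>0 \<sigma>1)
        qed
      next
        case 3
        have "\<forall>\<^sub>F k in sequentially. (real k + 2) * (t - lo) \<ge> 1" using 3 that by (intro big) auto
        then show ?thesis
        proof eventually_elim
          case (elim k)
          then show ?case unfolding B_def args using 3 by (simp add: \<sigma>1)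
        qed
      qed
    qed
    show "smooth_fun (\<Theta> lo hi k)" for lo hi k
      unfolding \<Theta>_def by (rule smooth_fun.mult[OF smooth_fun.const smooth_fun.add[OF smQ smooth_fun.mult[OF smooth_fun.const smQ]]])
    show "(\<Theta> lo hi k has_real_derivative B lo hi k t - ((real k + 2) * (hi - lo) - 1) / (real k + 1) * B 0 1 k t) (at t)" for lo hi k t
      unfolding \<Theta>_def using DERIV_cmult[OF DERIV_add[OF dQ DERIV_cmult[OF dQ, of "- r lo hi k"]], of "1 / (real k + 2)"]
    proof (rule DERIV_cong)
      have "1 / K * (K * X + - R * (K * Y)) = X - R * Y" if "K \<noteq> 0" for K R X Y :: real
        using that by (simp add: field_simps)
      from this[of "real k + 2" "B lo hi k t" "r lo hi k" "B 0 1 k t"]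
      show "1 / (real k + 2) * ((real k + 2) * B lo hi k t + - r lo hi k * ((real k + 2) * B 0 1 k t)) =
          B lo hi k t - ((real k + 2) * (hi - lo) - 1) / (real k + 1) * B 0 1 k t"
        unfolding r_def[symmetric] by (simp add: add_eq_0_iff)
    qed
    show "\<bar>t\<bar> \<le> \<bar>lo\<bar> + \<bar>hi\<bar> + 2" if "\<Theta> lo hi k t \<noteq> 0" for lo hi k t
    proof (rule ccontr)
      assume "\<not> \<bar>t\<bar> \<le> \<bar>lo\<bar> + \<bar>hi\<bar> + 2"
      then consider "t \<le> lo" "t \<le> hi - 1" "t \<le> 0" | "t \<ge> lo + 1" "t \<ge> hi" "t \<ge> 1" by linarith
      then have "Q lo hi k t + (- r lo hi k) * Q 0 1 k t = 0"
      proof cases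
        case 1
        then show ?thesis by (simp add: Q_low)
      next
        case 2
        have "Q 0 1 k t = real k + 1" using Q_high[of 0 t 1 k] 2 by simp
        then show ?thesis using Q_high[of lo t hi k] 2 by (simp add: r_def)
      qed
      then show False using that by (simp add: \<Theta>_def)
    qed
  qed
qed

section \<open>A vanishing weak derivative means independence of the coordinate\<close>

context weak_partial
begin

lemma obox_upd: "obox l u (x(i := t)) = indicator {l i<..<u i} t * (\<Prod>j\<in>UNIV - {i}. indicator {l j<..<u j} (x j))"
  unfolding obox_def by (rule prod_upd)

text \<open>Testing with primitives of \<open>1\<^bsub>(l\<^sub>i,u\<^sub>i)\<^esub> - (u\<^sub>i - l\<^sub>i) 1\<^bsub>(0,1)\<^esub>\<close> in the \<open>i\<close>-th variable,
  which have compact support.\<close>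

lemma integral_U_box:
  assumes lu: "\<And>j. l j < u j"
  shows "(LINT x|lborel_fun. U x * obox l u x) =
    (u i - l i) * (LINT x|lborel_fun. U x * obox (l(i := 0)) (u(i := 1)) x)"
    and "integrable lborel_fun (\<lambda>x. U x * obox l u x)"
proof -
  obtain B \<Theta> :: "real \<Rightarrow> real \<Rightarrow> nat \<Rightarrow> real \<Rightarrow> real"
    where smB: "\<And>lo hi k. smooth_fun (B lo hi k)"
    and B1: "\<And>lo hi k t. lo < hi \<Longrightarrow> \<bar>B lo hi k t\<bar> \<le> 1"
    and Bs: "\<And>lo hi k t. B lo hi k t \<noteq> 0 \<Longrightarrow> \<bar>t\<bar> \<le> \<bar>lo\<bar> + \<bar>hi\<bar> + 1"
    and Blim: "\<And>lo hi t. lo < hi \<Longrightarrow> (\<lambda>k. B lo hi k t) \<longlonglongrightarrow> indicator {lo<..<hi} t"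
    and sm\<Theta>: "\<And>lo hi k. smooth_fun (\<Theta> lo hi k)"
    and d\<Theta>: "\<And>lo hi k t. (\<Theta> lo hi k has_real_derivative B lo hi k t - ((real k + 2) * (hi - lo) - 1) / (real k + 1) * B 0 1 k t) (at t)"
    and \<Theta>s: "\<And>lo hi k t. \<Theta> lo hi k t \<noteq> 0 \<Longrightarrow> \<bar>t\<bar> \<le> \<bar>lo\<bar> + \<bar>hi\<bar> + 2"
    by (rule smooth_interval_approx) (rule that)
  define d where "d = u i - l i"
  have d: "d > 0" using lu[of i] by (simp add: d_def)
  \<comment> \<open>A cube large enough for the supports of all approximations, those of (0, 1)
    included.\<close>
  define m where "m = (\<Sum>j\<in>UNIV. \<bar>l j\<bar> + \<bar>u j\<bar>) + 2"
  have m: "\<bar>l j\<bar> + \<bar>u j\<bar> + 2 \<le> m" for j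
    unfolding m_def using member_le_sum[of j UNIV "\<lambda>j. \<bar>l j\<bar> + \<bar>u j\<bar>"] by auto
  have m2: "2 \<le> m" using m[of i] by linarith
  define r where "r k = ((real k + 2) * d - 1) / (real k + 1)" for k :: nat
  have r_eq: "r k = d + (d - 1) / (real k + 1)" for k
  proof -
    have "real k + 1 \<noteq> 0" by linarith
    then show ?thesis unfolding r_def by (simp add: field_simps)
  qed
  have r_lim: "r \<longlonglongrightarrow> d"
  proof -
    have "(\<lambda>k. d + (d - 1) / real (Suc k)) \<longlonglongrightarrow> d + 0"
      by (intro tendsto_add tendsto_const LIMSEQ_Suc[OF lim_const_over_n])
    then show ?thesis by (simp add: r_eq[abs_def] add.commute)
  qed
  have r_bnd: "\<bar>r k\<bar> \<le> d + \<bar>d - 1\<bar>" for k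
  proof -
    have "\<bar>(d - 1) / (real k + 1)\<bar> \<le> \<bar>d - 1\<bar> / 1"
      unfolding abs_divide by (intro divide_left_mono) auto
    then have "\<bar>(d - 1) / (real k + 1)\<bar> \<le> \<bar>d - 1\<bar>" by simp
    then show ?thesis unfolding r_eq using d by (smt (verit))
  qed
  \<comment> \<open>The derivative of the i-th factor. The other factors approximate indicators, so
    the tested products tend to a difference of two box indicators, the second one with factor
    d.\<close>
  define \<eta> where "\<eta> k t = B (l i) (u i) k t - r k * B 0 1 k t" for k t
  define \<theta> where "\<theta> k j = (if j = i then \<Theta> (l i) (u i) k else B (l j) (u j) k)" for k j
  have sm\<eta>: "smooth_fun (\<eta> k)" for k
  proof -
    have eq: "\<eta> k = (\<lambda>t. B (l i) (u i) k t + (- r k) * B 0 1 k t)" by (auto simp: \<eta>_def)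
    show ?thesis unfolding eq by (rule smooth_fun.add[OF smB smooth_fun.mult[OF smooth_fun.const smB]])
  qed
  have z: "(LINT x|lborel_fun. U x * (\<Prod>j\<in>UNIV. ((\<theta> k)(i := \<eta> k)) j (x j))) = 0" for k
  proof (rule weak_U[where m = m])
    show "smooth_fun (\<theta> k j)" for j by (auto simp: \<theta>_def smB sm\<Theta>)
    show "\<bar>t\<bar> \<le> m" if "\<theta> k j t \<noteq> 0" for j t
    proof (cases "j = i")
      case True
      then show ?thesis using that \<Theta>s[of "l i" "u i" k t] m[of i] by (simp add: \<theta>_def)
    next
      case False
      then show ?thesis using that Bs[of "l j" "u j" k t] m[of j] by (simp add: \<theta>_def)
    qed
    show "smooth_fun (\<eta> k)" by (rule sm\<eta>)
    show "(\<theta> k i has_real_derivative \<eta> k t) (at t)" for t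
      using d\<Theta>[of "l i" "u i" k t] by (simp add: \<theta>_def \<eta>_def r_def d_def)
  qed
  have P: "(\<Prod>j\<in>UNIV. ((\<theta> k)(i := \<eta> k)) j (x j)) = \<eta> k (x i) * (\<Prod>j\<in>UNIV - {i}. B (l j) (u j) k (x j))" for k x
    by (subst prod.remove[of UNIV i]) (auto intro!: prod.cong simp: \<theta>_def)
  define L where "L x = U x * obox l u x - d * (U x * obox (l(i := 0)) (u(i := 1)) x)" for x
  have oi: "obox l' u' x = indicator {l' i<..<u' i} (x i) * (\<Prod>j\<in>UNIV - {i}. indicator {l' j<..<u' j} (x j))" for l' u' x
    using prod_upd[of "\<lambda>j. indicator {l' j<..<u' j}" x i "x i"] unfolding obox_def by simp
  have Lx: "L x = U x * ((indicator {l i<..<u i} (x i) - d * indicator {0<..<1} (x i)) * (\<Prod>j\<in>UNIV - {i}. indicator {l j<..<u j} (x j)))" for x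
  proof -
    have "(\<Prod>j\<in>UNIV - {i}. indicator {(l(i := 0)) j<..<(u(i := 1)) j} (x j)) = (\<Prod>j\<in>UNIV - {i}. indicator {l j<..<u j} (x j) :: real)"
      by (intro prod.cong) auto
    then show ?thesis unfolding L_def oi by (simp add: algebra_simps)
  qed
  have [measurable]: "B lo hi k \<in> borel_measurable borel" for lo hi k
    by (intro borel_measurable_continuous_onI smooth_fun_continuous smB)
  have [measurable]: "\<eta> k \<in> borel_measurable borel" for k
    unfolding \<eta>_def by measurable
  have iU: "integrable lborel_fun (\<lambda>x. U x * obox l' u' x)" if "\<And>j. \<bar>l' j\<bar> + \<bar>u' j\<bar> \<le> m" for l' u'
    unfolding obox_def
  proof (rule integrable_mult_test[OF U_loc, where C = "\<lambda>_. 1" and m = m])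
    show "\<bar>t\<bar> \<le> m" if "indicator {l' j<..<u' j} t \<noteq> (0::real)" for j t
      using that \<open>\<And>j. \<bar>l' j\<bar> + \<bar>u' j\<bar> \<le> m\<close>[of j] by (auto simp: indicator_def split: if_splits)
  qed auto
  have "(\<lambda>k. LINT x|lborel_fun. U x * (\<Prod>j\<in>UNIV. ((\<theta> k)(i := \<eta> k)) j (x j))) \<longlonglongrightarrow> (LINT x|lborel_fun. L x)"
  proof (rule integral_dominated_convergence[where w = "\<lambda>x. (1 + (d + \<bar>d - 1\<bar>)) * \<bar>indicator (cube m) x * U x\<bar>"])
    show "integrable lborel_fun (\<lambda>x. (1 + (d + \<bar>d - 1\<bar>)) * \<bar>indicator (cube m) x * U x\<bar>)"
      by (intro integrable_mult_right integrable_abs U_loc)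
    show "L \<in> borel_measurable lborel_fun" unfolding L_def by measurable
    show "(\<lambda>x. U x * (\<Prod>j\<in>UNIV. ((\<theta> k)(i := \<eta> k)) j (x j))) \<in> borel_measurable lborel_fun" for k
      unfolding P by measurable
    show "AE x in lborel_fun. (\<lambda>k. U x * (\<Prod>j\<in>UNIV. ((\<theta> k)(i := \<eta> k)) j (x j))) \<longlonglongrightarrow> L x"
      unfolding P Lx \<eta>_def
      by (intro AE_I2 tendsto_mult tendsto_const tendsto_diff tendsto_prod Blim r_lim) (auto simp: lu)
    show "AE x in lborel_fun. norm (U x * (\<Prod>j\<in>UNIV. ((\<theta> k)(i := \<eta> k)) j (x j))) \<le> (1 + (d + \<bar>d - 1\<bar>)) * \<bar>indicator (cube m) x * U x\<bar>" for k
    proof (rule AE_I2)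
      fix x
      let ?R = "\<Prod>j\<in>UNIV - {i}. B (l j) (u j) k (x j)"
      have e: "\<bar>\<eta> k t\<bar> \<le> 1 + (d + \<bar>d - 1\<bar>)" for t
      proof -
        have "\<bar>r k * B 0 1 k t\<bar> \<le> (d + \<bar>d - 1\<bar>) * 1"
          unfolding abs_mult using r_bnd[of k] B1[of 0 1 k t] d by (intro mult_mono) auto
        then show ?thesis
          using B1[OF lu[of i], of k t] abs_triangle_ineq4[of "B (l i) (u i) k t" "r k * B 0 1 k t"]
          unfolding \<eta>_def by simp
      qed
      have R: "\<bar>?R\<bar> \<le> 1"
        unfolding abs_prod using B1[OF lu] by (intro prod_le_1) auto
      show "norm (U x * (\<Prod>j\<in>UNIV. ((\<theta> k)(i := \<eta> k)) j (x j))) \<le> (1 + (d + \<bar>d - 1\<bar>)) * \<bar>indicator (cube m) x * U x\<bar>"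
      proof (cases "x \<in> cube m")
        case True
        have "\<bar>\<eta> k (x i) * ?R\<bar> \<le> (1 + (d + \<bar>d - 1\<bar>)) * 1"
          unfolding abs_mult using e R d by (intro mult_mono) auto
        then have "\<bar>\<eta> k (x i) * ?R\<bar> * \<bar>U x\<bar> \<le> (1 + (d + \<bar>d - 1\<bar>)) * \<bar>U x\<bar>"
          by (intro mult_right_mono) auto
        then show ?thesis unfolding P using True by (simp add: abs_mult mult_ac)
      next
        case False
        then obtain j where j: "m < \<bar>x j\<bar>" by (auto simp: cube_def not_le)
        have zz: "\<eta> k (x i) * ?R = 0"
        proof (cases "j = i")
          case True
          have "B (l i) (u i) k (x i) = 0" "B 0 1 k (x i) = 0"
            using Bs[of "l i" "u i" k "x i"] Bs[of 0 1 k "x i"] m[of i] m2 j True by force+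
          then show ?thesis by (simp add: \<eta>_def)
        next
          case False
          have "B (l j) (u j) k (x j) = 0"
            using Bs[of "l j" "u j" k "x j"] m[of j] j by force
          then have "?R = 0" using False by (intro prod_zero) auto
          then show ?thesis by simp
        qed
        show ?thesis unfolding P zz using d by simp
      qed
    qed
  qed
  then have L0: "(LINT x|lborel_fun. L x) = 0"
    unfolding z by (simp add: LIMSEQ_const_iff)
  have b1: "\<bar>l j\<bar> + \<bar>u j\<bar> \<le> m" for j using m[of j] by linarith
  have b2: "\<bar>(l(i := 0)) j\<bar> + \<bar>(u(i := 1)) j\<bar> \<le> m" for j using b1[of j] m2 by (cases "j = i") auto
  show "integrable lborel_fun (\<lambda>x. U x * obox l u x)" by (rule iU[OF b1])
  show "(LINT x|lborel_fun. U x * obox l u x) = (u i - l i) * (LINT x|lborel_fun. U x * obox (l(i := 0)) (u(i := 1)) x)"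
    using L0 iU[OF b1] iU[OF b2] unfolding L_def d_def by (simp add: Bochner_Integration.integral_diff)
qed

text \<open>The mean of U over a unit interval on the line, which is the value of U if U is constant
  there.\<close>

definition c :: "('n \<Rightarrow> real) \<Rightarrow> real" where "c x = (LINT s|lborel. U (x(i := s)) * indicator {0<..<1} s)"

lemma c_upd: "c (x(i := t)) = c x"
  by (simp add: c_def)

lemma measurable_c[measurable]: "c \<in> borel_measurable lborel_fun"
proof -
  have [measurable]: "(\<lambda>z. U ((fst z)(i := snd z))) \<in> borel_measurable (lborel_fun \<Otimes>\<^sub>M lborel)"
    by (rule measurable_compose[OF _ measurable_U]) measurable
  show ?thesis
    unfolding c_def
    by (rule lborel.borel_measurable_lebesgue_integral) (unfold case_prod_unfold, measurable)
qed

text \<open>By \<open>integral_U_box\<close>, integrals of U over boxes are proportional to the i-th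
  side length. Hence c, which is constant in that coordinate, has the same integrals over boxes as
  U.\<close>

lemma AE_U_eq_c: "AE x in lborel_fun. U x = c x"
proof -
  have H: "integrable lborel_fun (\<lambda>x. c x * obox l u x) \<and>
      (LINT x|lborel_fun. c x * obox l u x) = (LINT x|lborel_fun. U x * obox l u x)"
    if lu: "\<forall>j. l j < u j" for l u
  proof -
    let ?l = "l(i := 0)" and ?u = "u(i := 1)"
    have lu': "?l j < ?u j" for j using lu by auto
    have iU: "integrable lborel_fun (\<lambda>x. (u i - l i) * (U x * obox ?l ?u x))"
      using integral_U_box(2)[of ?l ?u] lu' by simp
    define Q where "Q x = (\<Prod>j\<in>UNIV - {i}. indicator {l j<..<u j} (x j) :: real)" for x
    have Q: "Q x \<ge> 0" for x unfolding Q_def by (intro prod_nonneg) auto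
    have o1: "obox l u (x(i := t)) = indicator {l i<..<u i} t * Q x" for x t
      by (simp add: obox_upd Q_def)
    have o2: "obox ?l ?u (x(i := t)) = indicator {0<..<1} t * Q x" for x t
      unfolding obox_upd[of ?l] Q_def by (auto intro!: prod.cong)
    have [measurable]: "(\<lambda>t. U (x(i := t))) \<in> borel_measurable borel" for x
      by (rule measurable_compose[OF _ measurable_U]) simp
    have "(\<lambda>x. c x * obox l u x) \<in> borel_measurable lborel_fun"
      by (intro borel_measurable_times measurable_c measurable_obox)
    then have m1: "(\<lambda>x. ennreal (norm (c x * obox l u x))) \<in> borel_measurable lborel_fun"
      by measurable
    have m2: "(\<lambda>x. ennreal (norm ((u i - l i) * (U x * obox ?l ?u x)))) \<in> borel_measurable lborel_fun"
      using borel_measurable_integrable[OF iU] by measurable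
    have i1: "integrable lborel_fun (\<lambda>x. c x * obox l u x)"
    proof (rule integrableI_bounded)
      have "(\<integral>\<^sup>+x. ennreal (norm (c x * obox l u x)) \<partial>lborel_fun) \<le>
          (\<integral>\<^sup>+x. ennreal (norm ((u i - l i) * (U x * obox ?l ?u x))) \<partial>lborel_fun)"
      proof (rule nn_integral_lborel_fun_line_mono[where i = i, OF m1 m2], rule AE_I2)
        fix x :: "'n \<Rightarrow> real"
        define K where "K = (\<integral>\<^sup>+s. ennreal (norm (U (x(i := s)) * indicator {0<..<1} s)) \<partial>lborel)"
        \<comment> \<open>If the line integral does not exist, c x is 0 by default and the estimate
          is trivial.\<close>
        have cK: "ennreal \<bar>c x\<bar> \<le> K"
        proof (cases "integrable lborel (\<lambda>s. U (x(i := s)) * indicator {0<..<1} s)")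
          case True
          from integral_norm_bound_ennreal[OF this] show ?thesis by (simp add: c_def K_def)
        next
          case False
          then show ?thesis by (simp add: c_def not_integrable_integral_eq)
        qed
        have "(\<integral>\<^sup>+t. ennreal (norm (c (x(i := t)) * obox l u (x(i := t)))) \<partial>lborel) =
            (\<integral>\<^sup>+t. (ennreal \<bar>c x\<bar> * ennreal (Q x)) * indicator {l i<..<u i} t \<partial>lborel)"
          using Q[of x] by (intro nn_integral_cong) (auto simp: c_upd o1 abs_mult indicator_def ennreal_mult)
        also have "\<dots> = (ennreal \<bar>c x\<bar> * ennreal (Q x)) * ennreal (u i - l i)"
          using lu by (subst nn_integral_cmult_indicator) (auto simp: less_imp_le)
        also have "\<dots> \<le> (K * ennreal (Q x)) * ennreal (u i - l i)"
          using cK by (intro mult_right_mono) auto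
        also have "\<dots> = (\<integral>\<^sup>+t. (ennreal (Q x) * ennreal (u i - l i)) * ennreal (norm (U (x(i := t)) * indicator {0<..<1} t)) \<partial>lborel)"
          unfolding K_def by (subst nn_integral_cmult) (auto simp: mult_ac)
        also have "\<dots> = (\<integral>\<^sup>+t. ennreal (norm ((u i - l i) * (U (x(i := t)) * obox ?l ?u (x(i := t))))) \<partial>lborel)"
          using lu Q[of x] unfolding o2
          by (intro nn_integral_cong) (auto simp: abs_mult ennreal_mult[symmetric] less_imp_le mult_ac)
        finally show "(\<integral>\<^sup>+t. ennreal (norm (c (x(i := t)) * obox l u (x(i := t)))) \<partial>lborel) \<le>
            (\<integral>\<^sup>+t. ennreal (norm ((u i - l i) * (U (x(i := t)) * obox ?l ?u (x(i := t))))) \<partial>lborel)" .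
      qed
      also have "\<dots> < \<infinity>" using iU unfolding integrable_iff_bounded by (rule conjunct2)
      finally show "(\<integral>\<^sup>+x. ennreal (norm (c x * obox l u x)) \<partial>lborel_fun) < \<infinity>" .
    qed measurable
    have "(LINT x|lborel_fun. c x * obox l u x) = (LINT x|lborel_fun. (u i - l i) * (U x * obox ?l ?u x))"
    proof (rule integral_lborel_fun_line_cong[where i = i, OF i1 iU], rule AE_I2)
      fix x :: "'n \<Rightarrow> real"
      have "(LINT t|lborel. c (x(i := t)) * obox l u (x(i := t))) = (LINT t|lborel. (c x * Q x) * indicator {l i<..<u i} t)"
        by (intro Bochner_Integration.integral_cong) (auto simp: c_upd o1)
      also have "\<dots> = (c x * Q x) * (u i - l i)"
        using lu by (simp add: less_imp_le)
      also have "\<dots> = (LINT t|lborel. (u i - l i) * Q x * (U (x(i := t)) * indicator {0<..<1} t))"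
        by (simp add: c_def)
      also have "\<dots> = (LINT t|lborel. (u i - l i) * (U (x(i := t)) * obox ?l ?u (x(i := t))))"
        by (intro Bochner_Integration.integral_cong) (auto simp: o2)
      finally show "(LINT t|lborel. c (x(i := t)) * obox l u (x(i := t))) =
          (LINT t|lborel. (u i - l i) * (U (x(i := t)) * obox ?l ?u (x(i := t))))" .
    qed
    then show ?thesis
      using i1 integral_U_box(1)[of l u] lu by simp
  qed
  have "AE x in lborel_fun. U x - c x = 0"
  proof (rule AE_zero_of_boxes)
    show "(\<lambda>x. U x - c x) \<in> borel_measurable lborel_fun" by measurable
    fix l u :: "'n \<Rightarrow> real" assume lu: "\<forall>j. l j < u j"
    show "integrable lborel_fun (\<lambda>x. (U x - c x) * obox l u x)"
      using H[OF lu] integral_U_box(2)[of l u] lu by (simp add: left_diff_distrib)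
    show "(LINT x|lborel_fun. (U x - c x) * obox l u x) = 0"
      using H[OF lu] integral_U_box(2)[of l u] lu
      by (simp add: left_diff_distrib Bochner_Integration.integral_diff)
  qed
  then show ?thesis by eventually_elim simp
qed

lemma ac_lines: "AE x in lborel_fun. \<exists>h. ac h (\<lambda>t. g (x(i := t))) \<and> (AE t in lborel. h t = f (x(i := t)))"
  using AE_lborel_fun_line[OF AE_U_eq_c, of i] AE_good
proof eventually_elim
  case (elim x)
  have "ac (\<lambda>t. G (x(i := t)) + c x) (\<lambda>t. g (x(i := t)))"
    using ac_G[OF elim(2)] by (simp add: ac_def)
  moreover have "AE t in lborel. G (x(i := t)) + c x = f (x(i := t))"
    using elim(1) by eventually_elim (simp add: U_def c_upd)
  ultimately show ?case by blast
qed

end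

section \<open>Gaussians\<close>

text \<open>The positive and the negative part of V define finite measures with the same
  distribution function.\<close>

lemma AE_zero_of_Iic:
  fixes V :: "real \<Rightarrow> real"
  assumes V: "integrable lborel V" and zero: "\<And>x. (LINT r|lborel. V r * indicator {..x} r) = 0"
  shows "AE x in lborel. V x = 0"
proof -
  have [measurable]: "V \<in> borel_measurable borel" using V by auto
  define \<nu> where "\<nu> s = density lborel (\<lambda>x. ennreal (s * V x))" for s
  have fin: "(\<integral>\<^sup>+x. ennreal (s * V x) \<partial>lborel) < \<infinity>" for s
  proof -
    have "integrable lborel (\<lambda>x. s * V x)" using V by simp
    then have "(\<integral>\<^sup>+x. ennreal (norm (s * V x)) \<partial>lborel) < \<infinity>" unfolding integrable_iff_bounded by (rule conjunct2)
    moreover have "(\<integral>\<^sup>+x. ennreal (s * V x) \<partial>lborel) \<le> (\<integral>\<^sup>+x. ennreal (norm (s * V x)) \<partial>lborel)"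
      by (intro nn_integral_mono ennreal_leI) auto
    ultimately show ?thesis by (rule le_less_trans[rotated])
  qed
  have fbm: "finite_borel_measure (\<nu> s)" for s
  proof (intro finite_borel_measure.intro finite_measureI finite_borel_measure_axioms.intro)
    show "emeasure (\<nu> s) (space (\<nu> s)) \<noteq> \<infinity>"
      using fin[of s] by (simp add: \<nu>_def emeasure_density less_top)
    show "sets (\<nu> s) = sets borel" by (simp add: \<nu>_def)
  qed
  have cdf: "cdf (\<nu> s) x = enn2real (\<integral>\<^sup>+r. ennreal (s * (V r * indicator {..x} r)) \<partial>lborel)" for s x
    unfolding cdf_def measure_def \<nu>_def
    by (subst emeasure_density) (auto intro!: arg_cong[of _ _ enn2real] nn_integral_cong simp: indicator_def)
  have "cdf (\<nu> 1) x = cdf (\<nu> (-1)) x" for x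
  proof -
    have "integrable lborel (\<lambda>r. V r * indicator {..x} r)"
      using V by (intro integrable_real_mult_indicator) auto
    then show ?thesis
      using zero[of x] unfolding cdf by (simp add: real_lebesgue_integral_def)
  qed
  then have "\<nu> 1 = \<nu> (-1)"
    by (intro cdf_unique' fbm) auto
  then have "AE x in lborel. ennreal (1 * V x) = ennreal ((-1) * V x)"
    unfolding \<nu>_def by (intro sigma_finite_measure.density_unique[OF sigma_finite_lborel]) auto
  then show ?thesis
  proof eventually_elim
    case (elim x)
    then show ?case by (cases "V x \<ge> 0") (auto simp: ennreal_neg ennreal_eq_0_iff)
  qed
qed

lemma ac_minus:
  assumes u: "ac u u'" and v: "ac v v'"
  shows "ac (\<lambda>t. u t - v t) (\<lambda>t. u' t - v' t)"
  unfolding ac_def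
proof (intro conjI allI impI)
  show "set_integrable lborel {a..b} (\<lambda>t. u' t - v' t)" for a b
    by (rule set_integral_diff(1)[OF ac_integrable[OF u] ac_integrable[OF v]])
  show "u b - v b - (u a - v a) = (LBINT t:{a..b}. u' t - v' t)" if "a \<le> b" for a b
    unfolding set_integral_diff(2)[OF ac_integrable[OF u] ac_integrable[OF v]]
    using ac_diff[OF u that] ac_diff[OF v that] by linarith
qed

text \<open>By continuity u vanishes at every point of the open domain, so all its increments there
  are 0 and u' vanishes almost everywhere on compact intervals, countably many of which exhaust the
  domain.\<close>

lemma ac_deriv_zero:
  assumes u: "ac u u'" and a: "a \<ge> 0" and zero: "AE t in lborel. t \<in> dom1 a \<longrightarrow> u t = 0"
  shows "AE t in lborel. t \<in> dom1 a \<longrightarrow> u' t = 0"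
proof -
  have op: "open (dom1 a)"
    by (cases "a > 0") (auto simp: dom1_def greaterThan_def[symmetric])
  have all0: "u t = 0" if t: "t \<in> dom1 a" for t
  proof (rule ccontr)
    assume "u t \<noteq> 0"
    have "isCont u t"
      using continuous_on_interior[OF ac_continuous[OF u, of UNIV], of t] by simp
    then have "(u \<longlongrightarrow> u t) (nhds t)"
      unfolding isCont_def tendsto_at_iff_tendsto_nhds .
    then have "\<forall>\<^sub>F s in nhds t. u s \<in> - {0}"
      by (rule topological_tendstoD) (use \<open>u t \<noteq> 0\<close> in auto)
    then have "\<forall>\<^sub>F s in nhds t. u s \<noteq> 0 \<and> s \<in> dom1 a"
      using eventually_nhds_in_open[OF op t] by eventually_elim auto
    then obtain e where e: "e > 0" "\<And>s. dist s t < e \<Longrightarrow> u s \<noteq> 0 \<and> s \<in> dom1 a"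
      by (auto simp: eventually_nhds_metric)
    have "AE s in lborel. s \<notin> {t<..<t + e}"
      using zero
    proof eventually_elim
      case (elim s)
      then show ?case using e(2)[of s] by (auto simp: dist_real_def)
    qed
    then have "emeasure lborel {t<..<t + e} = 0"
      by (subst (asm) AE_iff_measurable[of "{t<..<t + e}"]) auto
    then show False using e(1) by simp
  qed
  have loc: "AE t in lborel. p \<le> t \<and> t \<le> q \<longrightarrow> u' t = 0" if p: "p \<in> dom1 a" for p q
  proof -
    have "AE t in lborel. u' t * indicator {p..q} t = 0"
    proof (rule AE_zero_of_Iic)
      show "integrable lborel (\<lambda>t. u' t * indicator {p..q} t)"
        using ac_integrable[OF u, of p q] by (simp add: set_integrable_def mult.commute)
      fix x
      have "(LINT r|lborel. u' r * indicator {p..q} r * indicator {..x} r) = (LBINT r:{p..min q x}. u' r)"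
        unfolding set_lebesgue_integral_def by (intro Bochner_Integration.integral_cong) (auto simp: indicator_def)
      also have "\<dots> = 0"
      proof (cases "p \<le> min q x")
        case True
        moreover have "min q x \<in> dom1 a" using p True by (auto simp: dom1_def)
        ultimately show ?thesis using ac_diff[OF u True] all0 p by simp
      next
        case False
        then show ?thesis by (simp add: set_lebesgue_integral_def)
      qed
      finally show "(LINT r|lborel. u' r * indicator {p..q} r * indicator {..x} r) = 0" .
    qed
    then show ?thesis by eventually_elim (auto simp: indicator_def)
  qed
  define p where "p n = (if a > 0 then 1 / (real n + 1) else - real n)" for n :: nat
  have "p n \<in> dom1 a" for n by (auto simp: p_def dom1_def)
  then have "AE t in lborel. \<forall>n::nat. p n \<le> t \<and> t \<le> real n \<longrightarrow> u' t = 0"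
    unfolding AE_all_countable using loc by blast
  then show ?thesis
  proof eventually_elim
    case (elim t)
    show ?case
    proof
      assume t: "t \<in> dom1 a"
      obtain n :: nat where n: "max \<bar>t\<bar> (1 / \<bar>t\<bar>) \<le> real n" using real_arch_simple by blast
      have "p n \<le> t"
      proof (cases "a > 0")
        case True
        then have "t > 0" using t by (simp add: dom1_def)
        then show ?thesis using True n by (simp add: p_def field_simps)
      next
        case False
        then show ?thesis using n by (simp add: p_def abs_le_iff)
      qed
      then show "u' t = 0" using elim n by auto
    qed
  qed
qed

text \<open>The substitution t = y + s u and homogeneity of the weight; a weight with a > 0 is not
  translation invariant, which ties the centre to 0.\<close>

lemma nn_integral_wt_gauss_affine:
  assumes a: "a \<ge> 0" and s: "s > 0" and y: "a > 0 \<Longrightarrow> y = 0"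
  shows "(\<integral>\<^sup>+t. ennreal (wt a t * exp (- ((t - y)\<^sup>2 / (2 * s\<^sup>2)))) \<partial>lborel) = ennreal (s powr (a + 1) * Z a)"
    and "(\<integral>\<^sup>+t. ennreal ((t - y)\<^sup>2 * (wt a t * exp (- ((t - y)\<^sup>2 / (2 * s\<^sup>2))))) \<partial>lborel) =
      ennreal (s\<^sup>2 * (1 + a) * (s powr (a + 1) * Z a))"
proof -
  have w: "wt a (y + s * u) = s powr a * wt a u" for u
    using a s y by (auto simp: wt_def powr_mult zero_less_mult_iff)
  have e: "(y + s * u - y)\<^sup>2 / (2 * s\<^sup>2) = u\<^sup>2 / 2" for u
    using s by (simp add: power_mult_distrib)
  have p1: "ennreal (wt a (y + s * u) * exp (- ((y + s * u - y)\<^sup>2 / (2 * s\<^sup>2)))) =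
      ennreal (s powr a) * ennreal (wt a u * exp (- (u\<^sup>2 / 2)))" for u
    unfolding e w by (simp add: mult.assoc flip: ennreal_mult')
  have p2: "ennreal ((y + s * u - y)\<^sup>2 * (wt a (y + s * u) * exp (- ((y + s * u - y)\<^sup>2 / (2 * s\<^sup>2))))) =
      ennreal (s\<^sup>2 * s powr a) * ennreal (u\<^sup>2 * (wt a u * exp (- (u\<^sup>2 / 2))))" for u
    unfolding e w by (simp add: power_mult_distrib mult_ac flip: ennreal_mult')
  have sp: "s * s powr a = s powr (a + 1)" using s by (simp add: powr_add)
  have "(\<integral>\<^sup>+t. ennreal (wt a t * exp (- ((t - y)\<^sup>2 / (2 * s\<^sup>2)))) \<partial>lborel) =
      ennreal s * (\<integral>\<^sup>+u. ennreal (s powr a) * ennreal (wt a u * exp (- (u\<^sup>2 / 2))) \<partial>lborel)"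
    unfolding p1[symmetric] using s by (subst nn_integral_real_affine[where c = s and t = y]) auto
  also have "\<dots> = ennreal s * (ennreal (s powr a) * ennreal (Z a))"
    by (subst nn_integral_cmult) (auto simp: nn_integral_wt_gauss[OF a])
  also have "\<dots> = ennreal (s powr (a + 1) * Z a)"
    using s by (simp add: sp[symmetric] mult.assoc flip: ennreal_mult')
  finally show "(\<integral>\<^sup>+t. ennreal (wt a t * exp (- ((t - y)\<^sup>2 / (2 * s\<^sup>2)))) \<partial>lborel) = ennreal (s powr (a + 1) * Z a)" .
  have "(\<integral>\<^sup>+t. ennreal ((t - y)\<^sup>2 * (wt a t * exp (- ((t - y)\<^sup>2 / (2 * s\<^sup>2))))) \<partial>lborel) =
      ennreal s * (\<integral>\<^sup>+u. ennreal (s\<^sup>2 * s powr a) * ennreal (u\<^sup>2 * (wt a u * exp (- (u\<^sup>2 / 2)))) \<partial>lborel)"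
    unfolding p2[symmetric] using s by (subst nn_integral_real_affine[where c = s and t = y]) auto
  also have "\<dots> = ennreal s * (ennreal (s\<^sup>2 * s powr a) * ennreal ((1 + a) * Z a))"
    by (subst nn_integral_cmult) (auto simp: nn_integral_wt_gauss[OF a])
  also have "\<dots> = ennreal (s * ((s\<^sup>2 * s powr a) * ((1 + a) * Z a)))"
    by (subst ennreal_mult'[symmetric], simp, subst ennreal_mult'[symmetric]) (use s in auto)
  also have "\<dots> = ennreal (s\<^sup>2 * (1 + a) * (s powr (a + 1) * Z a))"
    unfolding sp[symmetric] by (simp add: mult_ac)
  finally show "(\<integral>\<^sup>+t. ennreal ((t - y)\<^sup>2 * (wt a t * exp (- ((t - y)\<^sup>2 / (2 * s\<^sup>2))))) \<partial>lborel) =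
      ennreal (s\<^sup>2 * (1 + a) * (s powr (a + 1) * Z a))" .
qed

section \<open>Mass, entropy and energy of a Gaussian\<close>

context sobolev_lines
begin

definition Dim :: real where "Dim = (\<Sum>i\<in>UNIV. 1 + A i)"

definition Zprod :: real where "Zprod = (\<Prod>i\<in>UNIV. Z (A i))"

lemma Dim_pos: "Dim > 0"
  unfolding Dim_def by (intro sum_pos) (auto intro: add_pos_nonneg A_nonneg)

lemma Zprod_pos: "Zprod > 0"
  unfolding Zprod_def by (intro prod_pos) (auto intro: Z_pos A_nonneg)

lemma sum_bnd: "(\<Sum>j\<in>UNIV. bnd l j) = 2 * l\<^sup>2 * (\<Sum>j\<in>UNIV. energy_of j) - Dim * (1 + ln l) - ln Zprod"
proof -
  have "ln Zprod = (\<Sum>j\<in>UNIV. ln (Z (A j)))"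
    unfolding Zprod_def by (intro ln_prod) (auto simp: less_imp_neq[OF Z_pos[OF A_nonneg], symmetric])
  then show ?thesis
    by (simp add: bnd_def sum_subtractf Dim_def sum_distrib_left sum_distrib_right)
qed

context
  fixes s \<beta> :: real and y :: "'i \<Rightarrow> real"
  assumes s: "s > 0" and y: "\<And>i. A i > 0 \<Longrightarrow> y i = 0"
    and gauss: "AE x in M. f x = \<beta> * exp (- (\<Sum>j\<in>UNIV. (x j - y j)\<^sup>2) / (4 * s\<^sup>2))"
begin

text \<open>Squaring f turns 4 s^2 into 2 s^2, and the integrand factorizes over the coordinates.
  The factors k j yield the mass and the second moments.\<close>

lemma gauss_nn_integral:
  assumes [measurable]: "\<And>j. k j \<in> borel_measurable borel" and k: "\<And>j t. k j t \<ge> 0"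
  shows "(\<integral>\<^sup>+x. ennreal ((\<Prod>j\<in>UNIV. k j (x j)) * F x) \<partial>M) =
    ennreal (\<beta>\<^sup>2) * (\<Prod>j\<in>UNIV. \<integral>\<^sup>+t. ennreal (k j t * (wt (A j) t * exp (- ((t - y j)\<^sup>2 / (2 * s\<^sup>2))))) \<partial>lborel)"
proof -
  let ?K = "\<lambda>x. \<Prod>j\<in>UNIV. k j (x j)"
  let ?e = "\<lambda>j t. exp (- ((t - y j)\<^sup>2 / (2 * s\<^sup>2)))"
  have K: "?K x \<ge> 0" for x by (intro prod_nonneg) (auto simp: k)
  have sq: "(\<beta> * exp (- (\<Sum>j\<in>UNIV. (x j - y j)\<^sup>2) / (4 * s\<^sup>2)))\<^sup>2 = \<beta>\<^sup>2 * (\<Prod>j\<in>UNIV. ?e j (x j))" for x :: "'i \<Rightarrow> real"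
  proof -
    have "(exp (- (\<Sum>j\<in>UNIV. (x j - y j)\<^sup>2) / (4 * s\<^sup>2)))\<^sup>2 = exp (\<Sum>j\<in>UNIV. - ((x j - y j)\<^sup>2 / (2 * s\<^sup>2)))"
      using s by (simp add: exp_double[symmetric] sum_negf sum_divide_distrib[symmetric] field_simps)
    then show ?thesis by (simp add: power_mult_distrib exp_sum)
  qed
  have "(\<integral>\<^sup>+x. ennreal (?K x * F x) \<partial>M) = (\<integral>\<^sup>+x. ennreal (\<Psi> x) * ennreal (?K x * (\<beta>\<^sup>2 * (\<Prod>j\<in>UNIV. ?e j (x j)))) \<partial>M)"
  proof (rule nn_integral_cong_AE)
    show "AE x in M. ennreal (?K x * F x) = ennreal (\<Psi> x) * ennreal (?K x * (\<beta>\<^sup>2 * (\<Prod>j\<in>UNIV. ?e j (x j))))"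
      using gauss
    proof eventually_elim
      case (elim x)
      have "(f x)\<^sup>2 = \<beta>\<^sup>2 * (\<Prod>j\<in>UNIV. ?e j (x j))" unfolding elim by (rule sq)
      then show ?case
        using \<Psi>_pos[of x] K[of x] by (simp add: F_def mult_ac flip: ennreal_mult')
    qed
  qed
  also have "\<dots> = (\<integral>\<^sup>+x. ennreal (Wt x) * ennreal (?K x * (\<beta>\<^sup>2 * (\<Prod>j\<in>UNIV. ?e j (x j)))) \<partial>lborel_fun)"
    by (rule nn_integral_M_\<Psi>) measurable
  also have "\<dots> = (\<integral>\<^sup>+x. ennreal (\<beta>\<^sup>2) * (\<Prod>j\<in>UNIV. ennreal (k j (x j) * (wt (A j) (x j) * ?e j (x j)))) \<partial>lborel_fun)"
  proof (intro nn_integral_cong)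
    fix x
    have "Wt x \<ge> 0" unfolding Wt_def by (intro prod_nonneg) (auto simp: wt_nonneg)
    then have "ennreal (Wt x) * ennreal (?K x * (\<beta>\<^sup>2 * (\<Prod>j\<in>UNIV. ?e j (x j)))) =
        ennreal (\<beta>\<^sup>2 * (\<Prod>j\<in>UNIV. k j (x j) * (wt (A j) (x j) * ?e j (x j))))"
      by (simp add: Wt_def prod.distrib mult_ac flip: ennreal_mult')
    also have "\<dots> = ennreal (\<beta>\<^sup>2) * (\<Prod>j\<in>UNIV. ennreal (k j (x j) * (wt (A j) (x j) * ?e j (x j))))"
      by (subst prod_ennreal) (auto simp: k wt_nonneg ennreal_mult')
    finally show "ennreal (Wt x) * ennreal (?K x * (\<beta>\<^sup>2 * (\<Prod>j\<in>UNIV. ?e j (x j)))) =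
        ennreal (\<beta>\<^sup>2) * (\<Prod>j\<in>UNIV. ennreal (k j (x j) * (wt (A j) (x j) * ?e j (x j))))" .
  qed
  also have "\<dots> = ennreal (\<beta>\<^sup>2) * (\<integral>\<^sup>+x. (\<Prod>j\<in>UNIV. ennreal (k j (x j) * (wt (A j) (x j) * ?e j (x j)))) \<partial>lborel_fun)"
    by (rule nn_integral_cmult) measurable
  also have "(\<integral>\<^sup>+x. (\<Prod>j\<in>UNIV. ennreal (k j (x j) * (wt (A j) (x j) * ?e j (x j)))) \<partial>lborel_fun) =
      (\<Prod>j\<in>UNIV. \<integral>\<^sup>+t. ennreal (k j t * (wt (A j) t * ?e j t)) \<partial>lborel)"
    by (subst product_sigma_finite.product_nn_integral_prod[OF product_sigma_finite_lborel]) auto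
  finally show ?thesis .
qed

lemma prod_powr: "(\<Prod>j\<in>UNIV. s powr (A j + 1) * Z (A j)) = s powr Dim * Zprod"
  using s by (simp add: prod.distrib Zprod_def Dim_def powr_sum add.commute)

lemma gauss_normalization: "\<beta>\<^sup>2 * (s powr Dim * Zprod) = 1"
proof -
  have "1 = (\<integral>\<^sup>+x. ennreal ((\<Prod>j\<in>UNIV. (\<lambda>_ _. 1) j (x j)) * F x) \<partial>M)"
    by (simp add: F_total)
  also have "\<dots> = ennreal (\<beta>\<^sup>2) * (\<Prod>j\<in>UNIV. \<integral>\<^sup>+t. ennreal (1 * (wt (A j) t * exp (- ((t - y j)\<^sup>2 / (2 * s\<^sup>2))))) \<partial>lborel)"
    by (rule gauss_nn_integral) auto
  also have "\<dots> = ennreal (\<beta>\<^sup>2) * (\<Prod>j\<in>UNIV. ennreal (s powr (A j + 1) * Z (A j)))"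
    unfolding mult_1 using nn_integral_wt_gauss_affine(1)[OF A_nonneg s y] by simp
  also have "\<dots> = ennreal (\<beta>\<^sup>2 * (s powr Dim * Zprod))"
    using Z_pos[OF A_nonneg] unfolding prod_powr[symmetric] by (subst prod_ennreal) (auto simp: ennreal_mult' less_imp_le)
  finally have "ennreal (\<beta>\<^sup>2 * (s powr Dim * Zprod)) = 1" by (rule sym)
  then show ?thesis by (simp only: ennreal_eq_1)
qed

lemma gauss_second_moment:
  "integrable M (\<lambda>x. (x i - y i)\<^sup>2 * F x)" "(\<integral>x. (x i - y i)\<^sup>2 * F x \<partial>M) = s\<^sup>2 * (1 + A i)"
proof -
  let ?k = "\<lambda>j t. if j = i then (t - y i)\<^sup>2 else 1"
  have k: "(\<Prod>j\<in>UNIV. ?k j (x j)) = (x i - y i)\<^sup>2" for x :: "'i \<Rightarrow> real"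
    by (subst prod.remove[of UNIV i]) auto
  have "(\<integral>\<^sup>+x. ennreal ((\<Prod>j\<in>UNIV. ?k j (x j)) * F x) \<partial>M) =
      ennreal (\<beta>\<^sup>2) * (\<Prod>j\<in>UNIV. \<integral>\<^sup>+t. ennreal (?k j t * (wt (A j) t * exp (- ((t - y j)\<^sup>2 / (2 * s\<^sup>2))))) \<partial>lborel)"
    by (rule gauss_nn_integral) auto
  also have "(\<Prod>j\<in>UNIV. \<integral>\<^sup>+t. ennreal (?k j t * (wt (A j) t * exp (- ((t - y j)\<^sup>2 / (2 * s\<^sup>2))))) \<partial>lborel) =
      (\<Prod>j\<in>UNIV. ennreal ((if j = i then s\<^sup>2 * (1 + A i) else 1) * (s powr (A j + 1) * Z (A j))))"
    using nn_integral_wt_gauss_affine[OF A_nonneg s y]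
    by (intro prod.cong refl) auto
  also have "\<dots> = ennreal (\<Prod>j\<in>UNIV. (if j = i then s\<^sup>2 * (1 + A i) else 1) * (s powr (A j + 1) * Z (A j)))"
    using Z_pos[OF A_nonneg] A_nonneg s by (intro prod_ennreal) (auto intro!: mult_nonneg_nonneg simp: less_imp_le)
  also have "(\<Prod>j\<in>UNIV. (if j = i then s\<^sup>2 * (1 + A i) else 1) * (s powr (A j + 1) * Z (A j))) = s\<^sup>2 * (1 + A i) * (s powr Dim * Zprod)"
    unfolding prod.distrib[of "\<lambda>j. if j = i then s\<^sup>2 * (1 + A i) else 1"] prod_powr by simp
  also have "ennreal (\<beta>\<^sup>2) * ennreal (s\<^sup>2 * (1 + A i) * (s powr Dim * Zprod)) = ennreal (s\<^sup>2 * (1 + A i) * (\<beta>\<^sup>2 * (s powr Dim * Zprod)))"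
    by (simp add: mult_ac flip: ennreal_mult')
  finally have *: "(\<integral>\<^sup>+x. ennreal ((x i - y i)\<^sup>2 * F x) \<partial>M) = ennreal (s\<^sup>2 * (1 + A i))"
    unfolding k gauss_normalization by simp
  show "integrable M (\<lambda>x. (x i - y i)\<^sup>2 * F x)"
    using * by (intro integrableI_nonneg) (auto simp: F_nonneg)
  show "(\<integral>x. (x i - y i)\<^sup>2 * F x \<partial>M) = s\<^sup>2 * (1 + A i)"
    using * A_nonneg[of i] s by (subst integral_eq_nn_integral) (auto simp: F_nonneg)
qed

text \<open>ln (f^2) is a constant minus the squared distance to y over 2 s^2, so the second moments
  determine the entropy.\<close>

lemma gauss_entropy:
  "integrable M (\<lambda>x. ln ((f x)\<^sup>2) * F x)" "(\<integral>x. ln ((f x)\<^sup>2) * F x \<partial>M) = ln (\<beta>\<^sup>2) - Dim / 2"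
proof -
  have \<beta>: "\<beta> \<noteq> 0" using gauss_normalization by auto
  let ?H = "\<lambda>x. ln (\<beta>\<^sup>2) * F x - 1 / (2 * s\<^sup>2) * (\<Sum>j\<in>UNIV. (x j - y j)\<^sup>2 * F x)"
  have eq: "AE x in M. ln ((f x)\<^sup>2) * F x = ?H x"
    using gauss
  proof eventually_elim
    case (elim x)
    let ?q = "\<Sum>j\<in>UNIV. (x j - y j)\<^sup>2"
    have "(f x)\<^sup>2 = \<beta>\<^sup>2 * exp (- ?q / (2 * s\<^sup>2))"
      unfolding elim power_mult_distrib exp_double[symmetric] using s by (simp add: field_simps)
    then have "ln ((f x)\<^sup>2) = ln (\<beta>\<^sup>2) - 1 / (2 * s\<^sup>2) * ?q"
      using \<beta> by (simp add: ln_mult)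
    then show ?case by (simp add: left_diff_distrib sum_distrib_right)
  qed
  have iH: "integrable M ?H"
    by (intro Bochner_Integration.integrable_diff integrable_mult_right integrable_F Bochner_Integration.integrable_sum gauss_second_moment)
  have [measurable]: "?H \<in> borel_measurable M" by (rule borel_measurable_integrable[OF iH])
  show "integrable M (\<lambda>x. ln ((f x)\<^sup>2) * F x)"
    using iH eq by (subst integrable_cong_AE[where g = ?H]) auto
  have "(\<integral>x. ln ((f x)\<^sup>2) * F x \<partial>M) = (\<integral>x. ?H x \<partial>M)"
    using eq by (intro integral_cong_AE) auto
  also have "\<dots> = ln (\<beta>\<^sup>2) - 1 / (2 * s\<^sup>2) * (\<Sum>j\<in>UNIV. s\<^sup>2 * (1 + A j))"
    using integrable_F gauss_second_moment
    by (simp add: Bochner_Integration.integral_diff Bochner_Integration.integral_sum integral_F Bochner_Integration.integrable_sum)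
  also have "\<dots> = ln (\<beta>\<^sup>2) - Dim / 2"
    using s by (simp add: Dim_def flip: sum_distrib_left)
  finally show "(\<integral>x. ln ((f x)\<^sup>2) * F x \<partial>M) = ln (\<beta>\<^sup>2) - Dim / 2" .
qed

text \<open>On each line g is tied to f only through some pair h, h', so h' is compared with the
  classical derivative of the Gaussian by \<open>ac_deriv_zero\<close>. The identity passes from
  lines to M by integrating the absolute difference.\<close>

lemma gauss_gradient: "AE x in M. g i x = - (x i - y i) / (2 * s\<^sup>2) * f x"
proof -
  have lines_eq: "AE x in M. AE t in \<mu>1 i. g i (x(i := t)) = - (t - y i) / (2 * s\<^sup>2) * f (x(i := t))"
    using lines[of i] AE_line[OF gauss, of i]
  proof eventually_elim
    case (elim x)
    obtain h h' where h: "ac h h'"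
      and hf: "AE t in lborel. t \<in> dom1 (A i) \<longrightarrow> h t = f (x(i := t)) \<and> h' t = g i (x(i := t))"
      using elim(1) by blast
    define E where "E = (\<Sum>j\<in>UNIV - {i}. (x j - y j)\<^sup>2)"
    define \<gamma> where "\<gamma> t = \<beta> * exp (- ((t - y i)\<^sup>2 + E) / (4 * s\<^sup>2))" for t
    define \<gamma>' where "\<gamma>' t = - (t - y i) / (2 * s\<^sup>2) * \<gamma> t" for t
    have sumE: "(\<Sum>j\<in>UNIV. ((x(i := t)) j - y j)\<^sup>2) = (t - y i)\<^sup>2 + E" for t
      unfolding E_def by (subst sum.remove[of UNIV i]) (auto intro!: sum.cong)
    have ac\<gamma>: "ac \<gamma> \<gamma>'"
    proof (rule ac_C1)
      show "(\<gamma> has_real_derivative \<gamma>' t) (at t)" for t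
        unfolding \<gamma>'_def \<gamma>_def[abs_def] using s
        by (auto intro!: derivative_eq_intros simp: field_simps)
      show "continuous_on UNIV \<gamma>'"
        unfolding \<gamma>'_def \<gamma>_def using s by (intro continuous_intros) auto
    qed
    have f\<gamma>: "AE t in lborel. t \<in> dom1 (A i) \<longrightarrow> f (x(i := t)) = \<gamma> t"
      using elim(2) unfolding AE_\<mu>1 sumE \<gamma>_def .
    have "AE t in lborel. t \<in> dom1 (A i) \<longrightarrow> h' t - \<gamma>' t = 0"
    proof (rule ac_deriv_zero[OF _ A_nonneg])
      show "ac (\<lambda>t. h t - \<gamma> t) (\<lambda>t. h' t - \<gamma>' t)"
        by (rule ac_minus[OF h ac\<gamma>])
      show "AE t in lborel. t \<in> dom1 (A i) \<longrightarrow> h t - \<gamma> t = 0"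
        using hf f\<gamma> by eventually_elim auto
    qed
    then show ?case
      unfolding AE_\<mu>1 using hf f\<gamma>
      by eventually_elim (auto simp: \<gamma>'_def)
  qed
  have zero_iff: "z + p / q * w = 0 \<longleftrightarrow> z = - p / q * w" for p q w z :: real
    by (simp add: add_eq_0_iff2)
  let ?d = "\<lambda>x. ennreal \<bar>g i x + (x i - y i) / (2 * s\<^sup>2) * f x\<bar>"
  have "(\<integral>\<^sup>+x. ?d x \<partial>M) = (\<integral>\<^sup>+x. \<integral>\<^sup>+t. ?d (x(i := t)) \<partial>\<mu>1 i \<partial>M)"
    by (rule nn_integral_line) measurable
  also have "\<dots> = (\<integral>\<^sup>+x. 0 \<partial>M)"
  proof (rule nn_integral_cong_AE)
    show "AE x in M. (\<integral>\<^sup>+t. ?d (x(i := t)) \<partial>\<mu>1 i) = 0"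
      using lines_eq
    proof eventually_elim
      case (elim x)
      have "(\<integral>\<^sup>+t. ?d (x(i := t)) \<partial>\<mu>1 i) = (\<integral>\<^sup>+t. 0 \<partial>\<mu>1 i)"
        by (rule nn_integral_cong_AE, rule eventually_mono[OF elim]) (simp only: fun_upd_same zero_iff[THEN iffD2] ennreal_0 abs_zero)
      then show ?case by simp
    qed
  qed
  finally have "(\<integral>\<^sup>+x. ?d x \<partial>M) = 0" by simp
  then have "AE x in M. ?d x = 0"
    by (subst (asm) nn_integral_0_iff_AE) auto
  then show ?thesis
    by eventually_elim (simp only: ennreal_eq_0_iff abs_le_zero_iff zero_iff)
qed

lemma gauss_energy: "(\<Sum>i\<in>UNIV. energy_of i) = Dim / (4 * s\<^sup>2)"
proof -
  have "energy_of i = (1 + A i) / (4 * s\<^sup>2)" for i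
  proof -
    have "energy_of i = (\<integral>x. 1 / (4 * s ^ 4) * ((x i - y i)\<^sup>2 * F x) \<partial>M)"
      unfolding energy_of_def
    proof (rule integral_cong_AE)
      show "AE x in M. (g i x)\<^sup>2 * \<Psi> x = 1 / (4 * s ^ 4) * ((x i - y i)\<^sup>2 * F x)"
        using gauss_gradient[of i]
      proof eventually_elim
        case (elim x)
        have "(g i x)\<^sup>2 = 1 / (4 * s ^ 4) * ((x i - y i)\<^sup>2 * (f x)\<^sup>2)"
          unfolding elim by (simp add: power_mult_distrib power_divide power2_commute[of "y i"] flip: power_mult)
        then show ?case by (simp add: F_def)
      qed
    qed measurable
    also have "\<dots> = 1 / (4 * s ^ 4) * (s\<^sup>2 * (1 + A i))"
      by (simp add: gauss_second_moment)
    also have "\<dots> = (1 + A i) / (4 * s\<^sup>2)"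
      using s by (simp add: field_simps power2_eq_square eval_nat_numeral)
    finally show ?thesis .
  qed
  then show ?thesis by (simp add: Dim_def sum_divide_distrib)
qed

end

end

section \<open>The sharp inequality\<close>

lemma ext_integral_integrable:
  assumes "integrable N h"
  shows "ext_integral N h = ereal (\<integral>x. h x \<partial>N)"
proof -
  have "(\<integral>\<^sup>+x. ennreal (h x) \<partial>N) < \<infinity>" "(\<integral>\<^sup>+x. ennreal (- h x) \<partial>N) < \<infinity>"
    using assms by (auto simp: real_integrable_def less_top)
  then obtain p q where "(\<integral>\<^sup>+x. ennreal (h x) \<partial>N) = ennreal p" "p \<ge> 0" "(\<integral>\<^sup>+x. ennreal (- h x) \<partial>N) = ennreal q" "q \<ge> 0"
    by (cases "\<integral>\<^sup>+x. ennreal (h x) \<partial>N"; cases "\<integral>\<^sup>+x. ennreal (- h x) \<partial>N") auto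
  then show ?thesis
    using real_lebesgue_integral_def[OF assms] by (simp add: ext_integral_def)
qed

text \<open>An integrable majorant makes the positive part finite, so \<infinity> - \<infinity>
  cannot occur and -\<infinity> is the only infinite value left.\<close>

lemma ext_integral_cases:
  assumes [measurable]: "h \<in> borel_measurable N" and r: "integrable N r" and le: "AE x in N. h x \<le> r x"
  shows "(integrable N h \<and> ext_integral N h = ereal (\<integral>x. h x \<partial>N)) \<or> ext_integral N h = - \<infinity>"
proof -
  have "(\<integral>\<^sup>+x. ennreal (h x) \<partial>N) \<le> (\<integral>\<^sup>+x. ennreal (r x) \<partial>N)"
    using le by (intro nn_integral_mono_AE) (auto elim!: eventually_mono intro: ennreal_leI)
  also have "\<dots> < \<infinity>" using r by (auto simp: real_integrable_def less_top)
  finally have fin: "(\<integral>\<^sup>+x. ennreal (h x) \<partial>N) < \<infinity>" .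
  show ?thesis
  proof (cases "(\<integral>\<^sup>+x. ennreal (- h x) \<partial>N) = \<infinity>")
    case False
    then have "integrable N h" using fin by (auto simp: real_integrable_def less_top)
    then show ?thesis using ext_integral_integrable by blast
  next
    case True
    obtain p where "(\<integral>\<^sup>+x. ennreal (h x) \<partial>N) = ennreal p" "p \<ge> 0"
      using fin by (cases "\<integral>\<^sup>+x. ennreal (h x) \<partial>N") auto
    then show ?thesis using True by (simp add: ext_integral_def)
  qed
qed

lemma ext_integral_le:
  assumes "h \<in> borel_measurable N" and r: "integrable N r" and le: "AE x in N. h x \<le> r x"
  shows "ext_integral N h \<le> ereal (\<integral>x. r x \<partial>N)"
  using ext_integral_cases[OF assms] integral_mono_AE[OF _ r le] by auto

text \<open>Sobolev functions are measurable for the completed measure, whereas the product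
  constructions take Borel functions. Integrals are moved to a Borel function v that agrees with u
  almost everywhere.\<close>

lemma lebesgue_transfer:
  fixes u v :: "real^'n::finite \<Rightarrow> real"
  assumes u: "u \<in> borel_measurable lebesgue" and v[measurable]: "v \<in> borel_measurable borel"
    and eq: "AE x in lborel. u x = v x"
  shows "(\<integral>\<^sup>+x. ennreal (u x) \<partial>lebesgue) = (\<integral>\<^sup>+x. ennreal (v (vec_lambda x)) \<partial>lborel_fun)"
    and "integrable lebesgue u \<longleftrightarrow> integrable lborel_fun (\<lambda>x. v (vec_lambda x))"
    and "(LINT x|lebesgue. u x) = (LINT x|lborel_fun. v (vec_lambda x))"
proof -
  have eq': "AE x in lebesgue. u x = v x" using eq by (rule AE_completion)
  have v': "v \<in> borel_measurable lebesgue" by (rule measurable_completion) simp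
  have "(\<integral>\<^sup>+x. ennreal (u x) \<partial>lebesgue) = (\<integral>\<^sup>+x. ennreal (v x) \<partial>lebesgue)"
    using eq' by (intro nn_integral_cong_AE) (auto elim!: eventually_mono)
  also have "\<dots> = (\<integral>\<^sup>+x. ennreal (v x) \<partial>lborel)" by (rule nn_integral_completion)
  also have "\<dots> = (\<integral>\<^sup>+x. ennreal (v (vec_lambda x)) \<partial>lborel_fun)"
    by (subst distr_lborel_fun[symmetric], subst nn_integral_distr) auto
  finally show "(\<integral>\<^sup>+x. ennreal (u x) \<partial>lebesgue) = (\<integral>\<^sup>+x. ennreal (v (vec_lambda x)) \<partial>lborel_fun)" .
  have "integrable lebesgue u \<longleftrightarrow> integrable lebesgue v"
    using u v' eq' by (rule integrable_cong_AE)
  also have "\<dots> \<longleftrightarrow> integrable lborel v" by (rule integrable_completion) simp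
  also have "\<dots> \<longleftrightarrow> integrable lborel_fun (\<lambda>x. v (vec_lambda x))"
    by (subst distr_lborel_fun[symmetric], subst integrable_distr_eq) auto
  finally show "integrable lebesgue u \<longleftrightarrow> integrable lborel_fun (\<lambda>x. v (vec_lambda x))" .
  have "(LINT x|lebesgue. u x) = (LINT x|lebesgue. v x)"
    using u v' eq' by (rule integral_cong_AE)
  also have "\<dots> = (LINT x|lborel. v x)" by (rule integral_completion) simp
  also have "\<dots> = (LINT x|lborel_fun. v (vec_lambda x))"
    by (subst distr_lborel_fun[symmetric], subst integral_distr) auto
  finally show "(LINT x|lebesgue. u x) = (LINT x|lborel_fun. v (vec_lambda x))" .
qed

lemma locally_integrable_measurable:
  fixes u :: "real^'n::finite \<Rightarrow> real"
  assumes "locally_integrable UNIV u"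
  shows "u \<in> borel_measurable lebesgue"
proof (rule borel_measurable_LIMSEQ_real)
  let ?B = "\<lambda>n::nat. cbox (- (real n *\<^sub>R One)) (real n *\<^sub>R One) :: (real^'n) set"
  have "integrable lebesgue (\<lambda>x. indicator (?B n) x *\<^sub>R u x)" for n
    using assms compact_cbox[of "- (real n *\<^sub>R One)" "real n *\<^sub>R One :: real^'n"]
    unfolding locally_integrable_def set_integrable_def by blast
  then show "(\<lambda>x. indicator (?B n) x *\<^sub>R u x) \<in> borel_measurable lebesgue" for n
    by (rule borel_measurable_integrable)
  fix x :: "real^'n"
  obtain k :: nat where k: "norm x \<le> real k" using real_arch_simple by blast
  have "indicator (?B n) x *\<^sub>R u x = u x" if "n \<ge> k" for n
  proof -
    have "\<bar>x \<bullet> i\<bar> \<le> real n" if "i \<in> Basis" for i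
      using Basis_le_norm[OF that, of x] k \<open>n \<ge> k\<close> by linarith
    then have "x \<in> ?B n" by (auto simp: mem_box abs_le_iff minus_le_iff)
    then show ?thesis by simp
  qed
  then show "(\<lambda>n. indicator (?B n) x *\<^sub>R u x) \<longlonglongrightarrow> u x"
    by (intro tendsto_eventually) (auto simp: eventually_sequentially)
qed

lemma locally_integrable_component:
  assumes "locally_integrable UNIV (g :: real^'n::finite \<Rightarrow> real^'n)"
  shows "locally_integrable UNIV (\<lambda>x. g x $ i)"
  using assms absolutely_integrable_linear[OF _ bounded_linear_vec_nth[of i], where f = g]
  unfolding locally_integrable_def by (simp add: o_def)

text \<open>Borel versions of f and of each component of g satisfy \<open>weak_partial\<close>:
  smooth compactly supported products are test functions in the sense of \<open>C_k\<close>, and a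
  partial derivative of them replaces one factor.\<close>

lemma has_weak_gradient_lines:
  fixes f :: "real^'n::finite \<Rightarrow> real"
  assumes hw: "has_weak_gradient UNIV f g"
  obtains f1 :: "real^'n \<Rightarrow> real" and g1 :: "'n \<Rightarrow> real^'n \<Rightarrow> real"
  where "f1 \<in> borel_measurable borel" "\<And>i. g1 i \<in> borel_measurable borel"
    "AE x in lborel. f x = f1 x" "\<And>i. AE x in lborel. g x $ i = g1 i x"
    "f \<in> borel_measurable lebesgue" "\<And>i. (\<lambda>x. g x $ i) \<in> borel_measurable lebesgue"
    "\<And>i. AE x in lborel_fun. \<exists>h. ac h (\<lambda>t. g1 i (vec_lambda (x(i := t)))) \<and> (AE t in lborel. h t = f1 (vec_lambda (x(i := t))))"
proof -
  have lf: "locally_integrable UNIV f" and lg: "locally_integrable UNIV (\<lambda>x. g x $ i)" for i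
    using hw locally_integrable_component by (auto simp: has_weak_gradient_def)
  have mf: "f \<in> borel_measurable lebesgue" and mg: "(\<lambda>x. g x $ i) \<in> borel_measurable lebesgue" for i
    using lf lg by (auto intro: locally_integrable_measurable)
  obtain f1 where f1[measurable]: "f1 \<in> borel_measurable borel" and ef: "AE x in lborel. f x = f1 x"
    using completion_ex_borel_measurable_real[OF mf] by auto
  have "\<exists>g1. g1 \<in> borel_measurable borel \<and> (AE x in lborel. g x $ i = g1 x)" for i
    using completion_ex_borel_measurable_real[OF mg[of i]] by auto
  then obtain g1 where g1[measurable]: "\<And>i. g1 i \<in> borel_measurable borel" and eg: "\<And>i. AE x in lborel. g x $ i = g1 i x"
    by metis
  have loc: "integrable lborel_fun (\<lambda>x. indicator (cube m) x * u1 (vec_lambda x))"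
    if lu: "locally_integrable UNIV u" and u1[measurable]: "u1 \<in> borel_measurable borel" and eu: "AE x in lborel. u x = u1 x"
    for u u1 :: "real^'n \<Rightarrow> real" and m
  proof -
    let ?B = "cbox (\<chi> i. - m) (\<chi> i. m) :: (real^'n) set"
    have "integrable lebesgue (\<lambda>x. indicator ?B x *\<^sub>R u x)"
      using lu compact_cbox[of "\<chi> i. - m" "(\<chi> i. m) :: real^'n"]
      unfolding locally_integrable_def set_integrable_def by blast
    moreover have "AE x in lborel. indicator ?B x *\<^sub>R u x = indicator ?B x * u1 x"
      using eu by eventually_elim simp
    ultimately have "integrable lborel_fun (\<lambda>x. indicator ?B (vec_lambda x) * u1 (vec_lambda x))"
      by (subst lebesgue_transfer(2)[symmetric, where u = "\<lambda>x. indicator ?B x *\<^sub>R u x"]) (auto dest: borel_measurable_integrable)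
    moreover have "indicator ?B (vec_lambda x) = (indicator (cube m) x :: real)" for x
      by (auto simp: indicator_def cube_def mem_box_cart abs_le_iff minus_le_iff)
    ultimately show ?thesis by simp
  qed
  have "weak_partial (\<lambda>x. f1 (vec_lambda x)) (\<lambda>x. g1 i (vec_lambda x)) i" for i
  proof
    show "(\<lambda>x. f1 (vec_lambda x)) \<in> borel_measurable lborel_fun" by measurable
    show "(\<lambda>x. g1 i (vec_lambda x)) \<in> borel_measurable lborel_fun" by measurable
    show "integrable lborel_fun (\<lambda>x. indicator (cube m) x * f1 (vec_lambda x))" for m by (rule loc[OF lf f1 ef])
    show "integrable lborel_fun (\<lambda>x. indicator (cube m) x * g1 i (vec_lambda x))" for m by (rule loc[OF lg g1 eg])
    fix \<theta> :: "'n \<Rightarrow> real \<Rightarrow> real" and \<theta>' m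
    assume sm: "\<And>j. smooth_fun (\<theta> j)" and supp: "\<And>j t. \<theta> j t \<noteq> 0 \<Longrightarrow> \<bar>t\<bar> \<le> m"
      and sm': "smooth_fun \<theta>'" and d: "\<And>t. (\<theta> i has_real_derivative \<theta>' t) (at t)"
    have "\<exists>u'. smooth_fun u' \<and> (\<forall>t. (\<theta> j has_real_derivative u' t) (at t))" for j
      using smooth_fun_deriv[OF sm[of j]] by blast
    then obtain \<delta> where \<delta>: "\<And>j t. (\<theta> j has_real_derivative \<delta> j t) (at t)"
      by metis
    define \<epsilon> where "\<epsilon> = \<delta>(i := \<theta>')"
    have \<epsilon>: "(\<theta> j has_real_derivative \<epsilon> j t) (at t)" for j t
      using \<delta> d by (auto simp: \<epsilon>_def)
    let ?\<phi> = "\<lambda>x::real^'n. \<Prod>j\<in>UNIV. \<theta> j (x $ j)"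
    let ?\<psi> = "\<lambda>x::real^'n. \<Prod>j\<in>UNIV. (\<theta>(i := \<theta>')) j (x $ j)"
    have pd: "partial_deriv i ?\<phi> = ?\<psi>"
      using partial_deriv_prod_coords[of \<theta> \<epsilon> i] \<epsilon> by (simp add: \<epsilon>_def)
    have [measurable]: "\<theta> j \<in> borel_measurable borel" "(\<theta>(i := \<theta>')) j \<in> borel_measurable borel" for j
      using sm sm' by (auto intro!: borel_measurable_continuous_onI smooth_fun_continuous)
    have comp[measurable]: "(\<lambda>x::real^'n. x $ j) \<in> borel_measurable borel" for j
      by (intro borel_measurable_continuous_onI continuous_intros)
    have m\<phi>[measurable]: "?\<phi> \<in> borel_measurable borel" by measurable
    have m\<psi>[measurable]: "?\<psi> \<in> borel_measurable borel"
      using measurable_compose[OF comp \<open>\<And>j. (\<theta>(i := \<theta>')) j \<in> borel_measurable borel\<close>]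
      by (intro borel_measurable_prod) blast
    have leb: "?\<phi> \<in> borel_measurable lebesgue" "?\<psi> \<in> borel_measurable lebesgue"
      using m\<phi> m\<psi> by (auto intro: measurable_completion)
    have "?\<phi> \<in> test_functions UNIV"
      using sm supp by (rule prod_coords_test_function)
    then have "(LINT x|lebesgue. f x * partial_deriv i ?\<phi> x) = - (LINT x|lebesgue. g x $ i * ?\<phi> x)"
      using hw unfolding has_weak_gradient_def lebesgue_on_UNIV_eq by blast
    then have "(LINT x|lebesgue. f x * ?\<psi> x) = - (LINT x|lebesgue. g x $ i * ?\<phi> x)"
      unfolding pd .
    moreover have "(LINT x|lebesgue. f x * ?\<psi> x) = (LINT x|lborel_fun. f1 (vec_lambda x) * ?\<psi> (vec_lambda x))"
    proof (rule lebesgue_transfer(3)[where u = "\<lambda>x. f x * ?\<psi> x" and v = "\<lambda>x. f1 x * ?\<psi> x"])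
      show "(\<lambda>x. f x * ?\<psi> x) \<in> borel_measurable lebesgue" using mf leb(2) by (rule borel_measurable_times)
      show "(\<lambda>x. f1 x * ?\<psi> x) \<in> borel_measurable borel" using f1 m\<psi> by (rule borel_measurable_times)
      show "AE x in lborel. f x * ?\<psi> x = f1 x * ?\<psi> x" using ef by eventually_elim simp
    qed
    moreover have "(LINT x|lebesgue. g x $ i * ?\<phi> x) = (LINT x|lborel_fun. g1 i (vec_lambda x) * ?\<phi> (vec_lambda x))"
    proof (rule lebesgue_transfer(3)[where u = "\<lambda>x. g x $ i * ?\<phi> x" and v = "\<lambda>x. g1 i x * ?\<phi> x"])
      show "(\<lambda>x. g x $ i * ?\<phi> x) \<in> borel_measurable lebesgue" using mg leb(1) by (rule borel_measurable_times)
      show "(\<lambda>x. g1 i x * ?\<phi> x) \<in> borel_measurable borel" using g1 m\<phi> by (rule borel_measurable_times)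
      show "AE x in lborel. g x $ i * ?\<phi> x = g1 i x * ?\<phi> x" using eg[of i] by eventually_elim simp
    qed
    ultimately show "(LINT x|lborel_fun. f1 (vec_lambda x) * (\<Prod>j\<in>UNIV. (\<theta>(i := \<theta>')) j (x j))) =
        - (LINT x|lborel_fun. g1 i (vec_lambda x) * (\<Prod>j\<in>UNIV. \<theta> j (x j)))"
      by simp
  qed
  then have "AE x in lborel_fun. \<exists>h. ac h (\<lambda>t. g1 i (vec_lambda (x(i := t)))) \<and> (AE t in lborel. h t = f1 (vec_lambda (x(i := t))))" for i
    by (rule weak_partial.ac_lines)
  then show thesis using that f1 g1 ef eg mf mg by blast
qed

section \<open>Transfer from the monomial domain to the reference law\<close>

context
  fixes A :: "real^'n::finite"
  assumes A: "\<And>i. 0 \<le> A $ i"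
begin

interpretation monomial_product "vec_nth A"
  using A by unfold_locales

lemma sets_monomial_domain: "monomial_domain A \<in> sets borel"
proof -
  have "monomial_domain A = (\<Inter>i\<in>UNIV. {x. A $ i > 0 \<longrightarrow> x $ i > 0})"
    by (auto simp: monomial_domain_def)
  moreover have "{x::real^'n. A $ i > 0 \<longrightarrow> x $ i > 0} \<in> sets borel" for i
    by (cases "A $ i > 0") (auto intro!: borel_open open_Collect_less continuous_intros)
  ultimately show ?thesis by auto
qed

lemma monomial_domain_iff: "vec_lambda x \<in> monomial_domain A \<longleftrightarrow> (\<forall>i. x i \<in> dom1 (A $ i))"
  by (simp add: monomial_domain_def dom1_def)

text \<open>On the domain the coordinates with positive exponent are positive, so the absolute
  values have no effect; off it some factor \<open>wt\<close> is 0.\<close>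

lemma indicator_weight: "monomial_weight A x * indicator (monomial_domain A) x = Wt (vec_nth x)"
proof (cases "x \<in> monomial_domain A")
  case True
  have "(if A $ i = 0 then 1 else \<bar>x $ i\<bar> powr A $ i) = wt (A $ i) (x $ i)" for i
    using True A[of i] by (auto simp: monomial_domain_def wt_def less_le)
  then show ?thesis using True by (simp add: monomial_weight_def Wt_def)
next
  case False
  then obtain i where "A $ i > 0" "\<not> x $ i > 0" by (auto simp: monomial_domain_def)
  then have "wt (A $ i) (x $ i) = 0" by (simp add: wt_def)
  then show ?thesis using False by (auto simp: Wt_def)
qed

lemma measurable_Wt: "Wt \<in> borel_measurable lborel_fun"
  unfolding Wt_def by measurable

lemma Wt_nonneg: "Wt x \<ge> 0"
  unfolding Wt_def by (intro prod_nonneg) (auto simp: wt_nonneg)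

lemma domain_transfer:
  fixes u v :: "real^'n \<Rightarrow> real"
  assumes u: "u \<in> borel_measurable lebesgue" and v[measurable]: "v \<in> borel_measurable borel"
    and eq: "AE x in lborel. u x = v x"
  shows "(\<integral>\<^sup>+x. ennreal (u x * monomial_weight A x) \<partial>lebesgue_on (monomial_domain A)) = (\<integral>\<^sup>+x. ennreal (v (vec_lambda x) * \<Psi> x) \<partial>M)"
    and "integrable (lebesgue_on (monomial_domain A)) (\<lambda>x. u x * monomial_weight A x) \<longleftrightarrow> integrable M (\<lambda>x. v (vec_lambda x) * \<Psi> x)"
    and "(LINT x|lebesgue_on (monomial_domain A). u x * monomial_weight A x) = (\<integral>x. v (vec_lambda x) * \<Psi> x \<partial>M)"
proof -
  have W[measurable]: "(\<lambda>x::real^'n. Wt (vec_nth x)) \<in> borel_measurable borel"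
    by (rule measurable_compose[OF measurable_vec_nth measurable_Wt])
  have W': "(\<lambda>x::real^'n. Wt (vec_nth x)) \<in> borel_measurable lebesgue"
    by (rule measurable_completion) simp
  have S: "monomial_domain A \<inter> space lebesgue \<in> sets lebesgue"
    using sets_monomial_domain by (auto intro: sets_completionI_sets)
  note T = lebesgue_transfer[where u = "\<lambda>x. u x * Wt (vec_nth x)" and v = "\<lambda>x. v x * Wt (vec_nth x)"]
  have uW: "(\<lambda>x. u x * Wt (vec_nth x)) \<in> borel_measurable lebesgue"
    using u W' by (rule borel_measurable_times)
  have vW: "(\<lambda>x. v x * Wt (vec_nth x)) \<in> borel_measurable borel" by measurable
  have eW: "AE x in lborel. u x * Wt (vec_nth x) = v x * Wt (vec_nth x)"
    using eq by eventually_elim simp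
  have v0: "(\<lambda>x. v (vec_lambda x)) \<in> borel_measurable lborel_fun" by measurable
  have "(\<integral>\<^sup>+x. ennreal (u x * monomial_weight A x) \<partial>lebesgue_on (monomial_domain A)) =
      (\<integral>\<^sup>+x. ennreal (u x * monomial_weight A x) * indicator (monomial_domain A) x \<partial>lebesgue)"
    by (rule nn_integral_restrict_space[OF S])
  also have "\<dots> = (\<integral>\<^sup>+x. ennreal (u x * Wt (vec_nth x)) \<partial>lebesgue)"
    by (intro nn_integral_cong) (auto simp: indicator_weight[symmetric] indicator_def)
  also have "\<dots> = (\<integral>\<^sup>+x. ennreal (v (vec_lambda x) * Wt x) \<partial>lborel_fun)"
    unfolding T(1)[OF uW vW eW] vec_nth_vec_lambda ..
  also have "\<dots> = (\<integral>\<^sup>+x. ennreal (Wt x) * ennreal (v (vec_lambda x)) \<partial>lborel_fun)"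
    using Wt_nonneg by (intro nn_integral_cong) (simp add: mult.commute[of "ennreal (Wt _)"] ennreal_mult'')
  also have "\<dots> = (\<integral>\<^sup>+x. ennreal (\<Psi> x) * ennreal (v (vec_lambda x)) \<partial>M)"
    by (rule nn_integral_M_\<Psi>[symmetric]) measurable
  also have "\<dots> = (\<integral>\<^sup>+x. ennreal (v (vec_lambda x) * \<Psi> x) \<partial>M)"
    using \<Psi>_pos by (intro nn_integral_cong) (simp add: mult.commute[of "ennreal (\<Psi> _)"] ennreal_mult'' less_imp_le)
  finally show "(\<integral>\<^sup>+x. ennreal (u x * monomial_weight A x) \<partial>lebesgue_on (monomial_domain A)) = (\<integral>\<^sup>+x. ennreal (v (vec_lambda x) * \<Psi> x) \<partial>M)" .
  have eqs: "indicator (monomial_domain A) x *\<^sub>R (u x * monomial_weight A x) = u x * Wt (vec_nth x)" for x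
    by (simp add: indicator_weight[symmetric] mult_ac)
  show "integrable (lebesgue_on (monomial_domain A)) (\<lambda>x. u x * monomial_weight A x) \<longleftrightarrow> integrable M (\<lambda>x. v (vec_lambda x) * \<Psi> x)"
    unfolding integrable_restrict_space[OF S] eqs T(2)[OF uW vW eW] integrable_M_\<Psi>[OF v0] vec_nth_vec_lambda ..
  show "(LINT x|lebesgue_on (monomial_domain A). u x * monomial_weight A x) = (\<integral>x. v (vec_lambda x) * \<Psi> x \<partial>M)"
    unfolding integral_restrict_space[OF S] eqs T(3)[OF uW vW eW] integral_M_\<Psi>[OF v0] vec_nth_vec_lambda ..
qed

lemma AE_domain_transfer:
  fixes u v :: "real^'n \<Rightarrow> real"
  assumes v[measurable]: "v \<in> borel_measurable borel" and eq: "AE x in lborel. u x = v x"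
    and k[measurable]: "k \<in> borel_measurable borel"
  shows "(AE x in lebesgue_on (monomial_domain A). u x = k x) \<longleftrightarrow> (AE x in M. v (vec_lambda x) = k (vec_lambda x))"
proof -
  have S: "monomial_domain A \<inter> space lebesgue \<in> sets lebesgue"
    using sets_monomial_domain by (auto intro: sets_completionI_sets)
  have "(AE x in lebesgue_on (monomial_domain A). u x = k x) \<longleftrightarrow> (AE x in lebesgue. x \<in> monomial_domain A \<longrightarrow> u x = k x)"
    by (rule AE_restrict_space_iff[OF S])
  also have "\<dots> \<longleftrightarrow> (AE x in lborel. x \<in> monomial_domain A \<longrightarrow> u x = k x)"
    by (rule AE_completion_iff)
  also have "\<dots> \<longleftrightarrow> (AE x in lborel. x \<in> monomial_domain A \<longrightarrow> v x = k x)"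
    using eq by (intro eventually_subst) (auto elim!: eventually_mono)
  also have "\<dots> \<longleftrightarrow> (AE x in lborel_fun. vec_lambda x \<in> monomial_domain A \<longrightarrow> v (vec_lambda x) = k (vec_lambda x))"
  proof (rule AE_lborel_fun)
    have "{x. x \<in> monomial_domain A \<longrightarrow> v x = k x} = - monomial_domain A \<union> {x \<in> space borel. v x = k x}" by auto
    also have "\<dots> \<in> sets borel"
    proof (rule sets.Un)
      show "- monomial_domain A \<in> sets borel" using sets_monomial_domain by (rule borel_comp)
      show "{x \<in> space borel. v x = k x} \<in> sets borel" by measurable
    qed
    finally show "{x. x \<in> monomial_domain A \<longrightarrow> v x = k x} \<in> sets borel" .
  qed
  also have "\<dots> \<longleftrightarrow> (AE x in M. v (vec_lambda x) = k (vec_lambda x))"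
    by (simp add: AE_M monomial_domain_iff)
  finally show ?thesis .
qed

end

lemma Pi_const_pos:
  fixes A :: "real^'n::finite"
  assumes A: "\<And>i. 0 \<le> A $ i"
  shows "Pi_const A > 0"
proof -
  have "(\<Prod>i\<in>UNIV. Gamma ((A $ i + 1) / 2)) > 0"
    using A by (intro prod_pos) (auto intro!: Gamma_real_pos add_nonneg_pos)
  then have "(\<Prod>i\<in>UNIV. Gamma ((A $ i + 1) / 2)) / 2 ^ card {i. A $ i > 0} > 0"
    by (rule divide_pos_pos) simp
  then show ?thesis
    unfolding Pi_const_def powr_gt_zero by (rule less_imp_neq[THEN not_sym])
qed

text \<open>Powers of 2 are collected, with D for \<open>hom_dim A\<close>: the exponents (a - 1) /
  2 contribute D / 2 - n, and the n - k coordinates with exponent 0 contribute n - k. What remains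
  is 2^(D / 2) divided by the 2^k of \<open>Pi_const\<close>.\<close>

lemma prod_Z_eq_Pi_const:
  fixes A :: "real^'n::finite"
  assumes A: "\<And>i. 0 \<le> A $ i"
  shows "(\<Prod>i\<in>UNIV. Z (A $ i)) = (2 * Pi_const A) powr (hom_dim A / 2)"
proof -
  define n where "n = CARD('n)"
  define k where "k = card {i. A $ i > 0}"
  define P where "P = (\<Prod>i\<in>UNIV. Gamma ((A $ i + 1) / 2))"
  have P: "P > 0"
    unfolding P_def using A by (intro prod_pos) (auto intro!: Gamma_real_pos add_nonneg_pos)
  have D: "hom_dim A > 0"
    unfolding hom_dim_def using A by (intro add_pos_nonneg sum_nonneg) auto
  have "(\<Prod>i\<in>UNIV. if A $ i = 0 then 2 else 1 :: real) = 2 ^ card {i. A $ i = 0}"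
    by (simp add: prod.If_cases)
  moreover have "card {i. A $ i = 0} = n - k"
  proof -
    have "{i. A $ i = 0} = UNIV - {i. A $ i > 0}" using A by (auto simp: less_le)
    then show ?thesis by (simp add: card_Diff_subset n_def k_def)
  qed
  moreover have "k \<le> n" unfolding n_def k_def by (intro card_mono) auto
  ultimately have "(\<Prod>i\<in>UNIV. if A $ i = 0 then 2 else 1 :: real) = 2 powr (real n - real k)"
    by (simp add: powr_realpow[symmetric] of_nat_diff)
  moreover have "(\<Prod>i\<in>UNIV. 2 powr ((A $ i - 1) / 2)) = (2::real) powr ((hom_dim A - 2 * real n) / 2)"
  proof -
    have "(\<Prod>i\<in>UNIV. 2 powr ((A $ i - 1) / 2)) = (2::real) powr (\<Sum>i\<in>UNIV. (A $ i - 1) / 2)"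
      by (rule powr_sum[symmetric]) simp
    also have "(\<Sum>i\<in>UNIV. (A $ i - 1) / 2) = (hom_dim A - 2 * real n) / 2"
      by (simp add: hom_dim_def n_def sum_divide_distrib[symmetric] sum_subtractf)
    finally show ?thesis .
  qed
  ultimately have "(\<Prod>i\<in>UNIV. Z (A $ i)) = 2 powr ((hom_dim A - 2 * real n) / 2) * P * 2 powr (real n - real k)"
    by (simp add: Z_def prod.distrib P_def)
  also have "\<dots> = P * 2 powr (((hom_dim A - 2 * real n) / 2) + (real n - real k))"
    unfolding powr_add by simp
  also have "((hom_dim A - 2 * real n) / 2) + (real n - real k) = hom_dim A / 2 - real k"
    by (simp add: field_simps)
  also have "P * 2 powr (hom_dim A / 2 - real k) = 2 powr (hom_dim A / 2) * (P / 2 ^ k)"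
    by (simp add: powr_diff powr_realpow)
  also have "P / 2 ^ k = Pi_const A powr (hom_dim A / 2)"
    using P D by (simp add: Pi_const_def P_def[symmetric] k_def[symmetric] powr_powr)
  finally show ?thesis using Pi_const_pos[OF A] by (simp add: powr_mult)
qed

section \<open>The best scale and the characterization of equality\<close>

context sobolev_lines
begin

lemma entropy_le:
  assumes "l > 0"
  shows "ext_integral M (\<lambda>x. ln ((f x)\<^sup>2) * F x) \<le> ereal (\<Sum>j\<in>UNIV. bnd l j)"
proof -
  obtain r where r: "integrable M (\<lambda>x. r x * F x)" "(\<integral>x. r x * F x \<partial>M) \<le> (\<Sum>j\<in>UNIV. bnd l j)"
    "AE x in M. F x \<noteq> 0 \<longrightarrow> ln ((f x)\<^sup>2) \<le> r x"
    using entropy_bound[OF assms] by blast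
  have "AE x in M. ln ((f x)\<^sup>2) * F x \<le> r x * F x"
    using r(3) by eventually_elim (metis F_nonneg mult_right_mono mult_zero_right order_refl)
  then have "ext_integral M (\<lambda>x. ln ((f x)\<^sup>2) * F x) \<le> ereal (\<integral>x. r x * F x \<partial>M)"
    by (intro ext_integral_le r(1)) measurable
  also have "\<dots> \<le> ereal (\<Sum>j\<in>UNIV. bnd l j)" using r(2) by simp
  finally show ?thesis .
qed

lemma entropy_finite:
  assumes "ext_integral M (\<lambda>x. ln ((f x)\<^sup>2) * F x) = ereal e"
  shows "integrable M (\<lambda>x. ln ((f x)\<^sup>2) * F x) \<and> (\<integral>x. ln ((f x)\<^sup>2) * F x \<partial>M) = e"
proof -
  obtain r where r: "integrable M (\<lambda>x. r x * F x)"
    "AE x in M. F x \<noteq> 0 \<longrightarrow> ln ((f x)\<^sup>2) \<le> r x"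
    using entropy_bound[of 1] by auto
  have "AE x in M. ln ((f x)\<^sup>2) * F x \<le> r x * F x"
    using r(2) by eventually_elim (metis F_nonneg mult_right_mono mult_zero_right order_refl)
  then show ?thesis
    using ext_integral_cases[of "\<lambda>x. ln ((f x)\<^sup>2) * F x" M, OF _ r(1)] assms by auto
qed

definition energy_total :: real where "energy_total = (\<Sum>j\<in>UNIV. energy_of j)"

lemma energy_total_nonneg: "energy_total \<ge> 0"
  unfolding energy_total_def energy_of_def
  using \<Psi>_pos by (intro sum_nonneg Bochner_Integration.integral_nonneg) (auto simp: less_imp_le)

text \<open>The right-hand side of the theorem before \<Pi> is introduced:
  \<open>Zprod powr (2 / Dim)\<close> is twice \<Pi>, hence 4 in place of 2.\<close>

definition optimal_rhs :: real
  where "optimal_rhs = Dim / 2 * ln (4 * energy_total / (Zprod powr (2 / Dim) * exp 1 * Dim))"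

lemma optimal_rhs_eq:
  assumes "energy_total > 0"
  shows "optimal_rhs = Dim / 2 * ln (4 * energy_total / (Dim * exp 1)) - ln Zprod"
proof -
  have "4 * energy_total / (Zprod powr (2 / Dim) * exp 1 * Dim) = 4 * energy_total / (Dim * exp 1) / Zprod powr (2 / Dim)"
    by (simp add: field_simps)
  also have "ln \<dots> = ln (4 * energy_total / (Dim * exp 1)) - 2 / Dim * ln Zprod"
    using assms Dim_pos Zprod_pos by (subst ln_divide_pos) (auto simp: ln_powr)
  finally show ?thesis
    unfolding optimal_rhs_def using Dim_pos by (simp add: right_diff_distrib)
qed

text \<open>The value of the scale at which the bound of \<open>entropy_le\<close> is smallest.\<close>

definition optimal_scale :: real where "optimal_scale = sqrt (Dim / (4 * energy_total))"

text \<open>With E for the total energy and D for \<open>Dim\<close>, minimizing 2 l^2 E - D ln l in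
  l gives l^2 = D / (4 E).\<close>

lemma optimal_scale:
  assumes "energy_total > 0"
  shows "optimal_scale > 0" and "(\<Sum>j\<in>UNIV. bnd optimal_scale j) = optimal_rhs"
proof -
  have pos: "Dim / (4 * energy_total) > 0" using assms Dim_pos by simp
  then show "optimal_scale > 0" by (simp add: optimal_scale_def)
  have sq: "optimal_scale\<^sup>2 = Dim / (4 * energy_total)"
    unfolding optimal_scale_def using pos by (intro real_sqrt_pow2) simp
  have ln: "ln optimal_scale = ln (Dim / (4 * energy_total)) / 2"
    unfolding optimal_scale_def using pos by (intro ln_sqrt) simp
  have "2 * optimal_scale\<^sup>2 * energy_total = Dim / 2"
    unfolding sq using assms by simp
  then have "(\<Sum>j\<in>UNIV. bnd optimal_scale j) = Dim / 2 - Dim * (1 + ln (Dim / (4 * energy_total)) / 2) - ln Zprod"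
    unfolding sum_bnd energy_total_def[symmetric] ln by simp
  also have "ln (Dim / (4 * energy_total)) = ln Dim - ln (4 * energy_total)"
    using assms Dim_pos by (intro ln_divide_pos) auto
  also have "Dim / 2 - Dim * (1 + (ln Dim - ln (4 * energy_total)) / 2) - ln Zprod =
      Dim / 2 * (ln (4 * energy_total) - (ln Dim + 1)) - ln Zprod"
    by (simp add: field_simps)
  also have "ln (4 * energy_total) - (ln Dim + 1) = ln (4 * energy_total / (Dim * exp 1))"
    using assms Dim_pos by (simp add: ln_divide_pos ln_mult_pos)
  finally show "(\<Sum>j\<in>UNIV. bnd optimal_scale j) = optimal_rhs"
    unfolding optimal_rhs_eq[OF assms] .
qed

text \<open>For zero energy there is no best scale: the bound decreases to -\<infinity> as l grows,
  while the right-hand side is 0 because ln 0 = 0. The inequality is then strict.\<close>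

lemma sharp_inequality: "ext_integral M (\<lambda>x. ln ((f x)\<^sup>2) * F x) \<le> ereal optimal_rhs"
  and strict_of_zero_energy:
    "energy_total = 0 \<Longrightarrow> ext_integral M (\<lambda>x. ln ((f x)\<^sup>2) * F x) \<noteq> ereal optimal_rhs"
proof -
  have zero: "ext_integral M (\<lambda>x. ln ((f x)\<^sup>2) * F x) < ereal optimal_rhs" if e: "energy_total = 0"
  proof -
    have rhs: "optimal_rhs = 0" using e by (simp add: optimal_rhs_def)
    \<comment> \<open>Chosen such that Dim * ln l is the absolute value of ln Zprod; the bound is
      then at most -Dim.\<close>
    define l where "l = exp (\<bar>ln Zprod\<bar> / Dim)"
    have "ext_integral M (\<lambda>x. ln ((f x)\<^sup>2) * F x) \<le> ereal (\<Sum>j\<in>UNIV. bnd l j)"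
      by (rule entropy_le) (simp add: l_def)
    also have "(\<Sum>j\<in>UNIV. bnd l j) = - Dim - \<bar>ln Zprod\<bar> - ln Zprod"
      unfolding sum_bnd energy_total_def[symmetric] e l_def using Dim_pos by (simp add: field_simps)
    also have "\<dots> < optimal_rhs" unfolding rhs using Dim_pos by linarith
    finally show ?thesis by simp
  qed
  show "ext_integral M (\<lambda>x. ln ((f x)\<^sup>2) * F x) \<le> ereal optimal_rhs"
  proof (cases "energy_total = 0")
    case True
    then show ?thesis using zero by (simp add: less_imp_le)
  next
    case False
    then have "energy_total > 0" using energy_total_nonneg by simp
    then show ?thesis using entropy_le[OF optimal_scale(1)] optimal_scale(2) by simp
  qed
  show "ext_integral M (\<lambda>x. ln ((f x)\<^sup>2) * F x) \<noteq> ereal optimal_rhs" if "energy_total = 0"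
    using zero[OF that] by simp
qed

text \<open>In one direction the best scale becomes the width s of the Gaussian. In the other,
  normalization, entropy and energy are explicit in s, and both sides evaluate to the same
  number.\<close>

lemma equality_iff_gaussian:
  "ext_integral M (\<lambda>x. ln ((f x)\<^sup>2) * F x) = ereal optimal_rhs \<longleftrightarrow>
    (\<exists>s \<beta> y. s > 0 \<and> (\<forall>i. A i > 0 \<longrightarrow> y i = 0) \<and> \<beta>\<^sup>2 * (s powr Dim * Zprod) = 1 \<and>
      (AE x in M. f x = \<beta> * exp (- (\<Sum>j\<in>UNIV. (x j - y j)\<^sup>2) / (4 * s\<^sup>2))))"
  (is "?L \<longleftrightarrow> (\<exists>s \<beta> y. ?P s \<beta> y)")
proof
  assume eq: ?L
  have pos: "energy_total > 0"
    using eq strict_of_zero_energy energy_total_nonneg by force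
  define s where "s = optimal_scale"
  have s: "s > 0" and b: "(\<Sum>j\<in>UNIV. bnd s j) = optimal_rhs"
    using optimal_scale[OF pos] by (auto simp: s_def)
  have "integrable M (\<lambda>x. ln ((f x)\<^sup>2) * F x)" "(\<integral>x. ln ((f x)\<^sup>2) * F x \<partial>M) = (\<Sum>j\<in>UNIV. bnd s j)"
    using entropy_finite[OF eq] b by auto
  from gaussian_of_equality[OF s this]
  obtain b c where b: "\<forall>i. A i > 0 \<longrightarrow> b i = 0"
    and gauss: "AE x in M. f x = c * exp (- (\<Sum>j\<in>UNIV. (x j / s + b j)\<^sup>2 / 4))" by blast
  define y where "y j = - (s * b j)" for j
  have "(x j / s + b j)\<^sup>2 / 4 = (x j - y j)\<^sup>2 / (4 * s\<^sup>2)" for x :: "'i \<Rightarrow> real" and j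
  proof -
    have "x j / s + b j = (x j - y j) / s" using s by (simp add: y_def field_simps)
    then show ?thesis by (simp add: power_divide)
  qed
  then have gauss': "AE x in M. f x = c * exp (- (\<Sum>j\<in>UNIV. (x j - y j)\<^sup>2) / (4 * s\<^sup>2))"
    using gauss by (simp add: sum_divide_distrib[symmetric] mult.commute)
  have y: "A i > 0 \<Longrightarrow> y i = 0" for i using b by (simp add: y_def)
  have "c\<^sup>2 * (s powr Dim * Zprod) = 1"
    by (rule gauss_normalization[OF s y gauss'])
  then show "\<exists>s \<beta> y. ?P s \<beta> y" using s y gauss' by blast
next
  assume "\<exists>s \<beta> y. ?P s \<beta> y"
  then obtain s \<beta> y where s: "s > 0" and y: "\<And>i. A i > 0 \<Longrightarrow> y i = 0"
    and gauss: "AE x in M. f x = \<beta> * exp (- (\<Sum>j\<in>UNIV. (x j - y j)\<^sup>2) / (4 * s\<^sup>2))" by blast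
  have G: "\<beta>\<^sup>2 * (s powr Dim * Zprod) = 1" "integrable M (\<lambda>x. ln ((f x)\<^sup>2) * F x)"
      "(\<integral>x. ln ((f x)\<^sup>2) * F x \<partial>M) = ln (\<beta>\<^sup>2) - Dim / 2" "(\<Sum>i\<in>UNIV. energy_of i) = Dim / (4 * s\<^sup>2)"
    by (rule gauss_normalization[OF s y gauss] gauss_entropy[OF s y gauss] gauss_energy[OF s y gauss], assumption)+
  have \<beta>: "\<beta> \<noteq> 0" using G(1) by auto
  have "0 = ln (\<beta>\<^sup>2 * (s powr Dim * Zprod))" unfolding G(1) by simp
  also have "\<dots> = ln (\<beta>\<^sup>2) + (Dim * ln s + ln Zprod)"
    using \<beta> s Zprod_pos by (simp add: ln_mult_pos ln_powr)
  finally have ln\<beta>: "ln (\<beta>\<^sup>2) = - (Dim * ln s + ln Zprod)" by simp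
  have pos: "energy_total > 0"
    unfolding energy_total_def G(4) using Dim_pos s by simp
  have "4 * energy_total / (Dim * exp 1) = 1 / (s\<^sup>2 * exp 1)"
    unfolding energy_total_def G(4) using Dim_pos s by (simp add: field_simps)
  also have "ln \<dots> = - (2 * ln s + 1)"
    using s by (simp add: ln_divide_pos ln_mult_pos ln_realpow)
  finally have "optimal_rhs = Dim / 2 * (- (2 * ln s + 1)) - ln Zprod"
    by (simp add: optimal_rhs_eq[OF pos])
  also have "\<dots> = ln (\<beta>\<^sup>2) - Dim / 2" unfolding ln\<beta> by (simp add: field_simps)
  finally show ?L using ext_integral_integrable[OF G(2)] G(3) by simp
qed

end

text \<open>Borel versions of f and of the chosen weak gradient, read as functions of the
  coordinates, satisfy \<open>sobolev_lines\<close>. The parameters of the two descriptions of a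
  Gaussian are related by \<sigma> = 4 s^2.\<close>

theorem theorem1p1:
  fixes A :: "real ^ 'n" and f :: "real ^ 'n \<Rightarrow> real"
  assumes "\<And>i. A $ i \<ge> 0"
    and "f \<in> W12 UNIV (monomial_weight A)"
    and "(LINT x|lebesgue_on (monomial_domain A). \<bar>f x\<bar>\<^sup>2 * monomial_weight A x) = 1"
  shows "log_sobolev_lhs A f \<le> ereal (log_sobolev_rhs A f) \<and>
    (log_sobolev_lhs A f = ereal (log_sobolev_rhs A f) \<longleftrightarrow>
      (\<exists>\<sigma> x\<^sub>0 \<beta>. \<sigma> > 0 \<and> (\<forall>i. A $ i > 0 \<longrightarrow> x\<^sub>0 $ i = 0) \<and>
        \<bar>\<beta>\<bar> powi (- 2) = (\<sigma> * Pi_const A / 2) powr (hom_dim A / 2) \<and>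
        (AE x in lebesgue_on (monomial_domain A).
          f x = \<beta> * exp (- ((norm (x - x\<^sub>0))\<^sup>2 / \<sigma>)))))"
proof -
  note A = assms(1)
  define g where "g = weak_gradient UNIV f"
  have hw: "has_weak_gradient UNIV f g"
    using assms(2) someI_ex[of "has_weak_gradient UNIV f"] by (auto simp: W12_def g_def weak_gradient_def)
  obtain f1 g1 where f1[measurable]: "f1 \<in> borel_measurable borel" and g1[measurable]: "\<And>i. g1 i \<in> borel_measurable borel"
    and ef: "AE x in lborel. f x = f1 x" and eg: "\<And>i. AE x in lborel. g x $ i = g1 i x"
    and mf: "f \<in> borel_measurable lebesgue" and mg: "\<And>i. (\<lambda>x. g x $ i) \<in> borel_measurable lebesgue"
    and ln: "\<And>i. AE x in lborel_fun. \<exists>h. ac h (\<lambda>t. g1 i (vec_lambda (x(i := t)))) \<and> (AE t in lborel. h t = f1 (vec_lambda (x(i := t))))"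
    using has_weak_gradient_lines[OF hw] by blast
  define f0 where "f0 x = f1 (vec_lambda x)" for x
  define g0 where "g0 i x = g1 i (vec_lambda x)" for i x
  interpret mp: monomial_product "vec_nth A" using A by unfold_locales
  have [measurable]: "f0 \<in> borel_measurable mp.M" "g0 i \<in> borel_measurable mp.M" for i
    unfolding mp.measurable_M_iff f0_def[abs_def] g0_def[abs_def] by measurable
  have eg_all: "AE x in lborel. \<forall>i. g x $ i = g1 i x"
    using eg by (rule eventually_all_finite)
  have ng: "(norm (g x))\<^sup>2 = (\<Sum>i\<in>UNIV. (g x $ i)\<^sup>2)" for x
    by (simp add: power2_norm_eq_inner inner_vec_def) (simp add: power2_eq_square)
  have mg2: "(\<lambda>x. (g x $ i)\<^sup>2) \<in> borel_measurable lebesgue" for i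
    using mg by (rule borel_measurable_power)
  have eg2: "AE x in lborel. (g x $ i)\<^sup>2 = (g1 i x)\<^sup>2" for i
    using eg[of i] by eventually_elim simp
  have mf2: "(\<lambda>x. \<bar>f x\<bar>\<^sup>2) \<in> borel_measurable lebesgue"
    using mf by (intro borel_measurable_power borel_measurable_abs)
  have ef2: "AE x in lborel. \<bar>f x\<bar>\<^sup>2 = (f1 x)\<^sup>2"
    using ef by eventually_elim simp
  have mgn: "(\<lambda>x. (norm (g x))\<^sup>2) \<in> borel_measurable lebesgue"
    unfolding ng using mg2 by (intro borel_measurable_sum)
  have egn: "AE x in lborel. (norm (g x))\<^sup>2 = (\<Sum>i\<in>UNIV. (g1 i x)\<^sup>2)"
    using eg_all unfolding ng by eventually_elim simp
  have int_tot: "integrable (lebesgue_on (monomial_domain A)) (\<lambda>x. (\<bar>f x\<bar>\<^sup>2 + (norm (g x))\<^sup>2) * monomial_weight A x)"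
  proof -
    have "integrable lebesgue (\<lambda>x. (\<bar>f x\<bar>\<^sup>2 + (norm (g x))\<^sup>2) * monomial_weight A x)"
      using assms(2) by (simp add: W12_def g_def lebesgue_on_UNIV_eq)
    moreover have "monomial_domain A \<in> sets lebesgue"
      using sets_monomial_domain[OF A] by (auto intro: sets_completionI_sets)
    ultimately show ?thesis
      by (intro integrable_mult_indicator[THEN integrable_restrict_space[THEN iffD2, rotated]]) auto
  qed
  have "integrable mp.M (\<lambda>x. ((f1 (vec_lambda x))\<^sup>2 + (\<Sum>i\<in>UNIV. (g1 i (vec_lambda x))\<^sup>2)) * mp.\<Psi> x)"
  proof (subst domain_transfer(2)[OF A, symmetric, where u = "\<lambda>x. \<bar>f x\<bar>\<^sup>2 + (norm (g x))\<^sup>2" and v = "\<lambda>x. (f1 x)\<^sup>2 + (\<Sum>i\<in>UNIV. (g1 i x)\<^sup>2)"])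
    show "(\<lambda>x. \<bar>f x\<bar>\<^sup>2 + (norm (g x))\<^sup>2) \<in> borel_measurable lebesgue"
      using mf2 mgn by (rule borel_measurable_add)
    show "AE x in lborel. \<bar>f x\<bar>\<^sup>2 + (norm (g x))\<^sup>2 = (f1 x)\<^sup>2 + (\<Sum>i\<in>UNIV. (g1 i x)\<^sup>2)"
      using ef2 egn by eventually_elim simp
  qed (use int_tot in auto)
  then have int0: "integrable mp.M (\<lambda>x. ((f0 x)\<^sup>2 + (\<Sum>i\<in>UNIV. (g0 i x)\<^sup>2)) * mp.\<Psi> x)"
    by (simp add: f0_def g0_def)
  interpret sobolev_lines "vec_nth A" f0 g0
  proof
    show "f0 \<in> borel_measurable mp.M" "g0 i \<in> borel_measurable mp.M" for i by measurable
    have "(LINT x|lebesgue_on (monomial_domain A). \<bar>f x\<bar>\<^sup>2 * monomial_weight A x) = (\<integral>x. (f0 x)\<^sup>2 * mp.\<Psi> x \<partial>mp.M)"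
      using domain_transfer(3)[OF A mf2 _ ef2] by (simp add: f0_def)
    then have "enn2real (\<integral>\<^sup>+x. ennreal ((f0 x)\<^sup>2 * mp.\<Psi> x) \<partial>mp.M) = 1"
      using assms(3) mp.\<Psi>_pos by (subst (asm) integral_eq_nn_integral) (auto simp: less_imp_le)
    \<comment> \<open>\<open>enn2real\<close> maps infinity to 0, so the real value 1 determines the
      nonnegative integral.\<close>
    then show "(\<integral>\<^sup>+x. ennreal ((f0 x)\<^sup>2 * mp.\<Psi> x) \<partial>mp.M) = 1"
      by (cases "\<integral>\<^sup>+x. ennreal ((f0 x)\<^sup>2 * mp.\<Psi> x) \<partial>mp.M") auto
    show "integrable mp.M (\<lambda>x. (g0 i x)\<^sup>2 * mp.\<Psi> x)" for i
    proof (rule Bochner_Integration.integrable_bound[OF int0])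
      show "AE x in mp.M. norm ((g0 i x)\<^sup>2 * mp.\<Psi> x) \<le> norm (((f0 x)\<^sup>2 + (\<Sum>i\<in>UNIV. (g0 i x)\<^sup>2)) * mp.\<Psi> x)"
      proof (rule AE_I2)
        fix x
        have "(g0 i x)\<^sup>2 \<le> (\<Sum>i\<in>UNIV. (g0 i x)\<^sup>2)" by (rule member_le_sum) auto
        also have "\<dots> \<le> (f0 x)\<^sup>2 + (\<Sum>i\<in>UNIV. (g0 i x)\<^sup>2)" by simp
        finally have "(g0 i x)\<^sup>2 * mp.\<Psi> x \<le> ((f0 x)\<^sup>2 + (\<Sum>i\<in>UNIV. (g0 i x)\<^sup>2)) * mp.\<Psi> x"
          using mp.\<Psi>_pos[of x] by (intro mult_right_mono) auto
        moreover have "0 \<le> (g0 i x)\<^sup>2 * mp.\<Psi> x" using mp.\<Psi>_pos[of x] by simp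
        ultimately show "norm ((g0 i x)\<^sup>2 * mp.\<Psi> x) \<le> norm (((f0 x)\<^sup>2 + (\<Sum>i\<in>UNIV. (g0 i x)\<^sup>2)) * mp.\<Psi> x)"
          by simp
      qed
    qed measurable
    show "AE x in mp.M. \<exists>h h'. ac h h' \<and> (AE t in lborel. t \<in> dom1 (A $ i) \<longrightarrow> h t = f0 (x(i := t)) \<and> h' t = g0 i (x(i := t)))" for i
      unfolding mp.AE_M using ln[of i]
    proof eventually_elim
      case (elim x)
      then obtain h where h: "ac h (\<lambda>t. g0 i (x(i := t)))" "AE t in lborel. h t = f0 (x(i := t))"
        unfolding f0_def g0_def by blast
      have "AE t in lborel. t \<in> dom1 (A $ i) \<longrightarrow> h t = f0 (x(i := t)) \<and> g0 i (x(i := t)) = g0 i (x(i := t))"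
        using h(2) by eventually_elim simp
      then show ?case using h(1) by blast
    qed
  qed
  have D: "Dim = hom_dim A"
    by (simp add: Dim_def hom_dim_def sum.distrib)
  have Pi: "Pi_const A > 0" by (rule Pi_const_pos[OF A])
  have Zp: "Zprod = (2 * Pi_const A) powr (hom_dim A / 2)"
    unfolding Zprod_def by (rule prod_Z_eq_Pi_const[OF A])
  have lhs: "log_sobolev_lhs A f = ext_integral mp.M (\<lambda>x. ln ((f0 x)\<^sup>2) * F x)"
  proof -
    have m: "(\<lambda>x. \<bar>f x\<bar>\<^sup>2 * ln (\<bar>f x\<bar>\<^sup>2)) \<in> borel_measurable lebesgue"
      using mf2 by measurable
    have e: "AE x in lborel. \<bar>f x\<bar>\<^sup>2 * ln (\<bar>f x\<bar>\<^sup>2) = (f1 x)\<^sup>2 * ln ((f1 x)\<^sup>2)"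
      using ef2 by eventually_elim simp
    have m': "(\<lambda>x. - (\<bar>f x\<bar>\<^sup>2 * ln (\<bar>f x\<bar>\<^sup>2))) \<in> borel_measurable lebesgue"
      using m by (rule borel_measurable_uminus)
    have e': "AE x in lborel. - (\<bar>f x\<bar>\<^sup>2 * ln (\<bar>f x\<bar>\<^sup>2)) = - ((f1 x)\<^sup>2 * ln ((f1 x)\<^sup>2))"
      using e by eventually_elim simp
    have "(\<integral>\<^sup>+x. ennreal (\<bar>f x\<bar>\<^sup>2 * ln (\<bar>f x\<bar>\<^sup>2) * monomial_weight A x) \<partial>lebesgue_on (monomial_domain A)) =
        (\<integral>\<^sup>+x. ennreal (ln ((f0 x)\<^sup>2) * F x) \<partial>mp.M)"
      by (subst domain_transfer(1)[OF A m _ e]) (auto simp: f0_def F_def mult_ac)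
    moreover have "(\<integral>\<^sup>+x. ennreal (- (\<bar>f x\<bar>\<^sup>2 * ln (\<bar>f x\<bar>\<^sup>2) * monomial_weight A x)) \<partial>lebesgue_on (monomial_domain A)) =
        (\<integral>\<^sup>+x. ennreal (- (ln ((f0 x)\<^sup>2) * F x)) \<partial>mp.M)"
      unfolding minus_mult_left[of "\<bar>f _\<bar>\<^sup>2 * ln (\<bar>f _\<bar>\<^sup>2)"]
      by (subst domain_transfer(1)[OF A m' _ e']) (auto simp: f0_def F_def mult_ac)
    ultimately show ?thesis by (simp only: log_sobolev_lhs_def ext_integral_def)
  qed
  have energy: "(LINT x|lebesgue_on (monomial_domain A). (norm (g x))\<^sup>2 * monomial_weight A x) = energy_total"
  proof -
    have "(LINT x|lebesgue_on (monomial_domain A). (norm (g x))\<^sup>2 * monomial_weight A x) =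
        (\<integral>x. (\<Sum>i\<in>UNIV. (g0 i x)\<^sup>2 * mp.\<Psi> x) \<partial>mp.M)"
      by (subst domain_transfer(3)[OF A mgn _ egn]) (auto simp: g0_def sum_distrib_right)
    also have "\<dots> = energy_total"
      unfolding energy_total_def energy_of_def by (intro Bochner_Integration.integral_sum g_int)
    finally show ?thesis .
  qed
  have ZD: "Zprod powr (2 / Dim) = 2 * Pi_const A"
    unfolding Zp D[symmetric] using Pi Dim_pos by (simp add: powr_powr)
  have rhs: "log_sobolev_rhs A f = optimal_rhs"
    unfolding log_sobolev_rhs_def g_def[symmetric] energy optimal_rhs_def D ZD[unfolded D]
    by (simp add: field_simps)
  have \<sigma>: "(4 * s\<^sup>2 * Pi_const A / 2) powr (hom_dim A / 2) = s powr Dim * Zprod" if "s > 0" for s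
  proof -
    have "(4 * s\<^sup>2 * Pi_const A / 2) powr (hom_dim A / 2) = ((s powr 2) * (2 * Pi_const A)) powr (hom_dim A / 2)"
      using that by (simp add: powr_numeral mult_ac)
    also have "\<dots> = s powr Dim * Zprod"
      unfolding Zp D powr_mult using that by (simp only: powr_powr) simp
    finally show ?thesis .
  qed
  have \<beta>: "\<bar>\<beta>\<bar> powi (- 2) = c \<longleftrightarrow> \<beta>\<^sup>2 * c = 1" if "c > 0" for \<beta> c :: real
    using that by (cases "\<beta> = 0") (auto simp: power_int_minus field_simps)
  have AE: "(AE x in lebesgue_on (monomial_domain A). f x = \<beta> * exp (- ((norm (x - x0))\<^sup>2 / (4 * s\<^sup>2)))) \<longleftrightarrow>
      (AE x in mp.M. f0 x = \<beta> * exp (- (\<Sum>j\<in>UNIV. (x j - x0 $ j)\<^sup>2) / (4 * s\<^sup>2)))" for \<beta> s and x0 :: "real^'n"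
  proof -
    have k: "(\<lambda>x. \<beta> * exp (- ((norm (x - x0))\<^sup>2 / (4 * s\<^sup>2)))) \<in> borel_measurable borel" by measurable
    have "(norm (vec_lambda x - x0))\<^sup>2 = (\<Sum>j\<in>UNIV. (x j - x0 $ j)\<^sup>2)" for x
      by (simp add: power2_norm_eq_inner inner_vec_def) (simp add: power2_eq_square)
    then show ?thesis
      unfolding AE_domain_transfer[OF A f1 ef k] f0_def by simp
  qed
  have iff: "(\<exists>s \<beta> y. s > 0 \<and> (\<forall>i. A $ i > 0 \<longrightarrow> y i = 0) \<and> \<beta>\<^sup>2 * (s powr Dim * Zprod) = 1 \<and>
        (AE x in mp.M. f0 x = \<beta> * exp (- (\<Sum>j\<in>UNIV. (x j - y j)\<^sup>2) / (4 * s\<^sup>2)))) \<longleftrightarrow>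
      (\<exists>\<sigma> x\<^sub>0 \<beta>. \<sigma> > 0 \<and> (\<forall>i. A $ i > 0 \<longrightarrow> x\<^sub>0 $ i = 0) \<and>
        \<bar>\<beta>\<bar> powi (- 2) = (\<sigma> * Pi_const A / 2) powr (hom_dim A / 2) \<and>
        (AE x in lebesgue_on (monomial_domain A). f x = \<beta> * exp (- ((norm (x - x\<^sub>0))\<^sup>2 / \<sigma>))))"
  proof (intro iffI; elim exE conjE)
    fix s \<beta> :: real and y :: "'n \<Rightarrow> real"
    assume *: "s > 0" "\<forall>i. A $ i > 0 \<longrightarrow> y i = 0" "\<beta>\<^sup>2 * (s powr Dim * Zprod) = 1"
      "AE x in mp.M. f0 x = \<beta> * exp (- (\<Sum>j\<in>UNIV. (x j - y j)\<^sup>2) / (4 * s\<^sup>2))"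
    have "s powr Dim * Zprod > 0" using *(1) Zprod_pos by simp
    then have "\<bar>\<beta>\<bar> powi (- 2) = (4 * s\<^sup>2 * Pi_const A / 2) powr (hom_dim A / 2)"
      unfolding \<sigma>[OF *(1)] using *(3) by (subst \<beta>)
    moreover have "AE x in lebesgue_on (monomial_domain A). f x = \<beta> * exp (- ((norm (x - vec_lambda y))\<^sup>2 / (4 * s\<^sup>2)))"
      unfolding AE using *(4) by simp
    ultimately show "\<exists>\<sigma> x\<^sub>0 \<beta>. \<sigma> > 0 \<and> (\<forall>i. A $ i > 0 \<longrightarrow> x\<^sub>0 $ i = 0) \<and>
        \<bar>\<beta>\<bar> powi (- 2) = (\<sigma> * Pi_const A / 2) powr (hom_dim A / 2) \<and>
        (AE x in lebesgue_on (monomial_domain A). f x = \<beta> * exp (- ((norm (x - x\<^sub>0))\<^sup>2 / \<sigma>)))"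
      using *(1,2) by (intro exI[of _ "4 * s\<^sup>2"] exI[of _ "vec_lambda y"] exI[of _ \<beta>]) simp
  next
    fix \<sigma>' \<beta>' x0
    assume *: "\<sigma>' > 0" "\<forall>i. A $ i > 0 \<longrightarrow> x0 $ i = 0"
      "\<bar>\<beta>'\<bar> powi (- 2) = (\<sigma>' * Pi_const A / 2) powr (hom_dim A / 2)"
      "AE x in lebesgue_on (monomial_domain A). f x = \<beta>' * exp (- ((norm (x - x0))\<^sup>2 / \<sigma>'))"
    define s where "s = sqrt \<sigma>' / 2"
    have s: "s > 0" "\<sigma>' = 4 * s\<^sup>2" using *(1) by (auto simp: s_def power_divide)
    have "s powr Dim * Zprod > 0" using s(1) Zprod_pos by simp
    then have "\<beta>'\<^sup>2 * (s powr Dim * Zprod) = 1"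
      using *(3) unfolding s(2) \<sigma>[OF s(1)] by (subst (asm) \<beta>)
    then show "\<exists>s \<beta> y. s > 0 \<and> (\<forall>i. A $ i > 0 \<longrightarrow> y i = 0) \<and> \<beta>\<^sup>2 * (s powr Dim * Zprod) = 1 \<and>
        (AE x in mp.M. f0 x = \<beta> * exp (- (\<Sum>j\<in>UNIV. (x j - y j)\<^sup>2) / (4 * s\<^sup>2)))"
      using s(1) *(2,4) unfolding s(2) AE by blast
  qed
  show ?thesis
    unfolding lhs rhs equality_iff_gaussian iff using sharp_inequality by simp
qed

end
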